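(* Let the DAE $A(t)(Dx)'(t)+B(t)x(t)=q(t)$, $t\in[a,b]$, be regular with index $\mu\in\mathbb{N}$ and let the boundary condition $G_a x(a)+G_b x(b)=d$ be accurately stated. Let $x_*$ be a solution of this boundary value problem, and let $q$ and also $x_*$ be sufficiently smooth. Let the entries of $A$ and $B$ be polynomials of degree less than or equal to $N_{AB}$. Let all partitions $\pi$ be such that $h/h_{min}\le\rho$, with a global constant $\rho$. Then, with $$M\ge N+1+N_{AB},$$ the following statements are true: (1) For each sequence of arbitrarily placed nodes $0\le\tau_1<\dots<\tau_M\le1$ and sufficiently fine partitions $\pi$, there exists exactly one $x_\pi^R\in X_\pi$ minimizing the functional $\Phi^R_{\pi,M}$ on $X_\pi$, and $$\|x_\pi^R-x_*\|_{H_D^1}\le C_R\,h^{N-\mu+1},$$ with a constant $C_R$ independent of $\pi$ and $h$. (2) For each integration rule of interpolation type on the interval $[0,1]$ with $M$ nodes $0\le\tau_1<\dots<\tau_M\le1$ and positive weights $\gamma_1,\dots,\gamma_M$ which is exact for polynomials of degree less than or equal to $2M-2$, and sufficiently fine partitions $\pi$, there exists exactly one $x_\pi^I\in X_\pi$ minimizing the functional $\Phi^I_{\pi,M}$ on $X_\pi$, and $x_\pi^I=x_\pi^R$ (with $x_\pi^R$ the minimizer of $\Phi^R_{\pi,M}$ for the same nodes), thus $$\|x_\pi^I-x_*\|_{H_D^1}\le C_R\,h^{N-\mu+1}.$$ (3) If $A$ and $B$ are even constant matrices, then for each sequence of arbitrarily placed nodes $0\le\tau_1<\dots<\tau_M\le1$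 and sufficiently fine partitions $\pi$, there exists exactly one $x_\pi^R\in X_\pi$ minimizing the functional $\Phi^R_{\pi,M}$ on $X_\pi$, and $$\|x_\pi^R-x_*\|_{H_D^1}\le C_R\,h^{\max\{0,N-\mu+1\}},$$ with a constant $C_R$ independent of $\pi$ and $h$.
   Context: Setting. $[a,b]\subset\mathbb{R}$ is a compact interval, $k<m$, $D=[I\;0]\in\mathbb{R}^{k\times m}$ with $I$ the $k\times k$ identity, $A(t)\in\mathbb{R}^{m\times k}$, $B(t)\in\mathbb{R}^{m\times m}$, $q(t)\in\mathbb{R}^m$ are sufficiently smooth in $t\in[a,b]$. The boundary value problem is $$A(t)(Dx)'(t)+B(t)x(t)=q(t),\ t\in[a,b],\qquad G_ax(a)+G_bx(b)=d,$$ with $G_a,G_b\in\mathbb{R}^{l\times m}$, $d\in\mathbb{R}^l$, where $l$ is the dynamical degree of freedom of the DAE (the number of free parameters that can be fixed by initial and boundary conditions). The derivative is properly involved: $\ker A(t)\oplus\operatorname{im}D=\mathbb{R}^k$, i.e. $A(t)$ has full column rank $k$. So that boundary values are meaningful on $H_D^1$ (below), $\ker D\subseteq\ker G_a\cap\ker G_b$. Regularity and index (tractability index). Put $G_0=AD$, $B_0=B$, let $D^+=D^T$, $P_0=\Pi_0=D^+D$, $Q_0=I-P_0$. For $i\ge1$ put $G_i=G_{i-1}+B_{i-1}Q_{i-1}$; choose a continuous projector function $Q_i$ onto $N_i=\ker G_i$ with $N_0+\dots+N_{i-1}\subseteq\ker Q_i$; put $P_i=I-Q_i$, $\Pi_i=\Pi_{i-1}P_i$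 (with $D\Pi_iD^+$ continuously differentiable), and $B_i=B_{i-1}P_{i-1}-G_iD^+(D\Pi_iD^+)'D\Pi_{i-1}$. The DAE is regular with index $\mu\in\mathbb{N}$ if this sequence can be built with each $G_i$ of constant rank $r_i$ on $[a,b]$ and $r_0\le\dots\le r_{\mu-1}<r_\mu=m$. Then $l=m-\sum_{i=0}^{\mu-1}(m-r_i)$. The boundary condition is accurately stated if the homogeneous DAE ($q=0$) with boundary condition $G_ax(a)+G_bx(b)=d$ has exactly one solution for each $d\in\mathbb{R}^l$. Spaces. $L^2=L^2((a,b),\mathbb{R}^m)$, $H_D^1=\{x\in L^2: Dx\in H^1((a,b),\mathbb{R}^k)\}$ with $\|x\|_{H_D^1}^2=\|x\|_{L^2}^2+\|(Dx)'\|_{L^2}^2$; $|\cdot|$ is the Euclidean norm. Ansatz space. A partition is $\pi: a=t_0<t_1<\dots<t_n=b$, with $h_j=t_j-t_{j-1}$, $h=\max_jh_j$, $h_{min}=\min_jh_j$. For a fixed integer $N\ge1$, $X_\pi$ is the set of all functions $x:[a,b]\to\mathbb{R}^m$, piecewise continuous with breakpoints only at the meshpoints of $\pi$, such that $Dx$ is continuous on $[a,b]$ and, on each $[t_{j-1},t_j)$, the components $x_1,\dots,x_k$ are polynomials of degree at most $N$ and the components $x_{k+1},\dots,x_m$ are polynomials of degree at most $N-1$. Discretized functionals. Given nodes $0\le\tau_1<\dots<\tau_M\le1$, put $t_{ji}=t_{j-1}+\tau_ih_j$ ($i=1,\dots,M$, $j=1,\dots,n$), and let $l_{ji}(t)=\prod_{\kappa\ne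 i}\frac{t-t_{j\kappa}}{t_{ji}-t_{j\kappa}}$ be the Lagrange basis polynomials. At the points $t_{ji}$ the values of $x\in X_\pi$ and $(Dx)'$ are those of the polynomial piece of $x$ on the $j$-th subinterval. With $w_{ji}(x)=A(t_{ji})(Dx)'(t_{ji})+B(t_{ji})x(t_{ji})-q(t_{ji})$, define $$\Phi^R_{\pi,M}(x)=\sum_{j=1}^n\int_{t_{j-1}}^{t_j}\Bigl|\sum_{i=1}^Ml_{ji}(t)\,w_{ji}(x)\Bigr|^2dt+|G_ax(a)+G_bx(b)-d|^2,$$ and, for quadrature weights $\gamma_1,\dots,\gamma_M$ on $[0,1]$ belonging to these nodes, $$\Phi^I_{\pi,M}(x)=\sum_{j=1}^nh_j\sum_{i=1}^M\gamma_i\,|w_{ji}(x)|^2+|G_ax(a)+G_bx(b)-d|^2 .$$ An integration rule is of interpolation type if its weights are the integrals over $[0,1]$ of the Lagrange basis polynomials of its nodes. *)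

theory Defs
  imports "HOL-Analysis.Analysis" "HOL-Computational_Algebra.Polynomial"
begin

(* Conventions. Vectors in R^m are indexed by 'k + 'r: the components Inl i are the k = CARD('k)
   differentiated ones, the components Inr i are the remaining m - k = CARD('r) > 0 ones.
   The boundary matrices Ga, Gb have l rows, and l = 0 is possible; hence a matrix with l rows is
   given by its rows Ga 0, ..., Ga (l - 1), and likewise a vector d in R^l by d 0, ..., d (l - 1). *)

definition Dmat :: "real ^ ('k::finite + 'r::finite) ^ 'k" where
  "Dmat = (\<chi> i c. if c = Inl i then 1 else 0)"

definition ker :: "real ^ 'n::finite ^ 'p::finite \<Rightarrow> (real ^ 'n) set" where
  "ker M = {z. M *v z = 0}"

definition Ck_on :: "nat \<Rightarrow> real set \<Rightarrow> (real \<Rightarrow> 'v::real_normed_vector) \<Rightarrow> bool" where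
  "Ck_on s S f \<longleftrightarrow> (\<exists>F. F 0 = f \<and> (\<forall>i\<le>s. continuous_on S (F i)) \<and>
     (\<forall>i<s. \<forall>t\<in>S. (F i has_vector_derivative F (Suc i) t) (at t within S)))"

definition properly_involved :: "real \<Rightarrow> real \<Rightarrow> (real \<Rightarrow> real ^ 'k ^ ('k::finite + 'r::finite)) \<Rightarrow> bool" where
  "properly_involved a b A \<longleftrightarrow> (\<forall>t\<in>{a..b}.
     ker (A t) \<inter> range ((*v) (Dmat :: real ^ ('k + 'r) ^ 'k)) = {0} \<and>
     {u + v | u v. u \<in> ker (A t) \<and> v \<in> range ((*v) (Dmat :: real ^ ('k + 'r) ^ 'k))} = UNIV)"

(* Solutions are understood in the classical sense, not merely in HD1. *)
definition dae_solution ::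
  "real \<Rightarrow> real \<Rightarrow> (real \<Rightarrow> real ^ 'k ^ ('k::finite + 'r::finite)) \<Rightarrow> (real \<Rightarrow> real ^ ('k + 'r) ^ ('k + 'r))
   \<Rightarrow> (real \<Rightarrow> real ^ ('k + 'r)) \<Rightarrow> (real \<Rightarrow> real ^ ('k + 'r)) \<Rightarrow> bool" where
  "dae_solution a b A B q x \<longleftrightarrow>
     continuous_on {a..b} x \<and> Ck_on 1 {a..b} (\<lambda>s. Dmat *v x s) \<and>
     (\<forall>t\<in>{a..b}. A t *v vector_derivative (\<lambda>s. Dmat *v x s) (at t within {a..b}) + B t *v x t = q t)"

definition boundary_condition ::
  "real \<Rightarrow> real \<Rightarrow> nat \<Rightarrow> (nat \<Rightarrow> real ^ 'n::finite) \<Rightarrow> (nat \<Rightarrow> real ^ 'n) \<Rightarrow> (nat \<Rightarrow> real)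
   \<Rightarrow> (real \<Rightarrow> real ^ 'n) \<Rightarrow> bool" where
  "boundary_condition a b l Ga Gb d x \<longleftrightarrow> (\<forall>i<l. Ga i \<bullet> x a + Gb i \<bullet> x b = d i)"

(* Functions on [a,b] are represented by elements of extensional {a..b}, so that uniqueness is
   not spoiled by values outside the interval. *)
definition accurately_stated ::
  "real \<Rightarrow> real \<Rightarrow> (real \<Rightarrow> real ^ 'k ^ ('k::finite + 'r::finite)) \<Rightarrow> (real \<Rightarrow> real ^ ('k + 'r) ^ ('k + 'r))
   \<Rightarrow> nat \<Rightarrow> (nat \<Rightarrow> real ^ ('k + 'r)) \<Rightarrow> (nat \<Rightarrow> real ^ ('k + 'r)) \<Rightarrow> bool" where
  "accurately_stated a b A B l Ga Gb \<longleftrightarrow>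
     (\<forall>d. \<exists>!x. x \<in> extensional {a..b} \<and> dae_solution a b A B (\<lambda>_. 0) x \<and>
                boundary_condition a b l Ga Gb d x)"

definition projector_onto :: "real ^ 'n ^ 'n::finite \<Rightarrow> (real ^ 'n) set \<Rightarrow> bool" where
  "projector_onto Q S \<longleftrightarrow> Q ** Q = Q \<and> range ((*v) Q) = S"

(* r holds the ranks r_0, ..., r_mu of the matrices G_0, ..., G_mu. The projectors are needed up to
   Q_(mu-1) only, since G_mu is nonsingular. The span below is the sum N_0 + ... + N_(i-1). *)
definition regular_with_index ::
  "real \<Rightarrow> real \<Rightarrow> (real \<Rightarrow> real ^ 'k ^ ('k::finite + 'r::finite)) \<Rightarrow> (real \<Rightarrow> real ^ ('k + 'r) ^ ('k + 'r))
   \<Rightarrow> nat \<Rightarrow> (nat \<Rightarrow> nat) \<Rightarrow> bool" where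
  "regular_with_index a b A B \<mu> r \<longleftrightarrow>
    (\<exists>(G :: nat \<Rightarrow> real \<Rightarrow> real ^ ('k + 'r) ^ ('k + 'r)) Bs Q Pi.
       let D = (Dmat :: real ^ ('k + 'r) ^ 'k); Dp = transpose D in
       (\<forall>t\<in>{a..b}. G 0 t = A t ** D \<and> Bs 0 t = B t \<and>
                   Pi 0 t = Dp ** D \<and> Q 0 t = mat 1 - Dp ** D) \<and>
       (\<forall>i\<in>{1..\<mu>}. \<forall>t\<in>{a..b}. G i t = G (i - 1) t + Bs (i - 1) t ** Q (i - 1) t) \<and>
       (\<forall>i\<in>{1..<\<mu>}.
          continuous_on {a..b} (Q i) \<and>
          Ck_on 1 {a..b} (\<lambda>s. D ** Pi i s ** Dp) \<and>
          (\<forall>t\<in>{a..b}.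
             projector_onto (Q i t) (ker (G i t)) \<and>
             span (\<Union>j<i. ker (G j t)) \<subseteq> ker (Q i t) \<and>
             Pi i t = Pi (i - 1) t ** (mat 1 - Q i t) \<and>
             Bs i t = Bs (i - 1) t ** (mat 1 - Q (i - 1) t)
               - G i t ** Dp ** vector_derivative (\<lambda>s. D ** Pi i s ** Dp) (at t within {a..b})
                  ** D ** Pi (i - 1) t)) \<and>
       (\<forall>i\<le>\<mu>. \<forall>t\<in>{a..b}. rank (G i t) = r i) \<and>
       (\<forall>i j. i \<le> j \<and> j \<le> \<mu> \<longrightarrow> r i \<le> r j) \<and>
       (\<forall>i<\<mu>. r i < r \<mu>) \<and> r \<mu> = CARD('k + 'r))"

definition L2 :: "real \<Rightarrow> real \<Rightarrow> (real \<Rightarrow> 'v::euclidean_space) set" where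
  "L2 a b = {u. u \<in> borel_measurable (lebesgue_on {a<..<b}) \<and>
                integrable (lebesgue_on {a<..<b}) (\<lambda>t. (norm (u t))\<^sup>2)}"

definition L2_norm :: "real \<Rightarrow> real \<Rightarrow> (real \<Rightarrow> 'v::euclidean_space) \<Rightarrow> real" where
  "L2_norm a b u = sqrt (\<integral>t. (norm (u t))\<^sup>2 \<partial>lebesgue_on {a<..<b})"

(* Test functions of class C^1 give the same weak derivatives as smooth ones. *)
definition test_function :: "real \<Rightarrow> real \<Rightarrow> (real \<Rightarrow> real) \<Rightarrow> bool" where
  "test_function a b \<phi> \<longleftrightarrow> Ck_on 1 UNIV \<phi> \<and>
     (\<exists>c e. a < c \<and> e < b \<and> (\<forall>t. t \<notin> {c..e} \<longrightarrow> \<phi> t = 0))"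

definition weak_derivative ::
  "real \<Rightarrow> real \<Rightarrow> (real \<Rightarrow> 'v::euclidean_space) \<Rightarrow> (real \<Rightarrow> 'v) \<Rightarrow> bool" where
  "weak_derivative a b u g \<longleftrightarrow> (\<forall>\<phi>. test_function a b \<phi> \<longrightarrow>
     (\<integral>t. deriv \<phi> t *\<^sub>R u t \<partial>lebesgue_on {a<..<b}) = - (\<integral>t. \<phi> t *\<^sub>R g t \<partial>lebesgue_on {a<..<b}))"

definition H1 :: "real \<Rightarrow> real \<Rightarrow> (real \<Rightarrow> 'v::euclidean_space) set" where
  "H1 a b = {u \<in> L2 a b. \<exists>g\<in>L2 a b. weak_derivative a b u g}"

definition HD1 :: "real \<Rightarrow> real \<Rightarrow> (real \<Rightarrow> real ^ ('k::finite + 'r::finite)) set" where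
  "HD1 a b = {x \<in> L2 a b. (\<lambda>t. Dmat *v x t :: real ^ 'k) \<in> H1 a b}"

(* The weak derivative is determined almost everywhere, so the choice does not affect the norm. *)
definition HD1_norm :: "real \<Rightarrow> real \<Rightarrow> (real \<Rightarrow> real ^ ('k::finite + 'r::finite)) \<Rightarrow> real" where
  "HD1_norm a b x = sqrt ((L2_norm a b x)\<^sup>2 +
     (L2_norm a b (SOME g :: real \<Rightarrow> real ^ 'k. g \<in> L2 a b \<and> weak_derivative a b (\<lambda>t. Dmat *v x t) g))\<^sup>2)"

definition is_partition :: "real \<Rightarrow> real \<Rightarrow> nat \<Rightarrow> (nat \<Rightarrow> real) \<Rightarrow> bool" where
  "is_partition a b n t \<longleftrightarrow> 1 \<le> n \<and> t 0 = a \<and> t n = b \<and> (\<forall>j\<in>{1..n}. t (j - 1) < t j)"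

definition step :: "(nat \<Rightarrow> real) \<Rightarrow> nat \<Rightarrow> real" where
  "step t j = t j - t (j - 1)"

definition step_max :: "nat \<Rightarrow> (nat \<Rightarrow> real) \<Rightarrow> real" where
  "step_max n t = Max (step t ` {1..n})"

definition step_min :: "nat \<Rightarrow> (nat \<Rightarrow> real) \<Rightarrow> real" where
  "step_min n t = Min (step t ` {1..n})"

(* The half-open intervals do not determine the components Inr i at b; the point b is not a jump,
   i.e. the last polynomial piece extends to b. *)
definition ansatz_space ::
  "real \<Rightarrow> real \<Rightarrow> nat \<Rightarrow> nat \<Rightarrow> (nat \<Rightarrow> real) \<Rightarrow> (real \<Rightarrow> real ^ ('k::finite + 'r::finite)) set" where
  "ansatz_space a b N n t = {x \<in> extensional {a..b}.
     continuous_on {a..b} (\<lambda>s. Dmat *v x s :: real ^ 'k) \<and>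
     continuous (at b within {a..b}) x \<and>
     (\<forall>j\<in>{1..n}. \<forall>c. \<exists>p :: real poly.
        degree p \<le> (case c of Inl _ \<Rightarrow> N | Inr _ \<Rightarrow> N - 1) \<and>
        (\<forall>s\<in>{t (j - 1)..<t j}. x s $ c = poly p s))}"

definition piece :: "(nat \<Rightarrow> real) \<Rightarrow> (real \<Rightarrow> real ^ 'n::finite) \<Rightarrow> nat \<Rightarrow> 'n \<Rightarrow> real poly" where
  "piece t x j c = (THE p. \<forall>s\<in>{t (j - 1)..<t j}. x s $ c = poly p s)"

definition nodes :: "nat \<Rightarrow> (nat \<Rightarrow> real) \<Rightarrow> bool" where
  "nodes M \<tau> \<longleftrightarrow> strict_mono_on {1..M} \<tau> \<and> \<tau> ` {1..M} \<subseteq> {0..1}"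

definition lagrange :: "nat \<Rightarrow> (nat \<Rightarrow> real) \<Rightarrow> nat \<Rightarrow> real \<Rightarrow> real" where
  "lagrange M \<sigma> i s = (\<Prod>\<kappa>\<in>{1..M} - {i}. (s - \<sigma> \<kappa>) / (\<sigma> i - \<sigma> \<kappa>))"

definition colloc :: "(nat \<Rightarrow> real) \<Rightarrow> (nat \<Rightarrow> real) \<Rightarrow> nat \<Rightarrow> nat \<Rightarrow> real" where
  "colloc t \<tau> j i = t (j - 1) + \<tau> i * step t j"

definition residual ::
  "(real \<Rightarrow> real ^ 'k ^ ('k::finite + 'r::finite)) \<Rightarrow> (real \<Rightarrow> real ^ ('k + 'r) ^ ('k + 'r))
   \<Rightarrow> (real \<Rightarrow> real ^ ('k + 'r)) \<Rightarrow> (nat \<Rightarrow> real) \<Rightarrow> (nat \<Rightarrow> real)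
   \<Rightarrow> (real \<Rightarrow> real ^ ('k + 'r)) \<Rightarrow> nat \<Rightarrow> nat \<Rightarrow> real ^ ('k + 'r)" where
  "residual A B q t \<tau> x j i = (let s = colloc t \<tau> j i in
     A s *v (\<chi> c. poly (pderiv (piece t x j (Inl c))) s) +
     B s *v (\<chi> c. poly (piece t x j c) s) - q s)"

definition boundary_defect ::
  "real \<Rightarrow> real \<Rightarrow> nat \<Rightarrow> (nat \<Rightarrow> real ^ 'n::finite) \<Rightarrow> (nat \<Rightarrow> real ^ 'n) \<Rightarrow> (nat \<Rightarrow> real)
   \<Rightarrow> (real \<Rightarrow> real ^ 'n) \<Rightarrow> real" where
  "boundary_defect a b l Ga Gb d x = (\<Sum>i<l. (Ga i \<bullet> x a + Gb i \<bullet> x b - d i)\<^sup>2)"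

definition PhiR where
  "PhiR a b A B q l Ga Gb d M \<tau> n t x =
     (\<Sum>j = 1..n. integral {t (j - 1)..t j}
        (\<lambda>s. (norm (\<Sum>i = 1..M. lagrange M (colloc t \<tau> j) i s *\<^sub>R residual A B q t \<tau> x j i))\<^sup>2)) +
     boundary_defect a b l Ga Gb d x"

definition PhiI where
  "PhiI a b A B q l Ga Gb d M \<tau> \<gamma> n t x =
     (\<Sum>j = 1..n. step t j * (\<Sum>i = 1..M. \<gamma> i * (norm (residual A B q t \<tau> x j i))\<^sup>2)) +
     boundary_defect a b l Ga Gb d x"

definition interpolation_type :: "nat \<Rightarrow> (nat \<Rightarrow> real) \<Rightarrow> (nat \<Rightarrow> real) \<Rightarrow> bool" where
  "interpolation_type M \<tau> \<gamma> \<longleftrightarrow> (\<forall>i\<in>{1..M}. \<gamma> i = integral {0..1} (lagrange M \<tau> i))"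

definition exact_up_to :: "nat \<Rightarrow> nat \<Rightarrow> (nat \<Rightarrow> real) \<Rightarrow> (nat \<Rightarrow> real) \<Rightarrow> bool" where
  "exact_up_to e M \<tau> \<gamma> \<longleftrightarrow> (\<forall>p :: real poly. degree p \<le> e \<longrightarrow>
     (\<Sum>i = 1..M. \<gamma> i * poly p (\<tau> i)) = integral {0..1} (poly p))"

definition unique_minimizer :: "('x \<Rightarrow> real) \<Rightarrow> 'x set \<Rightarrow> 'x \<Rightarrow> bool" where
  "unique_minimizer \<Phi> X x \<longleftrightarrow> is_arg_min \<Phi> (\<lambda>y. y \<in> X) x \<and>
     (\<forall>y. is_arg_min \<Phi> (\<lambda>y. y \<in> X) y \<longrightarrow> y = x)"

(* Membership in HD1 is included because HD1_norm is meaningless outside HD1. *)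
definition HD1_error_le ::
  "real \<Rightarrow> real \<Rightarrow> (real \<Rightarrow> real ^ ('k::finite + 'r::finite)) \<Rightarrow> (real \<Rightarrow> real ^ ('k + 'r)) \<Rightarrow> real \<Rightarrow> bool" where
  "HD1_error_le a b x y e \<longleftrightarrow> (\<lambda>t. x t - y t) \<in> HD1 a b \<and> HD1_norm a b (\<lambda>t. x t - y t) \<le> e"

definition for_fine_partitions ::
  "real \<Rightarrow> real \<Rightarrow> real \<Rightarrow> (nat \<Rightarrow> (nat \<Rightarrow> real) \<Rightarrow> bool) \<Rightarrow> bool" where
  "for_fine_partitions a b \<rho> P \<longleftrightarrow> (\<exists>h\<^sub>0>0. \<forall>n t.
     is_partition a b n t \<and> step_max n t / step_min n t \<le> \<rho> \<and> step_max n t \<le> h\<^sub>0 \<longrightarrow> P n t)"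

definition poly_entries :: "real \<Rightarrow> real \<Rightarrow> nat \<Rightarrow> (real \<Rightarrow> real ^ 'n::finite ^ 'p::finite) \<Rightarrow> bool" where
  "poly_entries a b e F \<longleftrightarrow> (\<forall>i j. \<exists>p :: real poly. degree p \<le> e \<and> (\<forall>t\<in>{a..b}. F t $ i $ j = poly p t))"

end

theory Submission
  imports Defs
begin

text \<open>Let T x = A (Dx)' + B x, let m be the number of components and x_s the given solution.
  Minimizing \<open>PhiR\<close> over the ansatz space is a linear least-squares problem. On each
  piece T x is a polynomial of degree at most N + N_AB < M for every ansatz function x, so
  interpolation at M nodes reproduces it, and only q is really interpolated
  (\<open>PhiR_pw\<close>). There is an ansatz function p that approximates x_s with error O(h^N) in
  the H_D^1 norm, with exact values of D x_s at the mesh points (\<open>approximation\<close>). The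
  functional at p is O(h^(2N)), hence so is its minimum, and the parallelogram identity
  (\<open>lsq_parallelogram\<close>) shows that T and the boundary operator applied to the
  difference of the minimizer and p give O(h^N). The error bound now follows from
  \<open>stability\<close>: on the ansatz space the H_D^1 norm is at most C h_min^(-(\<mu>-1)) times
  the L^2 norm of T x together with the boundary values; h / h_min \<le> \<rho> turns h_min into h.
  The same inequality makes the quadratic form definite, so the minimizer is unique; existence holds
  because a quadratic functional bounded below on a finite-dimensional space attains its minimum
  (\<open>quadratic_minimum\<close>).

  Stability rests on a continuous fact about index \<mu>: if T x = w, then x is bounded pointwise by
  w, w', ..., w^(\<mu>-1), an integral of |w| and finitely many parameters, which the boundary
  condition controls. On polynomial pieces the inverse inequality trades the derivatives of w for
  the factor h^(-(\<mu>-1)). For constant coefficients w has degree at most N, so that derivatives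
  of order above N vanish and the loss is at most h^(-N).

  The continuous fact is obtained as follows. The projectors Q_i are only continuous, so the
  argument passes from them to the subspaces K_i = N_0 + ... + N_(i-1) (\<open>KK\<close>) and S_i =
  G_i K_i (\<open>SS\<close>). Three facts are extracted: T maps sections of K_(i+1) into S_(i+1);
  where the image of such a section lies in S_i, the section lies in K_i
  (\<open>DAE_op_section\<close>, from the identity \<open>decoupling\<close>); and K_(i+1) is the
  set of all z with A D z in S_i (\<open>G_0_in_SS_iff\<close>). By the last one K_(i+1) is the
  kernel of a smooth matrix of constant rank, so smooth local frames adapted to the filtration K_1
  \<le> K_2 \<le> ... can be built step by step (\<open>frame_step\<close>). In the coordinates of
  such a frame (\<open>omega_eq\<close>) the DAE splits into an explicit ODE for the coordinates
  modulo K_\<mu> and a triangular system for the others: level \<mu>-1 is determined algebraically,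
  and each lower level costs one more derivative of w (\<open>expr_coordinate\<close>). The ODE
  controls the distance from K_\<mu> along the interval (\<open>propagation\<close>); compactness
  and connectedness of [a,b] make the local estimates global. An accurately stated boundary
  condition provides l homogeneous solutions whose initial values span a complement of K_\<mu>(a)
  (\<open>initial_decomposition\<close>). Subtracting a combination of them from an ansatz function
  removes the free parameters, and their coefficients are recovered from the boundary values
  (\<open>stability_pointwise\<close>).

  For quadrature rules exact up to degree 2M-2 the two functionals coincide
  (\<open>PhiI_eq_PhiR\<close>), because the squared norm of the interpolated residual is a
  polynomial of that degree on each piece.\<close>

declare transpose_matrix_vector [simp del]

section \<open>Matrix calculus, kernels, and the matrix \<open>Dmat\<close>\<close>

lemma has_vector_derivative_matrix_vector:
  fixes M :: "real \<Rightarrow> real^'n^'m"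
  assumes "(M has_vector_derivative M') (at t within J)" "(v has_vector_derivative v') (at t within J)"
  shows "((\<lambda>s. M s *v v s) has_vector_derivative M t *v v' + M' *v v t) (at t within J)"
proof -
  have "bilinear ((*v) :: real^'n^'m \<Rightarrow> _)"
    unfolding bilinear_def
    by (auto intro!: linearI simp: matrix_vector_mult_add_rdistrib matrix_vector_right_distrib
        scaleR_matrix_vector_assoc matrix_vector_mult_scaleR)
  then have "bounded_bilinear ((*v) :: real^'n^'m \<Rightarrow> _)"
    by (simp add: bilinear_conv_bounded_bilinear)
  from bounded_bilinear.has_vector_derivative[OF this assms] show ?thesis .
qed

text \<open>The kernel is the orthogonal complement of the row space, and \<open>rank\<close> is the
  dimension of the row space.\<close>

lemma dim_ker_add_rank:
  fixes M :: "real^'n^'p"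
  shows "dim (ker M) + rank M = CARD('n)"
proof -
  have "ker M = {y \<in> UNIV. \<forall>x\<in>span (rows M). orthogonal x y}"
  proof (intro equalityI subsetI)
    fix y assume "y \<in> ker M"
    then show "y \<in> {y \<in> UNIV. \<forall>x\<in>span (rows M). orthogonal x y}"
      using orthogonal_nullspace_rowspace[of M y] by (auto simp: ker_def orthogonal_commute)
  next
    fix y assume y: "y \<in> {y \<in> UNIV. \<forall>x\<in>span (rows M). orthogonal x y}"
    have "orthogonal (row i M) y" for i
      using y span_base[of "row i M" "rows M"] by (auto simp: rows_def)
    then have "M *v y = 0"
      by (simp add: vec_eq_iff matrix_vector_mul_component orthogonal_def row_def)
    then show "y \<in> ker M" by (simp add: ker_def)
  qed
  then show ?thesis
    using dim_subspace_orthogonal_to_vectors[of "span (rows M)" UNIV]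
    by (simp add: row_rank_def add.commute)
qed

lemma subspace_ker: "subspace (ker M)" for M :: "real^'n^'p"
  by (auto simp: ker_def subspace_def matrix_vector_right_distrib matrix_vector_mult_scaleR)

lemma Dmat_nth: "((Dmat :: real^('k::finite+'r::finite)^'k) *v x) $ i = x $ Inl i"
  by (simp add: Dmat_def matrix_vector_mult_def if_distrib[of "\<lambda>y. y * _"] cong: if_cong)

lemma transpose_Dmat_nth:
  "(transpose (Dmat :: real^('k::finite+'r::finite)^'k) *v u) $ c = (case c of Inl i \<Rightarrow> u $ i | Inr _ \<Rightarrow> 0)"
  by (cases c) (auto simp: Dmat_def matrix_vector_mult_def transpose_def
      if_distrib[of "\<lambda>y. y * _"] cong: if_cong)

lemma Dmat_transpose_Dmat [simp]:
  "(Dmat :: real^('k::finite+'r::finite)^'k) *v (transpose Dmat *v u) = u"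
  by (simp add: vec_eq_iff Dmat_nth transpose_Dmat_nth)

lemmas mat_vec_simps = matrix_vector_mul_assoc[symmetric] matrix_vector_mult_add_rdistrib
  matrix_vector_mult_diff_rdistrib matrix_vector_right_distrib matrix_vector_mult_diff_distrib

section \<open>The tractability sequence and the subspaces \<open>KK\<close> and
  \<open>SS\<close>\<close>

text \<open>One fixed sequence as in \<open>regular_with_index\<close>, with its conditions in
  pointwise form. \<open>R i\<close> is the derivative of D Pi_i D^+, carried as a parameter;
  \<open>A_inj\<close> is the full column rank of A.\<close>

locale tractability =
  fixes a b :: real
    and A :: "real \<Rightarrow> real ^ 'k ^ ('k::finite + 'r::finite)"
    and B :: "real \<Rightarrow> real ^ ('k + 'r) ^ ('k + 'r)"
    and \<mu> :: nat and r :: "nat \<Rightarrow> nat"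
    and G Bs Q Pi :: "nat \<Rightarrow> real \<Rightarrow> real ^ ('k + 'r) ^ ('k + 'r)"
    and R :: "nat \<Rightarrow> real \<Rightarrow> real ^ 'k ^ 'k"
  assumes ab: "a < b"
    and A_inj: "t \<in> {a..b} \<Longrightarrow> A t *v u = 0 \<Longrightarrow> u = 0"
    and G_0: "t \<in> {a..b} \<Longrightarrow> G 0 t = A t ** Dmat"
    and Bs_0: "t \<in> {a..b} \<Longrightarrow> Bs 0 t = B t"
    and Pi_0: "t \<in> {a..b} \<Longrightarrow> Pi 0 t = transpose Dmat ** Dmat"
    and Q_0: "t \<in> {a..b} \<Longrightarrow> Q 0 t = mat 1 - transpose Dmat ** Dmat"
    and G_Suc: "t \<in> {a..b} \<Longrightarrow> i < \<mu> \<Longrightarrow> G (Suc i) t = G i t + Bs i t ** Q i t"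
    and Pi_deriv: "t \<in> {a..b} \<Longrightarrow> 0 < i \<Longrightarrow> i < \<mu> \<Longrightarrow>
      ((\<lambda>s. Dmat ** Pi i s ** transpose Dmat) has_vector_derivative R i t) (at t within {a..b})"
    and Q_proj: "t \<in> {a..b} \<Longrightarrow> 0 < i \<Longrightarrow> i < \<mu> \<Longrightarrow> projector_onto (Q i t) (ker (G i t))"
    and Q_adm: "t \<in> {a..b} \<Longrightarrow> 0 < i \<Longrightarrow> i < \<mu> \<Longrightarrow> span (\<Union>j<i. ker (G j t)) \<subseteq> ker (Q i t)"
    and Pi_Suc: "t \<in> {a..b} \<Longrightarrow> 0 < i \<Longrightarrow> i < \<mu> \<Longrightarrow> Pi i t = Pi (i - 1) t ** (mat 1 - Q i t)"
    and Bs_Suc: "t \<in> {a..b} \<Longrightarrow> 0 < i \<Longrightarrow> i < \<mu> \<Longrightarrow>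
      Bs i t = Bs (i - 1) t ** (mat 1 - Q (i - 1) t)
        - G i t ** transpose Dmat ** R i t ** Dmat ** Pi (i - 1) t"
    and rank_G: "t \<in> {a..b} \<Longrightarrow> i \<le> \<mu> \<Longrightarrow> rank (G i t) = r i"
    and rank_top: "r \<mu> = CARD('k + 'r)"
begin

text \<open>The sum N_0 + ... + N_(i-1). Unlike the projectors, this flag of subspaces will turn out
  to vary as smoothly as A and B do.\<close>

definition KK :: "nat \<Rightarrow> real \<Rightarrow> (real ^ ('k + 'r)) set" where
  "KK i t = span (\<Union>j<i. ker (G j t))"

(* PP i is the projector Pi_(i-1) along KK i, with the convention Pi_(-1) = I. *)
definition PP :: "nat \<Rightarrow> real \<Rightarrow> real ^ ('k + 'r) ^ ('k + 'r)" where
  "PP i t = (if i = 0 then mat 1 else Pi (i - 1) t)"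

text \<open>All later matrices G_(i+1), G_(i+2), ... agree with G_i on K_i, so these images increase
  with i; they have the same dimension as K_i.\<close>

definition SS :: "nat \<Rightarrow> real \<Rightarrow> (real ^ ('k + 'r)) set" where
  "SS i t = (*v) (G i t) ` KK i t"

text \<open>The common dimension of K_i and S_i; at \<mu> it is m - l.\<close>

definition dK :: "nat \<Rightarrow> nat" where
  "dK i = (\<Sum>j<i. CARD('k + 'r) - r j)"

lemma KK_0 [simp]: "KK 0 t = {0}"
  by (simp add: KK_def)

lemma subspace_KK: "subspace (KK i t)"
  by (simp add: KK_def)

lemma KK_mono: "i \<le> j \<Longrightarrow> KK i t \<subseteq> KK j t"
  unfolding KK_def by (intro span_mono UN_mono) auto

lemma ker_G_subset_KK: "ker (G i t) \<subseteq> KK (Suc i) t"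
  unfolding KK_def by (meson UN_I lessI span_base subsetI lessThan_iff)

lemma subspace_SS: "subspace (SS i t)"
  unfolding SS_def by (intro linear_subspace_image subspace_KK) auto

lemma SS_0 [simp]: "SS 0 t = {0}"
  by (simp add: SS_def)

context
  fixes t assumes t: "t \<in> {a..b}"
begin

lemma ker_G_0: "ker (G 0 t) = ker (Dmat :: real^('k+'r)^'k)"
  using A_inj[OF t] by (auto simp: ker_def G_0[OF t] mat_vec_simps)

text \<open>The case i = 0 is separate because Q_0 is given explicitly, as I - D^T D, and its range
  is ker D = ker G_0.\<close>

lemma Q_G:
  assumes "i < \<mu>"
  shows "Q i t *v (Q i t *v v) = Q i t *v v" "G i t *v (Q i t *v v) = 0"
    "G i t *v w = 0 \<Longrightarrow> Q i t *v w = w"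
proof -
  have "Q i t ** Q i t = Q i t \<and> range ((*v) (Q i t)) = ker (G i t)"
  proof (cases "i = 0")
    case True
    have D: "transpose Dmat *v (Dmat *v w) = w - Q 0 t *v w" for w :: "real^('k+'r)"
      by (simp add: Q_0[OF t] mat_vec_simps)
    have 1: "Dmat *v (Q 0 t *v w) = (0::real^'k)" for w
      by (simp add: Q_0[OF t] mat_vec_simps)
    have "Q 0 t ** Q 0 t = Q 0 t"
      by (simp add: matrix_eq matrix_vector_mul_assoc[symmetric])
        (metis 1 D diff_self eq_iff_diff_eq_0 matrix_vector_mult_0_right)
    moreover have "range ((*v) (Q 0 t)) = ker (G 0 t)"
    proof -
      have "w \<in> ker (Dmat :: real^('k+'r)^'k) \<Longrightarrow> w = Q 0 t *v w" for w
        using D[of w] by (simp add: ker_def)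
      then show ?thesis
        unfolding ker_G_0 using 1 by (auto simp: ker_def)
    qed
    ultimately show ?thesis using True by simp
  next
    case False
    then show ?thesis using Q_proj[OF t _ assms] by (simp add: projector_onto_def)
  qed
  then have 1: "Q i t ** Q i t = Q i t" and 2: "range ((*v) (Q i t)) = ker (G i t)" by auto
  show *: "Q i t *v (Q i t *v v) = Q i t *v v" for v
    by (simp add: matrix_vector_mul_assoc 1)
  show "G i t *v (Q i t *v v) = 0"
    using 2 by (auto simp: ker_def)
  assume "G i t *v w = 0"
  then have "w \<in> range ((*v) (Q i t))" by (simp add: 2 ker_def)
  then show "Q i t *v w = w" using * by auto
qed

lemma Q_KK: "i < \<mu> \<Longrightarrow> v \<in> KK i t \<Longrightarrow> Q i t *v v = 0"
  using Q_adm[OF t, of i] by (cases "i = 0") (auto simp: KK_def ker_def)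

lemma PP_Suc: "i < \<mu> \<Longrightarrow> PP (Suc i) t *v v = PP i t *v (v - Q i t *v v)"
  using Pi_Suc[OF t, of i] Pi_0[OF t] Q_0[OF t]
  by (cases "i = 0") (auto simp: PP_def mat_vec_simps)

text \<open>Together with \<open>PP_KK\<close> this identifies \<open>PP i t\<close> as a projector
  with kernel exactly K_i. In the induction step the component Q_i v is split off; it lies in ker
  G_i, hence in K_(i+1).\<close>

lemma diff_PP_in_KK: "i \<le> \<mu> \<Longrightarrow> v - PP i t *v v \<in> KK i t"
proof (induction i arbitrary: v)
  case 0 then show ?case by (simp add: PP_def)
next
  case (Suc i)
  let ?q = "Q i t *v v"
  have "(v - ?q) - PP i t *v (v - ?q) \<in> KK (Suc i) t"
    using Suc KK_mono[of i "Suc i" t] by force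
  moreover have "?q \<in> KK (Suc i) t"
    using Q_G(2)[of i v] ker_G_subset_KK[of i t] Suc.prems by (auto simp: ker_def)
  ultimately have "((v - ?q) - PP i t *v (v - ?q)) + ?q \<in> KK (Suc i) t"
    using subspace_KK subspace_add by blast
  then show ?case using Suc.prems by (simp add: PP_Suc)
qed

lemma PP_KK: "i \<le> \<mu> \<Longrightarrow> v \<in> KK i t \<Longrightarrow> PP i t *v v = 0"
proof (induction i arbitrary: v)
  case 0 then show ?case by simp
next
  case (Suc i)
  \<comment> \<open>It suffices to check the generators: on K_i the projector Q_i vanishes and the
    induction hypothesis applies, on N_i the projector Q_i is the identity.\<close>
  have "KK (Suc i) t = span (KK i t \<union> ker (G i t))"
    unfolding KK_def lessThan_Suc UN_insert span_Un span_span by (simp add: Un_commute[of "ker _"] flip: span_Un)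
  moreover have "PP (Suc i) t *v w = 0" if "w \<in> KK i t \<union> ker (G i t)" for w
    using that
  proof
    assume "w \<in> KK i t"
    with Suc show ?thesis by (simp add: PP_Suc Q_KK)
  next
    assume "w \<in> ker (G i t)"
    with Suc.prems show ?thesis by (simp add: PP_Suc Q_G(3) ker_def)
  qed
  ultimately show ?case
    using Suc.prems(2) linear_eq_0_on_span[of "(*v) (PP (Suc i) t)" "KK i t \<union> ker (G i t)" v]
    by auto
qed

lemma KK_iff: "i \<le> \<mu> \<Longrightarrow> v \<in> KK i t \<longleftrightarrow> PP i t *v v = 0"
  using PP_KK diff_PP_in_KK[of i v] by auto

lemma PP_idem: "i \<le> \<mu> \<Longrightarrow> PP i t *v (PP i t *v v) = PP i t *v v"
  using PP_KK[OF _ diff_PP_in_KK, of i v] by (simp add: mat_vec_simps)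

lemma Q_PP: "i < \<mu> \<Longrightarrow> Q i t *v (PP i t *v v) = Q i t *v v"
  using Q_KK[OF _ diff_PP_in_KK, of i v] by (simp add: mat_vec_simps)

lemma PP_Suc_PP: "i < \<mu> \<Longrightarrow> PP (Suc i) t *v (PP i t *v v) = PP (Suc i) t *v v"
  by (simp add: PP_Suc Q_PP mat_vec_simps PP_idem)

lemma Q_in_ker_KK: "i < \<mu> \<Longrightarrow> Q i t *v v \<in> KK (Suc i) t"
  using Q_G(2)[of i v] ker_G_subset_KK[of i t] by (auto simp: ker_def)

lemma diff_Q_in_KK: "i < \<mu> \<Longrightarrow> v \<in> KK (Suc i) t \<Longrightarrow> v - Q i t *v v \<in> KK i t"
  by (simp add: KK_iff PP_Suc)

text \<open>From index 1 on the projectors take values in the range of D^T D; with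
  \<open>PP_DtD\<close> they also depend on D v only. This is what allows Pi_i to be handled through
  D Pi_i D^+.\<close>

lemma DtD_PP: "0 < i \<Longrightarrow> i \<le> \<mu> \<Longrightarrow> transpose Dmat *v ((Dmat :: real^('k+'r)^'k) *v (PP i t *v v)) = PP i t *v v"
proof (induction i arbitrary: v rule: nat_induct_non_zero)
  case 1 then show ?case
    by (simp add: PP_def Pi_0[OF t] mat_vec_simps)
next
  case (Suc i) then show ?case by (simp add: PP_Suc)
qed

lemma PP_DtD:
  assumes "0 < i" "i \<le> \<mu>"
  shows "PP i t *v (transpose Dmat *v ((Dmat :: real^('k+'r)^'k) *v v)) = PP i t *v v"
proof -
  have "v - transpose Dmat *v ((Dmat :: real^('k+'r)^'k) *v v) \<in> KK i t"
    using Q_in_ker_KK[of 0 v] KK_mono[of 1 i t] assms by (auto simp: Q_0[OF t] mat_vec_simps)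
  from PP_KK[OF assms(2) this] show ?thesis by (simp add: mat_vec_simps)
qed

lemma G_Suc_Q: "i < \<mu> \<Longrightarrow> G (Suc i) t *v (Q i t *v v) = Bs i t *v (Q i t *v v)"
  by (simp add: G_Suc[OF t] mat_vec_simps Q_G)

lemma G_Suc_diff_Q: "i < \<mu> \<Longrightarrow> G (Suc i) t *v (v - Q i t *v v) = G i t *v v"
  by (simp add: G_Suc[OF t] mat_vec_simps Q_G)

lemma G_Suc_KK: "i < \<mu> \<Longrightarrow> v \<in> KK i t \<Longrightarrow> G (Suc i) t *v v = G i t *v v"
  by (simp add: G_Suc[OF t] mat_vec_simps Q_KK)

text \<open>Each step rewrites G_i v as G_(i+1) (v - Q_i v), which changes the argument by an
  element of K_(i+1) only.\<close>

lemma G_0_eq: "i \<le> \<mu> \<Longrightarrow> \<exists>k\<in>KK i t. G 0 t *v z = G i t *v (z + k)"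
proof (induction i)
  case 0 then show ?case by simp
next
  case (Suc i)
  then obtain k where k: "k \<in> KK i t" "G 0 t *v z = G i t *v (z + k)" by auto
  have "k - Q i t *v (z + k) \<in> KK (Suc i) t"
    using k KK_mono[of i "Suc i" t] Q_in_ker_KK[of i "z + k"] Suc.prems subspace_diff[OF subspace_KK]
    by auto
  moreover have "z + (k - Q i t *v (z + k)) = (z + k) - Q i t *v (z + k)" by simp
  ultimately show ?case using k G_Suc_diff_Q[of i "z + k"] Suc.prems by (metis Suc_le_lessD)
qed

text \<open>G_\<mu> is nonsingular. For i < \<mu> the projector Q_i is the identity on ker G_i and
  zero on K_i, so the two spaces meet in 0 only.\<close>

lemma G_inj_KK:
  assumes "i \<le> \<mu>" "v \<in> KK i t" "w \<in> KK i t" "G i t *v v = G i t *v w"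
  shows "v = w"
proof -
  have d: "G i t *v (v - w) = 0" using assms by (simp add: mat_vec_simps)
  have "v - w = 0"
  proof (cases "i = \<mu>")
    case True
    have "dim (ker (G i t)) = 0"
      using dim_ker_add_rank[of "G i t"] rank_G[OF t, of i] rank_top True by simp
    then show ?thesis using d by (auto simp: ker_def)
  next
    case False
    then show ?thesis using assms d Q_G(3)[of i "v - w"] Q_KK[of i "v - w"] subspace_diff[OF subspace_KK]
      by auto
  qed
  then show ?thesis by simp
qed

text \<open>A description of K_(i+1) that is free of projectors: with G_0 = A D it needs S_i alone.
  Through this recursion the smoothness of A and B passes on to the subspaces.\<close>

lemma G_0_in_SS_iff: "i < \<mu> \<Longrightarrow> G 0 t *v z \<in> SS i t \<longleftrightarrow> z \<in> KK (Suc i) t"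
proof -
  assume i: "i < \<mu>"
  obtain k where k: "k \<in> KK i t" "G 0 t *v z = G i t *v (z + k)"
    using G_0_eq[of i z] i by auto
  show ?thesis
  proof
    assume "G 0 t *v z \<in> SS i t"
    then obtain k' where k': "k' \<in> KK i t" "G i t *v (z + k) = G i t *v k'"
      by (auto simp: SS_def k)
    then have "z + k - k' \<in> ker (G i t)" by (simp add: ker_def mat_vec_simps)
    then have 1: "z + k - k' \<in> KK (Suc i) t"
      using ker_G_subset_KK by blast
    have 2: "k - k' \<in> KK (Suc i) t"
      using k k' KK_mono[of i "Suc i" t] subspace_diff[OF subspace_KK] by auto
    from subspace_diff[OF subspace_KK 1 2] show "z \<in> KK (Suc i) t" by simp
  next
    assume z: "z \<in> KK (Suc i) t"
    have "G 0 t *v z = G i t *v ((z - Q i t *v z) + k)"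
      using k i by (simp add: mat_vec_simps Q_G)
    moreover have "(z - Q i t *v z) + k \<in> KK i t"
      using diff_Q_in_KK[OF i z] k subspace_add[OF subspace_KK] by blast
    ultimately show "G 0 t *v z \<in> SS i t" by (auto simp: SS_def)
  qed
qed

text \<open>At i = \<mu> there is no further kernel, since G_\<mu> is nonsingular, so the recursion
  of \<open>G_0_in_SS_iff\<close> becomes stationary: A D z in S_\<mu> puts z into K_\<mu>
  itself.\<close>

lemma G_0_in_SS_top: "G 0 t *v z \<in> SS \<mu> t \<Longrightarrow> z \<in> KK \<mu> t"
proof -
  assume "G 0 t *v z \<in> SS \<mu> t"
  obtain k where k: "k \<in> KK \<mu> t" "G 0 t *v z = G \<mu> t *v (z + k)"
    using G_0_eq[of \<mu> z] by auto
  obtain k' where k': "k' \<in> KK \<mu> t" "G \<mu> t *v (z + k) = G \<mu> t *v k'"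
    using \<open>G 0 t *v z \<in> SS \<mu> t\<close> by (auto simp: SS_def k)
  have "dim (ker (G \<mu> t)) = 0"
    using dim_ker_add_rank[of "G \<mu> t"] rank_G[OF t, of \<mu>] rank_top by simp
  moreover have "z + k - k' \<in> ker (G \<mu> t)" using k' by (simp add: ker_def mat_vec_simps)
  ultimately have "z = k' - k" by (auto simp: algebra_simps)
  then show ?thesis using k k' subspace_diff[OF subspace_KK] by blast
qed

lemma dim_KK: "i \<le> \<mu> \<Longrightarrow> dim (KK i t) = dK i"
proof (induction i)
  case 0 then show ?case by (simp add: dK_def)
next
  case (Suc i)
  have "KK (Suc i) t = {x + y |x y. x \<in> KK i t \<and> y \<in> ker (G i t)}"
    unfolding KK_def lessThan_Suc UN_insert Un_commute[of "ker _"] span_Un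
    by (simp add: span_eq_iff[THEN iffD2, OF subspace_ker])
  moreover have "KK i t \<inter> ker (G i t) \<subseteq> {0}"
    using Suc.prems Q_G(3)[of i] Q_KK[of i] by (force simp: ker_def)
  then have "KK i t \<inter> ker (G i t) = {0}"
    using subspace_0[OF subspace_KK] subspace_0[OF subspace_ker] by blast
  ultimately have "dim (KK (Suc i) t) = dim (KK i t) + dim (ker (G i t))"
    using dim_sums_Int[OF subspace_KK[of i t] subspace_ker[of "G i t"]] by simp
  then show ?case
    using dim_ker_add_rank[of "G i t"] rank_G[OF t, of i] Suc by (simp add: dK_def)
qed

lemma dim_SS: "i \<le> \<mu> \<Longrightarrow> dim (SS i t) = dK i"
proof -
  assume i: "i \<le> \<mu>"
  have "inj_on ((*v) (G i t)) (span (KK i t))"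
    using G_inj_KK[OF i] by (auto simp: inj_on_def span_eq_iff[THEN iffD2, OF subspace_KK])
  then show ?thesis
    unfolding SS_def using dim_KK[OF i] by (subst dim_image_eq) auto
qed

text \<open>In B_i the first term reduces to B_(i-1) on K_(i-1), because I - Q_(i-1) maps K_i there,
  and the correction term contains Pi_(i-1), which vanishes on K_i.\<close>

lemma Bs_KK: "i < \<mu> \<Longrightarrow> v \<in> KK i t \<Longrightarrow> Bs i t *v v = 0"
proof (induction i arbitrary: v)
  case 0 then show ?case by simp
next
  case (Suc i)
  then have "Pi i t *v v = 0" using PP_KK[of "Suc i" v] by (simp add: PP_def)
  moreover have "Bs i t *v (v - Q i t *v v) = 0"
    using Suc diff_Q_in_KK[of i v] by simp
  ultimately show ?case
    using Suc.prems by (simp add: Bs_Suc[OF t] mat_vec_simps)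
qed

lemma Bs_PP: "i < \<mu> \<Longrightarrow> Bs i t *v (PP i t *v v) = Bs i t *v v"
  using Bs_KK[OF _ diff_PP_in_KK, of i v] by (simp add: mat_vec_simps)

end


section \<open>The DAE operator and its decoupling\<close>

definition DAE_op :: "real \<Rightarrow> real ^ 'k \<Rightarrow> real ^ ('k + 'r) \<Rightarrow> real ^ ('k + 'r)" where
  "DAE_op t u' v = A t *v u' + B t *v v"

(* The decoupling identity of the tractability analysis. The chain of derivatives is carried by
   D Pi_i x only, since every other contribution is absorbed in G_(i+1) KK_(i+1). *)
lemma decoupling:
  fixes x :: "real \<Rightarrow> real ^ ('k + 'r)"
  assumes J: "J \<subseteq> {a..b}" and t: "t \<in> J"
    and x: "((\<lambda>s. Dmat *v x s) has_vector_derivative u') (at t within J)"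
    and i: "i < \<mu>"
  shows "\<exists>w k. ((\<lambda>s. Dmat *v (PP (Suc i) s *v x s)) has_vector_derivative w) (at t within J) \<and>
    k \<in> KK i t \<and>
    DAE_op t u' (x t) = G (Suc i) t *v (transpose Dmat *v w + Q i t *v x t
      - Q i t *v (transpose Dmat *v w) + k) + Bs i t *v (PP (Suc i) t *v x t)"
  using i
proof (induction i)
  case 0
  have tab: "t \<in> {a..b}" using J t by auto
  have Dx: "Dmat *v (PP (Suc 0) s *v x s) = (Dmat *v x s :: real^'k)" if "s \<in> J" for s
    using that J Pi_0[of s] by (auto simp: PP_def mat_vec_simps)
  have "((\<lambda>s. Dmat *v (PP (Suc 0) s *v x s)) has_vector_derivative u') (at t within J)"
    by (rule has_vector_derivative_transform[OF t _ x]) (rule Dx)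
  moreover have "DAE_op t u' (x t) = G (Suc 0) t *v (transpose Dmat *v u' + Q 0 t *v x t
      - Q 0 t *v (transpose Dmat *v u') + 0) + Bs 0 t *v (PP (Suc 0) t *v x t)"
  proof -
    have "G (Suc 0) t *v (transpose Dmat *v u' - Q 0 t *v (transpose Dmat *v u')) = A t *v u'"
      using G_Suc_diff_Q[OF tab, of 0 "transpose Dmat *v u'"] 0 by (simp add: G_0[OF tab] mat_vec_simps)
    moreover have "G (Suc 0) t *v (Q 0 t *v x t) = B t *v (Q 0 t *v x t)"
      using G_Suc_Q[OF tab 0] by (simp add: Bs_0[OF tab])
    moreover have "PP (Suc 0) t *v x t = x t - Q 0 t *v x t"
      using PP_Suc[OF tab 0] by (simp add: PP_def)
    ultimately show ?thesis
      by (simp add: DAE_op_def mat_vec_simps Bs_0[OF tab])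
  qed
  ultimately show ?case using KK_0[of t] by blast
next
  case (Suc i)
  have tab: "t \<in> {a..b}" using J t by auto
  define j where "j = Suc i"
  have j: "0 < j" "j < \<mu>" "Suc i = j" using Suc.prems by (auto simp: j_def)
  obtain w k where w: "((\<lambda>s. Dmat *v (PP j s *v x s)) has_vector_derivative w) (at t within J)"
    and k: "k \<in> KK i t"
    and Tx: "DAE_op t u' (x t) = G j t *v (transpose Dmat *v w + Q i t *v x t
      - Q i t *v (transpose Dmat *v w) + k) + Bs i t *v (PP j t *v x t)"
    using Suc j by auto
  \<comment> \<open>The product rule for D Pi_j x = (D Pi_j D^+) (D Pi_(j-1) x), where w is the
    derivative of D Pi_(j-1) x and \<open>PP j\<close> stands for Pi_(j-1).\<close>
  define w1 where "w1 = (Dmat ** Pi j t ** transpose Dmat) *v w + R j t *v (Dmat *v (PP j t *v x t))"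
  have prod: "((\<lambda>s. (Dmat ** Pi j s ** transpose Dmat) *v (Dmat *v (PP j s *v x s)))
      has_vector_derivative w1) (at t within J)"
    unfolding w1_def
    by (rule has_vector_derivative_matrix_vector[OF _ w])
      (rule has_vector_derivative_within_subset[OF Pi_deriv[OF tab j(1,2)] J])
  have eq: "(Dmat ** Pi j s ** transpose Dmat) *v (Dmat *v (PP j s *v x s)) =
      Dmat *v (PP (Suc j) s *v x s)" if "s \<in> J" for s
  proof -
    have s: "s \<in> {a..b}" using that J by auto
    have "Pi j s *v v = PP (Suc j) s *v v" for v by (simp add: PP_def)
    then show ?thesis using j s by (simp add: mat_vec_simps DtD_PP PP_Suc_PP)
  qed
  have w1: "((\<lambda>s. Dmat *v (PP (Suc j) s *v x s)) has_vector_derivative w1) (at t within J)"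
    by (rule has_vector_derivative_transform[OF t _ prod]) (simp add: eq)
  define Dw :: "real^('k+'r)" where "Dw = transpose Dmat *v w"
  define Dw1 :: "real^('k+'r)" where "Dw1 = transpose Dmat *v w1"
  define z where "z = PP j t *v x t"
  \<comment> \<open>The term D^+ (D Pi_j D^+)' D Pi_(j-1) x. It appears in the product rule, and G_j
    applied to it is the correction in the definition of B_j; the two occurrences cancel.\<close>
  define rz :: "real^('k+'r)" where "rz = transpose Dmat *v (R j t *v (Dmat *v z))"
  have PDw: "PP (Suc j) t *v Dw = Dw1 - rz"
  proof -
    have "transpose Dmat *v (Dmat *v (PP (Suc j) t *v Dw)) = PP (Suc j) t *v Dw"
      using j by (intro DtD_PP[OF tab]) auto
    moreover have "Dmat *v (PP (Suc j) t *v Dw) = w1 - R j t *v (Dmat *v z)"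
      by (simp add: w1_def Dw_def z_def PP_def mat_vec_simps)
    ultimately show ?thesis by (simp add: Dw1_def rz_def mat_vec_simps)
  qed
  define d where "d = Dw - PP (Suc j) t *v Dw"
  have d: "d \<in> KK (Suc j) t" using diff_PP_in_KK[OF tab, of "Suc j"] j by (simp add: d_def)
  \<comment> \<open>All contributions that lie in K_j. Of d, which is only in K_(j+1), the part Q_j
    d may be dropped because G_j annihilates it.\<close>
  define k1 where "k1 = (d - Q j t *v d) + (Q i t *v x t - Q i t *v Dw + k)"
  have k1: "k1 \<in> KK j t"
  proof -
    have "k \<in> KK j t" "Q i t *v v \<in> KK j t" for v
      using Q_in_ker_KK[OF tab, of i] j k KK_mono[of i j t] by auto
    then have "Q i t *v x t - Q i t *v Dw + k \<in> KK j t"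
      using subspace_add[OF subspace_KK] subspace_diff[OF subspace_KK] by blast
    from subspace_add[OF subspace_KK diff_Q_in_KK[OF tab j(2) d] this] show ?thesis
      by (simp add: k1_def)
  qed
  have "Bs j t *v z = Bs i t *v z - G j t *v rz"
  proof -
    have "Pi i t *v z = z" using PP_idem[OF tab, of j "x t"] j by (auto simp: PP_def z_def)
    moreover have "Q i t *v z = 0"
    proof -
      have "z = PP i t *v (x t - Q i t *v x t)" using j PP_Suc[OF tab, of i] by (auto simp: z_def)
      then have "Q i t *v z = Q i t *v (x t - Q i t *v x t)" using Q_PP[OF tab, of i] j by auto
      also have "\<dots> = 0" using Q_G(1)[OF tab, of i] j by (simp add: mat_vec_simps)
      finally show ?thesis .
    qed
    moreover have "j - 1 = i" using j by simp
    ultimately show ?thesis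
      unfolding Bs_Suc[OF tab j(1,2)] by (simp add: mat_vec_simps rz_def)
  qed
  have "DAE_op t u' (x t) = G j t *v (Dw1 - rz + (d + (Q i t *v x t - Q i t *v Dw + k))) + Bs i t *v z"
  proof -
    have "Dw + Q i t *v x t - Q i t *v Dw + k = Dw1 - rz + (d + (Q i t *v x t - Q i t *v Dw + k))"
      by (simp add: d_def PDw)
    then show ?thesis unfolding Tx Dw_def[symmetric] z_def[symmetric] by (simp only:)
  qed
  moreover have "G j t *v d = G j t *v (d - Q j t *v d)"
    by (simp add: matrix_vector_mult_diff_distrib Q_G(2)[OF tab j(2)])
  ultimately have "DAE_op t u' (x t) = G j t *v Dw1 - G j t *v rz
      + (G j t *v (d - Q j t *v d) + G j t *v (Q i t *v x t - Q i t *v Dw + k)) + Bs i t *v z"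
    by (simp only: matrix_vector_right_distrib matrix_vector_mult_diff_distrib[of _ Dw1 rz])
  moreover note \<open>Bs j t *v z = Bs i t *v z - G j t *v rz\<close>
  ultimately have "DAE_op t u' (x t) = G j t *v (Dw1 + k1) + Bs j t *v z"
    unfolding k1_def matrix_vector_right_distrib[of _ Dw1] matrix_vector_right_distrib[of _ "d - Q j t *v d"]
    by simp
  also have "G j t *v (Dw1 + k1) = G (Suc j) t *v (Dw1 - Q j t *v Dw1 + k1)"
    using G_Suc_diff_Q[OF tab j(2), of Dw1] G_Suc_KK[OF tab j(2) k1] by (simp add: mat_vec_simps)
  also have "Bs j t *v z = Bs j t *v (PP (Suc j) t *v x t) + G (Suc j) t *v (Q j t *v x t)"
    unfolding z_def PP_Suc[OF tab j(2)] G_Suc_Q[OF tab j(2)] Bs_PP[OF tab j(2)]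
    by (simp add: matrix_vector_mult_diff_distrib)
  finally have "DAE_op t u' (x t) = G (Suc j) t *v (Dw1 + Q j t *v x t - Q j t *v Dw1 + k1)
      + Bs j t *v (PP (Suc j) t *v x t)"
    by (simp add: matrix_vector_right_distrib matrix_vector_mult_diff_distrib)
  then show ?case using w1 k1 unfolding j(3) Dw1_def by blast
qed

text \<open>Along a section of K_(i+1) the variable D Pi_i x is identically zero, and so is its
  derivative (\<open>nontriv\<close> makes that derivative unique). \<open>decoupling\<close> then
  shrinks to G_(i+1) (Q_i x + k) with k in K_i. If this is also a value of G_i on K_i, injectivity
  of G_(i+1) on K_(i+1) puts Q_i x into K_i, where Q_i vanishes; hence Q_i x = 0.\<close>

lemma DAE_op_section:
  fixes x :: "real \<Rightarrow> real ^ ('k + 'r)"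
  assumes J: "J \<subseteq> {a..b}" and t: "t \<in> J" and nontriv: "at t within J \<noteq> bot"
    and x: "((\<lambda>s. Dmat *v x s) has_vector_derivative u') (at t within J)"
    and i: "i < \<mu>" and sec: "\<And>s. s \<in> J \<Longrightarrow> x s \<in> KK (Suc i) s"
  shows "DAE_op t u' (x t) \<in> SS (Suc i) t"
    and "DAE_op t u' (x t) \<in> SS i t \<Longrightarrow> x t \<in> KK i t"
proof -
  have tab: "t \<in> {a..b}" using J t by auto
  obtain w k where w: "((\<lambda>s. Dmat *v (PP (Suc i) s *v x s)) has_vector_derivative w) (at t within J)"
    and k: "k \<in> KK i t"
    and Tx: "DAE_op t u' (x t) = G (Suc i) t *v (transpose Dmat *v w + Q i t *v x t
      - Q i t *v (transpose Dmat *v w) + k) + Bs i t *v (PP (Suc i) t *v x t)"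
    using decoupling[OF J t x i] by auto
  have 0: "PP (Suc i) s *v x s = 0" if "s \<in> J" for s
    using that sec i J by (intro PP_KK) auto
  have "((\<lambda>s. Dmat *v (PP (Suc i) s *v x s)) has_vector_derivative (0::real^'k)) (at t within J)"
    by (rule has_vector_derivative_transform[OF t _ has_vector_derivative_const[of 0]]) (simp add: 0)
  then have "w = 0" using vector_derivative_unique_within[OF nontriv w] by auto
  then have T: "DAE_op t u' (x t) = G (Suc i) t *v (Q i t *v x t + k)"
    using Tx 0[OF t] by simp
  have mem: "Q i t *v x t + k \<in> KK (Suc i) t"
    using Q_in_ker_KK[OF tab i] k KK_mono[of i "Suc i" t] subspace_add[OF subspace_KK] by auto
  then show "DAE_op t u' (x t) \<in> SS (Suc i) t"
    by (simp add: T SS_def)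
  assume "DAE_op t u' (x t) \<in> SS i t"
  then obtain k0 where k0: "k0 \<in> KK i t" "DAE_op t u' (x t) = G i t *v k0"
    by (auto simp: SS_def)
  then have "G (Suc i) t *v (Q i t *v x t + k) = G (Suc i) t *v k0"
    using T G_Suc_KK[OF tab i k0(1)] by simp
  from G_inj_KK[OF tab _ mem _ this] i k0 KK_mono[of i "Suc i" t]
  have "Q i t *v x t = k0 - k" by (auto simp: algebra_simps)
  then have "Q i t *v (Q i t *v x t) = 0"
    using Q_KK[OF tab i] k0 k by (simp add: mat_vec_simps)
  then have "Q i t *v x t = 0" using Q_G(1)[OF tab i] by simp
  then show "x t \<in> KK i t"
    using diff_Q_in_KK[OF tab i sec[OF t]] by simp
qed

end

text \<open>Since k < m, a unit vector with index \<open>Inr\<close> lies in ker D, so G_0 = A D is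
  singular.\<close>

lemma (in tractability) mu_pos: "0 < \<mu>"
proof (rule ccontr)
  assume "\<not> 0 < \<mu>"
  have a: "a \<in> {a..b}" using ab by simp
  have "dim (ker (G 0 a)) = 0"
    using dim_ker_add_rank[of "G 0 a"] rank_G[OF a, of 0] rank_top \<open>\<not> 0 < \<mu>\<close> by simp
  then have "ker (Dmat :: real^('k+'r)^'k) \<subseteq> {0}" by (simp add: ker_G_0[OF a])
  moreover have "axis (Inr undefined) 1 \<in> ker (Dmat :: real^('k+'r)^'k)"
    by (simp add: ker_def vec_eq_iff Dmat_nth axis_def)
  ultimately show False by (auto simp: axis_eq_0_iff)
qed

section \<open>Smooth functions, vectors and matrices on a set\<close>

fun Cn :: "nat \<Rightarrow> real set \<Rightarrow> (real \<Rightarrow> real) \<Rightarrow> bool" where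
  "Cn 0 J f = continuous_on J f"
| "Cn (Suc n) J f = (\<exists>f'. (\<forall>t\<in>J. (f has_real_derivative f' t) (at t within J)) \<and> Cn n J f')"

lemma Cn_SucI:
  "(\<And>t. t \<in> J \<Longrightarrow> (f has_real_derivative f' t) (at t within J)) \<Longrightarrow> Cn n J f' \<Longrightarrow> Cn (Suc n) J f"
  by auto

text \<open>Infinite smoothness spares counting derivatives in the frame construction; it is
  available because the entries of A and B will be polynomials.\<close>

definition sm :: "real set \<Rightarrow> (real \<Rightarrow> real) \<Rightarrow> bool" where
  "sm J f \<longleftrightarrow> (\<forall>n. Cn n J f)"

lemma Cn_cong: "Cn n J f \<Longrightarrow> (\<And>t. t \<in> J \<Longrightarrow> f t = g t) \<Longrightarrow> Cn n J g"
proof (induction n arbitrary: f g)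
  case 0 then show ?case by (simp cong: continuous_on_cong)
next
  case (Suc n)
  then obtain f' where f': "\<forall>t\<in>J. (f has_real_derivative f' t) (at t within J)" "Cn n J f'" by auto
  have "(g has_real_derivative f' t) (at t within J)" if "t \<in> J" for t
    using f' that Suc.prems(2) has_field_derivative_transform_within[of f "f' t" t J 1 g] by auto
  then show ?case using f' by auto
qed

lemma Cn_subset: "Cn n J f \<Longrightarrow> K \<subseteq> J \<Longrightarrow> Cn n K f"
proof (induction n arbitrary: f)
  case 0 then show ?case using continuous_on_subset by auto
next
  case (Suc n) then show ?case by (auto intro: has_field_derivative_subset) (meson has_field_derivative_subset subsetD)
qed

lemma Cn_SucD: "Cn (Suc n) J f \<Longrightarrow> Cn n J f"
proof (induction n arbitrary: f)
  case 0 then show ?case using DERIV_continuous_on by auto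
next
  case (Suc n) then show ?case by (metis Cn.simps(2))
qed

lemma Cn_const: "Cn n J (\<lambda>t. c)"
proof (induction n arbitrary: c)
  case (Suc n)
  have "\<forall>t\<in>J. ((\<lambda>t. c) has_real_derivative 0) (at t within J)" by (auto intro: derivative_eq_intros)
  then show ?case using Suc[of 0] by (intro Cn_SucI[of J _ "\<lambda>t. 0"]) auto
qed auto

lemma Cn_ident: "Cn n J (\<lambda>t. t)"
proof (cases n)
  case (Suc n)
  have "\<forall>t\<in>J. ((\<lambda>t. t) has_real_derivative 1) (at t within J)" by (auto intro: derivative_eq_intros)
  then show ?thesis using Cn_const[of _ J 1] Suc by (auto simp del: Cn.simps intro!: Cn_SucI[of J _ "\<lambda>t. 1"])
qed auto

lemma Cn_add: "Cn n J f \<Longrightarrow> Cn n J g \<Longrightarrow> Cn n J (\<lambda>t. f t + g t)"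
proof (induction n arbitrary: f g)
  case 0 then show ?case by (auto intro: continuous_intros)
next
  case (Suc n)
  then obtain f' g' where d: "\<forall>t\<in>J. (f has_real_derivative f' t) (at t within J)" "Cn n J f'"
    "\<forall>t\<in>J. (g has_real_derivative g' t) (at t within J)" "Cn n J g'" by auto
  then have "\<forall>t\<in>J. ((\<lambda>t. f t + g t) has_real_derivative f' t + g' t) (at t within J)"
    by (auto intro: derivative_eq_intros)
  with Suc.IH[OF d(2,4)] show ?case by (intro Cn_SucI) auto
qed

lemma Cn_mult: "Cn n J f \<Longrightarrow> Cn n J g \<Longrightarrow> Cn n J (\<lambda>t. f t * g t)"
proof (induction n arbitrary: f g)
  case 0 then show ?case by (auto intro: continuous_intros)
next
  case (Suc n)
  then obtain f' g' where d: "\<forall>t\<in>J. (f has_real_derivative f' t) (at t within J)" "Cn n J f'"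
    "\<forall>t\<in>J. (g has_real_derivative g' t) (at t within J)" "Cn n J g'" by auto
  then have "\<forall>t\<in>J. ((\<lambda>t. f t * g t) has_real_derivative f' t * g t + f t * g' t) (at t within J)"
    by (auto intro!: derivative_eq_intros)
  moreover have "Cn n J (\<lambda>t. f' t * g t + f t * g' t)"
    using Suc d Cn_SucD by (intro Cn_add Suc.IH) auto
  ultimately show ?case by (intro Cn_SucI) auto
qed

lemma Cn_inverse: "Cn n J f \<Longrightarrow> (\<And>t. t \<in> J \<Longrightarrow> f t \<noteq> 0) \<Longrightarrow> Cn n J (\<lambda>t. inverse (f t))"
proof (induction n arbitrary: f)
  case 0 then show ?case by (auto intro: continuous_intros)
next
  case (Suc n)
  then obtain f' where d: "\<forall>t\<in>J. (f has_real_derivative f' t) (at t within J)" "Cn n J f'" by auto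
  then have "\<forall>t\<in>J. ((\<lambda>t. inverse (f t)) has_real_derivative (-1) * f' t * (inverse (f t) * inverse (f t))) (at t within J)"
    using Suc.prems by (auto intro!: derivative_eq_intros simp: divide_simps)
  moreover have "Cn n J (\<lambda>t. (-1) * f' t * (inverse (f t) * inverse (f t)))"
    using Suc d Cn_SucD by (intro Cn_mult Cn_const Suc.IH) auto
  ultimately show ?case by (intro Cn_SucI) auto
qed

lemma sm_cong: "sm J f \<Longrightarrow> (\<And>t. t \<in> J \<Longrightarrow> f t = g t) \<Longrightarrow> sm J g"
  unfolding sm_def using Cn_cong by blast

lemma sm_subset: "sm J f \<Longrightarrow> K \<subseteq> J \<Longrightarrow> sm K f"
  unfolding sm_def using Cn_subset by blast

lemma sm_continuous_on: "sm J f \<Longrightarrow> continuous_on J f"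
  unfolding sm_def using Cn.simps(1) by blast

lemma sm_const [intro, simp]: "sm J (\<lambda>t. c)" by (simp add: sm_def Cn_const)
lemma sm_ident: "sm J (\<lambda>t. t)" by (simp add: sm_def Cn_ident)
lemma sm_add [intro]: "sm J f \<Longrightarrow> sm J g \<Longrightarrow> sm J (\<lambda>t. f t + g t)" by (simp add: sm_def Cn_add)
lemma sm_mult [intro]: "sm J f \<Longrightarrow> sm J g \<Longrightarrow> sm J (\<lambda>t. f t * g t)" by (simp add: sm_def Cn_mult)

lemma sm_divide: "sm J f \<Longrightarrow> sm J g \<Longrightarrow> (\<And>t. t \<in> J \<Longrightarrow> g t \<noteq> 0) \<Longrightarrow> sm J (\<lambda>t. f t / g t)"
  unfolding divide_inverse by (intro sm_mult) (auto simp: sm_def Cn_inverse)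

lemma sm_minus [intro]: "sm J f \<Longrightarrow> sm J (\<lambda>t. - f t)"
  using sm_mult[OF sm_const[of J "-1"]] by auto

lemma sm_diff [intro]: "sm J f \<Longrightarrow> sm J g \<Longrightarrow> sm J (\<lambda>t. f t - g t)"
  using sm_add[OF _ sm_minus] by force

lemma sm_sum: "(\<And>i. i \<in> I \<Longrightarrow> sm J (f i)) \<Longrightarrow> sm J (\<lambda>t. \<Sum>i\<in>I. f i t)"
  by (induction I rule: infinite_finite_induct) auto

lemma sm_prod: "(\<And>i. i \<in> I \<Longrightarrow> sm J (f i)) \<Longrightarrow> sm J (\<lambda>t. \<Prod>i\<in>I. f i t)"
  by (induction I rule: infinite_finite_induct) auto

lemma sm_poly: "sm J (poly p)"
proof (induction p)
  case 0 show ?case by (rule sm_cong[OF sm_const[of J 0]]) simp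
next
  case (pCons c p)
  show ?case
    by (rule sm_cong[OF sm_add[OF sm_const[of J c] sm_mult[OF sm_ident[of J] pCons(2)]]]) simp
qed

text \<open>\<open>Cn\<close> supplies a derivative separately for each order; on a nondegenerate
  interval these agree by uniqueness, so a single f' serves all orders.\<close>

lemma sm_deriv:
  assumes "sm {c..e} f" "c < e"
  obtains f' where "sm {c..e} f'" "\<And>t. t \<in> {c..e} \<Longrightarrow> (f has_real_derivative f' t) (at t within {c..e})"
proof -
  have "Cn (Suc 0) {c..e} f" using assms by (simp add: sm_def del: Cn.simps)
  then obtain f' where f': "\<forall>t\<in>{c..e}. (f has_real_derivative f' t) (at t within {c..e})" by auto
  have "Cn n {c..e} f'" for n
  proof -
    have "Cn (Suc n) {c..e} f" using assms by (simp add: sm_def del: Cn.simps)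
    then obtain f'' where f'': "\<forall>t\<in>{c..e}. (f has_real_derivative f'' t) (at t within {c..e})" "Cn n {c..e} f''"
      by auto
    have "f'' t = f' t" if "t \<in> {c..e}" for t
      using f' f'' that vector_derivative_unique_within_closed_interval[of c e t f "f'' t" "f' t"] assms
      by (auto simp: has_real_derivative_iff_has_vector_derivative)
    then show ?thesis using f''(2) Cn_cong by blast
  qed
  then show ?thesis using that[of f'] f' by (auto simp: sm_def)
qed

definition smv :: "real set \<Rightarrow> (real \<Rightarrow> real^'n) \<Rightarrow> bool" where
  "smv J f \<longleftrightarrow> (\<forall>i. sm J (\<lambda>t. f t $ i))"

definition smm :: "real set \<Rightarrow> (real \<Rightarrow> real^'n^'p) \<Rightarrow> bool" where
  "smm J M \<longleftrightarrow> (\<forall>i j. sm J (\<lambda>t. M t $ i $ j))"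

lemma smv_subset: "smv J f \<Longrightarrow> K \<subseteq> J \<Longrightarrow> smv K f"
  unfolding smv_def using sm_subset by blast

lemma smm_subset: "smm J f \<Longrightarrow> K \<subseteq> J \<Longrightarrow> smm K f"
  unfolding smm_def using sm_subset by blast

lemma smv_const [simp]: "smv J (\<lambda>t. c)" by (simp add: smv_def)

lemma smm_const [simp]: "smm J (\<lambda>t. c)" by (simp add: smm_def)

lemma smv_matrix_vector: "smm J M \<Longrightarrow> smv J f \<Longrightarrow> smv J (\<lambda>t. M t *v f t)"
  unfolding smv_def smm_def matrix_vector_mult_def by (auto intro!: sm_sum sm_mult)

lemma smm_matrix_matrix: "smm J M \<Longrightarrow> smm J L \<Longrightarrow> smm J (\<lambda>t. M t ** L t)"
  unfolding smm_def matrix_matrix_mult_def by (auto intro!: sm_sum sm_mult)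

lemma smm_add: "smm J M \<Longrightarrow> smm J L \<Longrightarrow> smm J (\<lambda>t. M t + L t)"
  unfolding smm_def by auto

lemma smv_add: "smv J M \<Longrightarrow> smv J L \<Longrightarrow> smv J (\<lambda>t. M t + L t)"
  unfolding smv_def by auto

lemma sm_det:
  fixes M :: "real \<Rightarrow> real^'n^'n"
  shows "smm J M \<Longrightarrow> sm J (\<lambda>t. det (M t))"
  unfolding smm_def det_def by (auto intro!: sm_sum sm_mult sm_prod)

lemma smv_continuous_on: "smv J f \<Longrightarrow> continuous_on J f"
  unfolding smv_def using continuous_on_vec_lambda[of J "\<lambda>i t. f t $ i"] sm_continuous_on by auto

lemma smm_continuous_on: "smm J M \<Longrightarrow> continuous_on J M"
  using continuous_on_vec_lambda[of J "\<lambda>i t. M t $ i"] smv_continuous_on[of J "\<lambda>t. M t $ _"]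
  unfolding smm_def smv_def by auto

lemma matrix_inv_mult_cancel:
  fixes M :: "real^'n^'n"
  assumes "det M \<noteq> 0"
  shows "M *v (matrix_inv M *v v) = v" "matrix_inv M *v (M *v v) = v"
proof -
  have "\<exists>M'. M ** M' = mat 1 \<and> M' ** M = mat 1"
    using assms unfolding invertible_det_nz[symmetric] invertible_def .
  then have "M ** matrix_inv M = mat 1 \<and> matrix_inv M ** M = mat 1"
    unfolding matrix_inv_def by (rule someI_ex)
  then show "M *v (matrix_inv M *v v) = v" "matrix_inv M *v (M *v v) = v"
    by (simp_all add: matrix_vector_mul_assoc)
qed

lemma has_vector_derivative_vec_iff:
  fixes f :: "real \<Rightarrow> real^'n"
  shows "(f has_vector_derivative f') (at t within J) \<longleftrightarrow>
    (\<forall>i. ((\<lambda>s. f s $ i) has_real_derivative f' $ i) (at t within J))"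
proof
  assume "(f has_vector_derivative f') (at t within J)"
  from bounded_linear.has_vector_derivative[OF bounded_linear_vec_nth this]
  show "\<forall>i. ((\<lambda>s. f s $ i) has_real_derivative f' $ i) (at t within J)"
    by (simp add: has_real_derivative_iff_has_vector_derivative)
next
  assume "\<forall>i. ((\<lambda>s. f s $ i) has_real_derivative f' $ i) (at t within J)"
  then have "((\<lambda>s. \<Sum>i\<in>UNIV. f s $ i *\<^sub>R axis i 1) has_vector_derivative (\<Sum>i\<in>UNIV. f' $ i *\<^sub>R (axis i 1 :: real^'n))) (at t within J)"
    by (intro has_vector_derivative_sum bounded_linear.has_vector_derivative[OF bounded_linear_scaleR_left])
      (simp add: has_real_derivative_iff_has_vector_derivative)
  moreover have "(\<Sum>i\<in>UNIV. v $ i *\<^sub>R (axis i 1 :: real^'n)) = v" for v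
    using basis_expansion[of v] by (simp add: scalar_mult_eq_scaleR)
  ultimately show "(f has_vector_derivative f') (at t within J)" by simp
qed

text \<open>By Cramer's rule the entries of the inverse are quotients of determinants.\<close>

lemma smm_inverse:
  fixes M :: "real \<Rightarrow> real^'n^'n"
  assumes M: "smm J M" and nz: "\<And>t. t \<in> J \<Longrightarrow> det (M t) \<noteq> 0"
  shows "smm J (\<lambda>t. matrix_inv (M t))"
  unfolding smm_def
proof (intro allI)
  fix i j
  have "sm J (\<lambda>t. det (\<chi> p q. if q = i then (axis j 1 :: real^'n) $ p else M t $ p $ q) / det (M t))"
  proof (intro sm_divide sm_det)
    show "smm J (\<lambda>t. \<chi> p q. if q = i then (axis j 1 :: real^'n) $ p else M t $ p $ q)"
      unfolding smm_def
    proof (intro allI)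
      fix p q show "sm J (\<lambda>t. (\<chi> p q. if q = i then (axis j 1 :: real^'n) $ p else M t $ p $ q) $ p $ q)"
        using M by (cases "q = i") (auto simp: smm_def)
    qed
  qed (use M nz in auto)
  then show "sm J (\<lambda>t. matrix_inv (M t) $ i $ j)"
  proof (rule sm_cong)
    fix t assume t: "t \<in> J"
    have "M t *v (matrix_inv (M t) *v axis j 1) = axis j 1"
      by (rule matrix_inv_mult_cancel[OF nz[OF t]])
    then have "matrix_inv (M t) *v axis j 1 =
        (\<chi> k. det (\<chi> p q. if q = k then (axis j 1 :: real^'n) $ p else M t $ p $ q) / det (M t))"
      using cramer[OF nz[OF t]] by blast
    then have "(matrix_inv (M t) *v axis j 1) $ i =
        det (\<chi> p q. if q = i then (axis j 1 :: real^'n) $ p else M t $ p $ q) / det (M t)" by simp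
    then show "det (\<chi> p q. if q = i then (axis j 1 :: real^'n) $ p else M t $ p $ q) / det (M t) =
        matrix_inv (M t) $ i $ j"
      by (simp add: matrix_vector_mult_basis column_def)
  qed
qed

lemma smv_deriv:
  fixes f :: "real \<Rightarrow> real^'n"
  assumes "smv {c..e} f" "c < e"
  obtains f' where "smv {c..e} f'" "\<And>t. t \<in> {c..e} \<Longrightarrow> (f has_vector_derivative f' t) (at t within {c..e})"
proof -
  have "\<exists>f'. sm {c..e} f' \<and> (\<forall>t\<in>{c..e}. ((\<lambda>t. f t $ i) has_real_derivative f' t) (at t within {c..e}))" for i
    by (rule sm_deriv[of c e "\<lambda>t. f t $ i"]) (use assms in \<open>auto simp: smv_def\<close>)
  then have "\<forall>i. \<exists>f'. sm {c..e} f' \<and> (\<forall>t\<in>{c..e}. ((\<lambda>t. f t $ i) has_real_derivative f' t) (at t within {c..e}))"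
    by blast
  from choice[OF this] obtain F where F: "\<forall>i. sm {c..e} (F i) \<and>
      (\<forall>t\<in>{c..e}. ((\<lambda>t. f t $ i) has_real_derivative F i t) (at t within {c..e}))" ..
  show ?thesis
  proof
    show "smv {c..e} (\<lambda>t. \<chi> i. F i t)" using F by (auto simp: smv_def)
    show "(f has_vector_derivative (\<chi> i. F i t)) (at t within {c..e})" if "t \<in> {c..e}" for t
      unfolding has_vector_derivative_vec_iff using F that by simp
  qed
qed

text \<open>Families of vectors indexed by a subset of the coordinate type\<close>

definition colm :: "('n \<Rightarrow> real^'m) \<Rightarrow> real^'n^'m" where
  "colm x = (\<chi> i j. x j $ i)"

text \<open>Families are indexed by subsets of the coordinate type itself: a family over
  \<open>UNIV\<close> is then a square matrix \<open>colm x\<close>, and independence becomes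
  nonvanishing of a determinant, an open condition.\<close>

definition indep :: "'n set \<Rightarrow> ('n \<Rightarrow> real^'m) \<Rightarrow> bool" where
  "indep I x \<longleftrightarrow> (\<forall>c. (\<Sum>b\<in>I. c b *\<^sub>R x b) = 0 \<longrightarrow> (\<forall>b\<in>I. c b = 0))"

lemma colm_mult: "colm x *v f = (\<Sum>b\<in>UNIV. f $ b *\<^sub>R x b)"
  by (simp add: vec_eq_iff colm_def matrix_vector_mult_def mult.commute)

lemma colm_axis: "colm x *v axis b 1 = x b"
  by (simp add: matrix_vector_mult_basis column_def colm_def)

lemma matrix_mult_colm: "M ** colm x = colm (\<lambda>b. M *v x b)"
  by (simp add: vec_eq_iff colm_def matrix_vector_mult_def matrix_matrix_mult_def)

lemma indep_cong: "(\<And>b. b \<in> I \<Longrightarrow> x b = y b) \<Longrightarrow> indep I x = indep I y"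
  by (simp add: indep_def cong: sum.cong)

lemma indepD: "indep I x \<Longrightarrow> (\<Sum>b\<in>I. c b *\<^sub>R x b) = 0 \<Longrightarrow> b \<in> I \<Longrightarrow> c b = 0"
  unfolding indep_def by blast

lemma indepI: "(\<And>c b. (\<Sum>b\<in>I. c b *\<^sub>R x b) = 0 \<Longrightarrow> b \<in> I \<Longrightarrow> c b = 0) \<Longrightarrow> indep I x"
  unfolding indep_def by blast

lemma indep_iff:
  fixes x :: "'n::finite \<Rightarrow> real^'m"
  shows "indep I x \<longleftrightarrow> inj_on x I \<and> independent (x ` I)"
proof
  assume i: "indep I x"
  have inj: "inj_on x I"
  proof (rule inj_onI, rule ccontr)
    fix b b' assume bb: "b \<in> I" "b' \<in> I" "x b = x b'" "b \<noteq> b'"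
    let ?c = "\<lambda>d. if d = b then 1 else if d = b' then -1 else (0::real)"
    have "(\<Sum>d\<in>I. ?c d *\<^sub>R x d) = (\<Sum>d\<in>{b,b'}. ?c d *\<^sub>R x d)"
      using bb by (intro sum.mono_neutral_right) auto
    also have "\<dots> = 0" using bb by simp
    finally have "?c b = 0" using indepD[OF i, of ?c b] bb(1) by blast
    then show False by simp
  qed
  moreover have "independent (x ` I)"
  proof (rule real_vector.independent_if_scalars_zero)
    fix f v assume f: "(\<Sum>v\<in>x ` I. f v *\<^sub>R v) = 0" "v \<in> x ` I"
    then have "(\<Sum>b\<in>I. f (x b) *\<^sub>R x b) = 0" by (simp add: sum.reindex[OF inj])
    then show "f v = 0" using f(2) indepD[OF i, of "\<lambda>b. f (x b)"] by auto
  qed simp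
  ultimately show "inj_on x I \<and> independent (x ` I)" ..
next
  assume *: "inj_on x I \<and> independent (x ` I)"
  show "indep I x"
    unfolding indep_def
  proof (intro allI impI ballI)
    fix c b assume c: "(\<Sum>b\<in>I. c b *\<^sub>R x b) = 0" and b: "b \<in> I"
    have "(\<Sum>v\<in>x ` I. c (inv_into I x v) *\<^sub>R v) = (\<Sum>b\<in>I. c b *\<^sub>R x b)"
      using * by (subst sum.reindex) (auto intro!: sum.cong)
    then have "c (inv_into I x (x b)) = 0"
      using * c b real_vector.independentD[of "x ` I" "x ` I" "\<lambda>v. c (inv_into I x v)" "x b"] by auto
    then show "c b = 0" using * b by simp
  qed
qed

lemma indep_UNIV_iff_det:
  fixes x :: "'m::finite \<Rightarrow> real^'m"
  shows "indep UNIV x \<longleftrightarrow> det (colm x) \<noteq> 0"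
proof -
  have "indep UNIV x \<longleftrightarrow> (\<forall>f. colm x *v f = 0 \<longrightarrow> f = 0)"
  proof
    assume i: "indep UNIV x"
    show "\<forall>f. colm x *v f = 0 \<longrightarrow> f = 0"
      using i unfolding indep_def colm_mult by (auto simp: vec_eq_iff)
  next
    assume i: "\<forall>f. colm x *v f = 0 \<longrightarrow> f = 0"
    show "indep UNIV x"
      unfolding indep_def
    proof (intro allI impI)
      fix c assume "(\<Sum>b\<in>UNIV. c b *\<^sub>R x b) = 0"
      then have "colm x *v (\<chi> b. c b) = 0" by (simp add: colm_mult)
      then show "\<forall>b\<in>UNIV. c b = 0" using i by (auto simp: vec_eq_iff)
    qed
  qed
  also have "\<dots> \<longleftrightarrow> det (colm x) \<noteq> 0"
    by (simp add: invertible_det_nz[symmetric] invertible_left_inverse matrix_left_invertible_ker)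
  finally show ?thesis .
qed

lemma indep_span:
  fixes x :: "'n::finite \<Rightarrow> real^'m"
  assumes "indep I x" "\<And>b. b \<in> I \<Longrightarrow> x b \<in> F" "dim F \<le> card I" "v \<in> F"
  shows "\<exists>c. v = (\<Sum>b\<in>I. c b *\<^sub>R x b)"
proof -
  have i: "inj_on x I" "independent (x ` I)" using assms(1) by (auto simp: indep_iff)
  then have "F \<subseteq> span (x ` I)"
    using assms by (intro card_ge_dim_independent) (auto simp: card_image)
  then have "v \<in> span (x ` I)" using assms by auto
  then obtain u where "v = (\<Sum>w\<in>x ` I. u w *\<^sub>R w)"
    by (auto simp: span_finite)
  then show ?thesis using i(1) by (auto simp: sum.reindex)
qed

lemma indep_extend:
  fixes x :: "'m::finite \<Rightarrow> real^'m"
  assumes x: "indep I x" "\<And>b. b \<in> I \<Longrightarrow> x b \<in> F"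
  obtains I' y where "I \<subseteq> I'" "card I' = dim F" "indep I' y" "\<And>b. b \<in> I' \<Longrightarrow> y b \<in> F"
    "\<And>b. b \<in> I \<Longrightarrow> y b = x b"
proof -
  have i: "inj_on x I" "independent (x ` I)" using x(1) by (auto simp: indep_iff)
  obtain Bs where Bs: "x ` I \<subseteq> Bs" "Bs \<subseteq> F" "independent Bs" "F \<subseteq> span Bs"
    using maximal_independent_subset_extend[of "x ` I" F] i x by auto
  have fin: "finite Bs" using Bs independent_imp_finite by auto
  have card: "card Bs = dim F" using basis_card_eq_dim[OF Bs(2,4,3)] by simp
  have le: "card Bs \<le> CARD('m)" unfolding card by (rule dim_subset_UNIV_cart)
  have "card (Bs - x ` I) = card Bs - card I"
    using Bs fin i by (simp add: card_Diff_subset card_image)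
  then have "card (Bs - x ` I) \<le> card (UNIV - I)"
    using le by (simp add: card_Diff_subset)
  then obtain K where K: "K \<subseteq> UNIV - I" "card K = card (Bs - x ` I)" "finite K"
    by (meson obtain_subset_with_card_n)
  then obtain f where f: "bij_betw f K (Bs - x ` I)"
    using fin by (metis finite_Diff finite_same_card_bij)
  define y where "y b = (if b \<in> I then x b else f b)" for b
  have f': "inj_on f K" "f ` K = Bs - x ` I" using f by (auto simp: bij_betw_def)
  have yK: "y b = f b" if "b \<in> K" for b using that K by (auto simp: y_def)
  have im: "y ` I = x ` I" "y ` K = Bs - x ` I"
    using f'(2) yK by (auto simp: y_def cong: image_cong)
  have "inj_on y I" "inj_on y K"
    using i(1) f'(1) yK by (auto simp: inj_on_def y_def)
  then have "inj_on y (I \<union> K)"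
    using im by (auto simp: inj_on_Un)
  moreover have "y ` (I \<union> K) = Bs" using im Bs by (auto simp: image_Un)
  ultimately have "indep (I \<union> K) y" using Bs by (simp add: indep_iff)
  moreover have "card (I \<union> K) = dim F"
    using \<open>inj_on y (I \<union> K)\<close> \<open>y ` (I \<union> K) = Bs\<close> card card_image by force
  moreover have "y b \<in> F" if "b \<in> I \<union> K" for b
    using that \<open>y ` (I \<union> K) = Bs\<close> Bs(2) by blast
  ultimately show ?thesis
    using that[of "I \<union> K" y] by (simp add: y_def)
qed

lemma indep_extend_UNIV:
  fixes x :: "'m::finite \<Rightarrow> real^'m"
  assumes "indep I x"
  obtains y where "det (colm y) \<noteq> 0" "\<And>b. b \<in> I \<Longrightarrow> y b = x b"
proof -
  obtain I' y where y: "I \<subseteq> I'" "card I' = dim (UNIV :: (real^'m) set)" "indep I' y" "\<And>b. b \<in> I \<Longrightarrow> y b = x b"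
    using indep_extend[OF assms, of UNIV] by auto
  then have "I' = UNIV" by (simp add: card_eq_UNIV_imp_eq_UNIV)
  then show ?thesis using that y by (simp add: indep_UNIV_iff_det)
qed

lemma indep_subset:
  assumes "indep (I::'n::finite set) x" "K \<subseteq> I" shows "indep K x"
  using assms real_vector.independent_mono[OF _ image_mono[OF assms(2)]]
  by (auto simp: indep_iff intro: inj_on_subset)

section \<open>Neighbourhoods in the interval and smooth kernels of constant dimension\<close>

definition nbhd :: "real \<Rightarrow> real \<Rightarrow> real \<Rightarrow> real \<Rightarrow> real set" where
  "nbhd a b t\<^sub>0 \<delta> = {max a (t\<^sub>0 - \<delta>)..min b (t\<^sub>0 + \<delta>)}"

lemma nbhd_mono: "\<delta> \<le> \<epsilon> \<Longrightarrow> nbhd a b t\<^sub>0 \<delta> \<subseteq> nbhd a b t\<^sub>0 \<epsilon>"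
  by (auto simp: nbhd_def)

lemma nbhd_subset: "nbhd a b t\<^sub>0 \<delta> \<subseteq> {a..b}"
  by (auto simp: nbhd_def)

lemma mem_nbhd: "t\<^sub>0 \<in> {a..b} \<Longrightarrow> 0 < \<delta> \<Longrightarrow> t\<^sub>0 \<in> nbhd a b t\<^sub>0 \<delta>"
  by (auto simp: nbhd_def)

lemma nbhd_nontrivial: "a < b \<Longrightarrow> t\<^sub>0 \<in> {a..b} \<Longrightarrow> 0 < \<delta> \<Longrightarrow> max a (t\<^sub>0 - \<delta>) < min b (t\<^sub>0 + \<delta>)"
  for a b t\<^sub>0 \<delta> :: real
  by (auto simp: max_def min_def)

lemma nbhd_at_nontrivial:
  assumes "a < b" "t\<^sub>0 \<in> {a..b}" "0 < \<delta>" "t \<in> nbhd a b t\<^sub>0 \<delta>"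
  shows "at t within nbhd a b t\<^sub>0 \<delta> \<noteq> bot"
  using islimpt_Icc[OF nbhd_nontrivial[OF assms(1-3)], of t] assms(4)
  by (simp add: nbhd_def trivial_limit_within)

lemma sm_nonzero_near:
  assumes f: "sm (nbhd a b t\<^sub>0 \<delta>) f" "f t\<^sub>0 \<noteq> 0" and t0: "t\<^sub>0 \<in> {a..b}" and \<delta>: "0 < \<delta>"
  obtains \<epsilon> where "0 < \<epsilon>" "\<epsilon> \<le> \<delta>" "\<And>t. t \<in> nbhd a b t\<^sub>0 \<epsilon> \<Longrightarrow> f t \<noteq> 0"
proof -
  have "continuous_on (nbhd a b t\<^sub>0 \<delta>) f" using f(1) by (rule sm_continuous_on)
  then obtain d where d: "d > 0" "\<forall>t\<in>nbhd a b t\<^sub>0 \<delta>. dist t t\<^sub>0 < d \<longrightarrow> dist (f t) (f t\<^sub>0) < \<bar>f t\<^sub>0\<bar>"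
    unfolding continuous_on_iff using mem_nbhd[OF t0 \<delta>] f(2) by (meson zero_less_abs_iff)
  show ?thesis
  proof (rule that[of "min \<delta> (d / 2)"])
    fix t assume t: "t \<in> nbhd a b t\<^sub>0 (min \<delta> (d / 2))"
    then have "dist t t\<^sub>0 < d" using d(1) by (auto simp: nbhd_def dist_real_def)
    moreover have "t \<in> nbhd a b t\<^sub>0 \<delta>" using t nbhd_mono[of "min \<delta> (d / 2)" \<delta>] by auto
    ultimately show "f t \<noteq> 0" using d(2) by (force simp: dist_real_def)
  qed (use d \<delta> in auto)
qed

lemma det_nonzero_near:
  fixes M :: "real \<Rightarrow> real^'n^'n"
  assumes "smm (nbhd a b t\<^sub>0 \<delta>) M" "det (M t\<^sub>0) \<noteq> 0" "t\<^sub>0 \<in> {a..b}" "0 < \<delta>"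
  obtains \<epsilon> where "0 < \<epsilon>" "\<epsilon> \<le> \<delta>" "\<And>t. t \<in> nbhd a b t\<^sub>0 \<epsilon> \<Longrightarrow> det (M t) \<noteq> 0"
  using sm_nonzero_near[OF sm_det[OF assms(1)] assms(2-4)] by blast

lemma smm_colm: "(\<And>b. smv J (x b)) \<Longrightarrow> smm J (\<lambda>t. colm (\<lambda>b. x b t))"
  by (simp add: smm_def smv_def colm_def)

lemma det_matrix_mult_colm:
  fixes M :: "real^'n^'n"
  assumes "det (colm (\<lambda>b. M *v \<xi> b)) \<noteq> 0" shows "det M \<noteq> 0"
  using assms by (metis det_mul matrix_mult_colm mult_zero_left)

(* If W maps a complement of ker W onto a complement of im M, then (M + W)^-1 W is a projector onto
   ker M; it is as smooth as M. *)
lemma kernel_sections: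
  fixes M :: "real \<Rightarrow> real^'n^'n"
  assumes sm: "smm (nbhd a b t\<^sub>0 \<delta>) M" and t0: "t\<^sub>0 \<in> {a..b}" and \<delta>: "0 < \<delta>"
    and dim: "\<And>t. t \<in> nbhd a b t\<^sub>0 \<delta> \<Longrightarrow> dim (ker (M t)) = d"
  obtains \<epsilon> Z where "0 < \<epsilon>" "\<epsilon> \<le> \<delta>" "smm (nbhd a b t\<^sub>0 \<epsilon>) Z"
    "\<And>t v. t \<in> nbhd a b t\<^sub>0 \<epsilon> \<Longrightarrow> M t *v (Z t *v v) = 0"
    "\<And>v. v \<in> ker (M t\<^sub>0) \<Longrightarrow> Z t\<^sub>0 *v v = v"
proof -
  let ?J = "nbhd a b t\<^sub>0"
  obtain I :: "'n set" and y where I: "card I = d" "indep I y" "\<And>b. b \<in> I \<Longrightarrow> y b \<in> ker (M t\<^sub>0)"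
  proof -
    have "indep {} (\<lambda>_::'n. 0::real^'n)" by (simp add: indep_def)
    then obtain I' :: "'n set" and y where "card I' = dim (ker (M t\<^sub>0))" "indep I' y"
        "\<And>b. b \<in> I' \<Longrightarrow> y b \<in> ker (M t\<^sub>0)"
      by (rule indep_extend[of "{}" _ "ker (M t\<^sub>0)"]) auto
    then show ?thesis using that dim[OF mem_nbhd[OF t0 \<delta>]] by simp
  qed
  obtain \<xi> where \<xi>: "det (colm \<xi>) \<noteq> 0" "\<And>b. b \<in> I \<Longrightarrow> \<xi> b = y b"
    using indep_extend_UNIV[OF I(2)] by blast
  have \<xi>ind: "indep UNIV \<xi>" using \<xi> by (simp add: indep_UNIV_iff_det)
  have ker_repr: "\<exists>c. v = (\<Sum>b\<in>I. c b *\<^sub>R \<xi> b)" if "v \<in> ker (M t\<^sub>0)" for v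
  proof (rule indep_span)
    show "indep I \<xi>" using \<xi>ind indep_subset by blast
    show "dim (ker (M t\<^sub>0)) \<le> card I" using I dim[OF mem_nbhd[OF t0 \<delta>]] by simp
  qed (use that I \<xi> in auto)
  have "indep (- I) (\<lambda>b. M t\<^sub>0 *v \<xi> b)"
    unfolding indep_def
  proof (intro allI impI)
    fix c assume c: "(\<Sum>b\<in>-I. c b *\<^sub>R (M t\<^sub>0 *v \<xi> b)) = 0"
    then have "(\<Sum>b\<in>-I. c b *\<^sub>R \<xi> b) \<in> ker (M t\<^sub>0)"
      by (simp add: ker_def linear_sum[OF matrix_vector_mul_linear] matrix_vector_mult_scaleR)
    then obtain e where e: "(\<Sum>b\<in>-I. c b *\<^sub>R \<xi> b) = (\<Sum>b\<in>I. e b *\<^sub>R \<xi> b)"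
      using ker_repr by blast
    define g where "g b = (if b \<in> I then - e b else c b)" for b
    have "(\<Sum>b\<in>UNIV. g b *\<^sub>R \<xi> b) = (\<Sum>b\<in>I. g b *\<^sub>R \<xi> b) + (\<Sum>b\<in>-I. g b *\<^sub>R \<xi> b)"
      by (subst sum.union_disjoint[symmetric]) (auto simp: Compl_partition)
    also have "\<dots> = 0" using e by (simp add: g_def sum_negf)
    finally have "\<forall>b\<in>UNIV. g b = 0" using indepD[OF \<xi>ind, of g] by simp
    then show "\<forall>b\<in>-I. c b = 0" by (auto simp: g_def split: if_splits)
  qed
  then obtain \<eta>
    where \<eta>: "det (colm \<eta>) \<noteq> 0" "\<And>b. b \<in> - I \<Longrightarrow> \<eta> b = M t\<^sub>0 *v \<xi> b"
    by (rule indep_extend_UNIV) (rule that)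
  \<comment> \<open>W annihilates the basis vectors \<xi> b off I and sends those in I, which span
    ker M(t0), to the completing vectors \<eta> b. Hence M(t0) + W maps the basis \<xi> to the basis
    \<eta>.\<close>
  define W where "W = colm (\<lambda>b. if b \<in> I then \<eta> b else 0) ** matrix_inv (colm \<xi>)"
  have W: "W *v \<xi> b = (if b \<in> I then \<eta> b else 0)" for b
    using matrix_inv_mult_cancel(2)[OF \<xi>(1), of "axis b 1"]
    by (simp add: W_def matrix_vector_mul_assoc[symmetric] colm_axis)
  have "(M t\<^sub>0 + W) *v \<xi> b = \<eta> b" for b
    using W[of b] \<eta>(2)[of b, unfolded Compl_iff] I(3)[of b] \<xi>(2)[of b] by (auto simp: matrix_vector_mult_add_rdistrib ker_def)
  then have dMW: "det (M t\<^sub>0 + W) \<noteq> 0"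
    using \<eta>(1) by (simp add: det_matrix_mult_colm[of _ \<xi>])
  have smMW: "smm (?J \<delta>) (\<lambda>t. M t + W)" using sm by (intro smm_add) auto
  obtain \<epsilon> where \<epsilon>: "0 < \<epsilon>" "\<epsilon> \<le> \<delta>" "\<And>t. t \<in> ?J \<epsilon> \<Longrightarrow> det (M t + W) \<noteq> 0"
    by (rule det_nonzero_near[OF smMW dMW t0 \<delta>]) (rule that)
  define Z where "Z t = matrix_inv (M t + W) ** W" for t
  \<comment> \<open>On ker M the matrices W and M + W agree, so Z is the identity there.\<close>
  have kerZ: "Z t *v v = v" if "t \<in> ?J \<epsilon>" "v \<in> ker (M t)" for t v
  proof -
    have "W *v v = (M t + W) *v v" using that by (simp add: ker_def matrix_vector_mult_add_rdistrib)
    then show ?thesis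
      using matrix_inv_mult_cancel(2)[OF \<epsilon>(3)[OF that(1)]] by (simp add: Z_def matrix_vector_mul_assoc[symmetric])
  qed
  have rangeW: "range ((*v) W) \<subseteq> span (\<eta> ` I)"
  proof
    fix w assume "w \<in> range ((*v) W)"
    then obtain v where "w = W *v v" by auto
    then have "w = colm (\<lambda>b. if b \<in> I then \<eta> b else 0) *v (matrix_inv (colm \<xi>) *v v)"
      by (simp add: W_def matrix_vector_mul_assoc)
    then show "w \<in> span (\<eta> ` I)"
      by (simp only: colm_mult, intro span_sum span_scale) (auto intro: span_base span_zero)
  qed
  \<comment> \<open>The kernel is contained in the range by \<open>kerZ\<close>, and the range has
    dimension at most that of the range of W, i.e. at most card I, the constant dimension of the
    kernels.\<close>
  have "range ((*v) (Z t)) = ker (M t)" if t: "t \<in> ?J \<epsilon>" for t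
  proof -
    have "ker (M t) \<subseteq> range ((*v) (Z t))" using kerZ[OF t] by (metis rangeI subsetI)
    moreover have "dim (range ((*v) (Z t))) \<le> dim (ker (M t))"
    proof -
      have "range ((*v) (Z t)) = (*v) (matrix_inv (M t + W)) ` range ((*v) W)"
        by (auto simp: Z_def matrix_vector_mul_assoc[symmetric] image_image)
      also have "dim \<dots> \<le> dim (range ((*v) W))" by (rule dim_image_le) auto
      also have "\<dots> \<le> dim (span (\<eta> ` I))" by (rule dim_subset[OF rangeW])
      also have "\<dots> \<le> card (\<eta> ` I)" by (simp add: dim_le_card')
      also have "\<dots> \<le> card I" by (simp add: card_image_le)
      also have "\<dots> = dim (ker (M t))" using I(1) dim[OF subsetD[OF nbhd_mono[OF \<epsilon>(2)] t]] by simp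
      finally show ?thesis .
    qed
    moreover have "subspace (range ((*v) (Z t)))" by (rule linear_subspace_image) auto
    ultimately show ?thesis using subspace_dim_equal[OF subspace_ker] by blast
  qed
  then have "M t *v (Z t *v v) = 0" if "t \<in> ?J \<epsilon>" for t v using that by (auto simp: ker_def)
  moreover have "smm (?J \<epsilon>) Z"
    unfolding Z_def
    using smm_subset[OF smMW nbhd_mono[OF \<epsilon>(2)]] \<epsilon>(3) by (intro smm_matrix_matrix smm_inverse) auto
  ultimately show ?thesis
    using that[OF \<epsilon>(1,2)] kerZ[OF mem_nbhd[OF t0 \<epsilon>(1)]] by blast
qed

section \<open>Local frames adapted to the filtration\<close>

lemma has_vector_derivative_Dmat:
  fixes x :: "real \<Rightarrow> real^('k::finite+'r::finite)"
  assumes "(x has_vector_derivative x') F"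
  shows "((\<lambda>s. (Dmat :: real^('k+'r)^'k) *v x s) has_vector_derivative Dmat *v x') F"
  by (rule bounded_linear.has_vector_derivative[OF _ assms]) simp

locale smooth_tractability = tractability a b A B \<mu> r G Bs Q Pi R
  for a b :: real
    and A :: "real \<Rightarrow> real ^ 'k ^ ('k::finite + 'r::finite)"
    and B :: "real \<Rightarrow> real ^ ('k + 'r) ^ ('k + 'r)"
    and \<mu> r G Bs Q Pi R +
  assumes smA: "smm {a..b} A" and smB: "smm {a..b} B"
begin

lemma G0v: "t \<in> {a..b} \<Longrightarrow> G 0 t *v z = A t *v (Dmat *v z)"
  by (simp add: G_0 matrix_vector_mul_assoc)

lemma SS_mono:
  assumes t: "t \<in> {a..b}" and "i \<le> j" "j \<le> \<mu>"
  shows "SS i t \<subseteq> SS j t"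
  using assms(2,3)
proof (induction j rule: dec_induct)
  case (step j)
  have "SS j t \<subseteq> SS (Suc j) t"
  proof
    fix v assume "v \<in> SS j t"
    then obtain w where w: "w \<in> KK j t" "v = G j t *v w" by (auto simp: SS_def)
    then have "v = G (Suc j) t *v w" using G_Suc_KK[OF t, of j w] step by simp
    then show "v \<in> SS (Suc j) t" using w KK_mono[of j "Suc j" t] by (auto simp: SS_def)
  qed
  then show ?case using step by auto
qed auto

text \<open>A moving frame on J: for i' \<le> i the vectors of level below i' form a basis of K_i'
  (the cardinality clause supplies the dimension), and the images under T of the vectors of level
  below i form a basis of S_i. The last clause records that a vector of level j lies in K_(j+1), so
  that A D x lies in S_j and is a smooth combination of images of lower level. Indices of level i or
  more are placeholders.\<close>

definition frame where
  "frame i J x dx lev c \<longleftrightarrow>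
     (\<forall>b. smv J (x b) \<and> smv J (dx b) \<and> (\<forall>t\<in>J. (x b has_vector_derivative dx b t) (at t within J))) \<and>
     (\<forall>i'\<le>i. card {b. lev b < i'} = dK i') \<and>
     (\<forall>t\<in>J. \<forall>b. lev b < i \<longrightarrow> x b t \<in> KK (Suc (lev b)) t) \<and>
     (\<forall>t\<in>J. indep {b. lev b < i} (\<lambda>b. x b t)) \<and>
     (\<forall>t\<in>J. indep {b. lev b < i} (\<lambda>b. DAE_op t (Dmat *v dx b t) (x b t))) \<and>
     (\<forall>b b'. sm J (c b b')) \<and>
     (\<forall>t\<in>J. \<forall>b. lev b < i \<longrightarrow> A t *v (Dmat *v x b t) =
        (\<Sum>b' | lev b' < lev b. c b b' t *\<^sub>R DAE_op t (Dmat *v dx b' t) (x b' t)))"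
  for J :: "real set" and x dx :: "'k + 'r \<Rightarrow> real \<Rightarrow> real ^ ('k + 'r)" and lev :: "'k + 'r \<Rightarrow> nat"

lemma frame_subset:
  assumes "frame i J x dx lev c" "K \<subseteq> J" shows "frame i K x dx lev c"
proof -
  have "smv K (x p) \<and> smv K (dx p) \<and> (\<forall>t\<in>K. (x p has_vector_derivative dx p t) (at t within K))" for p
    using assms smv_subset[of J _ K] has_vector_derivative_within_subset[of "x p" _ _ J K]
    unfolding frame_def by blast
  moreover have "sm K (c p q)" for p q
    using assms sm_subset[of J _ K] unfolding frame_def by blast
  ultimately show ?thesis
    using assms unfolding frame_def by blast
qed

lemma smv_DAE_op:
  assumes "J \<subseteq> {a..b}" "smv J x" "smv J dx"
  shows "smv J (\<lambda>t. DAE_op t (Dmat *v dx t) (x t))"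
  unfolding DAE_op_def
  using assms smA smB by (intro smv_add smv_matrix_vector smm_const) (auto intro: smm_subset)

lemma frame_DAE_op_in_SS:
  assumes f: "frame i J x dx lev c" and J: "J \<subseteq> {a..b}" "t \<in> J" "at t within J \<noteq> bot"
    and p: "lev p < i" "i \<le> \<mu>"
  shows "DAE_op t (Dmat *v dx p t) (x p t) \<in> SS (Suc (lev p)) t"
    "DAE_op t (Dmat *v dx p t) (x p t) \<in> SS i t"
proof -
  have d: "((\<lambda>s. Dmat *v x p s) has_vector_derivative Dmat *v dx p t) (at t within J)"
    using f J by (intro has_vector_derivative_Dmat) (auto simp: frame_def)
  show "DAE_op t (Dmat *v dx p t) (x p t) \<in> SS (Suc (lev p)) t"
    by (rule DAE_op_section(1)[OF J d]) (use f p in \<open>auto simp: frame_def\<close>)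
  then show "DAE_op t (Dmat *v dx p t) (x p t) \<in> SS i t"
    using SS_mono[OF subsetD[OF J(1,2)], of "Suc (lev p)" i] p by auto
qed

lemma frame_span_KK:
  assumes f: "frame i J x dx lev c" and J: "J \<subseteq> {a..b}" "t \<in> J" and i: "i \<le> \<mu>" and v: "v \<in> KK i t"
  shows "\<exists>e. v = (\<Sum>b | lev b < i. e b *\<^sub>R x b t)"
proof (rule indep_span[OF _ _ _ v])
  show "indep {b. lev b < i} (\<lambda>b. x b t)" using f J by (auto simp: frame_def)
  show "x b t \<in> KK i t" if "b \<in> {b. lev b < i}" for b
    using that f J KK_mono[of "Suc (lev b)" i t] by (auto simp: frame_def)
  show "dim (KK i t) \<le> card {b. lev b < i}"
    using dim_KK[of t i] f J i by (auto simp: frame_def)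
qed

lemma frame_span_SS:
  assumes f: "frame i J x dx lev c" and J: "J \<subseteq> {a..b}" "t \<in> J" "at t within J \<noteq> bot"
    and i: "i \<le> \<mu>" and v: "v \<in> SS i t"
  shows "\<exists>e. v = (\<Sum>b | lev b < i. e b *\<^sub>R DAE_op t (Dmat *v dx b t) (x b t))"
proof (rule indep_span[OF _ _ _ v])
  show "indep {b. lev b < i} (\<lambda>b. DAE_op t (Dmat *v dx b t) (x b t))" using f J by (auto simp: frame_def)
  show "DAE_op t (Dmat *v dx b t) (x b t) \<in> SS i t" if "b \<in> {b. lev b < i}" for b
    using frame_DAE_op_in_SS(2)[OF f J _ i] that by auto
  show "dim (SS i t) \<le> card {b. lev b < i}"
    using dim_SS[of t i] f J i by (auto simp: frame_def)
qed

lemma DAE_op_sum: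
  "DAE_op t (Dmat *v (\<Sum>b\<in>I. e b *\<^sub>R dx b)) (\<Sum>b\<in>I. e b *\<^sub>R x b) =
    (\<Sum>b\<in>I. e b *\<^sub>R DAE_op t (Dmat *v dx b) (x b))"
  by (simp add: DAE_op_def linear_sum[OF matrix_vector_mul_linear] matrix_vector_mult_scaleR
      scaleR_add_right sum.distrib)

text \<open>K_(i+1) consists of the z with A D z in S_i. Since S_i is spanned by the smooth vectors
  T b, this is a linear system M z = 0 with smooth M and kernels of constant dimension, and
  \<open>kernel_sections\<close> extends a basis of the kernel at t0 to smooth sections. The
  enlarged family of images stays independent by \<open>DAE_op_section\<close>: a combination of new
  sections whose image lies in S_i at some point lies in K_i there, against the independence of the
  enlarged frame.\<close>

lemma frame_step:
  assumes t0: "t\<^sub>0 \<in> {a..b}" and \<delta>: "0 < \<delta>" and i: "i < \<mu>"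
    and f: "frame i (nbhd a b t\<^sub>0 \<delta>) x dx lev c"
  shows "\<exists>\<epsilon> x dx lev c. 0 < \<epsilon> \<and> frame (Suc i) (nbhd a b t\<^sub>0 \<epsilon>) x dx lev c"
proof -
  let ?J = "nbhd a b t\<^sub>0"
  define I where "I = {b. lev b < i}"
  define T where "T b t = DAE_op t (Dmat *v dx b t) (x b t)" for b t
  have Jab: "?J \<epsilon> \<subseteq> {a..b}" for \<epsilon> by (rule nbhd_subset)
  have t0J: "t\<^sub>0 \<in> ?J \<epsilon>" if "0 < \<epsilon>" for \<epsilon> by (rule mem_nbhd[OF t0 that])
  have nt: "at t within ?J \<epsilon> \<noteq> bot" if "0 < \<epsilon>" "t \<in> ?J \<epsilon>" for t \<epsilon>
    by (rule nbhd_at_nontrivial[OF ab t0 that])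
  have smx: "smv (?J \<delta>) (x b)" "smv (?J \<delta>) (dx b)" for b using f by (auto simp: frame_def)
  have smT: "smv (?J \<delta>) (T b)" for b
    unfolding T_def by (rule smv_DAE_op[OF Jab smx])
  have Tind: "indep I (\<lambda>b. T b t)" if "t \<in> ?J \<delta>" for t
    using f that by (auto simp: frame_def I_def T_def)
  have TSS: "T b t \<in> SS i t" if "t \<in> ?J \<delta>" "b \<in> I" for b t
    using frame_DAE_op_in_SS(2)[OF f Jab that(1) nt[OF \<delta> that(1)]] that i by (auto simp: I_def T_def)
  have SSrep: "\<exists>e. v = (\<Sum>b\<in>I. e b *\<^sub>R T b t)" if "t \<in> ?J \<delta>" "v \<in> SS i t" for v t
    using frame_span_SS[OF f Jab that(1) nt[OF \<delta> that(1)] _ that(2)] i by (auto simp: I_def T_def)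
  obtain e where e: "det (colm e) \<noteq> 0" "\<And>b. b \<in> I \<Longrightarrow> e b = T b t\<^sub>0"
    by (rule indep_extend_UNIV[OF Tind[OF t0J[OF \<delta>]]]) (rule that)
  \<comment> \<open>The spanning vectors of S_i, completed by constant vectors to a basis at t0,
    hence also near t0.\<close>
  define F where "F b t = (if b \<in> I then T b t else e b)" for b t
  define Xs where "Xs t = colm (\<lambda>b. F b t)" for t
  have smXs: "smm (?J \<delta>) Xs"
    unfolding Xs_def
  proof (rule smm_colm)
    fix p
    have "F p = (if p \<in> I then T p else (\<lambda>_. e p))" by (auto simp: F_def)
    then show "smv (?J \<delta>) (F p)" using smT[of p] by simp
  qed
  have "(\<lambda>b. F b t\<^sub>0) = e" using e by (auto simp: F_def)
  then have dXs: "det (Xs t\<^sub>0) \<noteq> 0" using e by (simp add: Xs_def)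
  obtain \<delta>1 where \<delta>1: "0 < \<delta>1" "\<delta>1 \<le> \<delta>" "\<And>t. t \<in> ?J \<delta>1 \<Longrightarrow> det (Xs t) \<noteq> 0"
    by (rule det_nonzero_near[OF smXs dXs t0 \<delta>]) (rule that)
  have Xs_supp: "Xs t *v g = (\<Sum>b\<in>I. g $ b *\<^sub>R T b t)" if "\<And>b. b \<notin> I \<Longrightarrow> g $ b = 0" for g t
    unfolding Xs_def colm_mult F_def using that
    by (subst sum.mono_neutral_right[of UNIV I]) auto
  \<comment> \<open>Deletes the coordinates in I. With respect to the basis \<open>Xs\<close> the
    remaining coordinates are those transversal to S_i, so M z = 0 expresses that A D z lies in
    S_i.\<close>
  define Mk :: "real^('k+'r)^('k+'r)" where "Mk = (\<chi> p q. if p = q \<and> p \<notin> I then 1 else 0)"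
  have Mk: "(Mk *v v) $ p = (if p \<in> I then 0 else v $ p)" for v p
    by (auto simp: Mk_def matrix_vector_mult_def if_distrib[of "\<lambda>y. y * _"] cong: if_cong)
  define E :: "real \<Rightarrow> real^('k+'r)^('k+'r)" where "E t = A t ** Dmat" for t
  have smE: "smm (?J \<delta>1) E"
    unfolding E_def using smA smm_subset[OF smA Jab] by (intro smm_matrix_matrix) auto
  define M where "M t = Mk ** (matrix_inv (Xs t) ** E t)" for t
  have smXi: "smm (?J \<delta>1) (\<lambda>t. matrix_inv (Xs t))"
    using smm_subset[OF smXs nbhd_mono[OF \<delta>1(2)]] \<delta>1 by (intro smm_inverse) auto
  have smM: "smm (?J \<delta>1) M"
    unfolding M_def using smXi smE by (intro smm_matrix_matrix) auto
  have coord: "E t *v z \<in> SS i t \<longleftrightarrow> (\<forall>p. p \<notin> I \<longrightarrow> (matrix_inv (Xs t) *v (E t *v z)) $ p = 0)"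
    if t: "t \<in> ?J \<delta>1" for t z
  proof -
    have tJ: "t \<in> ?J \<delta>" using t nbhd_mono[OF \<delta>1(2)] by auto
    show ?thesis
    proof
      assume "E t *v z \<in> SS i t"
      then obtain g where g: "E t *v z = (\<Sum>b\<in>I. g b *\<^sub>R T b t)" using SSrep[OF tJ] by blast
      define h where "h = (\<chi> b. if b \<in> I then g b else 0)"
      have "E t *v z = Xs t *v h" using Xs_supp[of h] g by (simp add: h_def)
      then have "matrix_inv (Xs t) *v (E t *v z) = h"
        using matrix_inv_mult_cancel(2)[OF \<delta>1(3)[OF t]] by simp
      then show "\<forall>p. p \<notin> I \<longrightarrow> (matrix_inv (Xs t) *v (E t *v z)) $ p = 0" by (simp add: h_def)
    next
      assume *: "\<forall>p. p \<notin> I \<longrightarrow> (matrix_inv (Xs t) *v (E t *v z)) $ p = 0"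
      have "E t *v z = Xs t *v (matrix_inv (Xs t) *v (E t *v z))"
        using matrix_inv_mult_cancel(1)[OF \<delta>1(3)[OF t]] by simp
      also have "\<dots> = (\<Sum>b\<in>I. (matrix_inv (Xs t) *v (E t *v z)) $ b *\<^sub>R T b t)"
        using * by (intro Xs_supp) auto
      also have "\<dots> \<in> SS i t"
        using TSS[OF tJ] by (intro subspace_sum[OF subspace_SS] subspace_scale[OF subspace_SS])
      finally show "E t *v z \<in> SS i t" .
    qed
  qed
  have kerM: "ker (M t) = KK (Suc i) t" if t: "t \<in> ?J \<delta>1" for t
  proof -
    have tab: "t \<in> {a..b}" using t Jab by blast
    have "z \<in> ker (M t) \<longleftrightarrow> z \<in> KK (Suc i) t" for z
      using coord[OF t, of z] G_0_in_SS_iff[OF tab i, of z] G_0[OF tab]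
      by (auto simp: ker_def M_def vec_eq_iff Mk matrix_vector_mul_assoc[symmetric] E_def)
    then show ?thesis by blast
  qed
  have dimM: "dim (ker (M t)) = dK (Suc i)" if t: "t \<in> ?J \<delta>1" for t
    using dim_KK[OF subsetD[OF Jab t], of "Suc i"] i kerM[OF t] by simp
  obtain \<delta>2 Z where \<delta>2: "0 < \<delta>2" "\<delta>2 \<le> \<delta>1" "smm (?J \<delta>2) Z"
    "\<And>t v. t \<in> ?J \<delta>2 \<Longrightarrow> M t *v (Z t *v v) = 0"
    "\<And>v. v \<in> ker (M t\<^sub>0) \<Longrightarrow> Z t\<^sub>0 *v v = v"
    by (rule kernel_sections[OF smM t0 \<delta>1(1) dimM]) (assumption, rule that)
  have J21: "?J \<delta>2 \<subseteq> ?J \<delta>1" by (rule nbhd_mono[OF \<delta>2(2)])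
  have J10: "?J \<delta>1 \<subseteq> ?J \<delta>" by (rule nbhd_mono[OF \<delta>1(2)])
  have J20: "?J \<delta>2 \<subseteq> ?J \<delta>" using J21 J10 by (rule subset_trans)
  have xind0: "indep I (\<lambda>b. x b t\<^sub>0)" using f t0J[OF \<delta>] by (auto simp: frame_def I_def)
  have xin: "x b t \<in> KK (Suc (lev b)) t" if "b \<in> I" "t \<in> ?J \<delta>" for b t
    using f that by (auto simp: frame_def I_def)
  have xin': "x b t \<in> KK (Suc i) t" if "b \<in> I" "t \<in> ?J \<delta>" for b t
    using xin[OF that] KK_mono[of "Suc (lev b)" "Suc i" t] that(1) by (auto simp: I_def)
  obtain I' y where I': "I \<subseteq> I'" "card I' = dim (KK (Suc i) t\<^sub>0)" "indep I' y"
    "\<And>b. b \<in> I' \<Longrightarrow> y b \<in> KK (Suc i) t\<^sub>0" "\<And>b. b \<in> I \<Longrightarrow> y b = x b t\<^sub>0"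
    by (rule indep_extend[OF xind0 xin'[OF _ t0J[OF \<delta>]]]) (assumption, rule that)
  obtain g where g: "det (colm g) \<noteq> 0" "\<And>b. b \<in> I' \<Longrightarrow> g b = y b"
    by (rule indep_extend_UNIV[OF I'(3)]) (rule that)
  \<comment> \<open>The sections through the basis y of K_(i+1) at t0: there Z is the identity on
    this space.\<close>
  define zz where "zz b t = Z t *v y b" for b t
  have smzz: "smv (?J \<delta>2) (zz b)" for b
    unfolding zz_def using \<delta>2(3) by (intro smv_matrix_vector) auto
  have "\<exists>dz. smv (?J \<delta>2) dz \<and> (\<forall>t\<in>?J \<delta>2. (zz b has_vector_derivative dz t) (at t within ?J \<delta>2))" for b
    using smv_deriv[OF smzz[of b, unfolded nbhd_def] nbhd_nontrivial[OF ab t0 \<delta>2(1)]]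
    unfolding nbhd_def by metis
  then have "\<forall>b. \<exists>dz. smv (?J \<delta>2) dz \<and> (\<forall>t\<in>?J \<delta>2. (zz b has_vector_derivative dz t) (at t within ?J \<delta>2))"
    by blast
  from choice[OF this] obtain dz where dz: "\<And>b. smv (?J \<delta>2) (dz b)"
    "\<And>b t. t \<in> ?J \<delta>2 \<Longrightarrow> (zz b has_vector_derivative dz b t) (at t within ?J \<delta>2)"
    by blast
  define x' where "x' b = (if b \<in> I then x b else zz b)" for b
  define dx' where "dx' b = (if b \<in> I then dx b else dz b)" for b
  define lev' where "lev' b = (if b \<in> I then lev b else if b \<in> I' then i else Suc i)" for b
  define c' where "c' b b' t = (if b \<in> I then c b b' t else (matrix_inv (Xs t) *v (E t *v x' b t)) $ b')" for b b' t
  have smx': "smv (?J \<delta>2) (x' b)" "smv (?J \<delta>2) (dx' b)" for b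
    using smv_subset[OF smx(1) J20, of b] smv_subset[OF smx(2) J20, of b] smzz[of b] dz(1)[of b]
    by (auto simp: x'_def dx'_def)
  have dx': "(x' b has_vector_derivative dx' b t) (at t within ?J \<delta>2)" if "t \<in> ?J \<delta>2" for b t
  proof (cases "b \<in> I")
    case True
    have "(x b has_vector_derivative dx b t) (at t within ?J \<delta>)"
      using f subsetD[OF J20 that] by (auto simp: frame_def)
    from has_vector_derivative_within_subset[OF this J20] show ?thesis
      using True by (simp add: x'_def dx'_def)
  next
    case False then show ?thesis using dz that by (simp add: x'_def dx'_def)
  qed
  define L where "L t = colm (\<lambda>b. if b \<in> I' then x' b t else g b)" for t
  have smL: "smm (?J \<delta>2) L"
    unfolding L_def
  proof (rule smm_colm)
    fix p show "smv (?J \<delta>2) (\<lambda>t. if p \<in> I' then x' p t else g p)"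
      using smx'(1)[of p] by (cases "p \<in> I'") simp_all
  qed
  have "(\<lambda>b. if b \<in> I' then x' b t\<^sub>0 else g b) = g"
  proof
    fix b show "(if b \<in> I' then x' b t\<^sub>0 else g b) = g b"
      using I'(4,5) g(2) \<delta>2(5) kerM[OF t0J[OF \<delta>1(1)]] by (auto simp: x'_def zz_def)
  qed
  then have dL: "det (L t\<^sub>0) \<noteq> 0" using g by (simp add: L_def)
  obtain \<delta>3 where \<delta>3: "0 < \<delta>3" "\<delta>3 \<le> \<delta>2" "\<And>t. t \<in> ?J \<delta>3 \<Longrightarrow> det (L t) \<noteq> 0"
    by (rule det_nonzero_near[OF smL dL t0 \<delta>2(1)]) (rule that)
  have J32: "?J \<delta>3 \<subseteq> ?J \<delta>2" by (rule nbhd_mono[OF \<delta>3(2)])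
  have x'ind: "indep I' (\<lambda>b. x' b t)" if t: "t \<in> ?J \<delta>3" for t
  proof -
    have "indep UNIV (\<lambda>b. if b \<in> I' then x' b t else g b)"
      using \<delta>3(3)[OF t] by (simp add: indep_UNIV_iff_det L_def)
    then have "indep I' (\<lambda>b. if b \<in> I' then x' b t else g b)" by (rule indep_subset) auto
    then show ?thesis using indep_cong[of I' "\<lambda>b. if b \<in> I' then x' b t else g b" "\<lambda>b. x' b t"] by simp
  qed
  have zzin: "zz b t \<in> KK (Suc i) t" if "t \<in> ?J \<delta>2" for b t
    using \<delta>2(4)[OF that, of "y b"] kerM[of t] J21 that by (auto simp: zz_def ker_def)
  have lev'_I: "{b. lev' b < i'} = {b. lev b < i'}" if "i' \<le> i" for i'
    using that I'(1) by (auto simp: lev'_def I_def)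
  have lev'_I': "{b. lev' b < Suc i} = I'"
    using I'(1) by (auto simp: lev'_def I_def)
  define T' where "T' b t = DAE_op t (Dmat *v dx' b t) (x' b t)" for b t
  have T'I: "T' b t = T b t" if "b \<in> I" for b t using that by (simp add: T'_def T_def dx'_def x'_def)
  have T'ind: "indep I' (\<lambda>b. T' b t)" if t: "t \<in> ?J \<delta>3" for t
  proof (rule indepI)
    fix e b assume e: "(\<Sum>b\<in>I'. e b *\<^sub>R T' b t) = 0" and b: "b \<in> I'"
    have t2: "t \<in> ?J \<delta>2" and t': "t \<in> ?J \<delta>" using t J32 J21 J10 by auto
    define N where "N = I' - I"
    have split: "(\<Sum>b\<in>I'. h b) = (\<Sum>b\<in>I. h b) + (\<Sum>b\<in>N. h b)" for h :: "'k+'r \<Rightarrow> real^('k+'r)"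
      using sum.subset_diff[OF I'(1), of h] by (simp add: N_def add.commute)
    \<comment> \<open>The part of the relation that comes from the new sections. Its image is minus
      a combination of the old T b, thus in S_i.\<close>
    define xx where "xx s = (\<Sum>b\<in>N. e b *\<^sub>R x' b s)" for s
    have "(xx has_vector_derivative (\<Sum>b\<in>N. e b *\<^sub>R dx' b t)) (at t within ?J \<delta>2)"
      unfolding xx_def
      by (intro has_vector_derivative_sum bounded_linear.has_vector_derivative[OF bounded_linear_scaleR_right] dx' t2)
    then have d: "((\<lambda>s. (Dmat::real^('k+'r)^'k) *v xx s) has_vector_derivative Dmat *v (\<Sum>b\<in>N. e b *\<^sub>R dx' b t)) (at t within ?J \<delta>2)"
      by (rule has_vector_derivative_Dmat)
    have sec: "xx s \<in> KK (Suc i) s" if "s \<in> ?J \<delta>2" for s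
      unfolding xx_def using zzin[OF that]
      by (intro subspace_sum[OF subspace_KK] subspace_scale[OF subspace_KK]) (auto simp: N_def x'_def)
    have "DAE_op t (Dmat *v (\<Sum>b\<in>N. e b *\<^sub>R dx' b t)) (xx t) = (\<Sum>b\<in>N. e b *\<^sub>R T' b t)"
      unfolding xx_def DAE_op_sum T'_def ..
    also have "\<dots> = (\<Sum>b\<in>I. (- e b) *\<^sub>R T b t)"
      using e split[of "\<lambda>b. e b *\<^sub>R T' b t"] T'I by (simp add: sum_negf add_eq_0_iff cong: sum.cong)
    also have "\<dots> \<in> SS i t"
      using TSS[OF t'] by (intro subspace_sum[OF subspace_SS] subspace_scale[OF subspace_SS])
    finally have "xx t \<in> KK i t"
      by (intro DAE_op_section(2)[OF Jab t2 nt[OF \<delta>2(1) t2] d i sec])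
    then obtain q where q: "xx t = (\<Sum>b\<in>I. q b *\<^sub>R x b t)"
      using frame_span_KK[OF f Jab t'] i by (auto simp: I_def)
    \<comment> \<open>Being in K_i at t, the new part is a combination of old frame vectors. This is
      a relation in the independent family x' and forces all its coefficients to vanish.\<close>
    have "(\<Sum>b\<in>I'. (if b \<in> I then - q b else e b) *\<^sub>R x' b t) = 0"
    proof -
      have "(\<Sum>b\<in>N. (if b \<in> I then - q b else e b) *\<^sub>R x' b t) = xx t"
        unfolding xx_def by (intro sum.cong) (auto simp: N_def)
      moreover have "(\<Sum>b\<in>I. (if b \<in> I then - q b else e b) *\<^sub>R x' b t) = - (\<Sum>b\<in>I. q b *\<^sub>R x b t)"
        unfolding sum_negf[symmetric] by (intro sum.cong) (auto simp: x'_def)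
      ultimately show ?thesis unfolding split using q by simp
    qed
    then have q0: "(if p \<in> I then - q p else e p) = 0" if "p \<in> I'" for p
      using that by (rule indepD[OF x'ind[OF t]])
    have eN: "e p = 0" if "p \<in> N" for p
      using q0[of p] that by (simp add: N_def)
    then have "(\<Sum>b\<in>I. e b *\<^sub>R T b t) = 0"
      using e split[of "\<lambda>b. e b *\<^sub>R T' b t"] T'I by (simp cong: sum.cong)
    then have "e p = 0" if "p \<in> I" for p using that by (rule indepD[OF Tind[OF t']])
    with eN b show "e b = 0" by (cases "b \<in> I") (auto simp: N_def)
  qed
  have "frame (Suc i) (?J \<delta>3) x' dx' lev' c'"
    unfolding frame_def
  proof (intro conjI allI ballI impI)
    fix b show "smv (?J \<delta>3) (x' b)" "smv (?J \<delta>3) (dx' b)" using smx' J32 smv_subset by blast+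
  next
    fix b t assume "t \<in> ?J \<delta>3"
    then show "(x' b has_vector_derivative dx' b t) (at t within ?J \<delta>3)"
      using dx' J32 has_vector_derivative_within_subset by blast
  next
    fix i' assume "i' \<le> Suc i"
    then show "card {b. lev' b < i'} = dK i'"
      using lev'_I[of i'] lev'_I' f I'(2) dim_KK[OF t0, of "Suc i"] i
      by (cases "i' = Suc i") (auto simp: frame_def)
  next
    fix t b assume t: "t \<in> ?J \<delta>3" and b: "lev' b < Suc i"
    show "x' b t \<in> KK (Suc (lev' b)) t"
      using b xin[of b t] zzin[of t b] t J32 J21 J10 by (auto simp: x'_def lev'_def I_def)
  next
    fix t assume t: "t \<in> ?J \<delta>3"
    show "indep {b. lev' b < Suc i} (\<lambda>b. x' b t)"
      unfolding lev'_I' using x'ind[OF t] .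
    show "indep {b. lev' b < Suc i} (\<lambda>b. DAE_op t (Dmat *v dx' b t) (x' b t))"
      unfolding lev'_I' using T'ind[OF t] by (simp add: T'_def)
  next
    fix b b'
    have "smv (?J \<delta>2) (\<lambda>t. matrix_inv (Xs t) *v (E t *v x' b t))"
      using smm_subset[OF smXi J21] smm_subset[OF smE J21] smx' by (intro smv_matrix_vector)
    moreover have "sm (?J \<delta>) (c b b')" using f by (auto simp: frame_def)
    ultimately show "sm (?J \<delta>3) (c' b b')"
      unfolding c'_def smv_def using sm_subset[OF _ J32] sm_subset[OF _ subset_trans[OF J32 J20]]
      by (cases "b \<in> I") simp_all
  next
    fix t b assume t: "t \<in> ?J \<delta>3" and b: "lev' b < Suc i"
    have t1: "t \<in> ?J \<delta>1" and t': "t \<in> ?J \<delta>" using t J32 J21 J10 by auto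
    show "A t *v (Dmat *v x' b t) =
        (\<Sum>b' | lev' b' < lev' b. c' b b' t *\<^sub>R DAE_op t (Dmat *v dx' b' t) (x' b' t))"
    proof (cases "b \<in> I")
      case True
      then have "lev b < i" by (simp add: I_def)
      then have "A t *v (Dmat *v x b t) = (\<Sum>b' | lev b' < lev b. c b b' t *\<^sub>R T b' t)"
        using f t' by (auto simp: frame_def T_def)
      also have "\<dots> = (\<Sum>b' | lev' b' < lev' b. c' b b' t *\<^sub>R T' b' t)"
        using True lev'_I[of "lev b"] \<open>lev b < i\<close>
        by (intro sum.cong) (auto simp: lev'_def c'_def T'I I_def)
      finally show ?thesis using True by (simp add: x'_def T'_def)
    next
      case False
      then have bN: "b \<in> I'" "lev' b = i" using b lev'_I' by (auto simp: lev'_def split: if_splits)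
      note tab = subsetD[OF Jab t]
      define h where "h = matrix_inv (Xs t) *v (E t *v x' b t)"
      have "x' b t \<in> KK (Suc i) t" using zzin[of t b] False t J32 by (auto simp: x'_def)
      then have "E t *v x' b t \<in> SS i t"
        using G_0_in_SS_iff[OF tab i] G_0[OF tab] by (simp add: E_def)
      then have "\<And>p. p \<notin> I \<Longrightarrow> h $ p = 0" using coord[OF t1] by (simp add: h_def)
      then have "Xs t *v h = (\<Sum>b\<in>I. h $ b *\<^sub>R T b t)" by (rule Xs_supp)
      moreover have "Xs t *v h = A t *v (Dmat *v x' b t)"
        unfolding h_def matrix_inv_mult_cancel(1)[OF \<delta>1(3)[OF t1]] by (simp add: E_def matrix_vector_mul_assoc)
      moreover have "{b'. lev' b' < lev' b} = I" using lev'_I[of i] bN by (simp add: I_def)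
      ultimately show ?thesis
        using False by (simp add: h_def c'_def T'I flip: T'_def cong: sum.cong)
    qed
  qed
  then show ?thesis using \<delta>3(1) by blast
qed

lemma frame_exists:
  assumes t0: "t\<^sub>0 \<in> {a..b}" and "i \<le> \<mu>"
  shows "\<exists>\<delta> x dx lev c. 0 < \<delta> \<and> frame i (nbhd a b t\<^sub>0 \<delta>) x dx lev c"
  using assms(2)
proof (induction i)
  case 0
  have "frame 0 (nbhd a b t\<^sub>0 1) (\<lambda>_ _. 0) (\<lambda>_ _. 0) (\<lambda>_. 0) (\<lambda>_ _ _. 0)"
    by (auto simp: frame_def dK_def indep_def)
  then show ?case using zero_less_one by blast
next
  case (Suc i)
  then show ?case using frame_step[OF t0, of _ i] by (metis Suc_le_lessD Suc_leD)
qed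

end

lemma bounded_bilinear_matrix_vector:
  "bounded_bilinear ((*v) :: real^'n^'m \<Rightarrow> real^'n \<Rightarrow> real^'m)"
proof -
  have "bilinear ((*v) :: real^'n^'m \<Rightarrow> _)"
    unfolding bilinear_def
    by (auto intro!: linearI simp: matrix_vector_mult_add_rdistrib matrix_vector_right_distrib
        scaleR_matrix_vector_assoc matrix_vector_mult_scaleR)
  then show ?thesis by (simp add: bilinear_conv_bounded_bilinear)
qed

lemma smm_bounded:
  fixes M :: "real \<Rightarrow> real^'n^'m"
  assumes "smm J M" "compact J"
  obtains C where "0 \<le> C" "\<And>t v. t \<in> J \<Longrightarrow> norm (M t *v v) \<le> C * norm v"
proof -
  obtain K where K: "\<And>M v. norm ((M :: real^'n^'m) *v v) \<le> norm M * norm v * K" "0 \<le> K"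
    using bounded_bilinear.nonneg_bounded[OF bounded_bilinear_matrix_vector] by metis
  have "bounded (M ` J)"
    using assms smm_continuous_on compact_continuous_image compact_imp_bounded by blast
  then obtain L where L: "\<And>t. t \<in> J \<Longrightarrow> norm (M t) \<le> L" by (auto simp: bounded_iff)
  show ?thesis
  proof (rule that[of "\<bar>L\<bar> * K"])
    fix t and v :: "real^'n" assume "t \<in> J"
    then have "norm (M t) * norm v * K \<le> \<bar>L\<bar> * norm v * K"
      using L[of t] K(2) by (intro mult_right_mono) auto
    with K(1)[of "M t" v] show "norm (M t *v v) \<le> \<bar>L\<bar> * K * norm v" by (simp add: ac_simps)
  qed (use K in auto)
qed

lemma sm_bounded:
  assumes "sm J f" "compact J"
  obtains C where "0 \<le> C" "\<And>t. t \<in> J \<Longrightarrow> \<bar>f t\<bar> \<le> C"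
proof -
  have "bounded (f ` J)"
    using assms sm_continuous_on compact_continuous_image compact_imp_bounded by blast
  then obtain L where "\<And>t. t \<in> J \<Longrightarrow> norm (f t) \<le> L" by (auto simp: bounded_iff)
  then show ?thesis using that[of "\<bar>L\<bar>"] by force
qed

context smooth_tractability
begin

lemma frame_le: "frame i J x dx lev c \<Longrightarrow> j \<le> i \<Longrightarrow> frame j J x dx lev c"
  unfolding frame_def
  using indep_subset[of "{p. lev p < i}" _ "{p. lev p < j}"]
  by (smt (verit) Collect_mono_iff order_less_le_trans order_trans)

end

section \<open>Coordinates in a complete frame and the normal form of the DAE\<close>

text \<open>A frame of K_\<mu> completed to a basis of the whole space; the completing vectors have
  level \<mu> or more and are constant, so that they contribute no derivative terms of their
  own.\<close>

locale complete_frame = smooth_tractability a b A B \<mu> r G Bs Q Pi R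
  for a b :: real
    and A :: "real \<Rightarrow> real ^ 'k ^ ('k::finite + 'r::finite)"
    and B :: "real \<Rightarrow> real ^ ('k + 'r) ^ ('k + 'r)"
    and \<mu> r G Bs Q Pi R +
  fixes \<alpha> \<beta> :: real and J :: "real set"
    and x dx :: "'k + 'r \<Rightarrow> real \<Rightarrow> real ^ ('k + 'r)" and lev :: "'k + 'r \<Rightarrow> nat"
    and cf :: "'k + 'r \<Rightarrow> 'k + 'r \<Rightarrow> real \<Rightarrow> real"
  assumes fr: "frame \<mu> J x dx lev cf"
    and J: "J = {\<alpha>..\<beta>}" "\<alpha> < \<beta>" "J \<subseteq> {a..b}"
    and const: "\<And>p t. \<mu> \<le> lev p \<Longrightarrow> t \<in> J \<Longrightarrow> dx p t = 0"
    and det_x: "\<And>t. t \<in> J \<Longrightarrow> det (colm (\<lambda>p. x p t)) \<noteq> 0"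
begin

definition X where "X t = colm (\<lambda>p. x p t)"

definition Xi where "Xi t = matrix_inv (X t)"

definition T where "T p t = DAE_op t (Dmat *v dx p t) (x p t)"

text \<open>The matching basis of the image space: the images under T of the vectors of K_\<mu>, and
  A D x for the completing vectors. In this basis the DAE takes its decoupled form.\<close>

definition F where "F t = colm (\<lambda>p. if lev p < \<mu> then T p t else A t *v (Dmat *v x p t))"

definition Fi where "Fi t = matrix_inv (F t)"

text \<open>Of interest for q of level \<mu> or more; for lower levels \<open>T q t\<close> is
  itself a column of \<open>F t\<close>.\<close>

definition al where "al q p t = (Fi t *v T q t) $ p"

definition co :: "(real \<Rightarrow> real ^ ('k + 'r)) \<Rightarrow> 'k + 'r \<Rightarrow> real \<Rightarrow> real" where
  "co y p t = (Xi t *v y t) $ p"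

text \<open>A genuine derivative when p has positive level and D y is differentiable
  (\<open>co_has_derivative\<close>).\<close>

definition cod :: "(real \<Rightarrow> real ^ ('k + 'r)) \<Rightarrow> 'k + 'r \<Rightarrow> real \<Rightarrow> real" where
  "cod y p t = vector_derivative (co y p) (at t within J)"

lemma compact_J: "compact J" by (simp add: J)

lemma nt: "t \<in> J \<Longrightarrow> at t within J \<noteq> bot"
  using islimpt_Icc[OF J(2), of t] by (simp add: J trivial_limit_within)

lemma tab: "t \<in> J \<Longrightarrow> t \<in> {a..b}" using J(3) by blast

lemma smx: "smv J (x p)" "smv J (dx p)"
  and dx: "t \<in> J \<Longrightarrow> (x p has_vector_derivative dx p t) (at t within J)"
  using fr by (auto simp: frame_def)

lemma smX: "smm J X"
  unfolding X_def by (intro smm_colm smx)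

lemma smXi: "smm J Xi"
  unfolding Xi_def using smX by (rule smm_inverse) (simp add: X_def det_x)

lemma X_Xi: "t \<in> J \<Longrightarrow> X t *v (Xi t *v v) = v" and Xi_X: "t \<in> J \<Longrightarrow> Xi t *v (X t *v v) = v"
  unfolding Xi_def X_def using matrix_inv_mult_cancel det_x by blast+

lemma smT: "smv J (T p)"
  unfolding T_def by (rule smv_DAE_op[OF J(3) smx])

lemma indep_x: "t \<in> J \<Longrightarrow> indep UNIV (\<lambda>p. x p t)"
  using det_x by (simp add: indep_UNIV_iff_det)

lemma x_in_KK: "t \<in> J \<Longrightarrow> lev p < i \<Longrightarrow> i \<le> \<mu> \<Longrightarrow> x p t \<in> KK i t"
  using fr KK_mono[of "Suc (lev p)" i t] by (fastforce simp: frame_def)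

lemma repr: "t \<in> J \<Longrightarrow> y t = (\<Sum>p\<in>UNIV. co y p t *\<^sub>R x p t)"
  using X_Xi[of t "y t"] by (simp add: co_def X_def colm_mult)

lemma Xi_sum: "t \<in> J \<Longrightarrow> (Xi t *v (\<Sum>p\<in>UNIV. g p *\<^sub>R x p t)) $ q = g q"
  using Xi_X[of t "\<chi> p. g p"] by (simp add: X_def colm_mult)

lemma KK_iff_coords:
  assumes t: "t \<in> J" and i: "i \<le> \<mu>"
  shows "v \<in> KK i t \<longleftrightarrow> (\<forall>q. i \<le> lev q \<longrightarrow> (Xi t *v v) $ q = 0)"
proof
  assume "v \<in> KK i t"
  then obtain e where e: "v = (\<Sum>p | lev p < i. e p *\<^sub>R x p t)"
    using frame_span_KK[OF frame_le[OF fr i] J(3) t i] by blast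
  also have "\<dots> = (\<Sum>p\<in>UNIV. (if lev p < i then e p else 0) *\<^sub>R x p t)"
    by (rule sum.mono_neutral_cong_left) auto
  finally show "\<forall>q. i \<le> lev q \<longrightarrow> (Xi t *v v) $ q = 0"
    using Xi_sum[OF t, of "\<lambda>p. if lev p < i then e p else 0"] by auto
next
  assume *: "\<forall>q. i \<le> lev q \<longrightarrow> (Xi t *v v) $ q = 0"
  have "v = (\<Sum>p\<in>UNIV. (Xi t *v v) $ p *\<^sub>R x p t)"
    using X_Xi[OF t, of v] by (simp add: X_def colm_mult)
  also have "\<dots> \<in> KK i t"
  proof (rule subspace_sum[OF subspace_KK])
    fix p
    show "(Xi t *v v) $ p *\<^sub>R x p t \<in> KK i t"
      using * x_in_KK[OF t _ i, of p] subspace_scale[OF subspace_KK] subspace_0[OF subspace_KK]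
      by (cases "lev p < i") auto
  qed
  finally show "v \<in> KK i t" .
qed

lemma KK_1: "t \<in> {a..b} \<Longrightarrow> KK (Suc 0) t = ker (Dmat :: real^('k+'r)^'k)"
  using ker_G_0[of t] by (simp add: KK_def lessThan_Suc span_eq_iff[THEN iffD2, OF subspace_ker])

lemma D_x_0:
  assumes "t \<in> J" "lev p = 0"
  shows "Dmat *v x p t = (0::real^'k)" "Dmat *v dx p t = (0::real^'k)"
proof -
  have z: "Dmat *v x p s = (0::real^'k)" if "s \<in> J" for s
    using x_in_KK[OF that, of p "Suc 0"] assms mu_pos KK_1[OF tab[OF that]] by (auto simp: ker_def)
  then show "Dmat *v x p t = (0::real^'k)" using assms by simp
  have "((\<lambda>s. Dmat *v x p s) has_vector_derivative (0::real^'k)) (at t within J)"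
    by (rule has_vector_derivative_transform[OF assms(1) _ has_vector_derivative_const[of 0]]) (simp add: z)
  from vector_derivative_unique_within[OF nt[OF assms(1)] has_vector_derivative_Dmat[OF dx[OF assms(1)]] this]
  show "Dmat *v dx p t = (0::real^'k)" .
qed

text \<open>Changing y by an element of ker D = K_1 affects coordinates of level 0 only. The other
  coordinates therefore inherit the differentiability of D y, although y itself need not be
  differentiable.\<close>

lemma co_Dmat:
  assumes t: "t \<in> J" and p: "0 < lev p"
  shows "co y p t = (Xi t *v (transpose Dmat *v (Dmat *v y t :: real^'k))) $ p"
proof -
  let ?v = "y t - transpose Dmat *v (Dmat *v y t :: real^'k)"
  have "?v \<in> KK (Suc 0) t" by (simp add: KK_1[OF tab[OF t]] ker_def mat_vec_simps)
  then have "(Xi t *v ?v) $ p = 0" using KK_iff_coords[OF t, of "Suc 0"] mu_pos p by auto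
  then show ?thesis by (simp add: co_def matrix_vector_mult_diff_distrib)
qed

lemma co_has_derivative:
  fixes u' :: "real^'k"
  assumes t: "t \<in> J" and p: "0 < lev p"
    and u: "((\<lambda>s. Dmat *v y s) has_vector_derivative u') (at t within J)"
  shows "(co y p has_real_derivative cod y p t) (at t within J)"
proof -
  let ?g = "\<lambda>s. (Xi s *v (transpose Dmat *v (Dmat *v y s :: real^'k))) $ p"
  have "\<exists>f'. ((\<lambda>s. Xi s $ p $ q) has_real_derivative f') (at t within J)" for q
  proof -
    have "sm {\<alpha>..\<beta>} (\<lambda>s. Xi s $ p $ q)" using smXi by (simp add: smm_def J)
    from sm_deriv[OF this J(2)] show ?thesis using t unfolding J by metis
  qed
  then obtain f' where f': "\<And>q. ((\<lambda>s. Xi s $ p $ q) has_real_derivative f' q) (at t within J)" by metis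
  have "((\<lambda>s. transpose Dmat *v (Dmat *v y s :: real^'k) :: real^('k+'r)) has_vector_derivative transpose Dmat *v u') (at t within J)"
    by (rule bounded_linear.has_vector_derivative[OF _ u]) simp
  then have g: "((\<lambda>s. (transpose Dmat *v (Dmat *v y s :: real^'k)) $ q) has_real_derivative (transpose Dmat *v u') $ q) (at t within J)" for q :: "'k+'r"
    by (simp add: has_vector_derivative_vec_iff)
  have "((\<lambda>s. \<Sum>q\<in>UNIV. Xi s $ p $ q * (transpose Dmat *v (Dmat *v y s :: real^'k)) $ q) has_real_derivative
      (\<Sum>q\<in>UNIV. f' q * (transpose Dmat *v (Dmat *v y t :: real^'k)) $ q + (transpose Dmat *v u') $ q * Xi t $ p $ q)) (at t within J)"
    by (intro DERIV_sum DERIV_mult f' g)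
  then have "(?g has_real_derivative
      (\<Sum>q\<in>UNIV. f' q * (transpose Dmat *v (Dmat *v y t :: real^'k)) $ q + (transpose Dmat *v u') $ q * Xi t $ p $ q)) (at t within J)"
    by (simp add: matrix_vector_mult_def)
  then obtain d where "(?g has_real_derivative d) (at t within J)" by blast
  then have "(co y p has_real_derivative d) (at t within J)"
    by (rule has_field_derivative_transform_within[of _ _ _ _ 1]) (use t p co_Dmat in auto)
  then show ?thesis
    using vector_derivative_unique_within[OF nt[OF t]] unfolding cod_def
    by (metis has_real_derivative_iff_has_vector_derivative differentiableI_vector vector_derivative_works)
qed

text \<open>The product rule applied to D y, the sum of y_p D x_p. Level 0 drops out of the
  derivative terms since D x_p vanishes identically there.\<close>

lemma DAE_op_coords:
  fixes u' :: "real^'k"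
  assumes t: "t \<in> J"
    and u: "((\<lambda>s. Dmat *v y s) has_vector_derivative u') (at t within J)"
  shows "DAE_op t u' (y t) = (\<Sum>p\<in>UNIV. co y p t *\<^sub>R T p t)
      + (\<Sum>p | 0 < lev p. cod y p t *\<^sub>R (A t *v (Dmat *v x p t)))"
proof -
  let ?D = "Dmat :: real^('k+'r)^'k"
  have Dy: "?D *v y s = (\<Sum>p | 0 < lev p. co y p s *\<^sub>R (?D *v x p s))" if s: "s \<in> J" for s
  proof -
    have "?D *v y s = (\<Sum>p\<in>UNIV. co y p s *\<^sub>R (?D *v x p s))"
      using arg_cong[OF repr[OF s, of y], of "(*v) ?D"]
      by (simp add: linear_sum[OF matrix_vector_mul_linear] matrix_vector_mult_scaleR)
    also have "\<dots> = (\<Sum>p | 0 < lev p. co y p s *\<^sub>R (?D *v x p s))"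
      using D_x_0(1)[OF s] by (intro sum.mono_neutral_right) auto
    finally show ?thesis .
  qed
  have "((\<lambda>s. \<Sum>p | 0 < lev p. co y p s *\<^sub>R (?D *v x p s)) has_vector_derivative
      (\<Sum>p | 0 < lev p. co y p t *\<^sub>R (?D *v dx p t) + cod y p t *\<^sub>R (?D *v x p t))) (at t within J)"
    by (intro has_vector_derivative_sum has_vector_derivative_scaleR has_vector_derivative_Dmat dx t
        co_has_derivative[OF t _ u]) simp
  then have "((\<lambda>s. ?D *v y s) has_vector_derivative
      (\<Sum>p | 0 < lev p. co y p t *\<^sub>R (?D *v dx p t) + cod y p t *\<^sub>R (?D *v x p t))) (at t within J)"
    by (rule has_vector_derivative_transform[OF t, rotated]) (rule Dy)
  from vector_derivative_unique_within[OF nt[OF t] u this]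
  have u': "u' = (\<Sum>p | 0 < lev p. co y p t *\<^sub>R (?D *v dx p t)) + (\<Sum>p | 0 < lev p. cod y p t *\<^sub>R (?D *v x p t))"
    by (simp add: sum.distrib)
  have "(\<Sum>p | 0 < lev p. co y p t *\<^sub>R (?D *v dx p t)) = (\<Sum>p\<in>UNIV. co y p t *\<^sub>R (?D *v dx p t))"
    using D_x_0(2)[OF t] by (intro sum.mono_neutral_left) auto
  then have "DAE_op t u' (y t) = A t *v (\<Sum>p\<in>UNIV. co y p t *\<^sub>R (?D *v dx p t)) + B t *v (\<Sum>p\<in>UNIV. co y p t *\<^sub>R x p t)
      + A t *v (\<Sum>p | 0 < lev p. cod y p t *\<^sub>R (?D *v x p t))"
    using repr[OF t, of y] by (simp add: DAE_op_def u' matrix_vector_right_distrib)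
  then show ?thesis
    by (simp add: T_def DAE_op_def linear_sum[OF matrix_vector_mul_linear] matrix_vector_mult_scaleR
        scaleR_add_right sum.distrib)
qed

text \<open>A relation between the columns puts A D v into S_\<mu>, where v is the combination of
  the completing vectors. By \<open>G_0_in_SS_top\<close> v lies in K_\<mu>, hence v = 0, and what
  remains is a relation between the independent images T p.\<close>

lemma det_F: "t \<in> J \<Longrightarrow> det (F t) \<noteq> 0"
proof -
  assume t: "t \<in> J"
  have "indep UNIV (\<lambda>p. if lev p < \<mu> then T p t else A t *v (Dmat *v x p t))"
  proof (rule indepI)
    fix c p assume c: "(\<Sum>p\<in>UNIV. c p *\<^sub>R (if lev p < \<mu> then T p t else A t *v (Dmat *v x p t))) = 0"
    define v where "v = (\<Sum>p | \<not> lev p < \<mu>. c p *\<^sub>R x p t)"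
    have split: "(\<Sum>p\<in>UNIV. h p) = (\<Sum>p | lev p < \<mu>. h p) + (\<Sum>p | \<not> lev p < \<mu>. h p)" for h :: "'k+'r \<Rightarrow> real^('k+'r)"
      by (subst sum.union_disjoint[symmetric]) (auto intro: sum.cong)
    have sp: "(\<Sum>p | lev p < \<mu>. c p *\<^sub>R T p t) + A t *v (Dmat *v v) = 0"
      using c unfolding split
      by (simp add: v_def linear_sum[OF matrix_vector_mul_linear] matrix_vector_mult_scaleR)
    then have "A t *v (Dmat *v v) = (\<Sum>p | lev p < \<mu>. (- c p) *\<^sub>R T p t)"
      by (simp add: sum_negf add_eq_0_iff)
    also have "\<dots> \<in> SS \<mu> t"
      using frame_DAE_op_in_SS(2)[OF fr J(3) t nt[OF t]]
      by (intro subspace_sum[OF subspace_SS] subspace_scale[OF subspace_SS]) (auto simp: T_def)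
    finally have "v \<in> KK \<mu> t" using G_0_in_SS_top[OF tab[OF t]] by (simp add: G0v[OF tab[OF t]])
    moreover have "v = (\<Sum>p\<in>UNIV. (if lev p < \<mu> then 0 else c p) *\<^sub>R x p t)"
      unfolding v_def by (rule sum.mono_neutral_cong_left) auto
    ultimately have c0: "c q = 0" if "\<mu> \<le> lev q" for q
      using KK_iff_coords[OF t, of \<mu>] Xi_sum[OF t, of "\<lambda>p. if lev p < \<mu> then 0 else c p" q] that by auto
    then have "v = 0" by (simp add: v_def)
    then have s0: "(\<Sum>p | lev p < \<mu>. c p *\<^sub>R T p t) = 0" using sp by simp
    have ind: "indep {p. lev p < \<mu>} (\<lambda>p. T p t)" using fr t by (simp add: frame_def T_def)
    have "c q = 0" if "lev q < \<mu>" for q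
      by (rule indepD[OF ind s0]) (simp add: that)
    with c0 show "c p = 0" by (cases "lev p < \<mu>") auto
  qed
  then show ?thesis by (simp add: F_def indep_UNIV_iff_det)
qed

lemma smF: "smm J F"
  unfolding F_def
proof (rule smm_colm)
  fix p
  have "smm J A" using smm_subset[OF smA J(3)] .
  then have "smv J (\<lambda>t. A t *v (Dmat *v x p t))" by (intro smv_matrix_vector smx smm_const)
  then show "smv J (\<lambda>t. if lev p < \<mu> then T p t else A t *v (Dmat *v x p t))"
    using smT[of p] by (cases "lev p < \<mu>") simp_all
qed

lemma smFi: "smm J Fi"
  unfolding Fi_def by (rule smm_inverse[OF smF det_F])

lemma sm_al: "sm J (al q p)"
  using smv_matrix_vector[OF smFi smT[of q]] by (simp add: smv_def al_def[abs_def])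

lemma sm_cf: "sm J (cf p q)"
  using fr by (simp add: frame_def)

lemma Fi_col:
  assumes t: "t \<in> J"
  shows "lev p < \<mu> \<Longrightarrow> (Fi t *v T p t) $ q = (if q = p then 1 else 0)"
    and "\<mu> \<le> lev p \<Longrightarrow> (Fi t *v (A t *v (Dmat *v x p t))) $ q = (if q = p then 1 else 0)"
    and "lev p < \<mu> \<Longrightarrow> (Fi t *v (A t *v (Dmat *v x p t))) $ q = (if lev q < lev p then cf p q t else 0)"
proof -
  have ax: "Fi t *v (if lev p < \<mu> then T p t else A t *v (Dmat *v x p t)) = axis p 1" for p
    using matrix_inv_mult_cancel(2)[OF det_F[OF t], of "axis p 1"] by (simp add: Fi_def F_def colm_axis)
  show 1: "(Fi t *v T p t) $ q = (if q = p then 1 else 0)" if "lev p < \<mu>" for p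
    using ax[of p] that by (simp add: axis_def)
  show "\<mu> \<le> lev p \<Longrightarrow> (Fi t *v (A t *v (Dmat *v x p t))) $ q = (if q = p then 1 else 0)"
    using ax[of p] by (simp add: axis_def)
  assume p: "lev p < \<mu>"
  have "A t *v (Dmat *v x p t) = (\<Sum>p' | lev p' < lev p. cf p p' t *\<^sub>R T p' t)"
    using fr t p by (simp add: frame_def T_def)
  then have "(Fi t *v (A t *v (Dmat *v x p t))) $ q = (\<Sum>p' | lev p' < lev p. cf p p' t * (Fi t *v T p' t) $ q)"
    by (simp add: linear_sum[OF matrix_vector_mul_linear] matrix_vector_mult_scaleR)
  also have "\<dots> = (\<Sum>p' | lev p' < lev p. cf p p' t * (if q = p' then 1 else 0))"
    using p by (intro sum.cong) (auto simp: 1)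
  also have "\<dots> = (if lev q < lev p then cf p q t else 0)"
    by (simp add: if_distrib[of "\<lambda>y. _ * y"] sum.If_cases cong: if_cong)
  finally show "(Fi t *v (A t *v (Dmat *v x p t))) $ q = (if lev q < lev p then cf p q t else 0)" .
qed

text \<open>\<open>DAE_op_coords\<close> read in the basis F. Below level \<mu> the system is
  triangular: the equation of level j gives y_q up to derivatives of coordinates of strictly higher
  levels below \<mu>. From level \<mu> on it is an explicit linear ODE in which the lower
  coordinates do not occur.\<close>

lemma omega_eq:
  fixes u' :: "real^'k"
  assumes t: "t \<in> J"
    and u: "((\<lambda>s. Dmat *v y s) has_vector_derivative u') (at t within J)"
    and w: "DAE_op t u' (y t) = w"
  shows "lev q < \<mu> \<Longrightarrow> (Fi t *v w) $ q = co y q t + (\<Sum>p | \<mu> \<le> lev p. al p q t * co y p t)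
      + (\<Sum>p | lev q < lev p \<and> lev p < \<mu>. cf p q t * cod y p t)"
    and "\<mu> \<le> lev q \<Longrightarrow> (Fi t *v w) $ q = cod y q t + (\<Sum>p | \<mu> \<le> lev p. al p q t * co y p t)"
proof -
  let ?E = "\<lambda>p. (Fi t *v (A t *v (Dmat *v x p t))) $ q"
  have sum: "(Fi t *v w) $ q = (\<Sum>p\<in>UNIV. co y p t * (Fi t *v T p t) $ q) + (\<Sum>p | 0 < lev p. cod y p t * ?E p)"
    unfolding w[symmetric] DAE_op_coords[OF t u]
    by (simp add: matrix_vector_right_distrib linear_sum[OF matrix_vector_mul_linear] matrix_vector_mult_scaleR)
  have split: "UNIV = {p. lev p < \<mu>} \<union> {p. \<mu> \<le> lev p}" by auto
  have 1: "(\<Sum>p\<in>UNIV. co y p t * (Fi t *v T p t) $ q) =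
      (\<Sum>p | lev p < \<mu>. co y p t * (if q = p then 1 else 0)) + (\<Sum>p | \<mu> \<le> lev p. al p q t * co y p t)"
    unfolding split using Fi_col(1)[OF t]
    by (subst sum.union_disjoint) (auto simp: al_def intro!: arg_cong2[where f="(+)"] sum.cong)
  have split2: "{p. 0 < lev p} = {p. 0 < lev p \<and> lev p < \<mu>} \<union> {p. \<mu> \<le> lev p}" using mu_pos by auto
  have 2: "(\<Sum>p | 0 < lev p. cod y p t * ?E p) =
      (\<Sum>p | 0 < lev p \<and> lev p < \<mu>. cod y p t * (if lev q < lev p then cf p q t else 0))
      + (\<Sum>p | \<mu> \<le> lev p. cod y p t * (if q = p then 1 else 0))"
    unfolding split2 using Fi_col(2,3)[OF t]
    by (subst sum.union_disjoint) (auto intro!: arg_cong2[where f="(+)"] sum.cong)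
  have 3: "(\<Sum>p | lev p < \<mu>. co y p t * (if q = p then 1 else 0)) = (if lev q < \<mu> then co y q t else 0)"
    by (simp add: if_distrib[of "\<lambda>y. _ * y"] sum.If_cases cong: if_cong)
  have 4: "(\<Sum>p | \<mu> \<le> lev p. cod y p t * (if q = p then 1 else 0)) = (if \<mu> \<le> lev q then cod y q t else 0)"
    by (simp add: if_distrib[of "\<lambda>y. _ * y"] sum.If_cases cong: if_cong)
  have 5: "(\<Sum>p | 0 < lev p \<and> lev p < \<mu>. cod y p t * (if lev q < lev p then cf p q t else 0)) =
      (\<Sum>p | lev q < lev p \<and> lev p < \<mu>. cf p q t * cod y p t)"
    by (rule sum.mono_neutral_cong_right) auto
  show "lev q < \<mu> \<Longrightarrow> (Fi t *v w) $ q = co y q t + (\<Sum>p | \<mu> \<le> lev p. al p q t * co y p t)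
      + (\<Sum>p | lev q < lev p \<and> lev p < \<mu>. cf p q t * cod y p t)"
    unfolding sum 1 2 3 4 5 by simp
  assume q: "\<mu> \<le> lev q"
  then have "{p. lev q < lev p \<and> lev p < \<mu>} = {}" by auto
  then show "(Fi t *v w) $ q = cod y q t + (\<Sum>p | \<mu> \<le> lev p. al p q t * co y p t)"
    unfolding sum 1 2 3 4 5 using q by (simp only: if_True sum.empty) simp
qed

end

section \<open>Solving the triangular system: estimates by derivatives of the residual\<close>

definition wj :: "('n \<Rightarrow> real poly) \<Rightarrow> nat \<Rightarrow> real \<Rightarrow> real ^ 'n" where
  "wj W j t = (\<chi> c. poly ((pderiv ^^ j) (W c)) t)"

context complete_frame
begin

text \<open>The residual of y on J is the vector of polynomials W, so its derivatives
  \<open>wj W j\<close> of every order are at hand.\<close>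

definition Adm :: "(real \<Rightarrow> real ^ ('k + 'r)) \<Rightarrow> ('k + 'r \<Rightarrow> real poly) \<Rightarrow> bool" where
  "Adm y W \<longleftrightarrow> (\<forall>t\<in>J. \<exists>u'. ((\<lambda>s. (Dmat :: real^('k+'r)^'k) *v y s) has_vector_derivative u') (at t within J) \<and>
     DAE_op t u' (y t) = wj W 0 t)"

(* Linear differential operators of order n in the residual w, plus a term in the coordinates
   modulo KK \<mu>; the coefficients are smooth and do not depend on y and w. *)
definition expr :: "nat \<Rightarrow> ((real \<Rightarrow> real ^ ('k + 'r)) \<Rightarrow> ('k + 'r \<Rightarrow> real poly) \<Rightarrow> real \<Rightarrow> real) \<Rightarrow> bool" where
  "expr n \<Theta> \<longleftrightarrow> (\<exists>\<kappa> l. (\<forall>j c. sm J (\<kappa> j c)) \<and> (\<forall>q. sm J (l q)) \<and>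
     (\<forall>y W t. Adm y W \<longrightarrow> t \<in> J \<longrightarrow> \<Theta> y W t =
        (\<Sum>j\<le>n. \<Sum>c\<in>UNIV. \<kappa> j c t * wj W j t $ c) + (\<Sum>q | \<mu> \<le> lev q. l q t * co y q t)))"

lemma exprI:
  assumes "\<And>j c. sm J (\<kappa> j c)" "\<And>q. sm J (l q)"
    "\<And>y W t. Adm y W \<Longrightarrow> t \<in> J \<Longrightarrow> \<Theta> y W t =
        (\<Sum>j\<le>n. \<Sum>c\<in>UNIV. \<kappa> j c t * wj W j t $ c) + (\<Sum>q | \<mu> \<le> lev q. l q t * co y q t)"
  shows "expr n \<Theta>"
  unfolding expr_def using assms by blast

lemma exprE:
  assumes "expr n \<Theta>"
  obtains \<kappa> l where "\<And>j c. sm J (\<kappa> j c)" "\<And>q. sm J (l q)"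
    "\<And>y W t. Adm y W \<Longrightarrow> t \<in> J \<Longrightarrow> \<Theta> y W t =
        (\<Sum>j\<le>n. \<Sum>c\<in>UNIV. \<kappa> j c t * wj W j t $ c) + (\<Sum>q | \<mu> \<le> lev q. l q t * co y q t)"
proof -
  from assms obtain \<kappa> l where *: "(\<forall>j c. sm J (\<kappa> j c)) \<and> (\<forall>q. sm J (l q)) \<and>
     (\<forall>y W t. Adm y W \<longrightarrow> t \<in> J \<longrightarrow> \<Theta> y W t =
        (\<Sum>j\<le>n. \<Sum>c\<in>UNIV. \<kappa> j c t * wj W j t $ c) + (\<Sum>q | \<mu> \<le> lev q. l q t * co y q t))"
    unfolding expr_def by (elim exE) 
  show ?thesis by (rule that[of \<kappa> l]) (use * in simp_all)
qed

lemma expr_cong: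
  assumes "expr n \<Theta>" "\<And>y W t. Adm y W \<Longrightarrow> t \<in> J \<Longrightarrow> \<Theta>' y W t = \<Theta> y W t"
  shows "expr n \<Theta>'"
  using assms unfolding expr_def by simp

lemma expr_mono:
  assumes "expr n \<Theta>" "n \<le> n'" shows "expr n' \<Theta>"
proof (rule exprE[OF assms(1)])
  fix \<kappa> l
  assume k: "\<And>j c. sm J (\<kappa> j c)" "\<And>q. sm J (l q)"
    and e: "\<And>y W t. Adm y W \<Longrightarrow> t \<in> J \<Longrightarrow> \<Theta> y W t =
        (\<Sum>j\<le>n. \<Sum>c\<in>UNIV. \<kappa> j c t * wj W j t $ c) + (\<Sum>q | \<mu> \<le> lev q. l q t * co y q t)"
  show ?thesis
  proof (rule exprI[of "\<lambda>j c t. if j \<le> n then \<kappa> j c t else 0" l])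
    show "sm J (\<lambda>t. if j \<le> n then \<kappa> j c t else 0)" for j c using k(1)[of j c] by (cases "j \<le> n") simp_all
    fix y W t assume "Adm y W" "t \<in> J"
    have "(\<Sum>j\<le>n'. \<Sum>c\<in>UNIV. (if j \<le> n then \<kappa> j c t else 0) * wj W j t $ c) = (\<Sum>j\<le>n. \<Sum>c\<in>UNIV. \<kappa> j c t * wj W j t $ c)"
      using assms(2) by (intro sum.mono_neutral_cong_right) auto
    then show "\<Theta> y W t = (\<Sum>j\<le>n'. \<Sum>c\<in>UNIV. (if j \<le> n then \<kappa> j c t else 0) * wj W j t $ c) +
        (\<Sum>q | \<mu> \<le> lev q. l q t * co y q t)"
      using e[OF \<open>Adm y W\<close> \<open>t \<in> J\<close>] by simp
  qed (rule k)
qed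

lemma expr_add:
  assumes "expr n \<Theta>" "expr n \<Theta>'" shows "expr n (\<lambda>y W t. \<Theta> y W t + \<Theta>' y W t)"
proof (rule exprE[OF assms(1)], rule exprE[OF assms(2)])
  fix \<kappa> l \<kappa>' l'
  assume k: "\<And>j c. sm J (\<kappa> j c)" "\<And>q. sm J (l q)" "\<And>j c. sm J (\<kappa>' j c)" "\<And>q. sm J (l' q)"
    and e: "\<And>y W t. Adm y W \<Longrightarrow> t \<in> J \<Longrightarrow> \<Theta> y W t =
        (\<Sum>j\<le>n. \<Sum>c\<in>UNIV. \<kappa> j c t * wj W j t $ c) + (\<Sum>q | \<mu> \<le> lev q. l q t * co y q t)"
      "\<And>y W t. Adm y W \<Longrightarrow> t \<in> J \<Longrightarrow> \<Theta>' y W t =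
        (\<Sum>j\<le>n. \<Sum>c\<in>UNIV. \<kappa>' j c t * wj W j t $ c) + (\<Sum>q | \<mu> \<le> lev q. l' q t * co y q t)"
  show ?thesis
    by (rule exprI[of "\<lambda>j c t. \<kappa> j c t + \<kappa>' j c t" "\<lambda>q t. l q t + l' q t"])
      (simp_all add: k e sm_add sum.distrib algebra_simps)
qed

lemma expr_scale:
  assumes "expr n \<Theta>" "sm J g" shows "expr n (\<lambda>y W t. g t * \<Theta> y W t)"
proof (rule exprE[OF assms(1)])
  fix \<kappa> l
  assume k: "\<And>j c. sm J (\<kappa> j c)" "\<And>q. sm J (l q)"
    and e: "\<And>y W t. Adm y W \<Longrightarrow> t \<in> J \<Longrightarrow> \<Theta> y W t =
        (\<Sum>j\<le>n. \<Sum>c\<in>UNIV. \<kappa> j c t * wj W j t $ c) + (\<Sum>q | \<mu> \<le> lev q. l q t * co y q t)"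
  show ?thesis
    by (rule exprI[of "\<lambda>j c t. g t * \<kappa> j c t" "\<lambda>q t. g t * l q t"])
      (simp_all add: k e assms(2) sm_mult sum_distrib_left distrib_left mult.assoc)
qed

lemma expr_0: "expr n (\<lambda>y W t. 0)"
  by (rule exprI[of "\<lambda>_ _ _. 0" "\<lambda>_ _. 0"]) simp_all

lemma expr_sum: "(\<And>i. i \<in> I \<Longrightarrow> expr n (\<Theta> i)) \<Longrightarrow> expr n (\<lambda>y W t. \<Sum>i\<in>I. \<Theta> i y W t)"
  by (induction I rule: infinite_finite_induct) (simp_all add: expr_0 expr_add)

lemma expr_wj:
  assumes "j \<le> n" "sm J g" shows "expr n (\<lambda>y W t. g t * wj W j t $ c)"
proof (rule exprI[of "\<lambda>j' c' t. if j' = j \<and> c' = c then g t else 0" "\<lambda>_ _. 0"])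
  fix j' c' show "sm J (\<lambda>t. if j' = j \<and> c' = c then g t else 0)"
    using assms(2) by (cases "j' = j"; cases "c' = c") simp_all
next
  fix y W t
  have "(\<Sum>j'\<le>n. \<Sum>c'\<in>UNIV. (if j' = j \<and> c' = c then g t else 0) * wj W j' t $ c') =
      (\<Sum>j'\<in>{j}. \<Sum>c'\<in>UNIV. (if c' = c then g t else 0) * wj W j' t $ c')"
    using assms(1) by (intro sum.mono_neutral_cong_right) auto
  also have "\<dots> = (\<Sum>c'\<in>{c}. g t * wj W j t $ c')"
    by (simp add: if_distrib[of "\<lambda>y. y * _"] cong: if_cong)
  finally show "g t * wj W j t $ c = (\<Sum>j'\<le>n. \<Sum>c'\<in>UNIV. (if j' = j \<and> c' = c then g t else 0) * wj W j' t $ c')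
      + (\<Sum>q | \<mu> \<le> lev q. 0 * co y q t)" by simp
qed simp

lemma expr_co:
  assumes "\<mu> \<le> lev p" shows "expr n (\<lambda>y W t. co y p t)"
proof (rule exprI[of "\<lambda>_ _ _. 0" "\<lambda>q t. if q = p then 1 else 0"])
  fix y W t
  have "(\<Sum>q | \<mu> \<le> lev q. (if q = p then 1 else 0) * co y q t) = (\<Sum>q\<in>{p}. co y q t)"
    using assms by (intro sum.mono_neutral_cong_right) auto
  then show "co y p t = (\<Sum>j\<le>n. \<Sum>c\<in>UNIV. 0 * wj W j t $ c) + (\<Sum>q | \<mu> \<le> lev q. (if q = p then 1 else 0) * co y q t)"
    by simp
qed simp_all

lemma expr_omega: "expr n (\<lambda>y W t. (Fi t *v wj W 0 t) $ p)"
proof -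
  have "expr n (\<lambda>y W t. \<Sum>c\<in>UNIV. Fi t $ p $ c * wj W 0 t $ c)"
    using smFi by (intro expr_sum expr_wj) (simp_all add: smm_def)
  then show ?thesis by (simp add: matrix_vector_mult_def)
qed

lemma expr_diff:
  assumes "expr n \<Theta>" "expr n \<Theta>'" shows "expr n (\<lambda>y W t. \<Theta> y W t - \<Theta>' y W t)"
  using expr_add[OF assms(1) expr_scale[OF assms(2) sm_const[of J "-1"]]] by simp

lemma AdmD:
  assumes "Adm y W" "t \<in> J"
  obtains u' where "((\<lambda>s. (Dmat :: real^('k+'r)^'k) *v y s) has_vector_derivative u') (at t within J)"
    "DAE_op t u' (y t) = wj W 0 t"
  using assms unfolding Adm_def by blast

text \<open>The ODE part of \<open>omega_eq\<close> eliminates the derivative of a coordinate modulo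
  K_\<mu> without differentiating the residual.\<close>

lemma expr_cod:
  assumes "\<mu> \<le> lev p" shows "expr n (\<lambda>y W t. cod y p t)"
proof (rule expr_cong)
  show "expr n (\<lambda>y W t. (Fi t *v wj W 0 t) $ p - (\<Sum>q | \<mu> \<le> lev q. al q p t * co y q t))"
    by (intro expr_diff expr_omega expr_sum expr_scale expr_co sm_al) simp
  fix y W t assume "Adm y W" "t \<in> J"
  then obtain u' where "((\<lambda>s. (Dmat :: real^('k+'r)^'k) *v y s) has_vector_derivative u') (at t within J)"
    "DAE_op t u' (y t) = wj W 0 t" by (rule AdmD)
  from omega_eq(2)[OF \<open>t \<in> J\<close> this assms]
  show "cod y p t = (Fi t *v wj W 0 t) $ p - (\<Sum>q | \<mu> \<le> lev q. al q p t * co y q t)" by simp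
qed

lemma DERIV_wj: "((\<lambda>t. wj W j t $ c) has_real_derivative wj W (Suc j) t $ c) (at t within S)"
  by (simp add: wj_def poly_DERIV[THEN DERIV_subset])

lemma co_deriv_Adm:
  assumes "Adm y W" "t \<in> J" "0 < lev p"
  shows "(co y p has_real_derivative cod y p t) (at t within J)"
proof -
  obtain u' where "((\<lambda>s. (Dmat :: real^('k+'r)^'k) *v y s) has_vector_derivative u') (at t within J)"
    using assms(1,2) by (rule AdmD)
  from co_has_derivative[OF assms(2,3) this] show ?thesis .
qed

text \<open>Differentiation turns the j-th derivative of the residual into the next one, while
  derivatives of coordinates modulo K_\<mu> are removed by \<open>expr_cod\<close>; so the order
  grows by one.\<close>

lemma expr_deriv:
  assumes e: "expr n \<Theta>"
    and d: "\<And>y W t. Adm y W \<Longrightarrow> t \<in> J \<Longrightarrow> (\<Theta> y W has_real_derivative \<Theta>' y W t) (at t within J)"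
  shows "expr (Suc n) \<Theta>'"
proof (rule exprE[OF e])
  fix \<kappa> l
  assume k: "\<And>j c. sm J (\<kappa> j c)" "\<And>q. sm J (l q)"
    and e: "\<And>y W t. Adm y W \<Longrightarrow> t \<in> J \<Longrightarrow> \<Theta> y W t =
        (\<Sum>j\<le>n. \<Sum>c\<in>UNIV. \<kappa> j c t * wj W j t $ c) + (\<Sum>q | \<mu> \<le> lev q. l q t * co y q t)"
  have ex: "\<exists>f'. sm J f' \<and> (\<forall>t\<in>J. (f has_real_derivative f' t) (at t within J))" if "sm J f" for f
    using sm_deriv[OF that[unfolded J] J(2)] unfolding J by metis
  have "\<forall>j. \<forall>c. \<exists>f'. sm J f' \<and> (\<forall>t\<in>J. (\<kappa> j c has_real_derivative f' t) (at t within J))"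
    using ex k(1) by simp
  then obtain \<kappa>' where \<kappa>': "\<And>j c. sm J (\<kappa>' j c)"
      "\<And>j c t. t \<in> J \<Longrightarrow> (\<kappa> j c has_real_derivative \<kappa>' j c t) (at t within J)"
    by (metis (no_types, lifting))
  have "\<forall>q. \<exists>f'. sm J f' \<and> (\<forall>t\<in>J. (l q has_real_derivative f' t) (at t within J))"
    using ex k(2) by simp
  then obtain l' where l': "\<And>q. sm J (l' q)"
      "\<And>q t. t \<in> J \<Longrightarrow> (l q has_real_derivative l' q t) (at t within J)"
    by (metis (no_types, lifting))
  let ?d = "\<lambda>y W t. (\<Sum>j\<le>n. \<Sum>c\<in>UNIV. \<kappa>' j c t * wj W j t $ c + \<kappa> j c t * wj W (Suc j) t $ c) +
      (\<Sum>q | \<mu> \<le> lev q. l' q t * co y q t + l q t * cod y q t)"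
  show ?thesis
  proof (rule expr_cong)
    show "expr (Suc n) ?d"
      by (intro expr_add expr_sum expr_scale[OF _ l'(1)] expr_scale[OF _ k(2)] expr_co expr_cod
          expr_wj[OF _ \<kappa>'(1)] expr_wj[OF _ k(1)]) auto
    fix y W t assume A: "Adm y W" and t: "t \<in> J"
    have "((\<lambda>t. (\<Sum>j\<le>n. \<Sum>c\<in>UNIV. \<kappa> j c t * wj W j t $ c) + (\<Sum>q | \<mu> \<le> lev q. l q t * co y q t))
        has_real_derivative (\<Sum>j\<le>n. \<Sum>c\<in>UNIV. \<kappa>' j c t * wj W j t $ c + wj W (Suc j) t $ c * \<kappa> j c t) +
      (\<Sum>q | \<mu> \<le> lev q. l' q t * co y q t + cod y q t * l q t)) (at t within J)"
      using mu_pos by (intro DERIV_add DERIV_sum DERIV_mult \<kappa>'(2)[OF t] l'(2)[OF t] DERIV_wj co_deriv_Adm[OF A t]) auto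
    then have "(\<Theta> y W has_real_derivative (\<Sum>j\<le>n. \<Sum>c\<in>UNIV. \<kappa>' j c t * wj W j t $ c + wj W (Suc j) t $ c * \<kappa> j c t) +
      (\<Sum>q | \<mu> \<le> lev q. l' q t * co y q t + cod y q t * l q t)) (at t within J)"
      by (rule has_field_derivative_transform_within[of _ _ _ _ 1]) (use t e[OF A] in auto)
    with d[OF A t] show "\<Theta>' y W t = ?d y W t"
      using vector_derivative_unique_within[OF nt[OF t]]
      by (simp add: has_real_derivative_iff_has_vector_derivative mult.commute)
  qed
qed

text \<open>Backward substitution in the triangular system. Level \<mu>-1 is algebraic in the
  residual and the coordinates modulo K_\<mu>; every lower level involves derivatives of the levels
  above it and so costs one more order. Level 0 needs \<mu>-1 derivatives, which is the source of
  the loss of \<mu>-1 powers of h.\<close>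

lemma expr_coordinate:
  "lev p < \<mu> \<Longrightarrow> \<mu> \<le> lev p + Suc n \<Longrightarrow> expr n (\<lambda>y W. co y p)"
proof (induction n arbitrary: p)
  case 0
  show ?case
  proof (rule expr_cong)
    show "expr 0 (\<lambda>y W t. (Fi t *v wj W 0 t) $ p - (\<Sum>q | \<mu> \<le> lev q. al q p t * co y q t))"
      by (intro expr_diff expr_omega expr_sum expr_scale expr_co sm_al) simp
    fix y W t assume "Adm y W" "t \<in> J"
    then obtain u' where u': "((\<lambda>s. (Dmat :: real^('k+'r)^'k) *v y s) has_vector_derivative u') (at t within J)"
      "DAE_op t u' (y t) = wj W 0 t" by (rule AdmD)
    have "{q. lev p < lev q \<and> lev q < \<mu>} = {}" using 0 by auto
    with omega_eq(1)[OF \<open>t \<in> J\<close> u' 0(1)]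
    show "co y p t = (Fi t *v wj W 0 t) $ p - (\<Sum>q | \<mu> \<le> lev q. al q p t * co y q t)"
      by (simp only: sum.empty)
  qed
next
  case (Suc n)
  have d: "expr (Suc n) (\<lambda>y W. cod y q)" if "lev p < lev q" "lev q < \<mu>" for q
    by (rule expr_deriv[OF Suc.IH[of q]]) (use that Suc.prems co_deriv_Adm in auto)
  show ?case
  proof (rule expr_cong)
    show "expr (Suc n) (\<lambda>y W t. (Fi t *v wj W 0 t) $ p - (\<Sum>q | \<mu> \<le> lev q. al q p t * co y q t)
        - (\<Sum>q | lev p < lev q \<and> lev q < \<mu>. cf q p t * cod y q t))"
      by (intro expr_diff expr_omega expr_sum expr_scale expr_co sm_al sm_cf d) auto
    fix y W t assume "Adm y W" "t \<in> J"
    then obtain u' where u': "((\<lambda>s. (Dmat :: real^('k+'r)^'k) *v y s) has_vector_derivative u') (at t within J)"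
      "DAE_op t u' (y t) = wj W 0 t" by (rule AdmD)
    from omega_eq(1)[OF \<open>t \<in> J\<close> u' Suc.prems(1)]
    show "co y p t = (Fi t *v wj W 0 t) $ p - (\<Sum>q | \<mu> \<le> lev q. al q p t * co y q t)
        - (\<Sum>q | lev p < lev q \<and> lev q < \<mu>. cf q p t * cod y q t)"
      by simp
  qed
qed

text \<open>The coordinates modulo K_\<mu>, padded by zeros.\<close>

definition gv :: "real \<Rightarrow> real ^ ('k + 'r) \<Rightarrow> real ^ ('k + 'r)" where
  "gv t v = (\<chi> p. if \<mu> \<le> lev p then (Xi t *v v) $ p else 0)"

lemma expr_bound:
  assumes "expr n \<Theta>"
  shows "\<exists>C\<ge>0. \<forall>y W t. Adm y W \<longrightarrow> t \<in> J \<longrightarrow>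
    \<bar>\<Theta> y W t\<bar> \<le> C * ((\<Sum>j\<le>n. norm (wj W j t)) + norm (gv t (y t)))"
proof (rule exprE[OF assms])
  fix \<kappa> l
  assume k: "\<And>j c. sm J (\<kappa> j c)" "\<And>q. sm J (l q)"
    and e: "\<And>y W t. Adm y W \<Longrightarrow> t \<in> J \<Longrightarrow> \<Theta> y W t =
        (\<Sum>j\<le>n. \<Sum>c\<in>UNIV. \<kappa> j c t * wj W j t $ c) + (\<Sum>q | \<mu> \<le> lev q. l q t * co y q t)"
  have "\<forall>j. \<forall>c. \<exists>C. 0 \<le> C \<and> (\<forall>t\<in>J. \<bar>\<kappa> j c t\<bar> \<le> C)"
    using sm_bounded[OF k(1) compact_J] by metis
  then obtain K where K: "\<And>j c. 0 \<le> K j c" "\<And>j c t. t \<in> J \<Longrightarrow> \<bar>\<kappa> j c t\<bar> \<le> K j c" by metis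
  have "\<forall>q. \<exists>C. 0 \<le> C \<and> (\<forall>t\<in>J. \<bar>l q t\<bar> \<le> C)"
    using sm_bounded[OF k(2) compact_J] by metis
  then obtain L where L: "\<And>q. 0 \<le> L q" "\<And>q t. t \<in> J \<Longrightarrow> \<bar>l q t\<bar> \<le> L q" by metis
  define C where "C = (\<Sum>j\<le>n. \<Sum>c\<in>UNIV. K j c) + (\<Sum>q | \<mu> \<le> lev q. L q)"
  have C0: "0 \<le> (\<Sum>j\<le>n. \<Sum>c\<in>UNIV. K j c)" "0 \<le> (\<Sum>q | \<mu> \<le> lev q. L q)" using K L by (auto intro!: sum_nonneg)
  show ?thesis
  proof (intro exI[of _ C] conjI allI impI)
    show "0 \<le> C" using C0 by (simp add: C_def)
    fix y W t assume A: "Adm y W" and t: "t \<in> J"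
    define N where "N = (\<Sum>j\<le>n. norm (wj W j t)) + norm (gv t (y t))"
    have Nj: "norm (wj W j t) \<le> N" if "j \<le> n" for j
      using member_le_sum[of j "{..n}" "\<lambda>j. norm (wj W j t)"] that by (simp add: N_def add_increasing2)
    have N0: "0 \<le> N" by (simp add: N_def sum_nonneg)
    have 1: "\<bar>\<Sum>j\<le>n. \<Sum>c\<in>UNIV. \<kappa> j c t * wj W j t $ c\<bar> \<le> (\<Sum>j\<le>n. \<Sum>c\<in>UNIV. K j c * N)"
    proof (rule order_trans[OF sum_abs sum_mono], rule order_trans[OF sum_abs sum_mono])
      fix j c assume j: "j \<in> {..n}"
      have "\<bar>wj W j t $ c\<bar> \<le> N" using component_le_norm_cart[of "wj W j t" c] Nj[of j] j by simp
      then show "\<bar>\<kappa> j c t * wj W j t $ c\<bar> \<le> K j c * N"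
        unfolding abs_mult by (intro mult_mono K t) auto
    qed
    have 2: "\<bar>\<Sum>q | \<mu> \<le> lev q. l q t * co y q t\<bar> \<le> (\<Sum>q | \<mu> \<le> lev q. L q * N)"
    proof (rule order_trans[OF sum_abs sum_mono])
      fix q assume q: "q \<in> {q. \<mu> \<le> lev q}"
      have "\<bar>co y q t\<bar> \<le> norm (gv t (y t))"
        using component_le_norm_cart[of "gv t (y t)" q] q by (simp add: gv_def co_def)
      also have "\<dots> \<le> N" by (simp add: N_def sum_nonneg)
      finally show "\<bar>l q t * co y q t\<bar> \<le> L q * N"
        unfolding abs_mult by (intro mult_mono L t) auto
    qed
    have "\<bar>\<Theta> y W t\<bar> \<le> (\<Sum>j\<le>n. \<Sum>c\<in>UNIV. K j c * N) + (\<Sum>q | \<mu> \<le> lev q. L q * N)"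
      unfolding e[OF A t] using 1 2 by linarith
    also have "\<dots> = C * N" by (simp add: C_def distrib_right sum_distrib_right)
    finally show "\<bar>\<Theta> y W t\<bar> \<le> C * ((\<Sum>j\<le>n. norm (wj W j t)) + norm (gv t (y t)))" by (simp add: N_def)
  qed
qed

lemma KK_nonempty: "KK i t \<noteq> {}"
  using subspace_0[OF subspace_KK] by blast

text \<open>Together with \<open>infdist_le_gv\<close> this shows that the coordinates modulo
  K_\<mu> are comparable to the distance from K_\<mu>. The distance does not depend on the frame, so
  estimates from different local frames can be chained.\<close>

lemma gv_le_infdist: "\<exists>C\<ge>0. \<forall>t\<in>J. \<forall>v. norm (gv t v) \<le> C * infdist v (KK \<mu> t)"
proof -
  obtain C where C: "0 \<le> C" "\<And>t v. t \<in> J \<Longrightarrow> norm (Xi t *v v) \<le> C * norm v"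
    by (rule smm_bounded[OF smXi compact_J]) (rule that)
  have "norm (gv t v) \<le> (C + 1) * infdist v (KK \<mu> t)" if t: "t \<in> J" for t v
  proof -
    \<comment> \<open>C + 1 instead of C gives a positive divisor; the bound then passes to the
      infimum over K_\<mu>.\<close>
    have "norm (gv t v) / (C + 1) \<le> infdist v (KK \<mu> t)"
      unfolding infdist_notempty[OF KK_nonempty]
    proof (rule cINF_greatest[OF KK_nonempty])
      fix k assume k: "k \<in> KK \<mu> t"
      have "gv t v = gv t (v - k)"
        using KK_iff_coords[OF t, of \<mu> k] k by (auto simp: gv_def vec_eq_iff matrix_vector_mult_diff_distrib)
      also have "norm \<dots> \<le> norm (Xi t *v (v - k))"
        by (rule norm_le_componentwise_cart) (simp add: gv_def)
      also have "\<dots> \<le> C * dist v k" using C(2)[OF t] by (simp add: dist_norm)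
      also have "\<dots> \<le> (C + 1) * dist v k" by (intro mult_right_mono) auto
      finally show "norm (gv t v) / (C + 1) \<le> dist v k" using C(1) by (simp add: field_simps)
    qed
    then show ?thesis using C(1) by (simp add: field_simps)
  qed
  then show ?thesis using C(1) by (intro exI[of _ "C + 1"]) auto
qed

lemma infdist_le_gv: "\<exists>C\<ge>0. \<forall>t\<in>J. \<forall>v. infdist v (KK \<mu> t) \<le> C * norm (gv t v)"
proof -
  obtain C where C: "0 \<le> C" "\<And>t v. t \<in> J \<Longrightarrow> norm (X t *v v) \<le> C * norm v"
    by (rule smm_bounded[OF smX compact_J]) (rule that)
  have "infdist v (KK \<mu> t) \<le> C * norm (gv t v)" if t: "t \<in> J" for t v
  proof -
    have "v - X t *v gv t v \<in> KK \<mu> t"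
      unfolding KK_iff_coords[OF t order_refl]
      by (auto simp: matrix_vector_mult_diff_distrib Xi_X[OF t] gv_def)
    from infdist_le[OF this, of v] C(2)[OF t, of "gv t v"] show ?thesis by (simp add: dist_norm)
  qed
  then show ?thesis using C(1) by blast
qed

text \<open>Every coordinate is an \<open>expr (\<mu> - 1)\<close>: those below level \<mu> by back
  substitution, the others trivially.\<close>

lemma local_derivative_estimate:
  "\<exists>C\<ge>0. \<forall>y W t. Adm y W \<longrightarrow> t \<in> J \<longrightarrow>
    norm (y t) \<le> C * ((\<Sum>j<\<mu>. norm (wj W j t)) + infdist (y t) (KK \<mu> t))"
proof -
  have "\<forall>p. \<exists>C\<ge>0. \<forall>y W t. Adm y W \<longrightarrow> t \<in> J \<longrightarrow>
      \<bar>co y p t\<bar> \<le> C * ((\<Sum>j\<le>\<mu> - 1. norm (wj W j t)) + norm (gv t (y t)))"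
  proof
    fix p
    have "expr (\<mu> - 1) (\<lambda>y W. co y p)"
      using expr_coordinate[of p "\<mu> - 1"] expr_co[of p "\<mu> - 1"] mu_pos by (cases "lev p < \<mu>") auto
    from expr_bound[OF this] show "\<exists>C\<ge>0. \<forall>y W t. Adm y W \<longrightarrow> t \<in> J \<longrightarrow>
      \<bar>co y p t\<bar> \<le> C * ((\<Sum>j\<le>\<mu> - 1. norm (wj W j t)) + norm (gv t (y t)))" .
  qed
  from choice[OF this] obtain K where K0: "\<forall>p. 0 \<le> K p \<and> (\<forall>y W t. Adm y W \<longrightarrow> t \<in> J \<longrightarrow>
      \<bar>co y p t\<bar> \<le> K p * ((\<Sum>j\<le>\<mu> - 1. norm (wj W j t)) + norm (gv t (y t))))" ..
  have K: "0 \<le> K p" "Adm y W \<Longrightarrow> t \<in> J \<Longrightarrow>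
      \<bar>co y p t\<bar> \<le> K p * ((\<Sum>j\<le>\<mu> - 1. norm (wj W j t)) + norm (gv t (y t)))" for p y W t
    using K0 by simp_all
  obtain C where C: "0 \<le> C" "\<And>t v. t \<in> J \<Longrightarrow> norm (X t *v v) \<le> C * norm v"
    by (rule smm_bounded[OF smX compact_J]) (rule that)
  obtain L where L: "0 \<le> L" "\<And>t v. t \<in> J \<Longrightarrow> norm (gv t v) \<le> L * infdist v (KK \<mu> t)"
    using gv_le_infdist by auto
  define S where "S = C * (\<Sum>p\<in>UNIV. K p)"
  have S0: "0 \<le> S" using C K by (simp add: S_def sum_nonneg)
  show ?thesis
  proof (intro exI[of _ "S * (1 + L)"] conjI allI impI)
    show "0 \<le> S * (1 + L)" using S0 L by simp
    fix y W t assume A: "Adm y W" and t: "t \<in> J"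
    have "{..\<mu> - 1} = {..<\<mu>}" using mu_pos by auto
    then have Kp: "\<bar>co y p t\<bar> \<le> K p * ((\<Sum>j<\<mu>. norm (wj W j t)) + norm (gv t (y t)))" for p
      using K(2)[OF A t, of p] by simp
    have "norm (y t) = norm (X t *v (Xi t *v y t))" by (simp add: X_Xi[OF t])
    also have "\<dots> \<le> C * norm (Xi t *v y t)" by (rule C(2)[OF t])
    also have "\<dots> \<le> C * (\<Sum>p\<in>UNIV. \<bar>co y p t\<bar>)"
      using norm_le_l1_cart[of "Xi t *v y t"] C(1) by (simp add: co_def mult_left_mono)
    also have "\<dots> \<le> C * (\<Sum>p\<in>UNIV. K p * ((\<Sum>j<\<mu>. norm (wj W j t)) + norm (gv t (y t))))"
      using C(1) Kp by (intro mult_left_mono sum_mono)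
    also have "\<dots> = S * ((\<Sum>j<\<mu>. norm (wj W j t)) + norm (gv t (y t)))"
      by (simp add: S_def sum_distrib_right)
    also have "\<dots> \<le> S * ((1 + L) * ((\<Sum>j<\<mu>. norm (wj W j t)) + infdist (y t) (KK \<mu> t)))"
    proof (rule mult_left_mono[OF _ S0])
      have "0 \<le> L * (\<Sum>j<\<mu>. norm (wj W j t))" using L by (simp add: sum_nonneg)
      then show "(\<Sum>j<\<mu>. norm (wj W j t)) + norm (gv t (y t))
          \<le> (1 + L) * ((\<Sum>j<\<mu>. norm (wj W j t)) + infdist (y t) (KK \<mu> t))"
        using L(2)[OF t, of "y t"] infdist_nonneg[of "y t" "KK \<mu> t"] by (simp add: algebra_simps)
    qed
    finally show "norm (y t) \<le> S * (1 + L) * ((\<Sum>j<\<mu>. norm (wj W j t)) + infdist (y t) (KK \<mu> t))"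
      by (simp add: mult.assoc)
  qed
qed

end

section \<open>Propagation of the distance from \<open>KK \<mu>\<close>\<close>

context complete_frame
begin

definition gyd :: "(real \<Rightarrow> real ^ ('k + 'r)) \<Rightarrow> real \<Rightarrow> real ^ ('k + 'r)" where
  "gyd y t = (\<chi> p. if \<mu> \<le> lev p then cod y p t else 0)"

lemma gv_nth: "gv t (y t) $ p = (if \<mu> \<le> lev p then co y p t else 0)"
  by (simp add: gv_def co_def)

lemma gv_deriv:
  assumes t: "t \<in> J"
    and u: "((\<lambda>s. (Dmat :: real^('k+'r)^'k) *v y s) has_vector_derivative u') (at t within J)"
  shows "((\<lambda>s. gv s (y s)) has_vector_derivative gyd y t) (at t within J)"
  unfolding has_vector_derivative_vec_iff gv_nth gyd_def
  using co_has_derivative[OF t _ u] mu_pos by auto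

text \<open>The ODE part of \<open>omega_eq\<close> with coefficients bounded on the compact J; its
  right-hand side contains no coordinates of level below \<mu>.\<close>

lemma gv_deriv_bound:
  "\<exists>C\<ge>0. \<exists>L\<ge>0. \<forall>t\<in>J. \<forall>y u' w.
    ((\<lambda>s. (Dmat :: real^('k+'r)^'k) *v y s) has_vector_derivative u') (at t within J) \<longrightarrow>
    DAE_op t u' (y t) = w \<longrightarrow> norm (gyd y t) \<le> C * norm w + L * norm (gv t (y t))"
proof -
  define N :: "real \<Rightarrow> real^('k+'r)^('k+'r)"
    where "N t = (\<chi> p q. if \<mu> \<le> lev p \<and> \<mu> \<le> lev q then al q p t else 0)" for t
  have "smm J N"
    unfolding smm_def
  proof (intro allI)
    fix p q show "sm J (\<lambda>t. N t $ p $ q)"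
      using sm_al[of q p] by (cases "\<mu> \<le> lev p"; cases "\<mu> \<le> lev q") (simp_all add: N_def)
  qed
  then obtain L where L: "0 \<le> L" "\<And>t v. t \<in> J \<Longrightarrow> norm (N t *v v) \<le> L * norm v"
    by (rule smm_bounded[OF _ compact_J]) (rule that)
  obtain C where C: "0 \<le> C" "\<And>t v. t \<in> J \<Longrightarrow> norm (Fi t *v v) \<le> C * norm v"
    by (rule smm_bounded[OF smFi compact_J]) (rule that)
  have "norm (gyd y t) \<le> C * norm w + L * norm (gv t (y t))"
    if t: "t \<in> J" and u: "((\<lambda>s. (Dmat :: real^('k+'r)^'k) *v y s) has_vector_derivative u') (at t within J)"
      and w: "DAE_op t u' (y t) = w" for t y u' w
  proof -
    have N: "(N t *v gv t (y t)) $ p = (if \<mu> \<le> lev p then \<Sum>q | \<mu> \<le> lev q. al q p t * co y q t else 0)" for p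
    proof -
      have "(N t *v gv t (y t)) $ p = (\<Sum>q\<in>UNIV. N t $ p $ q * gv t (y t) $ q)"
        by (simp add: matrix_vector_mult_def)
      also have "\<dots> = (\<Sum>q | \<mu> \<le> lev q. N t $ p $ q * gv t (y t) $ q)"
        by (rule sum.mono_neutral_right) (auto simp: gv_nth)
      also have "\<dots> = (\<Sum>q | \<mu> \<le> lev q. (if \<mu> \<le> lev p then al q p t * co y q t else 0))"
        by (rule sum.cong) (auto simp: gv_nth N_def)
      finally show ?thesis by auto
    qed
    define m where "m = (\<chi> p. if \<mu> \<le> lev p then (Fi t *v w) $ p else 0)"
    have "gyd y t = m - N t *v gv t (y t)"
      unfolding vec_eq_iff using omega_eq(2)[OF t u w] by (auto simp: N gyd_def m_def)
    then have "norm (gyd y t) \<le> norm m + norm (N t *v gv t (y t))" by (simp add: norm_triangle_ineq4)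
    moreover have "norm m \<le> norm (Fi t *v w)"
      by (rule norm_le_componentwise_cart) (simp add: m_def)
    ultimately show ?thesis using C(2)[OF t, of w] L(2)[OF t, of "gv t (y t)"] by linarith
  qed
  then show ?thesis using C(1) L(1) by blast
qed

text \<open>Since \<mu> is positive, the coordinates modulo K_\<mu> depend on y only through D
  y.\<close>

lemma gv_continuous_on:
  assumes "K \<subseteq> J" "continuous_on K (\<lambda>s. (Dmat :: real^('k+'r)^'k) *v y s)"
  shows "continuous_on K (\<lambda>s. gv s (y s))"
proof -
  define m :: "real^('k+'r)^('k+'r)" where "m = (\<chi> p q. if p = q \<and> \<mu> \<le> lev p then 1 else 0)"
  have m: "(m *v v) $ p = (if \<mu> \<le> lev p then v $ p else 0)" for v p
    by (auto simp: m_def matrix_vector_mult_def if_distrib[of "\<lambda>y. y * _"] cong: if_cong)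
  note cont = bounded_bilinear.continuous_on[OF bounded_bilinear_matrix_vector]
  have "continuous_on K (\<lambda>s. m *v (Xi s *v (transpose Dmat *v (Dmat *v y s :: real^'k))))"
    by (intro cont continuous_on_const assms(2) continuous_on_subset[OF smm_continuous_on[OF smXi] assms(1)])
  moreover have "m *v (Xi s *v (transpose Dmat *v (Dmat *v y s :: real^'k))) = gv s (y s)" if "s \<in> K" for s
    using co_Dmat[of s _ y] that assms(1) mu_pos by (auto simp: vec_eq_iff m gv_nth)
  ultimately show ?thesis by (simp cong: continuous_on_cong)
qed

text \<open>The finite set S of exceptional points is there for mesh points, where D y is continuous
  but has a kink. The bound \<eta> on the length lets the absorption argument of
  \<open>local_propagation\<close> close.\<close>

definition propagates :: "real \<Rightarrow> real \<Rightarrow> bool" where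
  "propagates C \<eta> \<longleftrightarrow> (\<forall>\<alpha>' \<beta>' y w S. \<alpha> \<le> \<alpha>' \<and> \<alpha>' \<le> \<beta>' \<and> \<beta>' \<le> \<beta> \<and> \<beta>' - \<alpha>' \<le> \<eta> \<and> finite S \<and>
    continuous_on {\<alpha>'..\<beta>'} (\<lambda>s. (Dmat :: real^('k+'r)^'k) *v y s) \<and>
    (\<forall>t\<in>{\<alpha>'<..<\<beta>'} - S. \<exists>u'. ((\<lambda>s. (Dmat :: real^('k+'r)^'k) *v y s) has_vector_derivative u') (at t) \<and> DAE_op t u' (y t) = w t) \<and>
    (\<lambda>t. norm (w t)) integrable_on {\<alpha>'..\<beta>'} \<longrightarrow>
    (\<forall>s\<in>{\<alpha>'..\<beta>'}. \<forall>t\<in>{\<alpha>'..\<beta>'}. infdist (y t) (KK \<mu> t) \<le>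
      C * (infdist (y s) (KK \<mu> s) + integral {\<alpha>'..\<beta>'} (\<lambda>t. norm (w t)))))"

text \<open>In place of Gronwall's inequality: the ODE is integrated between two points, and on an
  interval so short that L \<eta> \<le> 1/2 the contribution of the maximum of |gv| is at most half
  of that maximum and can be absorbed.\<close>

lemma local_propagation: "\<exists>C\<ge>0. \<exists>\<eta>>0. propagates C \<eta>"
proof -
  from gv_deriv_bound obtain C where C0: "0 \<le> C \<and> (\<exists>L\<ge>0. \<forall>t\<in>J. \<forall>y u' w.
    ((\<lambda>s. (Dmat :: real^('k+'r)^'k) *v y s) has_vector_derivative u') (at t within J) \<longrightarrow>
    DAE_op t u' (y t) = w \<longrightarrow> norm (gyd y t) \<le> C * norm w + L * norm (gv t (y t)))" ..
  from conjunct2[OF C0] obtain L where L0: "0 \<le> L \<and> (\<forall>t\<in>J. \<forall>y u' w.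
    ((\<lambda>s. (Dmat :: real^('k+'r)^'k) *v y s) has_vector_derivative u') (at t within J) \<longrightarrow>
    DAE_op t u' (y t) = w \<longrightarrow> norm (gyd y t) \<le> C * norm w + L * norm (gv t (y t)))" ..
  have CL: "0 \<le> C" "0 \<le> L" "t \<in> J \<Longrightarrow>
    ((\<lambda>s. (Dmat :: real^('k+'r)^'k) *v y s) has_vector_derivative u') (at t within J) \<Longrightarrow>
    DAE_op t u' (y t) = w \<Longrightarrow> norm (gyd y t) \<le> C * norm w + L * norm (gv t (y t))" for t y u' w
    using C0 L0 by (blast, blast, blast)
  obtain K1 where K1: "0 \<le> K1" "\<And>t v. t \<in> J \<Longrightarrow> norm (gv t v) \<le> K1 * infdist v (KK \<mu> t)"
    using gv_le_infdist by auto
  obtain K2 where K2: "0 \<le> K2" "\<And>t v. t \<in> J \<Longrightarrow> infdist v (KK \<mu> t) \<le> K2 * norm (gv t v)"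
    using infdist_le_gv by auto
  \<comment> \<open>Gives L \<eta> \<le> 1/2 and is meaningful for L = 0 as well.\<close>
  define \<eta> where "\<eta> = 1 / (2 * L + 2)"
  have \<eta>: "0 < \<eta>" "L * \<eta> \<le> 1/2" using CL by (auto simp: \<eta>_def field_simps)
  define C' where "C' = K2 * (2 * (K1 + C))"
  have C'0: "0 \<le> C'" using K1 K2 CL by (auto simp: C'_def)
  show ?thesis
  proof (rule exI[of _ C'], rule conjI[OF C'0], rule exI[of _ \<eta>], rule conjI[OF \<eta>(1)], unfold propagates_def, intro allI impI ballI)
    fix \<alpha>' \<beta>' y w S s t
    assume h: "\<alpha> \<le> \<alpha>' \<and> \<alpha>' \<le> \<beta>' \<and> \<beta>' \<le> \<beta> \<and> \<beta>' - \<alpha>' \<le> \<eta> \<and> finite S \<and>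
      continuous_on {\<alpha>'..\<beta>'} (\<lambda>s. (Dmat :: real^('k+'r)^'k) *v y s) \<and>
      (\<forall>t\<in>{\<alpha>'<..<\<beta>'} - S. \<exists>u'. ((\<lambda>s. (Dmat :: real^('k+'r)^'k) *v y s) has_vector_derivative u') (at t)
        \<and> DAE_op t u' (y t) = w t) \<and>
      (\<lambda>t. norm (w t)) integrable_on {\<alpha>'..\<beta>'}"
      and s: "s \<in> {\<alpha>'..\<beta>'}" and t: "t \<in> {\<alpha>'..\<beta>'}"
    from h have ab': "\<alpha> \<le> \<alpha>'" "\<alpha>' \<le> \<beta>'" "\<beta>' \<le> \<beta>" "\<beta>' - \<alpha>' \<le> \<eta>" and S: "finite S"
      and cont: "continuous_on {\<alpha>'..\<beta>'} (\<lambda>s. (Dmat :: real^('k+'r)^'k) *v y s)"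
      and der: "\<forall>t\<in>{\<alpha>'<..<\<beta>'} - S. \<exists>u'. ((\<lambda>s. (Dmat :: real^('k+'r)^'k) *v y s) has_vector_derivative u') (at t)
        \<and> DAE_op t u' (y t) = w t"
      and int: "(\<lambda>t. norm (w t)) integrable_on {\<alpha>'..\<beta>'}" by - (elim conjE, assumption)+
    let ?g = "\<lambda>s. gv s (y s)"
    let ?I = "integral {\<alpha>'..\<beta>'} (\<lambda>t. norm (w t))"
    have sub: "{\<alpha>'..\<beta>'} \<subseteq> J" using ab' by (auto simp: J)
    have gc: "continuous_on {\<alpha>'..\<beta>'} ?g" by (rule gv_continuous_on[OF sub cont])
    have "\<exists>z\<in>{\<alpha>'..\<beta>'}. \<forall>\<tau>\<in>{\<alpha>'..\<beta>'}. norm (?g \<tau>) \<le> norm (?g z)"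
      using ab' by (intro continuous_attains_sup continuous_on_norm gc) auto
    then obtain z where z: "z \<in> {\<alpha>'..\<beta>'}" "\<And>\<tau>. \<tau> \<in> {\<alpha>'..\<beta>'} \<Longrightarrow> norm (?g \<tau>) \<le> norm (?g z)" by blast
    have gd: "(?g has_vector_derivative gyd y \<tau>) (at \<tau>)" "norm (gyd y \<tau>) \<le> C * norm (w \<tau>) + L * norm (?g z)"
      if \<tau>: "\<tau> \<in> {\<alpha>'<..<\<beta>'} - S" for \<tau>
    proof -
      obtain u' where u': "((\<lambda>s. (Dmat :: real^('k+'r)^'k) *v y s) has_vector_derivative u') (at \<tau>)"
        "DAE_op \<tau> u' (y \<tau>) = w \<tau>" using der \<tau> by blast
      have \<tau>J: "\<tau> \<in> J" using \<tau> sub by auto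
      have at: "at \<tau> within J = at \<tau>" unfolding J using \<tau> ab' by (intro at_within_Icc_at) auto
      show "(?g has_vector_derivative gyd y \<tau>) (at \<tau>)"
        using gv_deriv[OF \<tau>J, of y u'] u' by (simp add: at)
      have "norm (gyd y \<tau>) \<le> C * norm (w \<tau>) + L * norm (?g \<tau>)"
        using CL(3)[OF \<tau>J, of y u' "w \<tau>"] u' by (simp add: at)
      also have "\<dots> \<le> C * norm (w \<tau>) + L * norm (?g z)"
        using z(2)[of \<tau>] \<tau> CL by (intro add_left_mono mult_left_mono) auto
      finally show "norm (gyd y \<tau>) \<le> C * norm (w \<tau>) + L * norm (?g z)" .
    qed
    have diff: "norm (?g q - ?g p) \<le> C * ?I + norm (?g z) / 2"
      if pq: "p \<in> {\<alpha>'..\<beta>'}" "q \<in> {\<alpha>'..\<beta>'}" "p \<le> q" for p q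
    proof -
      \<comment> \<open>The derivative, set to 0 at the exceptional points, where \<open>gyd\<close>
        carries no information; this keeps the pointwise bound valid everywhere.\<close>
      define f where "f \<tau> = (if \<tau> \<in> {p<..<q} - S then gyd y \<tau> else 0)" for \<tau>
      have pqs: "{p..q} \<subseteq> {\<alpha>'..\<beta>'}" using pq by auto
      have "(f has_integral ?g q - ?g p) {p..q}"
      proof (rule fundamental_theorem_of_calculus_interior_strong[OF S pq(3)])
        show "(?g has_vector_derivative f \<tau>) (at \<tau>)" if "\<tau> \<in> {p<..<q} - S" for \<tau>
          using gd(1)[of \<tau>] that pq by (auto simp: f_def)
        show "continuous_on {p..q} ?g" using gc pqs continuous_on_subset by blast
      qed
      then have fi: "f integrable_on {p..q}" "integral {p..q} f = ?g q - ?g p"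
        by (auto simp: has_integral_iff)
      have iw: "(\<lambda>t. norm (w t)) integrable_on {p..q}" using int pqs integrable_on_subinterval by blast
      have "norm (integral {p..q} f) \<le> integral {p..q} (\<lambda>\<tau>. C * norm (w \<tau>) + L * norm (?g z))"
      proof (rule integral_norm_bound_integral[OF fi(1)])
        show "(\<lambda>\<tau>. C * norm (w \<tau>) + L * norm (?g z)) integrable_on {p..q}"
          using iw by (intro integrable_add integrable_on_mult_right) auto
        show "norm (f \<tau>) \<le> C * norm (w \<tau>) + L * norm (?g z)" if "\<tau> \<in> {p..q}" for \<tau>
          using gd(2)[of \<tau>] that pq CL by (auto simp: f_def)
      qed
      also have "\<dots> = C * integral {p..q} (\<lambda>\<tau>. norm (w \<tau>)) + L * norm (?g z) * (q - p)"
        using iw pq(3) by (subst integral_add) (auto intro: integrable_on_mult_right)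
      also have "\<dots> \<le> C * ?I + L * norm (?g z) * \<eta>"
      proof (rule add_mono)
        show "C * integral {p..q} (\<lambda>\<tau>. norm (w \<tau>)) \<le> C * ?I"
          using CL(1) by (intro mult_left_mono integral_subset_le pqs iw int) auto
        show "L * norm (?g z) * (q - p) \<le> L * norm (?g z) * \<eta>"
          using CL(2) pq ab' by (intro mult_left_mono) auto
      qed
      also have "L * norm (?g z) * \<eta> \<le> norm (?g z) / 2"
        using mult_right_mono[OF \<eta>(2), of "norm (?g z)"] by (simp add: ac_simps)
      finally show ?thesis using fi by simp
    qed
    have "norm (?g z) \<le> norm (?g s) + norm (?g z - ?g s)"
      using norm_triangle_ineq[of "?g s" "?g z - ?g s"] by simp
    also have "norm (?g z - ?g s) \<le> C * ?I + norm (?g z) / 2"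
      using diff[OF s z(1)] diff[OF z(1) s] by (cases "s \<le> z") (auto simp: norm_minus_commute)
    \<comment> \<open>Half of the maximum is moved to the left-hand side.\<close>
    finally have "norm (?g z) \<le> 2 * (norm (?g s) + C * ?I)" by simp
    then have gz: "norm (?g z) \<le> 2 * (K1 * infdist (y s) (KK \<mu> s) + C * ?I)"
      using K1(2)[of s "y s"] s sub by fastforce
    have I0: "0 \<le> ?I" by (intro integral_nonneg int) auto
    have N0: "0 \<le> infdist (y s) (KK \<mu> s)" by (rule infdist_nonneg)
    have "infdist (y t) (KK \<mu> t) \<le> K2 * norm (?g t)" using K2(2) t sub by blast
    also have "\<dots> \<le> K2 * (2 * (K1 * infdist (y s) (KK \<mu> s) + C * ?I))"
      using z(2)[OF t] gz K2(1) by (intro mult_left_mono) auto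
    also have "\<dots> \<le> K2 * (2 * (K1 + C) * (infdist (y s) (KK \<mu> s) + ?I))"
    proof (rule mult_left_mono[OF _ K2(1)])
      have "0 \<le> K1 * ?I" "0 \<le> C * infdist (y s) (KK \<mu> s)" using I0 N0 K1 CL by auto
      then show "2 * (K1 * infdist (y s) (KK \<mu> s) + C * ?I) \<le> 2 * (K1 + C) * (infdist (y s) (KK \<mu> s) + ?I)"
        by (simp add: algebra_simps)
    qed
    finally show "infdist (y t) (KK \<mu> t) \<le> C' * (infdist (y s) (KK \<mu> s) + ?I)"
      by (simp add: C'_def mult.assoc)
  qed
qed

end

section \<open>From local to global estimates\<close>

text \<open>A finite subcover leaves finitely many local constants; by monotonicity of Pr their sum
  works everywhere.\<close>

lemma compact_uniform_constant:
  fixes S :: "real set" and Pr :: "real \<Rightarrow> real \<Rightarrow> bool"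
  assumes S: "compact S"
    and loc: "\<And>t. t \<in> S \<Longrightarrow> \<exists>\<delta>>0. \<exists>C\<ge>0. \<forall>s\<in>S. \<bar>s - t\<bar> < \<delta> \<longrightarrow> Pr C s"
    and mono: "\<And>C C' s. C \<le> C' \<Longrightarrow> Pr C s \<Longrightarrow> Pr C' s"
  shows "\<exists>C\<ge>0. \<forall>s\<in>S. Pr C s"
proof -
  have "\<forall>t. \<exists>\<delta> C. t \<in> S \<longrightarrow> 0 < \<delta> \<and> 0 \<le> C \<and> (\<forall>s\<in>S. \<bar>s - t\<bar> < \<delta> \<longrightarrow> Pr C s)"
    using loc by blast
  from choice[OF this] obtain \<delta> where
    "\<forall>t. \<exists>C. t \<in> S \<longrightarrow> 0 < \<delta> t \<and> 0 \<le> C \<and> (\<forall>s\<in>S. \<bar>s - t\<bar> < \<delta> t \<longrightarrow> Pr C s)" ..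
  from choice[OF this] obtain C where
    *: "\<forall>t. t \<in> S \<longrightarrow> 0 < \<delta> t \<and> 0 \<le> C t \<and> (\<forall>s\<in>S. \<bar>s - t\<bar> < \<delta> t \<longrightarrow> Pr (C t) s)" ..
  have \<delta>: "t \<in> S \<Longrightarrow> 0 < \<delta> t" and C: "t \<in> S \<Longrightarrow> 0 \<le> C t"
    and P: "t \<in> S \<Longrightarrow> s \<in> S \<Longrightarrow> \<bar>s - t\<bar> < \<delta> t \<Longrightarrow> Pr (C t) s" for t s
    using * by simp_all
  have cover: "S \<subseteq> (\<Union>t\<in>S. ball t (\<delta> t))" using \<delta> by force
  obtain K where K: "K \<subseteq> S" "finite K" "S \<subseteq> (\<Union>t\<in>K. ball t (\<delta> t))"
    by (rule compactE_image[OF S _ cover]) (rule open_ball, rule that)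
  show ?thesis
  proof (intro exI[of _ "\<Sum>t\<in>K. C t"] conjI ballI)
    show "0 \<le> (\<Sum>t\<in>K. C t)" using K C by (intro sum_nonneg) auto
    fix s assume s: "s \<in> S"
    then obtain t where t: "t \<in> K" "\<bar>s - t\<bar> < \<delta> t" using K(3) by (auto simp: dist_real_def abs_minus_commute)
    have "C t \<le> (\<Sum>t\<in>K. C t)" using K C t by (intro member_le_sum) auto
    moreover have "Pr (C t) s" using P t K s by auto
    ultimately show "Pr (\<Sum>t\<in>K. C t) s" by (rule mono)
  qed
qed

context smooth_tractability
begin

text \<open>The frame of K_\<mu> is completed by constant vectors to a basis at t0; nonvanishing of
  the determinant persists on a smaller neighbourhood.\<close>

lemma complete_frame_exists:
  assumes t0: "t\<^sub>0 \<in> {a..b}"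
  shows "\<exists>\<delta>>0. \<exists>x dx lev cf. complete_frame a b A B \<mu> r G Bs Q Pi R (max a (t\<^sub>0 - \<delta>)) (min b (t\<^sub>0 + \<delta>))
    (nbhd a b t\<^sub>0 \<delta>) x dx lev cf"
proof -
  let ?J = "nbhd a b t\<^sub>0"
  obtain \<delta> x dx lev c where \<delta>: "0 < \<delta>" and f: "frame \<mu> (?J \<delta>) x dx lev c"
    using frame_exists[OF t0 order_refl] by blast
  have ind: "indep {p. lev p < \<mu>} (\<lambda>p. x p t\<^sub>0)"
    using f mem_nbhd[OF t0 \<delta>] by (auto simp: frame_def)
  obtain e where e: "det (colm e) \<noteq> 0" "\<And>p. p \<in> {p. lev p < \<mu>} \<Longrightarrow> e p = x p t\<^sub>0"
    by (rule indep_extend_UNIV[OF ind]) (rule that)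
  define x' where "x' p = (if lev p < \<mu> then x p else (\<lambda>_. e p))" for p
  define dx' where "dx' p = (if lev p < \<mu> then dx p else (\<lambda>_. 0))" for p
  have sm: "smv (?J \<delta>) (x' p)" "smv (?J \<delta>) (dx' p)" for p
    using f by (auto simp: frame_def x'_def dx'_def)
  have der: "(x' p has_vector_derivative dx' p t) (at t within ?J \<delta>)" if "t \<in> ?J \<delta>" for p t
    using f that by (auto simp: frame_def x'_def dx'_def)
  have same: "lev p < \<mu> \<Longrightarrow> x' p = x p" "lev p < \<mu> \<Longrightarrow> dx' p = dx p" for p by (auto simp: x'_def dx'_def)
  have f': "frame \<mu> (?J \<delta>) x' dx' lev c"
    unfolding frame_def
  proof (intro conjI allI ballI impI)
    fix t assume t: "t \<in> ?J \<delta>"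
    have "indep {p. lev p < \<mu>} (\<lambda>p. x p t)" using f t by (auto simp: frame_def)
    then show "indep {p. lev p < \<mu>} (\<lambda>p. x' p t)"
      by (subst indep_cong[of _ _ "\<lambda>p. x p t"]) (auto simp: same)
    have "indep {p. lev p < \<mu>} (\<lambda>p. DAE_op t (Dmat *v dx p t) (x p t))" using f t by (auto simp: frame_def)
    then show "indep {p. lev p < \<mu>} (\<lambda>p. DAE_op t (Dmat *v dx' p t) (x' p t))"
      by (subst indep_cong[of _ _ "\<lambda>p. DAE_op t (Dmat *v dx p t) (x p t)"]) (auto simp: same)
    fix p assume p: "lev p < \<mu>"
    have "A t *v (Dmat *v x p t) = (\<Sum>q | lev q < lev p. c p q t *\<^sub>R DAE_op t (Dmat *v dx q t) (x q t))"
      using f t p by (auto simp: frame_def)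
    also have "\<dots> = (\<Sum>q | lev q < lev p. c p q t *\<^sub>R DAE_op t (Dmat *v dx' q t) (x' q t))"
      using p by (intro sum.cong) (auto simp: same)
    finally show "A t *v (Dmat *v x' p t) =
        (\<Sum>q | lev q < lev p. c p q t *\<^sub>R DAE_op t (Dmat *v dx' q t) (x' q t))" using p by (simp add: same)
    show "x' p t \<in> KK (Suc (lev p)) t" using f t p by (auto simp: frame_def same)
  qed (use f sm der in \<open>auto simp: frame_def\<close>)
  have smX: "smm (?J \<delta>) (\<lambda>t. colm (\<lambda>p. x' p t))" by (rule smm_colm[OF sm(1)])
  have "(\<lambda>p. x' p t\<^sub>0) = e" using e by (auto simp: x'_def)
  then have d0: "det (colm (\<lambda>p. x' p t\<^sub>0)) \<noteq> 0" using e by simp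
  obtain \<epsilon> where \<epsilon>: "0 < \<epsilon>" "\<epsilon> \<le> \<delta>" "\<And>t. t \<in> ?J \<epsilon> \<Longrightarrow> det (colm (\<lambda>p. x' p t)) \<noteq> 0"
    by (rule det_nonzero_near[OF smX d0 t0 \<delta>]) (rule that)
  have "complete_frame a b A B \<mu> r G Bs Q Pi R (max a (t\<^sub>0 - \<epsilon>)) (min b (t\<^sub>0 + \<epsilon>)) (?J \<epsilon>) x' dx' lev c"
  proof
    show "frame \<mu> (?J \<epsilon>) x' dx' lev c" by (rule frame_subset[OF f' nbhd_mono[OF \<epsilon>(2)]])
    show "?J \<epsilon> = {max a (t\<^sub>0 - \<epsilon>)..min b (t\<^sub>0 + \<epsilon>)}" by (simp add: nbhd_def)
    show "max a (t\<^sub>0 - \<epsilon>) < min b (t\<^sub>0 + \<epsilon>)" by (rule nbhd_nontrivial[OF ab t0 \<epsilon>(1)])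
    show "?J \<epsilon> \<subseteq> {a..b}" by (rule nbhd_subset)
  qed (use \<epsilon>(3) in \<open>auto simp: dx'_def\<close>)
  then show ?thesis using \<epsilon>(1) by blast
qed

lemma mem_nbhd_iff: "s \<in> {a..b} \<Longrightarrow> \<bar>s - t\<bar> < \<delta> \<Longrightarrow> s \<in> nbhd a b t \<delta>"
  by (auto simp: nbhd_def)

lemma derivative_estimate:
  "\<exists>C\<ge>0. \<forall>t\<in>{a..b}. \<forall>y W.
    (\<forall>s\<in>{a..b}. \<exists>u'. ((\<lambda>s. (Dmat :: real^('k+'r)^'k) *v y s) has_vector_derivative u') (at s within {a..b}) \<and>
      DAE_op s u' (y s) = wj W 0 s) \<longrightarrow>
    norm (y t) \<le> C * ((\<Sum>j<\<mu>. norm (wj W j t)) + infdist (y t) (KK \<mu> t))"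
proof (rule compact_uniform_constant)
  show "compact {a..b}" by simp
  fix t assume t: "t \<in> {a..b}"
  obtain \<delta> x dx lev cf where \<delta>: "0 < \<delta>" and
    cf: "complete_frame a b A B \<mu> r G Bs Q Pi R (max a (t - \<delta>)) (min b (t + \<delta>)) (nbhd a b t \<delta>) x dx lev cf"
    using complete_frame_exists[OF t] by blast
  interpret complete_frame a b A B \<mu> r G Bs Q Pi R "max a (t - \<delta>)" "min b (t + \<delta>)" "nbhd a b t \<delta>" x dx lev cf
    by (rule cf)
  obtain C where C: "0 \<le> C" "\<And>y W t'. Adm y W \<Longrightarrow> t' \<in> nbhd a b t \<delta> \<Longrightarrow>
      norm (y t') \<le> C * ((\<Sum>j<\<mu>. norm (wj W j t')) + infdist (y t') (KK \<mu> t'))"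
    using local_derivative_estimate by blast
  show "\<exists>\<delta>>0. \<exists>C\<ge>0. \<forall>s\<in>{a..b}. \<bar>s - t\<bar> < \<delta> \<longrightarrow> (\<forall>y W.
      (\<forall>s\<in>{a..b}. \<exists>u'. ((\<lambda>s. (Dmat :: real^('k+'r)^'k) *v y s) has_vector_derivative u') (at s within {a..b}) \<and>
        DAE_op s u' (y s) = wj W 0 s) \<longrightarrow>
      norm (y s) \<le> C * ((\<Sum>j<\<mu>. norm (wj W j s)) + infdist (y s) (KK \<mu> s)))"
  proof (rule exI[of _ \<delta>], rule conjI[OF \<delta>], rule exI[of _ C], rule conjI[OF C(1)], intro ballI impI allI)
    fix s y W assume s: "s \<in> {a..b}" "\<bar>s - t\<bar> < \<delta>"
      and y: "\<forall>s\<in>{a..b}. \<exists>u'. ((\<lambda>s. (Dmat :: real^('k+'r)^'k) *v y s) has_vector_derivative u') (at s within {a..b}) \<and>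
        DAE_op s u' (y s) = wj W 0 s"
    have "Adm y W"
      unfolding Adm_def
    proof
      fix \<tau> assume "\<tau> \<in> nbhd a b t \<delta>"
      then obtain u' where u': "((\<lambda>s. (Dmat :: real^('k+'r)^'k) *v y s) has_vector_derivative u') (at \<tau> within {a..b})"
        "DAE_op \<tau> u' (y \<tau>) = wj W 0 \<tau>" using y tab by blast
      from has_vector_derivative_within_subset[OF u'(1) nbhd_subset] u'(2)
      show "\<exists>u'. ((\<lambda>s. (Dmat :: real^('k+'r)^'k) *v y s) has_vector_derivative u') (at \<tau> within nbhd a b t \<delta>) \<and>
        DAE_op \<tau> u' (y \<tau>) = wj W 0 \<tau>" by blast
    qed
    from C(2)[OF this mem_nbhd_iff[OF s]]
    show "norm (y s) \<le> C * ((\<Sum>j<\<mu>. norm (wj W j s)) + infdist (y s) (KK \<mu> s))" .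
  qed
next
  fix C C' s :: real
  assume le: "C \<le> C'"
    and P: "\<forall>y W. (\<forall>s\<in>{a..b}. \<exists>u'. ((\<lambda>s. (Dmat :: real^('k+'r)^'k) *v y s) has_vector_derivative u') (at s within {a..b}) \<and>
        DAE_op s u' (y s) = wj W 0 s) \<longrightarrow>
      norm (y s) \<le> C * ((\<Sum>j<\<mu>. norm (wj W j s)) + infdist (y s) (KK \<mu> s))"
  show "\<forall>y W. (\<forall>s\<in>{a..b}. \<exists>u'. ((\<lambda>s. (Dmat :: real^('k+'r)^'k) *v y s) has_vector_derivative u') (at s within {a..b}) \<and>
        DAE_op s u' (y s) = wj W 0 s) \<longrightarrow>
      norm (y s) \<le> C' * ((\<Sum>j<\<mu>. norm (wj W j s)) + infdist (y s) (KK \<mu> s))"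
  proof (intro allI impI)
    fix y W assume y: "\<forall>s\<in>{a..b}. \<exists>u'. ((\<lambda>s. (Dmat :: real^('k+'r)^'k) *v y s) has_vector_derivative u') (at s within {a..b}) \<and>
        DAE_op s u' (y s) = wj W 0 s"
    have "norm (y s) \<le> C * ((\<Sum>j<\<mu>. norm (wj W j s)) + infdist (y s) (KK \<mu> s))" using P y by blast
    also have "\<dots> \<le> C' * ((\<Sum>j<\<mu>. norm (wj W j s)) + infdist (y s) (KK \<mu> s))"
      using le infdist_nonneg by (intro mult_right_mono add_nonneg_nonneg sum_nonneg) auto
    finally show "norm (y s) \<le> C' * ((\<Sum>j<\<mu>. norm (wj W j s)) + infdist (y s) (KK \<mu> s))" .
  qed
qed

text \<open>D y is continuous and the residual is w outside finitely many points. Piecewise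
  polynomials have this property, also after subtraction of a homogeneous solution.\<close>

definition quasi :: "(real \<Rightarrow> real ^ ('k + 'r)) \<Rightarrow> (real \<Rightarrow> real ^ ('k + 'r)) \<Rightarrow> bool" where
  "quasi y w \<longleftrightarrow> continuous_on {a..b} (\<lambda>s. (Dmat :: real^('k+'r)^'k) *v y s) \<and>
    (\<exists>S. finite S \<and> (\<forall>t\<in>{a<..<b} - S. \<exists>u'. ((\<lambda>s. (Dmat :: real^('k+'r)^'k) *v y s) has_vector_derivative u') (at t) \<and>
      DAE_op t u' (y t) = w t)) \<and> (\<lambda>t. norm (w t)) integrable_on {a..b}"

definition transports :: "real \<Rightarrow> real \<Rightarrow> real \<Rightarrow> bool" where
  "transports C s t \<longleftrightarrow> 0 \<le> C \<and> (\<forall>y w. quasi y w \<longrightarrow>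
    infdist (y t) (KK \<mu> t) \<le> C * (infdist (y s) (KK \<mu> s) + integral {a..b} (\<lambda>t. norm (w t))))"

lemma transports_trans:
  assumes "transports C s t" "transports C' t u" shows "transports (C' * (C + 1)) s u"
  unfolding transports_def
proof (intro conjI allI impI)
  show "0 \<le> C' * (C + 1)" using assms by (simp add: transports_def)
  fix y w assume q: "quasi y w"
  let ?I = "integral {a..b} (\<lambda>t. norm (w t))"
  have I: "0 \<le> ?I" using q by (intro integral_nonneg) (auto simp: quasi_def)
  have "infdist (y u) (KK \<mu> u) \<le> C' * (infdist (y t) (KK \<mu> t) + ?I)"
    using assms q by (auto simp: transports_def)
  also have "\<dots> \<le> C' * (C * (infdist (y s) (KK \<mu> s) + ?I) + ?I)"
    using assms q by (intro mult_left_mono add_right_mono) (auto simp: transports_def)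
  also have "\<dots> \<le> C' * ((C + 1) * (infdist (y s) (KK \<mu> s) + ?I))"
    using assms infdist_nonneg[of "y s" "KK \<mu> s"]
    by (intro mult_left_mono) (auto simp: transports_def algebra_simps)
  finally show "infdist (y u) (KK \<mu> u) \<le> C' * (C + 1) * (infdist (y s) (KK \<mu> s) + ?I)"
    by (simp add: mult.assoc)
qed

lemma transports_local:
  assumes t: "t \<in> {a..b}"
  shows "\<exists>\<delta>>0. \<exists>C. \<forall>s\<in>{a..b}. \<bar>s - t\<bar> < \<delta> \<longrightarrow> transports C s t \<and> transports C t s"
proof -
  obtain \<delta> x dx lev cf where \<delta>: "0 < \<delta>" and
    cf: "complete_frame a b A B \<mu> r G Bs Q Pi R (max a (t - \<delta>)) (min b (t + \<delta>)) (nbhd a b t \<delta>) x dx lev cf"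
    using complete_frame_exists[OF t] by blast
  interpret complete_frame a b A B \<mu> r G Bs Q Pi R "max a (t - \<delta>)" "min b (t + \<delta>)" "nbhd a b t \<delta>" x dx lev cf
    by (rule cf)
  obtain C \<eta> where C: "0 \<le> C" and \<eta>: "0 < \<eta>" and pr: "propagates C \<eta>"
    using local_propagation by blast
  \<comment> \<open>The neighbourhood of radius \<epsilon> has length at most \<eta>, so any two of
    its points can be compared.\<close>
  define \<epsilon> where "\<epsilon> = min \<delta> (\<eta> / 2)"
  let ?\<alpha> = "max a (t - \<epsilon>)" and ?\<beta> = "min b (t + \<epsilon>)"
  have \<epsilon>: "0 < \<epsilon>" using \<delta> \<eta> by (simp add: \<epsilon>_def)
  have cond: "max a (t - \<delta>) \<le> ?\<alpha>" "?\<alpha> \<le> ?\<beta>" "?\<beta> \<le> min b (t + \<delta>)" "?\<beta> - ?\<alpha> \<le> \<eta>"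
    using t \<delta> \<eta> by (auto simp: \<epsilon>_def)
  have sub: "{?\<alpha> .. ?\<beta>} \<subseteq> {a..b}" by auto
  have main: "transports C s s'" if "s \<in> {?\<alpha> .. ?\<beta>}" "s' \<in> {?\<alpha> .. ?\<beta>}" for s s'
    unfolding transports_def
  proof (intro conjI allI impI C)
    fix y w assume q: "quasi y w"
    then obtain S where S: "finite S" "\<forall>t\<in>{a<..<b} - S. \<exists>u'. ((\<lambda>s. (Dmat :: real^('k+'r)^'k) *v y s) has_vector_derivative u') (at t) \<and>
      DAE_op t u' (y t) = w t" by (auto simp: quasi_def)
    have int: "(\<lambda>t. norm (w t)) integrable_on {?\<alpha> .. ?\<beta>}"
      using q sub by (auto simp: quasi_def intro: integrable_on_subinterval)
    have "infdist (y s') (KK \<mu> s') \<le> C * (infdist (y s) (KK \<mu> s) + integral {?\<alpha> .. ?\<beta>} (\<lambda>t. norm (w t)))"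
    proof -
      have "continuous_on {?\<alpha> .. ?\<beta>} (\<lambda>s. (Dmat :: real^('k+'r)^'k) *v y s)"
        using q continuous_on_subset[OF _ sub] unfolding quasi_def by blast
      moreover have "\<forall>t\<in>{?\<alpha> <..< ?\<beta>} - S. \<exists>u'. ((\<lambda>s. (Dmat :: real^('k+'r)^'k) *v y s) has_vector_derivative u') (at t) \<and> DAE_op t u' (y t) = w t"
        using S(2) by auto
      ultimately show ?thesis
        using pr[unfolded propagates_def, rule_format, of ?\<alpha> ?\<beta> S y w s s'] cond S(1) int that by blast
    qed
    also have "\<dots> \<le> C * (infdist (y s) (KK \<mu> s) + integral {a..b} (\<lambda>t. norm (w t)))"
      using C q sub int by (intro mult_left_mono add_left_mono integral_subset_le) (auto simp: quasi_def)
    finally show "infdist (y s') (KK \<mu> s') \<le> C * (infdist (y s) (KK \<mu> s) + integral {a..b} (\<lambda>t. norm (w t)))" .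
  qed
  show ?thesis
  proof (rule exI[of _ \<epsilon>], rule conjI[OF \<epsilon>], rule exI[of _ C], intro ballI impI conjI)
    fix s assume "s \<in> {a..b}" "\<bar>s - t\<bar> < \<epsilon>"
    then have "s \<in> {?\<alpha> .. ?\<beta>}" "t \<in> {?\<alpha> .. ?\<beta>}" using t \<epsilon> by auto
    then show "transports C s t" "transports C t s" using main by auto
  qed
qed

text \<open>Transport in both directions is an equivalence relation with open classes
  (\<open>transports_local\<close>), and {a..b} is connected.\<close>

lemma transports_global:
  assumes "s \<in> {a..b}" "t \<in> {a..b}"
  shows "\<exists>C. transports C s t"
proof -
  have "(\<exists>C. transports C s t) \<and> (\<exists>C. transports C t s)"
  proof (rule connected_equivalence_relation[of "{a..b}" s t])
    fix t assume t: "t \<in> {a..b}"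
    obtain \<delta> C where \<delta>: "0 < \<delta>" "\<forall>s\<in>{a..b}. \<bar>s - t\<bar> < \<delta> \<longrightarrow> transports C s t \<and> transports C t s"
      using transports_local[OF t] by blast
    show "\<exists>T. openin (top_of_set {a..b}) T \<and> t \<in> T \<and>
        (\<forall>x\<in>T. (\<exists>C. transports C t x) \<and> (\<exists>C. transports C x t))"
    proof (intro exI[of _ "{a..b} \<inter> ball t \<delta>"] conjI ballI)
      show "openin (top_of_set {a..b}) ({a..b} \<inter> ball t \<delta>)" by (simp add: openin_open_Int)
    qed (use t \<delta> in \<open>auto simp: dist_real_def abs_minus_commute\<close>)
  next
    fix x y z assume "(\<exists>C. transports C x y) \<and> (\<exists>C. transports C y x)"
      "(\<exists>C. transports C y z) \<and> (\<exists>C. transports C z y)"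
    then show "(\<exists>C. transports C x z) \<and> (\<exists>C. transports C z x)"
      using transports_trans by meson
  qed (use assms in auto)
  then show ?thesis by blast
qed

text \<open>Transport from a to t and from there to the points near t gives a constant that is
  locally uniform in the end point; compactness makes it uniform.\<close>

lemma propagation: "\<exists>C\<ge>0. \<forall>t\<in>{a..b}. \<forall>y w. quasi y w \<longrightarrow>
    infdist (y t) (KK \<mu> t) \<le> C * (infdist (y a) (KK \<mu> a) + integral {a..b} (\<lambda>t. norm (w t)))"
proof -
  have a: "a \<in> {a..b}" using ab by simp
  have "\<exists>C\<ge>0. \<forall>t\<in>{a..b}. \<forall>y w. quasi y w \<longrightarrow>
    infdist (y t) (KK \<mu> t) \<le> C * (infdist (y a) (KK \<mu> a) + integral {a..b} (\<lambda>t. norm (w t)))"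
  proof (rule compact_uniform_constant)
    fix t assume t: "t \<in> {a..b}"
    obtain \<delta> C where \<delta>: "0 < \<delta>" "\<forall>s\<in>{a..b}. \<bar>s - t\<bar> < \<delta> \<longrightarrow> transports C s t \<and> transports C t s"
      using transports_local[OF t] by blast
    obtain C1 where C1: "transports C1 a t" using transports_global[OF a t] by blast
    have tr: "transports (C * (C1 + 1)) a s" if "s \<in> {a..b}" "\<bar>s - t\<bar> < \<delta>" for s
      using transports_trans[OF C1, of C s] \<delta> that by blast
    show "\<exists>\<delta>>0. \<exists>C\<ge>0. \<forall>s\<in>{a..b}. \<bar>s - t\<bar> < \<delta> \<longrightarrow> (\<forall>y w. quasi y w \<longrightarrow>
        infdist (y s) (KK \<mu> s) \<le> C * (infdist (y a) (KK \<mu> a) + integral {a..b} (\<lambda>t. norm (w t))))"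
    proof (rule exI[of _ \<delta>], rule conjI[OF \<delta>(1)], rule exI[of _ "C * (C1 + 1)"], rule conjI)
      have "transports (C * (C1 + 1)) a t" using tr[OF t] \<delta> by simp
      then show "0 \<le> C * (C1 + 1)" by (simp add: transports_def)
    qed (use tr in \<open>auto simp: transports_def\<close>)
  next
    fix C C' s :: real
    assume le: "C \<le> C'" and P: "\<forall>y w. quasi y w \<longrightarrow>
      infdist (y s) (KK \<mu> s) \<le> C * (infdist (y a) (KK \<mu> a) + integral {a..b} (\<lambda>t. norm (w t)))"
    show "\<forall>y w. quasi y w \<longrightarrow>
      infdist (y s) (KK \<mu> s) \<le> C' * (infdist (y a) (KK \<mu> a) + integral {a..b} (\<lambda>t. norm (w t)))"
    proof (intro allI impI)
      fix y w assume q: "quasi y w"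
      have "infdist (y s) (KK \<mu> s) \<le> C * (infdist (y a) (KK \<mu> a) + integral {a..b} (\<lambda>t. norm (w t)))"
        using P q by blast
      also have "\<dots> \<le> C' * (infdist (y a) (KK \<mu> a) + integral {a..b} (\<lambda>t. norm (w t)))"
        using le infdist_nonneg q by (intro mult_right_mono add_nonneg_nonneg integral_nonneg) (auto simp: quasi_def)
      finally show "infdist (y s) (KK \<mu> s) \<le> C' * (infdist (y a) (KK \<mu> a) + integral {a..b} (\<lambda>t. norm (w t)))" .
    qed
  qed simp
  then show ?thesis .
qed

end

section \<open>Lagrange interpolation and inverse inequalities for polynomials\<close>

definition lagrange_poly :: "nat \<Rightarrow> (nat \<Rightarrow> real) \<Rightarrow> nat \<Rightarrow> real poly" where
  "lagrange_poly M \<sigma> i = (\<Prod>\<kappa>\<in>{1..M} - {i}. smult (1 / (\<sigma> i - \<sigma> \<kappa>)) [:- \<sigma> \<kappa>, 1:])"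

lemma poly_lagrange_poly: "poly (lagrange_poly M \<sigma> i) s = lagrange M \<sigma> i s"
  unfolding lagrange_poly_def lagrange_def poly_prod by (intro prod.cong) (simp_all add: diff_divide_distrib)

lemma degree_lagrange_poly: "i \<in> {1..M} \<Longrightarrow> degree (lagrange_poly M \<sigma> i) \<le> M - 1"
proof -
  assume i: "i \<in> {1..M}"
  have "degree (lagrange_poly M \<sigma> i) \<le> sum (degree \<circ> (\<lambda>\<kappa>. smult (1 / (\<sigma> i - \<sigma> \<kappa>)) [:- \<sigma> \<kappa>, 1:])) ({1..M} - {i})"
    unfolding lagrange_poly_def by (rule degree_prod_sum_le) simp
  also have "\<dots> \<le> sum (\<lambda>_. 1) ({1..M} - {i})"
    by (intro sum_mono) (simp add: degree_smult_eq)
  also have "\<dots> = M - 1" using i by simp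
  finally show ?thesis .
qed

lemma lagrange_node:
  assumes "inj_on \<sigma> {1..M}" "i \<in> {1..M}" "k \<in> {1..M}"
  shows "lagrange M \<sigma> i (\<sigma> k) = (if i = k then 1 else 0)"
proof (cases "i = k")
  case True
  then show ?thesis
  proof -
    have "(\<Prod>\<kappa>\<in>{1..M} - {i}. (\<sigma> i - \<sigma> \<kappa>) / (\<sigma> i - \<sigma> \<kappa>)) = 1"
    proof (rule prod.neutral, rule ballI)
      fix \<kappa> assume "\<kappa> \<in> {1..M} - {i}"
      then have "\<sigma> i \<noteq> \<sigma> \<kappa>" using inj_onD[OF assms(1), of i \<kappa>] assms(2) by blast
      then show "(\<sigma> i - \<sigma> \<kappa>) / (\<sigma> i - \<sigma> \<kappa>) = 1" by simp
    qed
    then show ?thesis using True by (simp only: lagrange_def) simp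
  qed
next
  case False
  then have "k \<in> {1..M} - {i}" using assms by auto
  then have "\<exists>\<kappa>\<in>{1..M} - {i}. (\<sigma> k - \<sigma> \<kappa>) / (\<sigma> i - \<sigma> \<kappa>) = 0"
    by (rule bexI[rotated]) simp
  from prod_zero[OF _ this] show ?thesis using False by (simp only: lagrange_def) simp
qed

lemma lagrange_interpolation:
  assumes \<sigma>: "inj_on \<sigma> {1..M}" and p: "degree p < M"
  shows "p = (\<Sum>i=1..M. smult (poly p (\<sigma> i)) (lagrange_poly M \<sigma> i))"
proof (rule poly_eqI_degree[of "\<sigma> ` {1..M}"])
  fix x assume "x \<in> \<sigma> ` {1..M}"
  then obtain k where k: "k \<in> {1..M}" "x = \<sigma> k" by auto
  have "poly (\<Sum>i=1..M. smult (poly p (\<sigma> i)) (lagrange_poly M \<sigma> i)) x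
      = (\<Sum>i=1..M. poly p (\<sigma> i) * (if i = k then 1 else 0))"
    using k lagrange_node[OF \<sigma>] by (auto simp: poly_sum poly_lagrange_poly intro!: sum.cong)
  also have "\<dots> = poly p x" using k by (simp add: if_distrib[of "\<lambda>y. _ * y"] cong: if_cong)
  finally show "poly p x = poly (\<Sum>i=1..M. smult (poly p (\<sigma> i)) (lagrange_poly M \<sigma> i)) x" ..
next
  have c: "card (\<sigma> ` {1..M}) = M" using card_image[OF \<sigma>] by simp
  show "card (\<sigma> ` {1..M}) > degree p" using p c by simp
  have "degree (\<Sum>i=1..M. smult (poly p (\<sigma> i)) (lagrange_poly M \<sigma> i)) \<le> M - 1"
    by (intro degree_sum_le finite_atLeastAtMost order_trans[OF degree_smult_le degree_lagrange_poly])
  then show "card (\<sigma> ` {1..M}) > degree (\<Sum>i=1..M. smult (poly p (\<sigma> i)) (lagrange_poly M \<sigma> i))"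
    using p c by simp
qed

corollary poly_lagrange:
  assumes "inj_on \<sigma> {1..M}" "degree p < M"
  shows "poly p s = (\<Sum>i=1..M. lagrange M \<sigma> i s * poly p (\<sigma> i))"
  using arg_cong[OF lagrange_interpolation[OF assms], of "\<lambda>p. poly p s"]
  by (simp add: poly_sum poly_lagrange_poly mult.commute)

lemma pderiv_sum: "pderiv (sum f I) = (\<Sum>i\<in>I. pderiv (f i))"
  by (induction I rule: infinite_finite_induct) (simp_all add: pderiv_add)

lemma poly_antiderivative:
  fixes p :: "real poly"
  obtains P where "pderiv P = p" "degree P \<le> degree p + 1" "poly P 0 = 0"
proof
  let ?P = "\<Sum>i\<le>degree p. monom (coeff p i / real (Suc i)) (Suc i)"
  have "pderiv ?P = (\<Sum>i\<le>degree p. monom (coeff p i) i)"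
    by (simp add: pderiv_sum pderiv_monom)
  then show "pderiv ?P = p" by (simp add: poly_as_sum_of_monoms)
  show "degree ?P \<le> degree p + 1"
    by (intro degree_sum_le) (auto intro: order_trans[OF degree_monom_le])
  show "poly ?P 0 = 0" by (simp add: poly_sum poly_monom)
qed

lemma higher_pderiv_sum: "(pderiv ^^ j) (sum f I) = (\<Sum>i\<in>I. (pderiv ^^ j) (f i))"
  by (induction j) (simp_all add: pderiv_sum)

lemma higher_pderiv_smult: "(pderiv ^^ j) (smult c p) = smult c ((pderiv ^^ j) p)"
  by (induction j) (simp_all add: pderiv_smult)

lemma degree_higher_pderiv: "degree ((pderiv ^^ j) p) = degree p - j" for p :: "real poly"
  by (induction j) (simp_all add: degree_pderiv)

lemma higher_pderiv_eq_0: "degree p < j \<Longrightarrow> (pderiv ^^ j) p = 0" for p :: "real poly"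
proof (induction j)
  case (Suc j)
  then show ?case
    using degree_higher_pderiv[of j p]
    by (cases "degree p < j") (auto simp: pderiv_eq_0_iff)
qed simp

lemma continuous_on_poly_abs: "continuous_on S (\<lambda>s. \<bar>poly p s\<bar>)" for p :: "real poly"
  by (intro continuous_intros)

(* The antiderivative of p is bounded by the L1 norm of p and is reproduced by interpolation at fixed nodes. *)
lemma higher_pderiv_le_L1_unit:
  "\<exists>C\<ge>0. \<forall>(p :: real poly) s. degree p \<le> L \<longrightarrow> s \<in> {0..1} \<longrightarrow>
     \<bar>poly ((pderiv ^^ j) p) s\<bar> \<le> C * integral {0..1} (\<lambda>s. \<bar>poly p s\<bar>)"
proof -
  \<comment> \<open>The antiderivative has degree at most L + 1, and reproduction by interpolation
    requires degree below the number of nodes.\<close>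
  define M where "M = L + 2"
  define \<sigma> where "\<sigma> i = real i / real M" for i
  have M: "0 < M" by (simp add: M_def)
  have \<sigma>: "inj_on \<sigma> {1..M}" using M by (auto simp: \<sigma>_def inj_on_def)
  have \<sigma>01: "\<sigma> i \<in> {0..1}" if "i \<in> {1..M}" for i using that M by (auto simp: \<sigma>_def divide_simps)
  let ?l = "\<lambda>i. (pderiv ^^ Suc j) (lagrange_poly M \<sigma> i)"
  have "\<exists>K. 0 \<le> K \<and> (\<forall>s\<in>{0..1}. \<bar>poly (?l i) s\<bar> \<le> K)" for i
  proof -
    have "bounded ((\<lambda>s. poly (?l i) s) ` {0..1})"
      by (intro compact_imp_bounded compact_continuous_image continuous_intros) auto
    then obtain K where "\<And>s. s \<in> {0..1} \<Longrightarrow> \<bar>poly (?l i) s\<bar> \<le> K" by (force simp: bounded_iff)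
    then show ?thesis by (intro exI[of _ "\<bar>K\<bar>"]) force
  qed
  then have "\<forall>i. \<exists>K. 0 \<le> K \<and> (\<forall>s\<in>{0..1}. \<bar>poly (?l i) s\<bar> \<le> K)" by blast
  from choice[OF this] obtain K where K: "\<forall>i. 0 \<le> K i \<and> (\<forall>s\<in>{0..1}. \<bar>poly (?l i) s\<bar> \<le> K i)" ..
  have K0: "0 \<le> (\<Sum>i=1..M. K i)" using K by (intro sum_nonneg) auto
  show ?thesis
  proof (rule exI[of _ "\<Sum>i=1..M. K i"], rule conjI[OF K0], intro allI impI)
    fix p :: "real poly" and s :: real assume p: "degree p \<le> L" and s: "s \<in> {0..1}"
    let ?I = "integral {0..1} (\<lambda>s. \<bar>poly p s\<bar>)"
    obtain P where P: "pderiv P = p" "degree P \<le> degree p + 1" "poly P 0 = 0"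
      by (rule poly_antiderivative)
    have ip: "(\<lambda>s. \<bar>poly p s\<bar>) integrable_on {c..d}" for c d
      by (intro integrable_continuous_real continuous_on_poly_abs)
    have PI: "\<bar>poly P z\<bar> \<le> ?I" if z: "z \<in> {0..1}" for z
    proof -
      have "(poly p has_integral poly P z - poly P 0) {0..z}"
        using z P(1) by (intro fundamental_theorem_of_calculus)
          (auto simp: has_real_derivative_iff_has_vector_derivative[symmetric] intro: poly_DERIV[THEN DERIV_subset])
      then have "integral {0..z} (poly p) = poly P z" "poly p integrable_on {0..z}"
        using P(3) by (auto simp: has_integral_iff)
      then have "\<bar>poly P z\<bar> \<le> integral {0..z} (\<lambda>s. \<bar>poly p s\<bar>)"
        using integral_norm_bound_integral[of "poly p" "{0..z}" "\<lambda>s. \<bar>poly p s\<bar>"] ip by simp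
      also have "\<dots> \<le> ?I" using z ip by (intro integral_subset_le) auto
      finally show ?thesis .
    qed
    have I0: "0 \<le> ?I" by (intro integral_nonneg ip) auto
    have "P = (\<Sum>i=1..M. smult (poly P (\<sigma> i)) (lagrange_poly M \<sigma> i))"
      using P(2) p by (intro lagrange_interpolation \<sigma>) (simp add: M_def)
    then have "(pderiv ^^ Suc j) P = (\<Sum>i=1..M. smult (poly P (\<sigma> i)) (?l i))"
      by (metis (no_types, lifting) higher_pderiv_smult higher_pderiv_sum sum.cong)
    then have "(pderiv ^^ j) p = (\<Sum>i=1..M. smult (poly P (\<sigma> i)) (?l i))"
      by (simp add: funpow_Suc_right P(1) del: funpow.simps)
    then have "\<bar>poly ((pderiv ^^ j) p) s\<bar> = \<bar>\<Sum>i=1..M. poly P (\<sigma> i) * poly (?l i) s\<bar>"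
      by (simp add: poly_sum del: funpow.simps)
    also have "\<dots> \<le> (\<Sum>i=1..M. ?I * K i)"
    proof (rule order_trans[OF sum_abs sum_mono])
      fix i assume "i \<in> {1..M}"
      then show "\<bar>poly P (\<sigma> i) * poly (?l i) s\<bar> \<le> ?I * K i"
        unfolding abs_mult using PI[OF \<sigma>01] K s I0 by (intro mult_mono) auto
    qed
    also have "\<dots> = (\<Sum>i=1..M. K i) * ?I" by (simp add: sum_distrib_right mult.commute)
    finally show "\<bar>poly ((pderiv ^^ j) p) s\<bar> \<le> (\<Sum>i=1..M. K i) * ?I" .
  qed
qed

text \<open>The square of f minus its mean has nonnegative integral.\<close>

lemma integral_Cauchy_Schwarz_1:
  fixes f :: "real \<Rightarrow> real"
  assumes "a \<le> b" and f: "f integrable_on {a..b}" and f2: "(\<lambda>s. (f s)\<^sup>2) integrable_on {a..b}"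
  shows "(integral {a..b} f)\<^sup>2 \<le> (b - a) * integral {a..b} (\<lambda>s. (f s)\<^sup>2)"
proof (cases "a = b")
  case False
  then have ab: "a < b" using assms by simp
  define m where "m = integral {a..b} f / (b - a)"
  have "((\<lambda>s. (f s)\<^sup>2 - 2 * m * f s + m\<^sup>2) has_integral
      integral {a..b} (\<lambda>s. (f s)\<^sup>2) - 2 * m * integral {a..b} f + m\<^sup>2 * (b - a)) {a..b}"
    using has_integral_const_real[of "m\<^sup>2" a b] ab
    by (intro has_integral_add has_integral_diff has_integral_mult_right integrable_integral f f2)
      (simp add: mult.commute)
  moreover have "0 \<le> (f s)\<^sup>2 - 2 * m * f s + m\<^sup>2" for s
    using zero_le_power2[of "f s - m"] by (simp add: power2_diff algebra_simps)
  ultimately have "0 \<le> integral {a..b} (\<lambda>s. (f s)\<^sup>2) - 2 * m * integral {a..b} f + m\<^sup>2 * (b - a)"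
    by (rule has_integral_nonneg) 
  moreover have m: "m * (b - a) = integral {a..b} f" using ab by (simp add: m_def)
  then have "m\<^sup>2 * (b - a) = m * integral {a..b} f" by (simp add: power2_eq_square mult.assoc)
  ultimately have "m * integral {a..b} f \<le> integral {a..b} (\<lambda>s. (f s)\<^sup>2)" by simp
  then have "(b - a) * (m * integral {a..b} f) \<le> (b - a) * integral {a..b} (\<lambda>s. (f s)\<^sup>2)"
    using ab by (intro mult_left_mono) auto
  moreover have "(b - a) * (m * integral {a..b} f) = (integral {a..b} f)\<^sup>2"
    using m by (simp add: power2_eq_square flip: mult.assoc) (simp add: mult.commute)
  ultimately show ?thesis by simp
qed simp

lemma higher_pderiv_pcompose_linear:
  "(pderiv ^^ j) (pcompose p [:c, h:]) = smult (h ^ j) (pcompose ((pderiv ^^ j) p) [:c, h:])" for p :: "real poly"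
  by (induction j) (simp_all add: pderiv_smult pderiv_pcompose pderiv_pCons mult.commute)

(* Inverse inequality, in a form that only uses h ^ j. *)
lemma inverse_inequality:
  "\<exists>C\<ge>0. \<forall>(p :: real poly) c h. degree p \<le> L \<longrightarrow> 0 < h \<longrightarrow>
     (h ^ j)\<^sup>2 * integral {c..c+h} (\<lambda>s. (poly ((pderiv ^^ j) p) s)\<^sup>2) \<le> C * integral {c..c+h} (\<lambda>s. (poly p s)\<^sup>2)"
proof -
  from higher_pderiv_le_L1_unit[of L j] obtain C
    where C0: "0 \<le> C \<and> (\<forall>(p :: real poly) s. degree p \<le> L \<longrightarrow> s \<in> {0..1} \<longrightarrow>
     \<bar>poly ((pderiv ^^ j) p) s\<bar> \<le> C * integral {0..1} (\<lambda>s. \<bar>poly p s\<bar>))" ..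
  have C: "0 \<le> C" "degree p \<le> L \<Longrightarrow> s \<in> {0..1} \<Longrightarrow>
     \<bar>poly ((pderiv ^^ j) p) s\<bar> \<le> C * integral {0..1} (\<lambda>s. \<bar>poly p s\<bar>)" for p :: "real poly" and s
    using C0 by simp_all
  have C20: "0 \<le> C\<^sup>2" by simp
  show ?thesis
  proof (rule exI[of _ "C\<^sup>2"], rule conjI[OF C20], intro allI impI)
    fix p :: "real poly" and c h :: real
    assume p: "degree p \<le> L" and h: "0 < h"
    let ?I = "integral {c..c+h} (\<lambda>s. (poly p s)\<^sup>2)"
    let ?A = "integral {c..c+h} (\<lambda>s. \<bar>poly p s\<bar>)"
    let ?q = "pcompose p [:c, h:]"
    have "((\<lambda>s. \<bar>poly p s\<bar>) has_integral ?A) (cbox c (c+h))"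
      by (simp add: integrable_integral integrable_continuous_real continuous_on_poly_abs)
    from has_integral_affinity'[OF this h, of c]
    have "((\<lambda>s. \<bar>poly ?q s\<bar>) has_integral ?A / h) {0..1}"
      using h by (simp add: poly_pcompose algebra_simps divide_inverse)
    then have A: "integral {0..1} (\<lambda>s. \<bar>poly ?q s\<bar>) = ?A / h" by (simp add: has_integral_iff)
    have dq: "degree ?q \<le> L" using p degree_pcompose_le[of p "[:c, h:]"] by (auto intro: order_trans)
    \<comment> \<open>The estimate on the unit interval, applied to \<open>?q\<close>; the chain
      rule produces the factor h^j.\<close>
    have sup: "h ^ j * \<bar>poly ((pderiv ^^ j) p) s\<bar> \<le> C * (?A / h)" if s: "s \<in> {c..c+h}" for s
    proof -
      have "(s - c) / h \<in> {0..1}" using s h by (simp add: field_simps)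
      from C(2)[OF dq this, unfolded A] h show ?thesis
        by (simp add: higher_pderiv_pcompose_linear poly_pcompose abs_mult)
    qed
    have A0: "0 \<le> ?A" by (intro integral_nonneg integrable_continuous_real continuous_on_poly_abs) auto
    have A2: "?A\<^sup>2 \<le> h * ?I"
      using integral_Cauchy_Schwarz_1[of c "c+h" "\<lambda>s. \<bar>poly p s\<bar>"] h
      by (simp add: integrable_continuous_real continuous_on_poly_abs continuous_intros)
    have "(h ^ j)\<^sup>2 * integral {c..c+h} (\<lambda>s. (poly ((pderiv ^^ j) p) s)\<^sup>2) =
        integral {c..c+h} (\<lambda>s. (h ^ j * \<bar>poly ((pderiv ^^ j) p) s\<bar>)\<^sup>2)"
      by (simp add: power_mult_distrib)
    also have "\<dots> \<le> integral {c..c+h} (\<lambda>s. (C * (?A / h))\<^sup>2)"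
      using sup h by (intro integral_le integrable_continuous_real continuous_intros power_mono) auto
    also have "\<dots> = C\<^sup>2 * (?A\<^sup>2 / h)" using h by (simp add: power_mult_distrib power_divide power2_eq_square)
    also have "\<dots> \<le> C\<^sup>2 * ?I"
      using A2 h by (intro mult_left_mono) (auto simp: field_simps)
    finally show "(h ^ j)\<^sup>2 * integral {c..c+h} (\<lambda>s. (poly ((pderiv ^^ j) p) s)\<^sup>2) \<le> C\<^sup>2 * ?I" .
  qed
qed

section \<open>Partitions and piecewise polynomials\<close>

lemma partition_less:
  assumes p: "is_partition a b n t" and "i < j" "j \<le> n" shows "t i < t j"
  using assms(2,3)
proof (induction j)
  case (Suc j)
  have "t j < t (Suc j)" using p Suc.prems by (auto simp: is_partition_def dest: bspec[of _ _ "Suc j"])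
  with Suc show ?case by (cases "i = j") auto
qed simp

lemma partition_le: "is_partition a b n t \<Longrightarrow> i \<le> j \<Longrightarrow> j \<le> n \<Longrightarrow> t i \<le> t j"
  using partition_less[of a b n t i j] by (cases "i = j") auto

lemma partition_ends: "is_partition a b n t \<Longrightarrow> t 0 = a \<and> t n = b \<and> 1 \<le> n"
  by (simp add: is_partition_def)

lemma partition_mem:
  assumes "is_partition a b n t" "j \<le> n" shows "a \<le> t j" "t j \<le> b"
  using partition_le[OF assms(1), of 0 j] partition_le[OF assms(1), of j n] assms partition_ends[OF assms(1)] by auto

lemma partition_step: "is_partition a b n t \<Longrightarrow> j \<in> {1..n} \<Longrightarrow> t (j - 1) < t j"
  by (simp add: is_partition_def)

lemma partition_piece_subset:
  assumes "is_partition a b n t" "j \<in> {1..n}" shows "{t (j - 1)..t j} \<subseteq> {a..b}"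
  using partition_mem[OF assms(1), of j] partition_mem[OF assms(1), of "j - 1"] assms(2) by auto

(* Index of the subinterval containing s; the last subinterval is closed on the right. *)
definition idx :: "nat \<Rightarrow> (nat \<Rightarrow> real) \<Rightarrow> real \<Rightarrow> nat" where
  "idx n t s = (if s < t n then LEAST j. s < t j else n)"

lemma idx_eq:
  assumes p: "is_partition a b n t" and j: "j \<in> {1..n}" and s: "s \<in> {t (j - 1)..<t j}"
  shows "idx n t s = j"
proof -
  have "s < t n" using s partition_le[OF p, of j n] j by auto
  moreover have "(LEAST j. s < t j) = j"
  proof (rule Least_equality)
    show "s < t j" using s by simp
    fix i assume i: "s < t i"
    show "j \<le> i"
    proof (rule ccontr)
      assume "\<not> j \<le> i"
      then have "t i \<le> t (j - 1)" using partition_le[OF p, of i "j - 1"] j by auto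
      then show False using i s by auto
    qed
  qed
  ultimately show ?thesis by (simp add: idx_def)
qed

lemma idx_b: "is_partition a b n t \<Longrightarrow> idx n t b = n"
  by (simp add: idx_def is_partition_def)

lemma partition_cover:
  assumes p: "is_partition a b n t" and s: "s \<in> {a..<b}"
  obtains j where "j \<in> {1..n}" "s \<in> {t (j - 1)..<t j}"
proof -
  define j where "j = (LEAST j. s < t j)"
  have e: "s < t n" using s partition_ends[OF p] by simp
  have j1: "s < t j" unfolding j_def by (rule LeastI[of _ n]) (rule e)
  have jn: "j \<le> n" unfolding j_def by (rule Least_le) (rule e)
  have j0: "j \<noteq> 0" using j1 s partition_ends[OF p] by (intro notI) auto
  have "\<not> s < t (j - 1)" using not_less_Least[of "j - 1" "\<lambda>j. s < t j"] j0 by (simp add: j_def)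
  then show ?thesis using that[of j] j0 jn j1 by auto
qed

lemma partition_cover_closed:
  assumes p: "is_partition a b n t" and s: "s \<in> {a..b}"
  obtains j where "j \<in> {1..n}" "s \<in> {t (j - 1)..t j}" "idx n t s = j"
proof (cases "s < b")
  case True
  then obtain j where j: "j \<in> {1..n}" "s \<in> {t (j - 1)..<t j}"
    using partition_cover[OF p, of s] s by auto
  then show ?thesis using that[of j] idx_eq[OF p j] by auto
next
  case False
  then have "s = b" using s by simp
  then show ?thesis using that[of n] idx_b[OF p] partition_ends[OF p] partition_step[OF p, of n] by auto
qed

text \<open>The values of f at mesh points are immaterial, as finitely many points do not influence
  the integral. Hence f may jump there, while each g j is continuous up to both ends of its
  piece.\<close>

lemma integral_pieces_aux:
  fixes f :: "real \<Rightarrow> 'v::euclidean_space"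
  assumes p: "is_partition a b n t" and "m \<le> n"
    and c: "\<And>j. j \<in> {1..n} \<Longrightarrow> continuous_on {t (j - 1)..t j} (g j)"
    and e: "\<And>j s. j \<in> {1..n} \<Longrightarrow> s \<in> {t (j - 1)<..<t j} \<Longrightarrow> f s = g j s"
  shows "(f has_integral (\<Sum>j=1..m. integral {t (j - 1)..t j} (g j))) {a..t m}"
  using assms(2)
proof (induction m)
  case 0 then show ?case using partition_ends[OF p] by (simp add: has_integral_refl)
next
  case (Suc m)
  have j: "Suc m \<in> {1..n}" using Suc.prems by simp
  have "(g (Suc m) has_integral integral {t m..t (Suc m)} (g (Suc m))) {t m..t (Suc m)}"
    using c[OF j] by (simp add: integrable_integral integrable_continuous_real)
  then have "(f has_integral integral {t m..t (Suc m)} (g (Suc m))) {t m..t (Suc m)}"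
    by (rule has_integral_spike_finite[of "{t m, t (Suc m)}", rotated 2]) (use e[OF j] in auto)
  from has_integral_combine[OF _ _ Suc.IH this] show ?case
    using partition_mem[OF p, of m] partition_le[OF p, of m "Suc m"] Suc.prems by simp
qed

lemma integral_pieces:
  fixes f :: "real \<Rightarrow> 'v::euclidean_space"
  assumes p: "is_partition a b n t"
    and c: "\<And>j. j \<in> {1..n} \<Longrightarrow> continuous_on {t (j - 1)..t j} (g j)"
    and e: "\<And>j s. j \<in> {1..n} \<Longrightarrow> s \<in> {t (j - 1)<..<t j} \<Longrightarrow> f s = g j s"
  shows "f integrable_on {a..b}" "integral {a..b} f = (\<Sum>j=1..n. integral {t (j - 1)..t j} (g j))"
  using integral_pieces_aux[OF p order_refl c e] partition_ends[OF p] by (auto simp: has_integral_iff)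

definition pval :: "('c \<Rightarrow> real poly) \<Rightarrow> real \<Rightarrow> real ^ 'c::finite" where
  "pval p s = (\<chi> c. poly (p c) s)"

text \<open>Ansatz functions are encoded by families of polynomials P j c, one for each piece j and
  component c. By the convention for \<open>idx\<close> the last polynomial also gives the value at
  b, and the restriction makes the function extensional as the ansatz space demands.\<close>

definition pw :: "nat \<Rightarrow> (nat \<Rightarrow> real) \<Rightarrow> (nat \<Rightarrow> 'c \<Rightarrow> real poly) \<Rightarrow> real \<Rightarrow> real ^ 'c::finite" where
  "pw n t P = restrict (\<lambda>s. pval (P (idx n t s)) s) {t 0..t n}"

text \<open>The second clause is continuity of D x at the interior mesh points. Only the members
  with index 1 to n count.\<close>

definition admissible_family ::
  "nat \<Rightarrow> nat \<Rightarrow> (nat \<Rightarrow> real) \<Rightarrow> (nat \<Rightarrow> 'k + 'r \<Rightarrow> real poly) \<Rightarrow> bool" where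
  "admissible_family N n t P \<longleftrightarrow>
     (\<forall>j\<in>{1..n}. \<forall>c. degree (P j c) \<le> (case c of Inl _ \<Rightarrow> N | Inr _ \<Rightarrow> N - 1)) \<and>
     (\<forall>j\<in>{1..<n}. \<forall>i. poly (P j (Inl i)) (t j) = poly (P (Suc j) (Inl i)) (t j))"

lemma continuous_on_pval: "continuous_on S (pval p)"
  unfolding pval_def by (intro continuous_on_vec_lambda continuous_intros)

lemma Dmat_nth': "((Dmat :: real^('k::finite+'r::finite)^'k) *v x) $ i = x $ Inl i"
  by (simp add: Dmat_def matrix_vector_mult_def if_distrib[of "\<lambda>y. y * _"] cong: if_cong)

lemma pw_eq:
  assumes "is_partition a b n t" "j \<in> {1..n}" "s \<in> {t (j - 1)..<t j}"
  shows "pw n t P s = pval (P j) s"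
  using idx_eq[OF assms] partition_piece_subset[OF assms(1,2)] assms(3) partition_ends[OF assms(1)]
  by (auto simp: pw_def)

lemma pw_b: "is_partition a b n t \<Longrightarrow> pw n t P b = pval (P n) b"
  using partition_mem[of a b n t 0] by (simp add: pw_def idx_b is_partition_def)

lemma pw_Dmat:
  fixes P :: "nat \<Rightarrow> 'k::finite + 'r::finite \<Rightarrow> real poly"
  assumes p: "is_partition a b n t" and P: "admissible_family N n t P" and j: "j \<in> {1..n}"
    and s: "s \<in> {t (j - 1)..t j}"
  shows "Dmat *v pw n t P s = (Dmat *v pval (P j) s :: real^'k)"
proof (cases "s < t j")
  case True
  then show ?thesis using pw_eq[OF p j, of s P] s by simp
next
  case False
  then have sj: "s = t j" using s by simp
  show ?thesis
  proof (cases "j = n")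
    case True
    then show ?thesis using sj pw_b[OF p, of P] partition_ends[OF p] by simp
  next
    case False
    then have j': "Suc j \<in> {1..n}" "j \<in> {1..<n}" using j by auto
    have "pw n t P s = pval (P (Suc j)) s"
      using pw_eq[OF p j'(1), of s P] sj partition_step[OF p j'(1)] by simp
    then show ?thesis using P j' sj by (simp add: vec_eq_iff Dmat_nth' pval_def admissible_family_def)
  qed
qed

lemma pw_Dmat_continuous:
  fixes P :: "nat \<Rightarrow> 'k::finite + 'r::finite \<Rightarrow> real poly"
  assumes p: "is_partition a b n t" and P: "admissible_family N n t P"
  shows "continuous_on {a..b} (\<lambda>s. Dmat *v pw n t P s :: real^'k)"
proof -
  have "continuous_on {t 0..t m} (\<lambda>s. Dmat *v pw n t P s :: real^'k)" if "m \<le> n" for m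
    using that
  proof (induction m)
    case (Suc m)
    have j: "Suc m \<in> {1..n}" using Suc.prems by simp
    have "continuous_on {t m..t (Suc m)} (\<lambda>s. Dmat *v pval (P (Suc m)) s :: real^'k)"
      by (intro bounded_linear.continuous_on[OF matrix_vector_mul_bounded_linear] continuous_on_pval)
    then have "continuous_on {t m..t (Suc m)} (\<lambda>s. Dmat *v pw n t P s :: real^'k)"
      by (rule continuous_on_eq) (simp add: pw_Dmat[OF p P j])
    with Suc have "continuous_on ({t 0..t m} \<union> {t m..t (Suc m)}) (\<lambda>s. Dmat *v pw n t P s :: real^'k)"
      by (intro continuous_on_closed_Un) auto
    moreover have "{t 0..t m} \<union> {t m..t (Suc m)} = {t 0..t (Suc m)}"
      using partition_le[OF p, of 0 m] partition_le[OF p, of m "Suc m"] Suc.prems by auto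
    ultimately show ?case by simp
  qed simp
  from this[of n] show ?thesis using partition_ends[OF p] by simp
qed

lemma pw_in_ansatz_space:
  fixes P :: "nat \<Rightarrow> 'k::finite + 'r::finite \<Rightarrow> real poly"
  assumes p: "is_partition a b n t" and P: "admissible_family N n t P"
  shows "pw n t P \<in> ansatz_space a b N n t"
  unfolding ansatz_space_def
proof (intro CollectI conjI ballI allI)
  show "pw n t P \<in> extensional {a..b}" using partition_ends[OF p] by (simp add: pw_def)
  show "continuous_on {a..b} (\<lambda>s. Dmat *v pw n t P s :: real^'k)" by (rule pw_Dmat_continuous[OF p P])
  show "continuous (at b within {a..b}) (pw n t P)"
  proof (rule continuous_transform_within)
    show "continuous (at b within {a..b}) (pval (P n))"
      using continuous_on_pval[of "{a..b}" "P n"] partition_mem(1)[OF p, of n] partition_ends[OF p]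
      by (auto simp: continuous_on_eq_continuous_within)
    have n: "n \<in> {1..n}" using partition_ends[OF p] by simp
    show "0 < b - t (n - 1)" using partition_step[OF p n] partition_ends[OF p] by simp
    show "b \<in> {a..b}" using partition_mem(1)[OF p, of n] partition_ends[OF p] by auto
    fix s assume s: "s \<in> {a..b}" "dist s b < b - t (n - 1)"
    show "pval (P n) s = pw n t P s"
    proof (cases "s = b")
      case True
      then show ?thesis by (simp only: pw_b[OF p])
    next
      case False
      then have "s \<in> {t (n - 1)..<t n}" using s partition_ends[OF p] by (auto simp: dist_real_def)
      then show ?thesis by (simp only: pw_eq[OF p n])
    qed
  qed
  fix j c assume j: "j \<in> {1..n}"
  show "\<exists>q :: real poly. degree q \<le> (case c of Inl _ \<Rightarrow> N | Inr _ \<Rightarrow> N - 1) \<and>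
      (\<forall>s\<in>{t (j - 1)..<t j}. pw n t P s $ c = poly q s)"
    using P j pw_eq[OF p j, of _ P] by (intro exI[of _ "P j c"]) (auto simp: admissible_family_def pval_def)
qed

lemma poly_eq_on_interval:
  fixes p q :: "real poly"
  assumes "u < v" "\<And>s. s \<in> {u..<v} \<Longrightarrow> poly p s = poly q s"
  shows "p = q"
proof (rule ccontr)
  assume "p \<noteq> q"
  then have "finite {s. poly (p - q) s = 0}" by (intro poly_roots_finite) simp
  moreover have "{u..<v} \<subseteq> {s. poly (p - q) s = 0}" using assms(2) by auto
  ultimately have "finite {u..<v}" by (rule rev_finite_subset)
  then show False using infinite_Ico[OF assms(1)] by simp
qed

lemma piece_eq:
  assumes "t (j - 1) < t j" "\<And>s. s \<in> {t (j - 1)..<t j} \<Longrightarrow> x s $ c = poly p s"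
  shows "piece t x j c = p"
  unfolding piece_def
proof (rule the_equality)
  show "\<forall>s\<in>{t (j - 1)..<t j}. x s $ c = poly p s" using assms(2) by simp
  fix q assume "\<forall>s\<in>{t (j - 1)..<t j}. x s $ c = poly q s"
  then show "q = p" using assms by (intro poly_eq_on_interval[of "t (j - 1)" "t j"]) auto
qed

lemma piece_pw:
  assumes "is_partition a b n t" "j \<in> {1..n}"
  shows "piece t (pw n t P) j c = P j c"
  using partition_step[OF assms] pw_eq[OF assms, of _ P] by (intro piece_eq) (auto simp: pval_def)

lemma continuous_eq_at_right_end:
  fixes f g :: "real \<Rightarrow> 'v::real_normed_vector"
  assumes "u < v" and f: "continuous (at v within {u..v}) f" and g: "continuous_on {u..v} g"
    and e: "\<And>s. s \<in> {u..<v} \<Longrightarrow> f s = g s"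
  shows "f v = g v"
proof -
  have nt: "at v within {u..v} \<noteq> bot" using assms(1) islimpt_Icc[of u v v] by (simp add: trivial_limit_within)
  have "(f \<longlongrightarrow> f v) (at v within {u..v})" using f by (simp add: continuous_within)
  moreover have "(g \<longlongrightarrow> g v) (at v within {u..v})" using g assms(1) by (auto simp: continuous_on)
  moreover have "eventually (\<lambda>s. g s = f s) (at v within {u..v})"
    unfolding eventually_at_filter using e by (intro always_eventually) (metis atLeastAtMost_iff atLeastLessThan_iff order_le_less)
  ultimately show ?thesis using tendsto_unique[OF nt] by (metis (mono_tags, lifting) Lim_transform_eventually)
qed

text \<open>Converse to \<open>pw_in_ansatz_space\<close>. At interior mesh points the left piece
  takes the right value because D x is continuous; at b the condition of continuity in the ansatz
  space determines the value.\<close>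

lemma ansatz_space_pw:
  fixes x :: "real \<Rightarrow> real ^ ('k::finite + 'r::finite)"
  assumes p: "is_partition a b n t" and x: "x \<in> ansatz_space a b N n t"
  shows "admissible_family N n t (piece t x)" "pw n t (piece t x) = x"
proof -
  have pc: "degree (piece t x j c) \<le> (case c of Inl _ \<Rightarrow> N | Inr _ \<Rightarrow> N - 1)"
    "s \<in> {t (j - 1)..<t j} \<Longrightarrow> x s $ c = poly (piece t x j c) s" if j: "j \<in> {1..n}" for j c s
  proof -
    obtain q :: "real poly" where q: "degree q \<le> (case c of Inl _ \<Rightarrow> N | Inr _ \<Rightarrow> N - 1)"
      "\<forall>s\<in>{t (j - 1)..<t j}. x s $ c = poly q s"
      using x j unfolding ansatz_space_def by blast
    have "piece t x j c = q" using q(2) partition_step[OF p j] by (intro piece_eq) auto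
    with q show "degree (piece t x j c) \<le> (case c of Inl _ \<Rightarrow> N | Inr _ \<Rightarrow> N - 1)"
      "s \<in> {t (j - 1)..<t j} \<Longrightarrow> x s $ c = poly (piece t x j c) s" by auto
  qed
  have Dx: "continuous_on {a..b} (\<lambda>s. Dmat *v x s :: real^'k)" using x by (simp add: ansatz_space_def)
  show adm: "admissible_family N n t (piece t x)"
    unfolding admissible_family_def
  proof (intro conjI ballI allI pc(1))
    fix j and i :: 'k assume j: "j \<in> {1..<n}"
    then have j1: "j \<in> {1..n}" "Suc j \<in> {1..n}" by auto
    have xi: "continuous_on {a..b} (\<lambda>s. x s $ Inl i)"
      using bounded_linear.continuous_on[OF bounded_linear_vec_nth Dx, of i] by (simp add: Dmat_nth')
    have "x (t j) $ Inl i = poly (piece t x j (Inl i)) (t j)"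
    proof (rule continuous_eq_at_right_end[OF partition_step[OF p j1(1)]])
      show "continuous (at (t j) within {t (j - 1)..t j}) (\<lambda>s. x s $ Inl i)"
        using continuous_on_subset[OF xi partition_piece_subset[OF p j1(1)]] partition_step[OF p j1(1)]
        by (auto simp: continuous_on_eq_continuous_within)
    qed (use pc(2)[OF j1(1)] in \<open>auto intro: continuous_intros\<close>)
    moreover have "x (t j) $ Inl i = poly (piece t x (Suc j) (Inl i)) (t j)"
      using pc(2)[OF j1(2), of "t j"] partition_step[OF p j1(2)] by simp
    ultimately show "poly (piece t x j (Inl i)) (t j) = poly (piece t x (Suc j) (Inl i)) (t j)" by simp
  qed
  show "pw n t (piece t x) = x"
  proof (rule extensionalityI[of _ "{a..b}"])
    show "pw n t (piece t x) \<in> extensional {a..b}" using partition_ends[OF p] by (simp add: pw_def)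
    show "x \<in> extensional {a..b}" using x by (simp add: ansatz_space_def)
    fix s assume s: "s \<in> {a..b}"
    have n: "n \<in> {1..n}" using partition_ends[OF p] by simp
    show "pw n t (piece t x) s = x s"
    proof (cases "s < b")
      case True
      then obtain j where j: "j \<in> {1..n}" "s \<in> {t (j - 1)..<t j}"
        using partition_cover[OF p, of s] s by auto
      then show ?thesis using pw_eq[OF p j, of "piece t x"] pc(2)[OF j] by (simp add: pval_def vec_eq_iff)
    next
      case False
      then have sb: "s = t n" using s partition_ends[OF p] by simp
      have cb: "continuous (at b within {a..b}) x" using x by (simp add: ansatz_space_def)
      have "x (t n) = pval (piece t x n) (t n)"
      proof (rule continuous_eq_at_right_end[OF partition_step[OF p n]])
        show "continuous (at (t n) within {t (n - 1)..t n}) x"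
          using continuous_within_subset[OF cb partition_piece_subset[OF p n]] partition_ends[OF p] by simp
        show "\<And>s. s \<in> {t (n - 1)..<t n} \<Longrightarrow> x s = pval (piece t x n) s"
          using pc(2)[OF n] by (simp add: pval_def vec_eq_iff)
      qed (rule continuous_on_pval)
      then show ?thesis using pw_b[OF p, of "piece t x"] sb partition_ends[OF p] by simp
    qed
  qed
qed

definition dval :: "('k + 'r \<Rightarrow> real poly) \<Rightarrow> real \<Rightarrow> real ^ 'k::finite" where
  "dval p s = (\<chi> i. poly (pderiv (p (Inl i))) s)"

lemma continuous_on_dval: "continuous_on S (dval p)"
  unfolding dval_def by (intro continuous_on_vec_lambda continuous_intros)

lemma dval_deriv:
  "((\<lambda>s. (Dmat :: real^('k::finite+'r::finite)^'k) *v pval p s) has_vector_derivative dval p s) (at s within S)"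
  by (simp add: has_vector_derivative_vec_iff Dmat_nth pval_def dval_def poly_DERIV[THEN DERIV_subset])

lemma continuous_on_wj: "continuous_on S (wj W i)"
  unfolding wj_def by (intro continuous_on_vec_lambda continuous_intros)

section \<open>The boundary value problem and its homogeneous solutions\<close>

locale dae_bvp = smooth_tractability a b A B \<mu> r G Bs Q Pi R
  for a b :: real
    and A :: "real \<Rightarrow> real ^ 'k ^ ('k::finite + 'r::finite)"
    and B :: "real \<Rightarrow> real ^ ('k + 'r) ^ ('k + 'r)"
    and \<mu> r G Bs Q Pi R +
  fixes l :: nat and Ga Gb :: "nat \<Rightarrow> real ^ ('k + 'r)"
    and PA :: "'k + 'r \<Rightarrow> 'k \<Rightarrow> real poly" and PB :: "'k + 'r \<Rightarrow> 'k + 'r \<Rightarrow> real poly"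
  assumes PA: "\<And>t c i. t \<in> {a..b} \<Longrightarrow> A t $ c $ i = poly (PA c i) t"
    and PB: "\<And>t c d. t \<in> {a..b} \<Longrightarrow> B t $ c $ d = poly (PB c d) t"
    and l: "l + dK \<mu> = CARD('k + 'r)"
    and GG: "\<And>i. i < l \<Longrightarrow> ker (Dmat :: real ^ ('k + 'r) ^ 'k) \<subseteq> {z. Ga i \<bullet> z = 0} \<inter> {z. Gb i \<bullet> z = 0}"
    and acc: "accurately_stated a b A B l Ga Gb"
begin

text \<open>With polynomial coefficients the residual A (Dp)' + B p of a polynomial vector p is
  again a vector of polynomials; these are its components, with q left out.\<close>

definition rp :: "('k + 'r \<Rightarrow> real poly) \<Rightarrow> 'k + 'r \<Rightarrow> real poly" where
  "rp p c = (\<Sum>i\<in>UNIV. PA c i * pderiv (p (Inl i))) + (\<Sum>d\<in>UNIV. PB c d * p d)"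

lemma DAE_op_pval: "s \<in> {a..b} \<Longrightarrow> DAE_op s (dval p s) (pval p s) = wj (rp p) 0 s"
  by (simp add: DAE_op_def vec_eq_iff matrix_vector_mult_def dval_def pval_def wj_def rp_def
      PA PB poly_sum)

lemma DAE_op_diff_sum:
  assumes "\<And>i. i \<in> I \<Longrightarrow> DAE_op s (u i) (z i) = 0"
  shows "DAE_op s (v - (\<Sum>i\<in>I. g i *\<^sub>R u i)) (x - (\<Sum>i\<in>I. g i *\<^sub>R z i)) = DAE_op s v x"
proof -
  have "DAE_op s v x - DAE_op s (v - (\<Sum>i\<in>I. g i *\<^sub>R u i)) (x - (\<Sum>i\<in>I. g i *\<^sub>R z i)) =
      (\<Sum>i\<in>I. g i *\<^sub>R DAE_op s (u i) (z i))"
    by (simp add: DAE_op_def matrix_vector_mult_diff_distrib linear_sum[OF matrix_vector_mul_linear]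
        matrix_vector_mult_scaleR scaleR_add_right sum.distrib)
  also have "\<dots> = 0" using assms by (intro sum.neutral) simp
  finally show ?thesis by simp
qed

lemma homogeneous_solution:
  assumes "dae_solution a b A B (\<lambda>_. 0) z"
  shows "\<exists>u. continuous_on {a..b} z \<and> continuous_on {a..b} u \<and> (\<forall>t\<in>{a..b}.
    ((\<lambda>s. (Dmat :: real^('k+'r)^'k) *v z s) has_vector_derivative u t) (at t within {a..b}) \<and> DAE_op t (u t) (z t) = 0)"
proof -
  have z: "continuous_on {a..b} z" "Ck_on 1 {a..b} (\<lambda>s. (Dmat :: real^('k+'r)^'k) *v z s)"
    "\<And>t. t \<in> {a..b} \<Longrightarrow> A t *v vector_derivative (\<lambda>s. Dmat *v z s) (at t within {a..b}) + B t *v z t = 0"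
    using assms unfolding dae_solution_def by auto
  obtain F where F: "F 0 = (\<lambda>s. (Dmat :: real^('k+'r)^'k) *v z s)" "\<forall>i\<le>1. continuous_on {a..b} (F i)"
    "\<forall>i<1. \<forall>t\<in>{a..b}. (F i has_vector_derivative F (Suc i) t) (at t within {a..b})"
    using z(2) unfolding Ck_on_def by blast
  have d: "((\<lambda>s. (Dmat :: real^('k+'r)^'k) *v z s) has_vector_derivative F 1 t) (at t within {a..b})"
    if "t \<in> {a..b}" for t
    using F(3) that unfolding F(1)[symmetric] by simp
  have "DAE_op t (F 1 t) (z t) = 0" if "t \<in> {a..b}" for t
    using z(3)[OF that] vector_derivative_within_closed_interval[OF ab that d[OF that]]
    by (simp add: DAE_op_def)
  then show ?thesis using z(1) F(2) d by (intro exI[of _ "F 1"]) auto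
qed

text \<open>Unique solvability for every d is applied to the unit vectors of R^l.\<close>

lemma fundamental_solutions:
  "\<exists>z u. (\<forall>i<l. continuous_on {a..b} (z i) \<and> continuous_on {a..b} (u i) \<and> (\<forall>t\<in>{a..b}.
      ((\<lambda>s. (Dmat :: real^('k+'r)^'k) *v z i s) has_vector_derivative u i t) (at t within {a..b}) \<and> DAE_op t (u i t) (z i t) = 0)) \<and>
    (\<forall>i<l. \<forall>i'<l. Ga i \<bullet> z i' a + Gb i \<bullet> z i' b = (if i = i' then 1 else 0))"
proof -
  have "\<exists>z u. continuous_on {a..b} z \<and> continuous_on {a..b} u \<and> (\<forall>t\<in>{a..b}.
      ((\<lambda>s. (Dmat :: real^('k+'r)^'k) *v z s) has_vector_derivative u t) (at t within {a..b}) \<and> DAE_op t (u t) (z t) = 0) \<and>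
    (\<forall>i<l. Ga i \<bullet> z a + Gb i \<bullet> z b = (if i = i' then 1 else 0))" for i'
  proof -
    obtain z where z: "dae_solution a b A B (\<lambda>_. 0) z" "boundary_condition a b l Ga Gb (\<lambda>i. if i = i' then 1 else 0) z"
      using acc unfolding accurately_stated_def by blast
    then show ?thesis using homogeneous_solution[OF z(1)] unfolding boundary_condition_def by blast
  qed
  then have "\<forall>i'. \<exists>z u. continuous_on {a..b} z \<and> continuous_on {a..b} u \<and> (\<forall>t\<in>{a..b}.
      ((\<lambda>s. (Dmat :: real^('k+'r)^'k) *v z s) has_vector_derivative u t) (at t within {a..b}) \<and> DAE_op t (u t) (z t) = 0) \<and>
    (\<forall>i<l. Ga i \<bullet> z a + Gb i \<bullet> z b = (if i = i' then 1 else 0))" by blast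
  from choice[OF this] obtain z where "\<forall>i'. \<exists>u. continuous_on {a..b} (z i') \<and> continuous_on {a..b} u \<and> (\<forall>t\<in>{a..b}.
      ((\<lambda>s. (Dmat :: real^('k+'r)^'k) *v z i' s) has_vector_derivative u t) (at t within {a..b}) \<and> DAE_op t (u t) (z i' t) = 0) \<and>
    (\<forall>i<l. Ga i \<bullet> z i' a + Gb i \<bullet> z i' b = (if i = i' then 1 else 0))" ..
  from choice[OF this] obtain u where "\<forall>i'. continuous_on {a..b} (z i') \<and> continuous_on {a..b} (u i') \<and> (\<forall>t\<in>{a..b}.
      ((\<lambda>s. (Dmat :: real^('k+'r)^'k) *v z i' s) has_vector_derivative u i' t) (at t within {a..b}) \<and> DAE_op t (u i' t) (z i' t) = 0) \<and>
    (\<forall>i<l. Ga i \<bullet> z i' a + Gb i \<bullet> z i' b = (if i = i' then 1 else 0))" ..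
  then show ?thesis by (intro exI[of _ z] exI[of _ u]) simp
qed

end

locale dae_bvp_fund = dae_bvp a b A B \<mu> r G Bs Q Pi R l Ga Gb PA PB
  for a b :: real
    and A :: "real \<Rightarrow> real ^ 'k ^ ('k::finite + 'r::finite)"
    and B :: "real \<Rightarrow> real ^ ('k + 'r) ^ ('k + 'r)"
    and \<mu> r G Bs Q Pi R l Ga Gb PA PB +
  fixes z :: "nat \<Rightarrow> real \<Rightarrow> real ^ ('k + 'r)" and u :: "nat \<Rightarrow> real \<Rightarrow> real ^ 'k"
  assumes zc: "\<And>i. i < l \<Longrightarrow> continuous_on {a..b} (z i)" and uc: "\<And>i. i < l \<Longrightarrow> continuous_on {a..b} (u i)"
    and zd: "\<And>i t. i < l \<Longrightarrow> t \<in> {a..b} \<Longrightarrow>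
      ((\<lambda>s. (Dmat :: real^('k+'r)^'k) *v z i s) has_vector_derivative u i t) (at t within {a..b})"
    and zh: "\<And>i t. i < l \<Longrightarrow> t \<in> {a..b} \<Longrightarrow> DAE_op t (u i t) (z i t) = 0"
    and zb: "\<And>i i'. i < l \<Longrightarrow> i' < l \<Longrightarrow> Ga i \<bullet> z i' a + Gb i \<bullet> z i' b = (if i = i' then 1 else 0)"
begin

definition zg where "zg g s = (\<Sum>i<l. g i *\<^sub>R z i s)"
definition ug where "ug g s = (\<Sum>i<l. g i *\<^sub>R u i s)"

lemma zg_deriv: "s \<in> {a..b} \<Longrightarrow>
    ((\<lambda>s. (Dmat :: real^('k+'r)^'k) *v zg g s) has_vector_derivative ug g s) (at s within {a..b})"
  unfolding zg_def ug_def linear_sum[OF matrix_vector_mul_linear] matrix_vector_mult_scaleR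
  by (intro has_vector_derivative_sum bounded_linear.has_vector_derivative[OF bounded_linear_scaleR_right] zd) auto

lemma zg_continuous: "continuous_on {a..b} (zg g)"
  unfolding zg_def by (intro continuous_intros zc) auto

lemma DAE_op_zg: "s \<in> {a..b} \<Longrightarrow> DAE_op s (v - ug g s) (x - zg g s) = DAE_op s v x"
  unfolding zg_def ug_def by (rule DAE_op_diff_sum) (simp add: zh)

lemma bc_zg: "i < l \<Longrightarrow> Ga i \<bullet> zg g a + Gb i \<bullet> zg g b = g i"
proof -
  assume i: "i < l"
  have "Ga i \<bullet> zg g a + Gb i \<bullet> zg g b = (\<Sum>i'<l. g i' * (Ga i \<bullet> z i' a + Gb i \<bullet> z i' b))"
    by (simp add: zg_def inner_sum_right sum.distrib distrib_left)
  also have "\<dots> = (\<Sum>i'<l. g i' * (if i = i' then 1 else 0))"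
    using i by (intro sum.cong) (auto simp: zb)
  also have "\<dots> = g i" using i by (simp add: if_distrib[of "\<lambda>y. _ * y"] cong: if_cong)
  finally show ?thesis .
qed

text \<open>A homogeneous solution that starts in K_\<mu>(a) stays in K_\<mu> by
  \<open>propagation\<close> with zero residual, and then vanishes by
  \<open>derivative_estimate\<close>. Its boundary values, which are the coefficients g, are
  therefore zero.\<close>

lemma zg_in_KK_imp_0:
  assumes "zg g a \<in> KK \<mu> a" "i < l" shows "g i = 0"
proof -
  obtain C where C: "0 \<le> C" "\<forall>t\<in>{a..b}. \<forall>y w. quasi y w \<longrightarrow>
    infdist (y t) (KK \<mu> t) \<le> C * (infdist (y a) (KK \<mu> a) + integral {a..b} (\<lambda>t. norm (w t)))"
    using propagation by blast
  obtain C' where C': "0 \<le> C'" "\<forall>t\<in>{a..b}. \<forall>y W.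
    (\<forall>s\<in>{a..b}. \<exists>u'. ((\<lambda>s. (Dmat :: real^('k+'r)^'k) *v y s) has_vector_derivative u') (at s within {a..b}) \<and>
      DAE_op s u' (y s) = wj W 0 s) \<longrightarrow>
    norm (y t) \<le> C' * ((\<Sum>j<\<mu>. norm (wj W j t)) + infdist (y t) (KK \<mu> t))"
    using derivative_estimate by blast
  have op: "DAE_op s (ug g s) (zg g s) = 0" if "s \<in> {a..b}" for s
    using DAE_op_zg[OF that, of "ug g s" g "zg g s"] by (simp add: DAE_op_def)
  have q: "quasi (zg g) (\<lambda>_. 0)"
    unfolding quasi_def
  proof (intro conjI exI[of _ "{}"] ballI)
    show "continuous_on {a..b} (\<lambda>s. (Dmat :: real^('k+'r)^'k) *v zg g s)"
      by (intro bounded_linear.continuous_on[OF matrix_vector_mul_bounded_linear] zg_continuous)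
    fix s assume s: "s \<in> {a<..<b} - {}"
    then have "at s within {a..b} = at s" by (intro at_within_Icc_at) auto
    then show "\<exists>u'. ((\<lambda>s. (Dmat :: real^('k+'r)^'k) *v zg g s) has_vector_derivative u') (at s) \<and> DAE_op s u' (zg g s) = 0"
      using zg_deriv[of s g] op[of s] s by (intro exI[of _ "ug g s"]) auto
  qed auto
  have 0: "infdist (zg g t) (KK \<mu> t) = 0" if "t \<in> {a..b}" for t
  proof -
    have "infdist (zg g t) (KK \<mu> t) \<le> C * (infdist (zg g a) (KK \<mu> a) + integral {a..b} (\<lambda>t. norm (0 :: real^('k+'r))))"
      using C(2) that q by blast
    also have "\<dots> = 0" using assms(1) by simp
    finally show ?thesis using infdist_nonneg[of "zg g t" "KK \<mu> t"] by simp
  qed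
  have w0: "wj (\<lambda>_. 0) j s = (0 :: real^('k+'r))" for j s
  proof -
    have "(pderiv ^^ j) (0 :: real poly) = 0" by (induction j) auto
    then show ?thesis by (simp add: wj_def vec_eq_iff)
  qed
  have z0: "zg g t = 0" if t: "t \<in> {a..b}" for t
  proof -
    have "\<forall>s\<in>{a..b}. \<exists>u'. ((\<lambda>s. (Dmat :: real^('k+'r)^'k) *v zg g s) has_vector_derivative u') (at s within {a..b}) \<and>
      DAE_op s u' (zg g s) = wj (\<lambda>_. 0) 0 s"
      using zg_deriv op w0 by metis
    then have "norm (zg g t) \<le> C' * ((\<Sum>j<\<mu>. norm (wj (\<lambda>_. 0) j t :: real^('k+'r))) + infdist (zg g t) (KK \<mu> t))"
      using C'(2) t by blast
    then show ?thesis using 0[OF t] w0 by simp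
  qed
  show ?thesis using bc_zg[OF assms(2), of g] z0[of a] z0[of b] ab by simp
qed

text \<open>The l initial values z_i(a) are independent modulo K_\<mu>(a) by
  \<open>zg_in_KK_imp_0\<close>, and l + dim K_\<mu>(a) = m.\<close>

lemma initial_decomposition: "\<exists>g. v - zg g a \<in> KK \<mu> a"
proof -
  have aab: "a \<in> {a..b}" using ab by simp
  have e: "indep {} (\<lambda>_::'k+'r. 0 :: real^('k+'r))" by (simp add: indep_def)
  obtain I and y :: "'k+'r \<Rightarrow> real^('k+'r)" where I: "card I = dim (KK \<mu> a)" "indep I y" "\<And>p. p \<in> I \<Longrightarrow> y p \<in> KK \<mu> a"
    by (rule indep_extend[OF e, of "KK \<mu> a"]) (simp, rule that)
  \<comment> \<open>A basis of K_\<mu>(a) occupies the indices in I; exactly l indices are left for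
    the homogeneous solutions.\<close>
  have "card (- I) = l"
    using l dim_KK[OF aab, of \<mu>] I(1) by (simp add: Compl_eq_Diff_UNIV card_Diff_subset)
  then have "\<exists>\<sigma>. bij_betw \<sigma> (- I) {..<l}"
    by (intro finite_same_card_bij) auto
  then obtain \<sigma> where \<sigma>: "bij_betw \<sigma> (- I) {..<l}" ..
  define v' where "v' p = (if p \<in> I then y p else z (\<sigma> p) a)" for p
  have split: "(\<Sum>p\<in>UNIV. h p) = (\<Sum>p\<in>I. h p) + (\<Sum>p\<in>-I. h p)" for h :: "'k+'r \<Rightarrow> real^('k+'r)"
    by (subst sum.union_disjoint[symmetric]) (auto simp: Compl_partition)
  have v': "(\<Sum>p\<in>UNIV. c p *\<^sub>R v' p) = (\<Sum>p\<in>I. c p *\<^sub>R y p) + (\<Sum>p\<in>-I. c p *\<^sub>R z (\<sigma> p) a)" for c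
    unfolding split by (intro arg_cong2[where f="(+)"] sum.cong) (auto simp: v'_def)
  have zsum: "(\<Sum>p\<in>-I. c p *\<^sub>R z (\<sigma> p) a) = zg (\<lambda>i. c (inv_into (-I) \<sigma> i)) a" for c
  proof -
    have "zg (\<lambda>i. c (inv_into (-I) \<sigma> i)) a = (\<Sum>p\<in>-I. c (inv_into (-I) \<sigma> (\<sigma> p)) *\<^sub>R z (\<sigma> p) a)"
      using sum.reindex_bij_betw[OF \<sigma>, of "\<lambda>i. c (inv_into (-I) \<sigma> i) *\<^sub>R z i a"] by (simp add: zg_def)
    also have "\<dots> = (\<Sum>p\<in>-I. c p *\<^sub>R z (\<sigma> p) a)"
      using bij_betw_imp_inj_on[OF \<sigma>] by (intro sum.cong) (auto simp: inv_into_f_f)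
    finally show ?thesis ..
  qed
  have "indep UNIV v'"
  proof (rule indepI)
    fix c p assume c: "(\<Sum>p\<in>UNIV. c p *\<^sub>R v' p) = 0"
    have s: "(\<Sum>p\<in>I. c p *\<^sub>R y p) + (\<Sum>p\<in>-I. c p *\<^sub>R z (\<sigma> p) a) = 0"
      using c unfolding v' .
    have "(\<Sum>p\<in>I. (- c p) *\<^sub>R y p) \<in> KK \<mu> a"
      using I(3) by (intro subspace_sum[OF subspace_KK] subspace_scale[OF subspace_KK])
    moreover have "(\<Sum>p\<in>I. (- c p) *\<^sub>R y p) = (\<Sum>p\<in>-I. c p *\<^sub>R z (\<sigma> p) a)"
      using s by (simp add: sum_negf add_eq_0_iff)
    ultimately have zK: "zg (\<lambda>i. c (inv_into (-I) \<sigma> i)) a \<in> KK \<mu> a" by (simp add: zsum)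
    have c0: "c q = 0" if "q \<notin> I" for q
    proof -
      have "\<sigma> q < l" using \<sigma> that by (auto simp: bij_betw_def)
      from zg_in_KK_imp_0[OF zK this] show ?thesis
        using \<sigma> that by (simp add: bij_betw_def)
    qed
    then have "(\<Sum>p\<in>-I. c p *\<^sub>R z (\<sigma> p) a) = 0" by (intro sum.neutral) simp
    then have s0: "(\<Sum>p\<in>I. c p *\<^sub>R y p) = 0" using s by simp
    have "c q = 0" if "q \<in> I" for q by (rule indepD[OF I(2) s0 that])
    with c0 show "c p = 0" by (cases "p \<in> I") auto
  qed
  then obtain c where c: "v = (\<Sum>p\<in>UNIV. c p *\<^sub>R v' p)"
    using indep_span[of UNIV v' UNIV v] dim_subset_UNIV_cart by auto
  have "v - zg (\<lambda>i. c (inv_into (-I) \<sigma> i)) a = (\<Sum>p\<in>I. c p *\<^sub>R y p)"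
    unfolding c v' zsum by simp
  also have "\<dots> \<in> KK \<mu> a" using I(3) by (intro subspace_sum[OF subspace_KK] subspace_scale[OF subspace_KK])
  finally show ?thesis by blast
qed

end

section \<open>Stability on the ansatz space\<close>

context smooth_tractability
begin

text \<open>A has full column rank, so the matrix inverse of A^T A times A^T is a left inverse of A;
  it is smooth and hence bounded on {a..b}.\<close>

lemma A_bounded_below: "\<exists>C\<ge>0. \<forall>t\<in>{a..b}. \<forall>u. norm u \<le> C * norm (A t *v u)"
proof -
  have cp: "compact {a..b}" by simp
  let ?N = "\<lambda>t. transpose (A t) ** A t"
  have smt: "smm {a..b} (\<lambda>t. transpose (A t))" using smA by (simp add: smm_def transpose_def)
  have inj: "det (?N t) \<noteq> 0" if t: "t \<in> {a..b}" for t
  proof -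
    have "u = 0" if "?N t *v u = 0" for u
    proof -
      have "(A t *v u) \<bullet> (A t *v u) = u \<bullet> (?N t *v u)"
        by (simp add: matrix_vector_mul_assoc[symmetric] dot_lmul_matrix[symmetric] transpose_matrix_vector inner_commute)
      then have "A t *v u = 0" using that by simp
      then show ?thesis by (rule A_inj[OF t])
    qed
    then show ?thesis
      by (simp add: invertible_det_nz[symmetric] invertible_left_inverse matrix_left_invertible_ker)
  qed
  have "smm {a..b} (\<lambda>t. matrix_inv (?N t) ** transpose (A t))"
    by (intro smm_matrix_matrix smm_inverse smt smA) (rule inj)
  then obtain C where C: "0 \<le> C" "\<And>t v. t \<in> {a..b} \<Longrightarrow> norm ((matrix_inv (?N t) ** transpose (A t)) *v v) \<le> C * norm v"
    by (rule smm_bounded[OF _ cp]) (rule that)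
  have "norm u \<le> C * norm (A t *v u)" if t: "t \<in> {a..b}" for t u
  proof -
    have "(matrix_inv (?N t) ** transpose (A t)) *v (A t *v u) = u"
      using matrix_inv_mult_cancel(2)[OF inj[OF t], of u] by (simp add: matrix_vector_mul_assoc[symmetric])
    then show ?thesis using C(2)[OF t, of "A t *v u"] by simp
  qed
  then show ?thesis using C(1) by blast
qed

end

context dae_bvp_fund
begin

text \<open>The residual on piece j with its derivatives up to order \<mu>-1, the quantity in
  \<open>derivative_estimate\<close>. \<open>HF\<close> is its integral over all pieces,
  \<open>bdry\<close> the boundary operator.\<close>

definition Fj :: "(nat \<Rightarrow> 'k + 'r \<Rightarrow> real poly) \<Rightarrow> nat \<Rightarrow> real \<Rightarrow> real" where
  "Fj P j s = (\<Sum>i<\<mu>. norm (wj (rp (P j)) i s))"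

definition HF :: "nat \<Rightarrow> (nat \<Rightarrow> real) \<Rightarrow> (nat \<Rightarrow> 'k + 'r \<Rightarrow> real poly) \<Rightarrow> real" where
  "HF n t P = (\<Sum>j=1..n. integral {t (j - 1)..t j} (Fj P j))"

definition bdry :: "(real \<Rightarrow> real ^ ('k + 'r)) \<Rightarrow> nat \<Rightarrow> real" where
  "bdry x i = Ga i \<bullet> x a + Gb i \<bullet> x b"

lemma continuous_on_Fj: "continuous_on S (Fj P j)"
  unfolding Fj_def by (intro continuous_intros continuous_on_wj)

lemma Fj_nonneg: "0 \<le> Fj P j s"
  by (simp add: Fj_def sum_nonneg)

lemma norm_w_le_Fj: "norm (wj (rp (P j)) 0 s) \<le> Fj P j s"
  using member_le_sum[of 0 "{..<\<mu>}" "\<lambda>i. norm (wj (rp (P j)) i s)"] mu_pos by (simp add: Fj_def)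

text \<open>The rows of G_a and G_b vanish on ker D and thus factor through D, so boundary values
  are controlled by D x alone.\<close>

lemma bdry_bound: "\<exists>C\<ge>0. \<forall>i<l. \<forall>v. \<bar>Ga i \<bullet> v\<bar> \<le> C * norm (Dmat *v v :: real^'k) \<and> \<bar>Gb i \<bullet> v\<bar> \<le> C * norm (Dmat *v v :: real^'k)"
proof -
  obtain K where K: "\<And>u. norm (transpose Dmat *v u :: real^('k+'r)) \<le> K * norm (u :: real^'k)" "0 < K"
    using bounded_linear.pos_bounded[OF matrix_vector_mul_bounded_linear[of "transpose Dmat :: real^'k^('k+'r)"]]
    by (metis mult.commute)
  define S where "S = (\<Sum>i<l. norm (Ga i) + norm (Gb i))"
  have le: "norm (Ga i) \<le> S" "norm (Gb i) \<le> S" if "i < l" for i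
    using member_le_sum[of i "{..<l}" "\<lambda>i. norm (Ga i) + norm (Gb i)"] that
    by (auto simp: S_def intro: order_trans[rotated])
  have S0: "0 \<le> S" by (simp add: S_def sum_nonneg)
  have main: "\<bar>h \<bullet> v\<bar> \<le> S * K * norm (Dmat *v v :: real^'k)"
    if h: "norm h \<le> S" and ker: "ker (Dmat :: real ^ ('k + 'r) ^ 'k) \<subseteq> {z. h \<bullet> z = 0}" for h v
  proof -
    have "v - transpose Dmat *v (Dmat *v v :: real^'k) \<in> ker (Dmat :: real ^ ('k + 'r) ^ 'k)"
      by (simp add: ker_def matrix_vector_mult_diff_distrib)
    then have "h \<bullet> v = h \<bullet> (transpose Dmat *v (Dmat *v v :: real^'k))" using ker by (auto simp: inner_diff_right)
    then have "\<bar>h \<bullet> v\<bar> \<le> norm h * norm (transpose Dmat *v (Dmat *v v :: real^'k) :: real^('k+'r))"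
      by (simp add: Cauchy_Schwarz_ineq2)
    also have "\<dots> \<le> S * (K * norm (Dmat *v v :: real^'k))" by (intro mult_mono h K S0) auto
    finally show ?thesis by (simp add: mult.assoc)
  qed
  have "\<bar>Ga i \<bullet> v\<bar> \<le> S * K * norm (Dmat *v v :: real^'k) \<and> \<bar>Gb i \<bullet> v\<bar> \<le> S * K * norm (Dmat *v v :: real^'k)"
    if "i < l" for i v
    using main[OF le(1)[OF that], of v] main[OF le(2)[OF that], of v] GG[OF that] by blast
  then show ?thesis using S0 K by (intro exI[of _ "S * K"]) auto
qed

lemma fundamental_bound: "\<exists>C\<ge>0. \<forall>g. \<forall>s\<in>{a..b}. norm (zg g s) + norm (ug g s) \<le> C * (\<Sum>i<l. \<bar>g i\<bar>)"
proof -
  have "\<exists>C. 0 \<le> C \<and> (\<forall>s\<in>{a..b}. norm (z i s) + norm (u i s) \<le> C)" if i: "i < l" for i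
  proof -
    have "continuous_on {a..b} (\<lambda>s. norm (z i s) + norm (u i s))" by (intro continuous_intros zc uc i)
    then have "bounded ((\<lambda>s. norm (z i s) + norm (u i s)) ` {a..b})"
      by (intro compact_imp_bounded compact_continuous_image) auto
    then obtain K where "\<forall>s\<in>{a..b}. \<bar>norm (z i s) + norm (u i s)\<bar> \<le> K" by (auto simp: bounded_iff)
    then show ?thesis by (intro exI[of _ "\<bar>K\<bar>"]) force
  qed
  then have "\<forall>i. \<exists>C. i < l \<longrightarrow> 0 \<le> C \<and> (\<forall>s\<in>{a..b}. norm (z i s) + norm (u i s) \<le> C)" by blast
  from choice[OF this] obtain K where K: "\<forall>i. i < l \<longrightarrow> 0 \<le> K i \<and> (\<forall>s\<in>{a..b}. norm (z i s) + norm (u i s) \<le> K i)" ..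
  define C where "C = (\<Sum>i<l. K i)"
  have C: "0 \<le> C" "\<And>i. i < l \<Longrightarrow> K i \<le> C"
    using K by (auto simp: C_def intro!: sum_nonneg member_le_sum)
  have "norm (zg g s) + norm (ug g s) \<le> C * (\<Sum>i<l. \<bar>g i\<bar>)" if s: "s \<in> {a..b}" for g s
  proof -
    have "norm (zg g s) + norm (ug g s) \<le> (\<Sum>i<l. norm (g i *\<^sub>R z i s)) + (\<Sum>i<l. norm (g i *\<^sub>R u i s))"
      unfolding zg_def ug_def by (intro add_mono norm_sum)
    also have "\<dots> = (\<Sum>i<l. \<bar>g i\<bar> * (norm (z i s) + norm (u i s)))"
      by (simp add: sum.distrib distrib_left)
    also have "\<dots> \<le> (\<Sum>i<l. \<bar>g i\<bar> * C)"
    proof (rule sum_mono, rule mult_left_mono)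
      fix i assume "i \<in> {..<l}"
      then have i: "i < l" by simp
      have "norm (z i s) + norm (u i s) \<le> K i" using K i s by blast
      also have "\<dots> \<le> C" by (rule C(2)[OF i])
      finally show "norm (z i s) + norm (u i s) \<le> C" .
    qed simp
    also have "\<dots> = C * (\<Sum>i<l. \<bar>g i\<bar>)" by (simp add: sum_distrib_left mult.commute)
    finally show ?thesis .
  qed
  then show ?thesis using C(1) by blast
qed

lemma pw_deriv:
  assumes p: "is_partition a b n t" and j: "j \<in> {1..n}" and s: "s \<in> {t (j - 1)<..<t j}"
  shows "((\<lambda>s. (Dmat :: real^('k+'r)^'k) *v pw n t P s) has_vector_derivative dval (P j) s) (at s)"
  by (rule has_vector_derivative_transform_within_open[OF dval_deriv, of "{t (j - 1)<..<t j}"])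
    (use s pw_eq[OF p j, of _ P] in auto)

lemma in_open_piece:
  assumes p: "is_partition a b n t" and s: "s \<in> {a<..<b} - t ` {0..n}"
  obtains j where "j \<in> {1..n}" "s \<in> {t (j - 1)<..<t j}"
proof -
  obtain j where j: "j \<in> {1..n}" "s \<in> {t (j - 1)..<t j}"
    using partition_cover[OF p, of s] s by auto
  moreover have "s \<noteq> t (j - 1)" using s j by auto
  ultimately show ?thesis using that[of j] by auto
qed

lemma residual_continuous_integrable:
  assumes p: "is_partition a b n t"
  shows "(\<lambda>s. norm (wj (rp (P (idx n t s))) 0 s)) integrable_on {a..b}"
    "integral {a..b} (\<lambda>s. norm (wj (rp (P (idx n t s))) 0 s)) \<le> HF n t P"
proof -
  have e: "norm (wj (rp (P (idx n t s))) 0 s) = norm (wj (rp (P j)) 0 s)" if "j \<in> {1..n}" "s \<in> {t (j - 1)<..<t j}" for j s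
    using idx_eq[OF p that(1), of s] that by simp
  have c: "continuous_on {t (j - 1)..t j} (\<lambda>s. norm (wj (rp (P j)) 0 s))" for j
    by (intro continuous_intros continuous_on_wj)
  note ip = integral_pieces[where f = "\<lambda>s. norm (wj (rp (P (idx n t s))) 0 s)" and g = "\<lambda>j s. norm (wj (rp (P j)) 0 s)", OF p c e]
  show "(\<lambda>s. norm (wj (rp (P (idx n t s))) 0 s)) integrable_on {a..b}" by (rule ip(1))
  have "integral {a..b} (\<lambda>s. norm (wj (rp (P (idx n t s))) 0 s)) =
      (\<Sum>j=1..n. integral {t (j - 1)..t j} (\<lambda>s. norm (wj (rp (P j)) 0 s)))" by (rule ip(2))
  also have "\<dots> \<le> HF n t P"
    unfolding HF_def
    by (intro sum_mono integral_le integrable_continuous_real[OF c] integrable_continuous_real[OF continuous_on_Fj] norm_w_le_Fj)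
  finally show "integral {a..b} (\<lambda>s. norm (wj (rp (P (idx n t s))) 0 s)) \<le> HF n t P" .
qed

lemma HF_integral:
  assumes p: "is_partition a b n t"
  shows "(\<lambda>s. Fj P (idx n t s) s) integrable_on {a..b}"
    "integral {a..b} (\<lambda>s. Fj P (idx n t s) s) = HF n t P"
proof -
  have e: "Fj P (idx n t s) s = Fj P j s" if "j \<in> {1..n}" "s \<in> {t (j - 1)<..<t j}" for j s
    using idx_eq[OF p that(1), of s] that by simp
  note ip = integral_pieces[where f = "\<lambda>s. Fj P (idx n t s) s" and g = "Fj P", OF p continuous_on_Fj e]
  show "(\<lambda>s. Fj P (idx n t s) s) integrable_on {a..b}" "integral {a..b} (\<lambda>s. Fj P (idx n t s) s) = HF n t P"
    using ip by (auto simp: HF_def)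
qed

lemma HF_nonneg: "0 \<le> HF n t P"
  unfolding HF_def
  by (intro sum_nonneg integral_nonneg integrable_continuous_real continuous_on_Fj Fj_nonneg)

lemma quasi_pw:
  assumes p: "is_partition a b n t" and P: "admissible_family N n t P"
  shows "quasi (\<lambda>s. pw n t P s - zg g s) (\<lambda>s. wj (rp (P (idx n t s))) 0 s)"
  unfolding quasi_def
proof (intro conjI exI[of _ "t ` {0..n}"] ballI)
  show "continuous_on {a..b} (\<lambda>s. (Dmat :: real^('k+'r)^'k) *v (pw n t P s - zg g s))"
    unfolding matrix_vector_mult_diff_distrib
    by (intro continuous_on_diff pw_Dmat_continuous[OF p P]
        bounded_linear.continuous_on[OF matrix_vector_mul_bounded_linear] zg_continuous)
  fix s assume s: "s \<in> {a<..<b} - t ` {0..n}"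
  then obtain j where j: "j \<in> {1..n}" "s \<in> {t (j - 1)<..<t j}" by (rule in_open_piece[OF p])
  have sab: "s \<in> {a..b}" "at s within {a..b} = at s" using s by (auto intro: at_within_Icc_at)
  have "((\<lambda>s. (Dmat :: real^('k+'r)^'k) *v (pw n t P s - zg g s)) has_vector_derivative dval (P j) s - ug g s) (at s)"
    unfolding matrix_vector_mult_diff_distrib
    using pw_deriv[OF p j, of P] zg_deriv[OF sab(1), of g] by (intro has_vector_derivative_diff) (simp_all add: sab)
  moreover have "DAE_op s (dval (P j) s - ug g s) (pw n t P s - zg g s) = wj (rp (P (idx n t s))) 0 s"
    using DAE_op_zg[OF sab(1)] DAE_op_pval[OF sab(1), of "P j"] pw_eq[OF p j(1), of s P] idx_eq[OF p j(1), of s] j by simp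
  ultimately show "\<exists>u'. ((\<lambda>s. (Dmat :: real^('k+'r)^'k) *v (pw n t P s - zg g s)) has_vector_derivative u') (at s) \<and>
      DAE_op s u' (pw n t P s - zg g s) = wj (rp (P (idx n t s))) 0 s" by blast
qed (use residual_continuous_integrable(1)[OF p] in auto)

text \<open>The difference of the ansatz function and a homogeneous solution starts in K_\<mu>(a).
  \<open>propagation\<close> bounds its distance from K_\<mu> by the integral of the residual,
  \<open>derivative_estimate\<close> turns this into a bound of the difference, and the equation A
  u' = w - B y with \<open>A_bounded_below\<close> bounds the derivative.\<close>

lemma defect_estimate:
  "\<exists>C\<ge>0. \<forall>n t P N g. is_partition a b n t \<longrightarrow> admissible_family N n t P \<longrightarrow>
    pw n t P a - zg g a \<in> KK \<mu> a \<longrightarrow>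
    (\<forall>j\<in>{1..n}. \<forall>s\<in>{t (j - 1)..t j}.
      norm (pval (P j) s - zg g s) + norm (dval (P j) s - ug g s) \<le> C * (Fj P j s + HF n t P))"
proof -
  obtain C1 where C1: "0 \<le> C1" "\<forall>t\<in>{a..b}. \<forall>y w. quasi y w \<longrightarrow>
    infdist (y t) (KK \<mu> t) \<le> C1 * (infdist (y a) (KK \<mu> a) + integral {a..b} (\<lambda>t. norm (w t)))"
    using propagation by blast
  obtain C2 where C2: "0 \<le> C2" "\<forall>t\<in>{a..b}. \<forall>y W.
    (\<forall>s\<in>{a..b}. \<exists>u'. ((\<lambda>s. (Dmat :: real^('k+'r)^'k) *v y s) has_vector_derivative u') (at s within {a..b}) \<and>
      DAE_op s u' (y s) = wj W 0 s) \<longrightarrow>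
    norm (y t) \<le> C2 * ((\<Sum>j<\<mu>. norm (wj W j t)) + infdist (y t) (KK \<mu> t))"
    using derivative_estimate by blast
  obtain Ca where Ca: "0 \<le> Ca" "\<And>t u. t \<in> {a..b} \<Longrightarrow> norm u \<le> Ca * norm (A t *v u)"
    using A_bounded_below by auto
  have cp: "compact {a..b}" by simp
  obtain Cb where Cb: "0 \<le> Cb" "\<And>t v. t \<in> {a..b} \<Longrightarrow> norm (B t *v v) \<le> Cb * norm v"
    by (rule smm_bounded[OF smB cp]) (rule that)
  define C where "C = C2 * (1 + C1) + Ca * (1 + Cb * (C2 * (1 + C1)))"
  have C0: "0 \<le> C" using C1(1) C2(1) Ca(1) Cb(1) by (simp add: C_def)
  show ?thesis
  proof (rule exI[of _ C], rule conjI[OF C0], intro allI impI ballI)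
    fix n t N g j s and P :: "nat \<Rightarrow> 'k + 'r \<Rightarrow> real poly"
    assume p: "is_partition a b n t" and P: "admissible_family N n t P"
      and init: "pw n t P a - zg g a \<in> KK \<mu> a" and j: "j \<in> {1..n}" and s: "s \<in> {t (j - 1)..t j}"
    let ?y = "\<lambda>s. pw n t P s - zg g s"
    let ?yj = "\<lambda>s. pval (P j) s - zg g s"
    let ?I = "integral {a..b} (\<lambda>s. norm (wj (rp (P (idx n t s))) 0 s))"
    let ?H = "HF n t P"
    have sub: "{t (j - 1)..t j} \<subseteq> {a..b}" by (rule partition_piece_subset[OF p j])
    have inf: "infdist (?y s) (KK \<mu> s) \<le> C1 * ?H" if "s \<in> {a..b}" for s
    proof -
      have "infdist (?y s) (KK \<mu> s) \<le> C1 * (infdist (?y a) (KK \<mu> a) + ?I)"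
        using C1(2) that quasi_pw[OF p P, of g] by blast
      also have "\<dots> \<le> C1 * ?H"
        using C1(1) init residual_continuous_integrable(2)[OF p, of P] by (intro mult_left_mono) auto
      finally show ?thesis .
    qed
    \<comment> \<open>The single polynomial piece \<open>P j\<close>, extended to all of {a..b}, has
      the polynomial residual \<open>rp (P j)\<close> there, so the global derivative estimate
      applies to it; only its distance from K_\<mu> is taken from the ansatz function.\<close>
    have adm: "\<forall>s\<in>{a..b}. \<exists>u'. ((\<lambda>s. (Dmat :: real^('k+'r)^'k) *v ?yj s) has_vector_derivative u') (at s within {a..b}) \<and>
      DAE_op s u' (?yj s) = wj (rp (P j)) 0 s"
    proof
      fix s assume s: "s \<in> {a..b}"
      have "((\<lambda>s. (Dmat :: real^('k+'r)^'k) *v ?yj s) has_vector_derivative dval (P j) s - ug g s) (at s within {a..b})"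
        unfolding matrix_vector_mult_diff_distrib
        by (intro has_vector_derivative_diff dval_deriv zg_deriv s)
      moreover have "DAE_op s (dval (P j) s - ug g s) (?yj s) = wj (rp (P j)) 0 s"
        using DAE_op_zg[OF s] DAE_op_pval[OF s] by simp
      ultimately show "\<exists>u'. ((\<lambda>s. (Dmat :: real^('k+'r)^'k) *v ?yj s) has_vector_derivative u') (at s within {a..b}) \<and>
        DAE_op s u' (?yj s) = wj (rp (P j)) 0 s" by blast
    qed
    have half: "norm (?yj s) \<le> C2 * (Fj P j s + C1 * ?H)" if s: "s \<in> {t (j - 1)..<t j}" for s
    proof -
      have sab: "s \<in> {a..b}" using s sub by auto
      have "?yj s = ?y s" by (simp add: pw_eq[OF p j s])
      then have i: "infdist (?yj s) (KK \<mu> s) \<le> C1 * ?H" using inf[OF sab] by simp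
      have "norm (?yj s) \<le> C2 * ((\<Sum>i<\<mu>. norm (wj (rp (P j)) i s)) + infdist (?yj s) (KK \<mu> s))"
        by (rule C2(2)[THEN bspec, OF sab, THEN spec[of _ ?yj], THEN spec[of _ "rp (P j)"], THEN mp, OF adm])
      also have "\<dots> \<le> C2 * (Fj P j s + C1 * ?H)"
        unfolding Fj_def using C2(1) i by (intro mult_left_mono) auto
      finally show ?thesis .
    qed
    \<comment> \<open>The piece and the ansatz function agree on a half-open interval; the right end
      point follows by continuity.\<close>
    have "norm (?yj s) - C2 * (Fj P j s + C1 * ?H) \<le> 0"
    proof (rule continuous_le_on_closure[of "{t (j - 1)..<t j}" "\<lambda>s. norm (?yj s) - C2 * (Fj P j s + C1 * ?H)"])
      have cl: "closure {t (j - 1)..<t j} = {t (j - 1)..t j}"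
        using partition_step[OF p j] by (simp add: closure_atLeastLessThan)
      show "s \<in> closure {t (j - 1)..<t j}" using s cl by simp
      show "continuous_on (closure {t (j - 1)..<t j}) (\<lambda>s. norm (?yj s) - C2 * (Fj P j s + C1 * ?H))"
        unfolding cl by (intro continuous_intros continuous_on_pval continuous_on_Fj continuous_on_subset[OF zg_continuous sub])
    qed (use half in auto)
    moreover have H0: "0 \<le> ?H" by (rule HF_nonneg)
    moreover have F0: "0 \<le> Fj P j s" by (rule Fj_nonneg)
    ultimately have y: "norm (?yj s) \<le> C2 * (1 + C1) * (Fj P j s + ?H)"
    proof -
      have "C2 * (Fj P j s + C1 * ?H) \<le> C2 * ((1 + C1) * (Fj P j s + ?H))"
        using C2(1) C1(1) H0 F0 by (intro mult_left_mono) (auto simp: algebra_simps)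
      then show ?thesis using \<open>norm (?yj s) - C2 * (Fj P j s + C1 * ?H) \<le> 0\<close> by (simp add: mult.assoc)
    qed
    have sab: "s \<in> {a..b}" using s sub by auto
    have "A s *v (dval (P j) s - ug g s) = wj (rp (P j)) 0 s - B s *v ?yj s"
      using DAE_op_zg[OF sab, of "dval (P j) s" g "pval (P j) s"] DAE_op_pval[OF sab, of "P j"]
      by (simp add: DAE_op_def algebra_simps)
    then have "norm (dval (P j) s - ug g s) \<le> Ca * norm (wj (rp (P j)) 0 s - B s *v ?yj s)"
      using Ca(2)[OF sab] by metis
    also have "\<dots> \<le> Ca * ((Fj P j s + ?H) + Cb * (C2 * (1 + C1) * (Fj P j s + ?H)))"
    proof (rule mult_left_mono[OF _ Ca(1)])
      have "norm (B s *v ?yj s) \<le> Cb * (C2 * (1 + C1) * (Fj P j s + ?H))"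
        using Cb(2)[OF sab, of "?yj s"] y Cb(1) by (meson mult_left_mono order_trans)
      then show "norm (wj (rp (P j)) 0 s - B s *v ?yj s) \<le> (Fj P j s + ?H) + Cb * (C2 * (1 + C1) * (Fj P j s + ?H))"
        using norm_triangle_ineq4[of "wj (rp (P j)) 0 s" "B s *v ?yj s"] norm_w_le_Fj[of P j s] H0 by linarith
    qed
    finally show "norm (pval (P j) s - zg g s) + norm (dval (P j) s - ug g s) \<le> C * (Fj P j s + HF n t P)"
      using y by (simp add: C_def algebra_simps)
  qed
qed

text \<open>The homogeneous solution with coefficients g that matches the initial value modulo
  K_\<mu>(a) is subtracted. The boundary values of this homogeneous solution are the g_i, so g
  differs from the boundary values of the ansatz function only by those of the difference, and these
  are bounded by the residual through \<open>defect_estimate\<close>.\<close>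

lemma stability_pointwise:
  "\<exists>C\<ge>0. \<forall>n t P N. is_partition a b n t \<longrightarrow> admissible_family N n t P \<longrightarrow>
    (\<forall>j\<in>{1..n}. \<forall>s\<in>{t (j - 1)..t j}.
      norm (pval (P j) s) + norm (dval (P j) s) \<le> C * (Fj P j s + HF n t P + (\<Sum>i<l. \<bar>bdry (pw n t P) i\<bar>)))"
proof -
  obtain C where C: "0 \<le> C" "\<forall>n t P N g. is_partition a b n t \<longrightarrow> admissible_family N n t P \<longrightarrow>
    pw n t P a - zg g a \<in> KK \<mu> a \<longrightarrow>
    (\<forall>j\<in>{1..n}. \<forall>s\<in>{t (j - 1)..t j}.
      norm (pval (P j) s - zg g s) + norm (dval (P j) s - ug g s) \<le> C * (Fj P j s + HF n t P))"
    using defect_estimate by blast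
  obtain Kg where Kg: "0 \<le> Kg" "\<And>i v. i < l \<Longrightarrow> \<bar>Ga i \<bullet> v\<bar> \<le> Kg * norm (Dmat *v v :: real^'k)"
    "\<And>i v. i < l \<Longrightarrow> \<bar>Gb i \<bullet> v\<bar> \<le> Kg * norm (Dmat *v v :: real^'k)"
    using bdry_bound by auto
  obtain Z where Z: "0 \<le> Z" "\<And>g s. s \<in> {a..b} \<Longrightarrow> norm (zg g s) + norm (ug g s) \<le> Z * (\<Sum>i<l. \<bar>g i\<bar>)"
    using fundamental_bound by auto
  obtain Kd where Kd: "\<And>v. norm (Dmat *v v :: real^'k) \<le> Kd * norm (v :: real^('k+'r))" "0 < Kd"
    using bounded_linear.pos_bounded[OF matrix_vector_mul_bounded_linear[of "Dmat :: real^('k+'r)^'k"]]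
    by (metis mult.commute)
  define K4 where "K4 = C * (1 + (b - a)) * (Kd / (b - a) + 1)"
  have K40: "0 \<le> K4" using C(1) Kd ab by (simp add: K4_def)
  define K5 where "K5 = real l * (2 * Kg * K4)"
  have K50: "0 \<le> K5" using K40 Kg by (simp add: K5_def)
  define K where "K = C + Z * (1 + K5)"
  have K0: "0 \<le> K" using C(1) Z(1) K50 by (simp add: K_def)
  show ?thesis
  proof (rule exI[of _ K], rule conjI[OF K0], intro allI impI ballI)
    fix n t N j s and P :: "nat \<Rightarrow> 'k + 'r \<Rightarrow> real poly"
    assume p: "is_partition a b n t" and P: "admissible_family N n t P"
      and j: "j \<in> {1..n}" and s: "s \<in> {t (j - 1)..t j}"
    let ?H = "HF n t P" let ?BC = "\<Sum>i<l. \<bar>bdry (pw n t P) i\<bar>"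
    obtain g where g: "pw n t P a - zg g a \<in> KK \<mu> a" using initial_decomposition by blast
    have est: "norm (pval (P j) s - zg g s) + norm (dval (P j) s - ug g s) \<le> C * (Fj P j s + ?H)"
      if "j \<in> {1..n}" "s \<in> {t (j - 1)..t j}" for j s
      using C(2) p P g that by blast
    have H0: "0 \<le> ?H" by (rule HF_nonneg)
    let ?y = "\<lambda>s. pw n t P s - zg g s"
    let ?Y = "\<lambda>s. (Dmat :: real^('k+'r)^'k) *v ?y s"
    \<comment> \<open>A common bound for the difference and the derivative of its D part, with an
      integral proportional to \<open>HF\<close>.\<close>
    define m where "m s = C * (Fj P (idx n t s) s + ?H)" for s
    have mi: "m integrable_on {a..b}" "integral {a..b} m = C * (1 + (b - a)) * ?H"
    proof -
      note F = HF_integral[OF p, of P]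
      show "m integrable_on {a..b}" unfolding m_def by (intro integrable_on_mult_right integrable_add F(1)) auto
      show "integral {a..b} m = C * (1 + (b - a)) * ?H"
      proof -
        have "integral {a..b} (\<lambda>s. Fj P (idx n t s) s + ?H) = ?H + (b - a) * ?H"
          using F ab by (subst integral_add) auto
        then have "integral {a..b} m = C * (?H + (b - a) * ?H)"
          unfolding m_def integral_mult_right by simp
        then show ?thesis by (simp add: algebra_simps)
      qed
    qed
    have ym: "norm (?y s) \<le> m s" if s: "s \<in> {a..b}" for s
    proof (cases "s < b")
      case True
      then obtain j where j: "j \<in> {1..n}" "s \<in> {t (j - 1)..<t j}"
        using partition_cover[OF p, of s] s by auto
      then show ?thesis
        using est[of j s] idx_eq[OF p j] pw_eq[OF p j, of P] norm_ge_zero[of "dval (P j) s - ug g s"]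
        unfolding m_def by (simp del: norm_ge_zero)
    next
      case False
      then have "s = b" using s by simp
      have n: "n \<in> {1..n}" "b \<in> {t (n - 1)..t n}" using partition_ends[OF p] partition_step[OF p, of n] by auto
      then show ?thesis
        using est[OF n] idx_b[OF p] pw_b[OF p, of P] norm_ge_zero[of "dval (P n) b - ug g b"] \<open>s = b\<close>
        unfolding m_def by (simp del: norm_ge_zero)
    qed
    have Yc: "continuous_on {a..b} ?Y" using quasi_pw[OF p P, of g] by (simp add: quasi_def)
    have Yd: "(?Y has_vector_derivative dval (P (idx n t \<tau>)) \<tau> - ug g \<tau>) (at \<tau>)"
      "norm (dval (P (idx n t \<tau>)) \<tau> - ug g \<tau>) \<le> m \<tau>" if \<tau>: "\<tau> \<in> {a<..<b} - t ` {0..n}" for \<tau>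
    proof -
      obtain j where j: "j \<in> {1..n}" "\<tau> \<in> {t (j - 1)<..<t j}" using \<tau> by (rule in_open_piece[OF p])
      have i: "idx n t \<tau> = j" using idx_eq[OF p j(1), of \<tau>] j by simp
      have sab: "\<tau> \<in> {a..b}" "at \<tau> within {a..b} = at \<tau>" using \<tau> by (auto intro: at_within_Icc_at)
      show "(?Y has_vector_derivative dval (P (idx n t \<tau>)) \<tau> - ug g \<tau>) (at \<tau>)"
        unfolding matrix_vector_mult_diff_distrib i
        using pw_deriv[OF p j, of P] zg_deriv[OF sab(1), of g] by (intro has_vector_derivative_diff) (simp_all add: sab)
      show "norm (dval (P (idx n t \<tau>)) \<tau> - ug g \<tau>) \<le> m \<tau>"
        using est[of j \<tau>] j norm_ge_zero[of "pval (P j) \<tau> - zg g \<tau>"]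
        unfolding m_def i by (simp del: norm_ge_zero)
    qed
    have m0: "0 \<le> m \<tau>" for \<tau> using C(1) H0 Fj_nonneg by (simp add: m_def)
    have Ydiff: "norm (?Y q - ?Y p') \<le> integral {a..b} m" if pq: "p' \<in> {a..b}" "q \<in> {a..b}" "p' \<le> q" for p' q
    proof -
      define f where "f \<tau> = (if \<tau> \<in> {p'<..<q} - t ` {0..n} then dval (P (idx n t \<tau>)) \<tau> - ug g \<tau> else 0)" for \<tau>
      have sub: "{p'..q} \<subseteq> {a..b}" using pq by auto
      have "(f has_integral ?Y q - ?Y p') {p'..q}"
      proof (rule fundamental_theorem_of_calculus_interior_strong[of "t ` {0..n}"])
        show "(?Y has_vector_derivative f \<tau>) (at \<tau>)" if "\<tau> \<in> {p'<..<q} - t ` {0..n}" for \<tau>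
          using Yd(1)[of \<tau>] that pq by (auto simp: f_def)
        show "continuous_on {p'..q} ?Y" using continuous_on_subset[OF Yc sub] .
      qed (use pq in auto)
      then have fi: "f integrable_on {p'..q}" "integral {p'..q} f = ?Y q - ?Y p'"
        by (auto simp: has_integral_iff)
      have mi': "m integrable_on {p'..q}" using integrable_on_subinterval[OF mi(1) sub] .
      have "norm (integral {p'..q} f) \<le> integral {p'..q} m"
      proof (rule integral_norm_bound_integral[OF fi(1) mi'])
        show "norm (f \<tau>) \<le> m \<tau>" if "\<tau> \<in> {p'..q}" for \<tau>
          using Yd(2)[of \<tau>] that pq m0[of \<tau>] by (auto simp: f_def)
      qed
      also have "\<dots> \<le> integral {a..b} m" by (intro integral_subset_le sub mi mi' ballI m0)
      finally show ?thesis using fi by simp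
    qed
    \<comment> \<open>An embedding of H^1 into the continuous functions: the value at e differs from
      that at \<tau> by at most the integral of m, and averaging over \<tau> replaces the value at
      \<tau> by an integral, too.\<close>
    have Yend: "norm (?Y e) \<le> K4 * ?H" if e: "e \<in> {a..b}" for e
    proof -
      let ?M = "integral {a..b} m"
      have pt: "norm (?Y e) \<le> Kd * m \<tau> + ?M" if \<tau>: "\<tau> \<in> {a..b}" for \<tau>
      proof -
        have "norm (?Y e - ?Y \<tau>) \<le> ?M"
          using Ydiff[OF \<tau> e] Ydiff[OF e \<tau>] by (cases "\<tau> \<le> e") (auto simp: norm_minus_commute)
        moreover have "norm (?Y \<tau>) \<le> Kd * m \<tau>"
          using Kd(1)[of "?y \<tau>"] ym[OF \<tau>] Kd(2) by (meson mult_left_mono order_less_imp_le order_trans)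
        ultimately show ?thesis using norm_triangle_ineq2[of "?Y e" "?Y \<tau>"] by linarith
      qed
      have "integral {a..b} (\<lambda>_. norm (?Y e)) \<le> integral {a..b} (\<lambda>\<tau>. Kd * m \<tau> + ?M)"
        by (intro integral_le integrable_add integrable_on_mult_right mi(1)) (auto intro: pt)
      moreover have "integral {a..b} (\<lambda>\<tau>. Kd * m \<tau> + ?M) = Kd * ?M + ?M * (b - a)"
        using ab mi(1) by (subst integral_add) (auto intro: integrable_on_mult_right)
      ultimately have "(b - a) * norm (?Y e) \<le> Kd * ?M + ?M * (b - a)"
        using ab by simp
      then have "norm (?Y e) \<le> (Kd * ?M + ?M * (b - a)) / (b - a)"
        using ab by (simp add: field_simps)
      also have "\<dots> = K4 * ?H"
        unfolding mi(2) using ab by (simp add: K4_def field_simps)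
      finally show ?thesis .
    qed
    \<comment> \<open>The i-th boundary value of the homogeneous part is g i; the rest stems from
      the difference at a and b.\<close>
    have gi: "\<bar>g i\<bar> \<le> \<bar>bdry (pw n t P) i\<bar> + 2 * Kg * K4 * ?H" if i: "i < l" for i
    proof -
      have "g i = bdry (pw n t P) i - (Ga i \<bullet> ?y a + Gb i \<bullet> ?y b)"
        using bc_zg[OF i, of g] by (simp add: bdry_def inner_diff_right)
      moreover have "\<bar>Ga i \<bullet> ?y a\<bar> \<le> Kg * (K4 * ?H)"
        using Kg(2)[OF i, of "?y a"] mult_left_mono[OF Yend[of a] Kg(1)] ab by simp
      moreover have "\<bar>Gb i \<bullet> ?y b\<bar> \<le> Kg * (K4 * ?H)"
        using Kg(3)[OF i, of "?y b"] mult_left_mono[OF Yend[of b] Kg(1)] ab by simp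
      ultimately show ?thesis by (simp add: mult.assoc)
    qed
    have gs: "(\<Sum>i<l. \<bar>g i\<bar>) \<le> ?BC + K5 * ?H"
    proof -
      have "(\<Sum>i<l. \<bar>g i\<bar>) \<le> (\<Sum>i<l. \<bar>bdry (pw n t P) i\<bar> + 2 * Kg * K4 * ?H)"
        by (intro sum_mono gi) simp
      also have "\<dots> = ?BC + K5 * ?H" by (simp add: sum.distrib K5_def)
      finally show ?thesis .
    qed
    have sab: "s \<in> {a..b}" using s partition_piece_subset[OF p j] by auto
    have BC0: "0 \<le> ?BC" by (simp add: sum_nonneg)
    have "norm (pval (P j) s) + norm (dval (P j) s) \<le>
        (norm (pval (P j) s - zg g s) + norm (zg g s)) + (norm (dval (P j) s - ug g s) + norm (ug g s))"
      using norm_triangle_sub[of "pval (P j) s" "zg g s"] norm_triangle_sub[of "dval (P j) s" "ug g s"] by linarith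
    also have "\<dots> \<le> C * (Fj P j s + ?H) + Z * (?BC + K5 * ?H)"
      using est[OF j s] Z(2)[OF sab, of g] mult_left_mono[OF gs Z(1)] by linarith
    also have "\<dots> \<le> K * (Fj P j s + ?H + ?BC)"
    proof -
      have "C * (Fj P j s + ?H) \<le> C * (Fj P j s + ?H + ?BC)"
        using C(1) BC0 by (intro mult_left_mono) auto
      moreover have "?BC + K5 * ?H \<le> (1 + K5) * (Fj P j s + ?H + ?BC)"
        using K50 BC0 H0 Fj_nonneg[of P j s] by (simp add: algebra_simps)
      then have "Z * (?BC + K5 * ?H) \<le> Z * ((1 + K5) * (Fj P j s + ?H + ?BC))"
        using Z(1) by (intro mult_left_mono)
      ultimately show ?thesis by (simp add: K_def algebra_simps)
    qed
    finally show "norm (pval (P j) s) + norm (dval (P j) s) \<le> K * (Fj P j s + ?H + ?BC)" .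
  qed
qed

end

lemma norm_pow2_vec: "(norm (v :: real^'n))\<^sup>2 = (\<Sum>c\<in>UNIV. (v $ c)\<^sup>2)"
  by (simp add: norm_vec_def L2_set_def sum_nonneg)

text \<open>A derivative of order i \<le> e costs h^i, and h0^e \<le> h^i since h0 \<le> 1 and h0
  \<le> h. If an order i > e occurs at all, then L \<le> e, and the derivative vanishes because the
  degree is below i. This alternative is what later distinguishes constant from polynomial
  coefficients.\<close>

lemma inverse_inequality_wj:
  "\<exists>C\<ge>0. \<forall>(W :: 'n::finite \<Rightarrow> real poly) c h h\<^sub>0. (\<forall>d. degree (W d) \<le> L) \<longrightarrow> 0 < h\<^sub>0 \<longrightarrow> h\<^sub>0 \<le> 1 \<longrightarrow> h\<^sub>0 \<le> h \<longrightarrow>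
     m \<le> Suc e \<or> L \<le> e \<longrightarrow>
     (h\<^sub>0 ^ e)\<^sup>2 * integral {c..c+h} (\<lambda>s. (\<Sum>i<m. norm (wj W i s))\<^sup>2) \<le> C * integral {c..c+h} (\<lambda>s. (norm (wj W 0 s))\<^sup>2)"
proof -
  have "\<forall>i. \<exists>C\<ge>0. \<forall>(p :: real poly) c h. degree p \<le> L \<longrightarrow> 0 < h \<longrightarrow>
     (h ^ i)\<^sup>2 * integral {c..c+h} (\<lambda>s. (poly ((pderiv ^^ i) p) s)\<^sup>2) \<le> C * integral {c..c+h} (\<lambda>s. (poly p s)\<^sup>2)"
    using inverse_inequality by blast
  from choice[OF this] obtain K where K: "\<forall>i. K i \<ge> 0 \<and> (\<forall>(p :: real poly) c h. degree p \<le> L \<longrightarrow> 0 < h \<longrightarrow>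
     (h ^ i)\<^sup>2 * integral {c..c+h} (\<lambda>s. (poly ((pderiv ^^ i) p) s)\<^sup>2) \<le> K i * integral {c..c+h} (\<lambda>s. (poly p s)\<^sup>2))" ..
  define C where "C = real m * (\<Sum>i<m. K i)"
  have C0: "0 \<le> C" using K by (simp add: C_def sum_nonneg)
  show ?thesis
  proof (rule exI[of _ C], rule conjI[OF C0], intro allI impI)
    fix W :: "'n \<Rightarrow> real poly" and c h h\<^sub>0 :: real
    assume W: "\<forall>d. degree (W d) \<le> L" and h0: "0 < h\<^sub>0" "h\<^sub>0 \<le> 1" "h\<^sub>0 \<le> h" and e: "m \<le> Suc e \<or> L \<le> e"
    let ?D = "{c..c+h}"
    have ci: "continuous_on ?D (\<lambda>s. (norm (wj W i s))\<^sup>2)" for i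
      unfolding wj_def by (intro continuous_intros continuous_on_vec_lambda)
    have ii: "(\<lambda>s. (norm (wj W i s))\<^sup>2) integrable_on ?D" for i
      by (rule integrable_continuous_real[OF ci])
    have pi: "(\<lambda>s. (poly p s)\<^sup>2) integrable_on ?D" for p :: "real poly"
      by (intro integrable_continuous_real continuous_intros)
    have split: "integral ?D (\<lambda>s. (norm (wj W i s))\<^sup>2) = (\<Sum>d\<in>UNIV. integral ?D (\<lambda>s. (poly ((pderiv ^^ i) (W d)) s)\<^sup>2))" for i
      unfolding norm_pow2_vec wj_def using pi by (simp add: integral_sum)
    have one: "(h\<^sub>0 ^ e)\<^sup>2 * integral ?D (\<lambda>s. (norm (wj W i s))\<^sup>2) \<le> K i * integral ?D (\<lambda>s. (norm (wj W 0 s))\<^sup>2)"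
      if i: "i < m" for i
    proof -
      have "(h\<^sub>0 ^ e)\<^sup>2 * integral ?D (\<lambda>s. (poly ((pderiv ^^ i) (W d)) s)\<^sup>2) \<le>
          K i * integral ?D (\<lambda>s. (poly (W d) s)\<^sup>2)" for d
      proof (cases "i \<le> e")
        case True
        have "h\<^sub>0 ^ e \<le> h\<^sub>0 ^ i" using h0 True by (intro power_decreasing) auto
        also have "\<dots> \<le> h ^ i" using h0 by (intro power_mono) auto
        finally have "(h\<^sub>0 ^ e)\<^sup>2 \<le> (h ^ i)\<^sup>2" using h0 by (intro power_mono) auto
        then have "(h\<^sub>0 ^ e)\<^sup>2 * integral ?D (\<lambda>s. (poly ((pderiv ^^ i) (W d)) s)\<^sup>2) \<le>
            (h ^ i)\<^sup>2 * integral ?D (\<lambda>s. (poly ((pderiv ^^ i) (W d)) s)\<^sup>2)"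
          by (intro mult_right_mono integral_nonneg pi) auto
        also have "\<dots> \<le> K i * integral ?D (\<lambda>s. (poly (W d) s)\<^sup>2)" using K W h0 by auto
        finally show ?thesis .
      next
        case False
        then have "degree (W d) < i" using e i W[rule_format, of d] by auto
        then have "(pderiv ^^ i) (W d) = 0" by (rule higher_pderiv_eq_0)
        moreover have "0 \<le> K i * integral ?D (\<lambda>s. (poly (W d) s)\<^sup>2)"
          using K by (intro mult_nonneg_nonneg integral_nonneg pi) auto
        ultimately show ?thesis by simp
      qed
      then have "(\<Sum>d\<in>UNIV. (h\<^sub>0 ^ e)\<^sup>2 * integral ?D (\<lambda>s. (poly ((pderiv ^^ i) (W d)) s)\<^sup>2)) \<le>
          (\<Sum>d\<in>UNIV. K i * integral ?D (\<lambda>s. (poly (W d) s)\<^sup>2))" by (intro sum_mono)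
      then show ?thesis using split[of i] split[of 0] by (simp add: sum_distrib_left)
    qed
    have "integral ?D (\<lambda>s. (\<Sum>i<m. norm (wj W i s))\<^sup>2) \<le> integral ?D (\<lambda>s. (\<Sum>i<m. (norm (wj W i s))\<^sup>2) * real m)"
    proof (rule integral_le)
      show "(\<lambda>s. (\<Sum>i<m. norm (wj W i s))\<^sup>2) integrable_on ?D"
        unfolding wj_def by (intro integrable_continuous_real continuous_intros continuous_on_vec_lambda)
      show "(\<lambda>s. (\<Sum>i<m. (norm (wj W i s))\<^sup>2) * real m) integrable_on ?D"
        by (intro integrable_on_mult_left integrable_sum ii) auto
      show "(\<Sum>i<m. norm (wj W i s))\<^sup>2 \<le> (\<Sum>i<m. (norm (wj W i s))\<^sup>2) * real m" for s
        using sum_squared_le_sum_of_squares[of "\<lambda>i. norm (wj W i s)" "{..<m}"] by simp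
    qed
    also have "\<dots> = real m * (\<Sum>i<m. integral ?D (\<lambda>s. (norm (wj W i s))\<^sup>2))"
      using ii by (simp add: integral_sum mult.commute)
    finally have "(h\<^sub>0 ^ e)\<^sup>2 * integral ?D (\<lambda>s. (\<Sum>i<m. norm (wj W i s))\<^sup>2) \<le>
        (h\<^sub>0 ^ e)\<^sup>2 * (real m * (\<Sum>i<m. integral ?D (\<lambda>s. (norm (wj W i s))\<^sup>2)))"
      by (intro mult_left_mono) auto
    also have "\<dots> = real m * (\<Sum>i<m. (h\<^sub>0 ^ e)\<^sup>2 * integral ?D (\<lambda>s. (norm (wj W i s))\<^sup>2))"
      by (simp add: sum_distrib_left mult.left_commute)
    also have "\<dots> \<le> real m * (\<Sum>i<m. K i * integral ?D (\<lambda>s. (norm (wj W 0 s))\<^sup>2))"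
      by (intro mult_left_mono sum_mono one) auto
    also have "\<dots> = C * integral ?D (\<lambda>s. (norm (wj W 0 s))\<^sup>2)" by (simp add: C_def sum_distrib_right)
    finally show "(h\<^sub>0 ^ e)\<^sup>2 * integral ?D (\<lambda>s. (\<Sum>i<m. norm (wj W i s))\<^sup>2) \<le> C * integral ?D (\<lambda>s. (norm (wj W 0 s))\<^sup>2)" .
  qed
qed

context dae_bvp_fund
begin

definition wenergy :: "nat \<Rightarrow> (nat \<Rightarrow> real) \<Rightarrow> (nat \<Rightarrow> 'k + 'r \<Rightarrow> real poly) \<Rightarrow> real" where
  "wenergy n t P = (\<Sum>j=1..n. integral {t (j - 1)..t j} (\<lambda>s. (norm (wj (rp (P j)) 0 s))\<^sup>2))"

text \<open>The squared H_D^1 norm of the ansatz function, and \<open>wenergy\<close> the squared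
  L^2 norm of its residual, both in terms of the polynomial pieces.\<close>

definition henergy :: "nat \<Rightarrow> (nat \<Rightarrow> real) \<Rightarrow> (nat \<Rightarrow> 'k + 'r \<Rightarrow> real poly) \<Rightarrow> real" where
  "henergy n t P = (\<Sum>j=1..n. integral {t (j - 1)..t j} (\<lambda>s. (norm (pval (P j) s))\<^sup>2 + (norm (dval (P j) s))\<^sup>2))"

lemma degree_rp:
  assumes dA: "\<And>c i. degree (PA c i) \<le> N'" and dB: "\<And>c d. degree (PB c d) \<le> N'"
    and p: "\<And>c. degree (p c) \<le> N"
  shows "degree (rp p c) \<le> N + N'"
proof -
  have 1: "degree (PA c i * pderiv (p (Inl i))) \<le> N + N'" for i
    using degree_mult_le[of "PA c i" "pderiv (p (Inl i))"] dA[of c i] p[of "Inl i"] by (simp add: degree_pderiv)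
  have 2: "degree (PB c d * p d) \<le> N + N'" for d
    using degree_mult_le[of "PB c d" "p d"] dB[of c d] p[of d] by simp
  show ?thesis unfolding rp_def
    by (intro degree_add_le degree_sum_le 1 2) auto
qed

lemma degree_admissible:
  "admissible_family N n t P \<Longrightarrow> j \<in> {1..n} \<Longrightarrow> degree (P j c) \<le> N"
  unfolding admissible_family_def by (cases c) (fastforce intro: order_trans)+

text \<open>The pointwise bound is squared and integrated; \<open>HF\<close> is estimated by
  Cauchy-Schwarz on [a,b], and the derivatives of the residual are removed by the inverse
  inequality. Here h0 is any lower bound of the step sizes that is at most 1, and e is the number of
  powers lost: \<mu>-1, or N + N' when that is smaller.\<close>

lemma stability:
  assumes dA: "\<And>c i. degree (PA c i) \<le> N'" and dB: "\<And>c d. degree (PB c d) \<le> N'"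
    and e: "\<mu> \<le> Suc e \<or> N + N' \<le> e"
  shows "\<exists>C\<ge>0. \<forall>n t P h\<^sub>0. is_partition a b n t \<longrightarrow> admissible_family N n t P \<longrightarrow>
    0 < h\<^sub>0 \<longrightarrow> h\<^sub>0 \<le> 1 \<longrightarrow> (\<forall>j\<in>{1..n}. h\<^sub>0 \<le> step t j) \<longrightarrow>
    (h\<^sub>0 ^ e)\<^sup>2 * henergy n t P \<le> C * (wenergy n t P + (\<Sum>i<l. (bdry (pw n t P) i)\<^sup>2))"
proof -
  obtain C where C: "0 \<le> C" "\<forall>n t P N. is_partition a b n t \<longrightarrow> admissible_family N n t P \<longrightarrow>
    (\<forall>j\<in>{1..n}. \<forall>s\<in>{t (j - 1)..t j}.
      norm (pval (P j) s) + norm (dval (P j) s) \<le> C * (Fj P j s + HF n t P + (\<Sum>i<l. \<bar>bdry (pw n t P) i\<bar>)))"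
    using stability_pointwise by blast
  from inverse_inequality_wj[of "N + N'" \<mu> e] obtain K where K0: "0 \<le> K \<and>
    (\<forall>(W :: 'k + 'r \<Rightarrow> real poly) c h h\<^sub>0. (\<forall>d. degree (W d) \<le> N + N') \<longrightarrow> 0 < h\<^sub>0 \<longrightarrow> h\<^sub>0 \<le> 1 \<longrightarrow> h\<^sub>0 \<le> h \<longrightarrow>
     \<mu> \<le> Suc e \<or> N + N' \<le> e \<longrightarrow>
     (h\<^sub>0 ^ e)\<^sup>2 * integral {c..c+h} (\<lambda>s. (\<Sum>i<\<mu>. norm (wj W i s))\<^sup>2) \<le> K * integral {c..c+h} (\<lambda>s. (norm (wj W 0 s))\<^sup>2))" ..
  define C1 where "C1 = 3 * C\<^sup>2 * (1 + (b - a)\<^sup>2)"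
  define C2 where "C2 = 3 * C\<^sup>2 * (b - a) * real l"
  have C12: "0 \<le> C1" "0 \<le> C2" using ab by (auto simp: C1_def C2_def)
  define D where "D = C1 * K + C2"
  have D0: "0 \<le> D" using C12 K0 by (simp add: D_def)
  show ?thesis
  proof (rule exI[of _ D], rule conjI[OF D0], intro allI impI)
    fix n t h\<^sub>0 and P :: "nat \<Rightarrow> 'k + 'r \<Rightarrow> real poly"
    assume p: "is_partition a b n t" and P: "admissible_family N n t P"
      and h0: "0 < h\<^sub>0" "h\<^sub>0 \<le> 1" and hj: "\<forall>j\<in>{1..n}. h\<^sub>0 \<le> step t j"
    let ?H = "HF n t P" let ?BC = "\<Sum>i<l. \<bar>bdry (pw n t P) i\<bar>" let ?B2 = "\<Sum>i<l. (bdry (pw n t P) i)\<^sup>2"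
    define FF where "FF = (\<Sum>j=1..n. integral {t (j - 1)..t j} (\<lambda>s. (Fj P j s)\<^sup>2))"
    have cF2: "continuous_on S (\<lambda>s. (Fj P j s)\<^sup>2)" for S j by (intro continuous_intros continuous_on_Fj)
    have len: "(\<Sum>j=1..n. t j - t (j - 1)) = b - a"
      using sum_telescope''[of 0 n t] partition_ends[OF p] by (simp add: sum.atLeast1_atMost_eq atLeastSucAtMost_greaterThanAtMost)
    \<comment> \<open>Cauchy-Schwarz on the whole interval, for the function that is
      \<open>Fj P j\<close> on piece j.\<close>
    have H2: "?H\<^sup>2 \<le> (b - a) * FF"
    proof -
      have eF: "Fj P (idx n t s) s = Fj P j s" if "j \<in> {1..n}" "s \<in> {t (j - 1)<..<t j}" for j s
        using idx_eq[OF p that(1), of s] that by simp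
      have eF2: "(Fj P (idx n t s) s)\<^sup>2 = (Fj P j s)\<^sup>2" if "j \<in> {1..n}" "s \<in> {t (j - 1)<..<t j}" for j s
        using eF[OF that] by simp
      note i2 = integral_pieces[where f = "\<lambda>s. (Fj P (idx n t s) s)\<^sup>2" and g = "\<lambda>j s. (Fj P j s)\<^sup>2", OF p cF2 eF2]
      note i1 = HF_integral[OF p, of P]
      have "(integral {a..b} (\<lambda>s. Fj P (idx n t s) s))\<^sup>2 \<le> (b - a) * integral {a..b} (\<lambda>s. (Fj P (idx n t s) s)\<^sup>2)"
        using ab by (intro integral_Cauchy_Schwarz_1 i1(1) i2(1)) auto
      then show ?thesis using i1(2) i2(2) by (simp add: FF_def)
    qed
    have B2: "?BC\<^sup>2 \<le> real l * ?B2"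
      using sum_squared_le_sum_of_squares[of "\<lambda>i. \<bar>bdry (pw n t P) i\<bar>" "{..<l}"] by (simp add: mult.commute)
    have pt: "(norm (pval (P j) s))\<^sup>2 + (norm (dval (P j) s))\<^sup>2 \<le> 3 * C\<^sup>2 * ((Fj P j s)\<^sup>2 + (?H\<^sup>2 + ?BC\<^sup>2))"
      if "j \<in> {1..n}" "s \<in> {t (j - 1)..t j}" for j s
    proof -
      have "(norm (pval (P j) s))\<^sup>2 + (norm (dval (P j) s))\<^sup>2 \<le> (norm (pval (P j) s) + norm (dval (P j) s))\<^sup>2"
        by (simp add: power2_sum)
      also have "\<dots> \<le> (C * (Fj P j s + ?H + ?BC))\<^sup>2"
        by (rule power_mono[OF C(2)[rule_format, OF p P that]]) simp
      also have "\<dots> = C\<^sup>2 * (Fj P j s + ?H + ?BC)\<^sup>2" by (simp add: power_mult_distrib)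
      also have "\<dots> \<le> C\<^sup>2 * (3 * ((Fj P j s)\<^sup>2 + (?H\<^sup>2 + ?BC\<^sup>2)))"
      proof (rule mult_left_mono)
        have "0 \<le> (x - y)\<^sup>2 + (y - z)\<^sup>2 + (x - z)\<^sup>2" for x y z :: real by simp
        then have "(x + y + z)\<^sup>2 \<le> 3 * (x\<^sup>2 + (y\<^sup>2 + z\<^sup>2))" for x y z :: real
          by (simp add: power2_eq_square algebra_simps)
        then show "(Fj P j s + ?H + ?BC)\<^sup>2 \<le> 3 * ((Fj P j s)\<^sup>2 + (?H\<^sup>2 + ?BC\<^sup>2))" .
      qed simp
      finally show ?thesis by (simp only: mult_ac)
    qed
    have "henergy n t P \<le> (\<Sum>j=1..n. 3 * C\<^sup>2 * (integral {t (j - 1)..t j} (\<lambda>s. (Fj P j s)\<^sup>2) + (t j - t (j - 1)) * (?H\<^sup>2 + ?BC\<^sup>2)))"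
      unfolding henergy_def
    proof (rule sum_mono)
      fix j assume j: "j \<in> {1..n}"
      have tj: "t (j - 1) \<le> t j" using partition_step[OF p j] by simp
      have "integral {t (j - 1)..t j} (\<lambda>s. (norm (pval (P j) s))\<^sup>2 + (norm (dval (P j) s))\<^sup>2) \<le>
          integral {t (j - 1)..t j} (\<lambda>s. 3 * C\<^sup>2 * ((Fj P j s)\<^sup>2 + (?H\<^sup>2 + ?BC\<^sup>2)))"
      proof (rule integral_le)
        show "(\<lambda>s. (norm (pval (P j) s))\<^sup>2 + (norm (dval (P j) s))\<^sup>2) integrable_on {t (j - 1)..t j}"
          by (intro integrable_continuous_real continuous_intros continuous_on_pval continuous_on_dval)
        show "(\<lambda>s. 3 * C\<^sup>2 * ((Fj P j s)\<^sup>2 + (?H\<^sup>2 + ?BC\<^sup>2))) integrable_on {t (j - 1)..t j}"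
          by (intro integrable_continuous_real continuous_intros continuous_on_Fj)
      qed (rule pt[OF j])
      also have "\<dots> = 3 * C\<^sup>2 * (integral {t (j - 1)..t j} (\<lambda>s. (Fj P j s)\<^sup>2) + (t j - t (j - 1)) * (?H\<^sup>2 + ?BC\<^sup>2))"
        unfolding integral_mult_right using tj
        by (subst integral_add) (auto intro: integrable_continuous_real cF2)
      finally show "integral {t (j - 1)..t j} (\<lambda>s. (norm (pval (P j) s))\<^sup>2 + (norm (dval (P j) s))\<^sup>2) \<le>
        3 * C\<^sup>2 * (integral {t (j - 1)..t j} (\<lambda>s. (Fj P j s)\<^sup>2) + (t j - t (j - 1)) * (?H\<^sup>2 + ?BC\<^sup>2))" .
    qed
    also have "\<dots> = 3 * C\<^sup>2 * (FF + (b - a) * (?H\<^sup>2 + ?BC\<^sup>2))"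
      using len by (simp add: sum_distrib_left[symmetric] sum.distrib sum_distrib_right[symmetric] FF_def)
    also have "\<dots> \<le> 3 * C\<^sup>2 * (FF + (b - a) * ((b - a) * FF + real l * ?B2))"
      using H2 B2 ab by (intro mult_left_mono add_left_mono add_mono) auto
    also have "\<dots> = C1 * FF + C2 * ?B2"
      by (simp add: C1_def C2_def power2_eq_square algebra_simps)
    finally have hen: "henergy n t P \<le> C1 * FF + C2 * ?B2" .
    have FFb: "(h\<^sub>0 ^ e)\<^sup>2 * FF \<le> K * wenergy n t P"
      unfolding FF_def wenergy_def sum_distrib_left
    proof (rule sum_mono)
      fix j assume j: "j \<in> {1..n}"
      have "\<forall>d. degree (rp (P j) d) \<le> N + N'"
        using degree_rp[OF dA dB, of "P j" N] degree_admissible[OF P j] by blast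
      then have "(h\<^sub>0 ^ e)\<^sup>2 * integral {t (j - 1)..t (j - 1) + step t j} (\<lambda>s. (\<Sum>i<\<mu>. norm (wj (rp (P j)) i s))\<^sup>2)
          \<le> K * integral {t (j - 1)..t (j - 1) + step t j} (\<lambda>s. (norm (wj (rp (P j)) 0 s))\<^sup>2)"
        using K0 h0 hj j e by blast
      then show "(h\<^sub>0 ^ e)\<^sup>2 * integral {t (j - 1)..t j} (\<lambda>s. (Fj P j s)\<^sup>2) \<le>
          K * integral {t (j - 1)..t j} (\<lambda>s. (norm (wj (rp (P j)) 0 s))\<^sup>2)"
        by (simp add: step_def Fj_def)
    qed
    have he1: "(h\<^sub>0 ^ e)\<^sup>2 \<le> 1" using h0 by (simp add: power_le_one)
    have B20: "0 \<le> ?B2" by (simp add: sum_nonneg)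
    have w0: "0 \<le> wenergy n t P"
      unfolding wenergy_def
      by (intro sum_nonneg integral_nonneg integrable_continuous_real continuous_intros continuous_on_wj) auto
    have "(h\<^sub>0 ^ e)\<^sup>2 * henergy n t P \<le> (h\<^sub>0 ^ e)\<^sup>2 * (C1 * FF + C2 * ?B2)"
      using hen by (intro mult_left_mono) auto
    also have "\<dots> = C1 * ((h\<^sub>0 ^ e)\<^sup>2 * FF) + C2 * ((h\<^sub>0 ^ e)\<^sup>2 * ?B2)" by (simp add: algebra_simps)
    also have "\<dots> \<le> C1 * (K * wenergy n t P) + C2 * (1 * ?B2)"
      using C12 FFb he1 B20 by (intro add_mono mult_left_mono mult_right_mono) auto
    also have "\<dots> \<le> D * (wenergy n t P + ?B2)"
      using C12 K0 B20 w0 by (simp add: D_def algebra_simps)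
    finally show "(h\<^sub>0 ^ e)\<^sup>2 * henergy n t P \<le> D * (wenergy n t P + ?B2)" .
  qed
qed

end

section \<open>Weak derivatives and the norm of H_D^1\<close>

lemma pieces_integrable:
  fixes f :: "real \<Rightarrow> 'v::euclidean_space"
  assumes p: "is_partition a b n t"
    and c: "\<And>j. j \<in> {1..n} \<Longrightarrow> continuous_on {t (j - 1)..t j} (g j)"
    and e: "\<And>j s. j \<in> {1..n} \<Longrightarrow> s \<in> {t (j - 1)<..<t j} \<Longrightarrow> f s = g j s"
  shows "integrable (lebesgue_on {a<..<b}) f"
    "(\<integral>s. f s \<partial>lebesgue_on {a<..<b}) = (\<Sum>j=1..n. integral {t (j - 1)..t j} (g j))"
proof -
  have en: "norm (f s) = norm (g j s)" if "j \<in> {1..n}" "s \<in> {t (j - 1)<..<t j}" for j s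
    using e[OF that] by simp
  have cn: "continuous_on {t (j - 1)..t j} (\<lambda>s. norm (g j s))" if "j \<in> {1..n}" for j
    using c[OF that] by (rule continuous_on_norm)
  have "f integrable_on {a..b}" by (rule integral_pieces(1)[where g = g, OF p c e])
  moreover have "(\<lambda>s. norm (f s)) integrable_on {a..b}"
    by (rule integral_pieces(1)[where g = "\<lambda>j s. norm (g j s)", OF p cn en])
  ultimately have "f absolutely_integrable_on {a..b}" by (rule absolutely_integrable_onI)
  then have "f absolutely_integrable_on {a<..<b}" by (rule set_integrable_subset) auto
  then show i: "integrable (lebesgue_on {a<..<b}) f" by (rule absolutely_integrable_imp_integrable) simp
  have "(\<integral>s. f s \<partial>lebesgue_on {a<..<b}) = integral {a<..<b} f"
    by (rule lebesgue_integral_eq_integral[OF i]) simp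
  also have "\<dots> = integral {a..b} f" by (rule integral_open_interval_real[symmetric])
  also have "\<dots> = (\<Sum>j=1..n. integral {t (j - 1)..t j} (g j))"
    by (rule integral_pieces(2)[where g = g, OF p c e])
  finally show "(\<integral>s. f s \<partial>lebesgue_on {a<..<b}) = (\<Sum>j=1..n. integral {t (j - 1)..t j} (g j))" .
qed

lemma pieces_L2:
  fixes f :: "real \<Rightarrow> 'v::euclidean_space"
  assumes p: "is_partition a b n t"
    and c: "\<And>j. j \<in> {1..n} \<Longrightarrow> continuous_on {t (j - 1)..t j} (g j)"
    and e: "\<And>j s. j \<in> {1..n} \<Longrightarrow> s \<in> {t (j - 1)<..<t j} \<Longrightarrow> f s = g j s"
  shows "f \<in> L2 a b" "(L2_norm a b f)\<^sup>2 = (\<Sum>j=1..n. integral {t (j - 1)..t j} (\<lambda>s. (norm (g j s))\<^sup>2))"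
proof -
  have en: "(norm (f s))\<^sup>2 = (norm (g j s))\<^sup>2" if "j \<in> {1..n}" "s \<in> {t (j - 1)<..<t j}" for j s
    using e[OF that] by simp
  have cn: "continuous_on {t (j - 1)..t j} (\<lambda>s. (norm (g j s))\<^sup>2)" if "j \<in> {1..n}" for j
    by (intro continuous_intros c that)
  note i = pieces_integrable[where f = "\<lambda>s. (norm (f s))\<^sup>2" and g = "\<lambda>j s. (norm (g j s))\<^sup>2", OF p cn en]
  have "integrable (lebesgue_on {a<..<b}) f" by (rule pieces_integrable(1)[where g = g, OF p c e])
  then show "f \<in> L2 a b" using i(1) by (auto simp: L2_def)
  have "0 \<le> (\<integral>s. (norm (f s))\<^sup>2 \<partial>lebesgue_on {a<..<b})" by (intro integral_nonneg_AE) simp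
  then have "(L2_norm a b f)\<^sup>2 = (\<integral>s. (norm (f s))\<^sup>2 \<partial>lebesgue_on {a<..<b})"
    by (simp add: L2_norm_def)
  then show "(L2_norm a b f)\<^sup>2 = (\<Sum>j=1..n. integral {t (j - 1)..t j} (\<lambda>s. (norm (g j s))\<^sup>2))"
    by (rule trans[OF _ i(2)])
qed

lemma L2_integrable:
  fixes f :: "real \<Rightarrow> 'v::euclidean_space"
  assumes "f \<in> L2 a b" shows "integrable (lebesgue_on {a<..<b}) f"
proof -
  interpret finite_measure "lebesgue_on {a<..<b}"
    by (intro finite_measure_lebesgue_on bounded_set_imp_lmeasurable) auto
  show ?thesis
  proof (rule Bochner_Integration.integrable_bound[of _ "\<lambda>s. 1 + (norm (f s))\<^sup>2"])
    show "integrable (lebesgue_on {a<..<b}) (\<lambda>s. 1 + (norm (f s))\<^sup>2)"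
      using assms by (auto simp: L2_def)
    show "f \<in> borel_measurable (lebesgue_on {a<..<b})" using assms by (simp add: L2_def)
    have "y \<le> 1 + y\<^sup>2" for y :: real
      using zero_le_power2[of "y - 1/2"] by (simp add: power2_eq_square algebra_simps)
    then show "AE s in lebesgue_on {a<..<b}. norm (f s) \<le> norm (1 + (norm (f s))\<^sup>2)"
      by (intro AE_I2) (simp add: add_nonneg_nonneg)
  qed
qed

lemma DERIV_max_0_power2: "((\<lambda>s. (max 0 (s - c))\<^sup>2) has_real_derivative 2 * max 0 (s - c)) (at s)"
proof (cases s c rule: linorder_cases)
  case less
  have "((\<lambda>s. 0) has_real_derivative 2 * max 0 (s - c)) (at s)" using less by simp
  then show ?thesis
    by (rule has_field_derivative_transform_within_open[of _ _ _ "{..<c}"]) (use less in auto)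
next
  case greater
  have "((\<lambda>s. (s - c)\<^sup>2) has_real_derivative 2 * max 0 (s - c)) (at s)"
    using greater by (auto intro!: derivative_eq_intros)
  then show ?thesis
    by (rule has_field_derivative_transform_within_open[of _ _ _ "{c<..}"]) (use greater in auto)
next
  case equal
  have "((\<lambda>h::real. ((max 0 h)\<^sup>2) / h) \<longlongrightarrow> 0) (at 0)"
  proof (rule Lim_null_comparison[of _ "\<lambda>h. \<bar>h\<bar>"])
    have "norm ((max 0 h)\<^sup>2 / h) \<le> \<bar>h\<bar>" for h :: real
      by (cases "0 < h") (auto simp: power2_eq_square max_def)
    then show "\<forall>\<^sub>F h in at 0. norm ((max 0 h)\<^sup>2 / h) \<le> \<bar>h\<bar>" by simp
    show "((\<lambda>h. \<bar>h\<bar>) \<longlongrightarrow> 0) (at (0::real))" by (auto intro!: tendsto_eq_intros)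
  qed
  then show ?thesis using equal by (simp add: DERIV_def)
qed

text \<open>With y a product of squared positive parts, 1 - 1/(1 + (n+1) y) is a C^1 function with
  values in [0,1]. It vanishes off the interval shortened by (b-a)/(n+3) at both ends and tends to 1
  at every interior point of (a,b).\<close>

definition cutoff :: "real \<Rightarrow> real \<Rightarrow> nat \<Rightarrow> real \<Rightarrow> real" where
  "cutoff a b n s = 1 - 1 / (1 + real (Suc n) *
     ((max 0 (s - (a + (b - a) / (real n + 3))))\<^sup>2 * (max 0 ((b - (b - a) / (real n + 3)) - s))\<^sup>2))"

lemma cutoff_C1:
  obtains D where "continuous_on UNIV D" "\<And>s. (cutoff a b n has_real_derivative D s) (at s)"
proof -
  define c where "c = a + (b - a) / (real n + 3)"
  define e where "e = b - (b - a) / (real n + 3)"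
  define y where "y s = (max 0 (s - c))\<^sup>2 * (max 0 (e - s))\<^sup>2" for s
  define y' where "y' s = 2 * max 0 (s - c) * (max 0 (e - s))\<^sup>2 - (max 0 (s - c))\<^sup>2 * (2 * max 0 (e - s))" for s
  have y0: "0 \<le> y s" for s by (simp add: y_def)
  have pos: "1 + real (Suc n) * y s > 0" for s using y0[of s] by (intro add_pos_nonneg) auto
  have e': "((\<lambda>s. (max 0 (e - s))\<^sup>2) has_real_derivative - (2 * max 0 (e - s))) (at s)" for s
  proof -
    have "((\<lambda>s. (max 0 ((- s) - (- e)))\<^sup>2) has_real_derivative (2 * max 0 ((- s) - (- e))) * (- 1)) (at s)"
      by (rule DERIV_chain2[OF DERIV_max_0_power2]) (auto intro!: derivative_eq_intros)
    then show ?thesis by simp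
  qed
  have dy: "(y has_real_derivative y' s) (at s)" for s
    unfolding y_def[abs_def] y'_def
    using DERIV_mult[OF DERIV_max_0_power2[of c s] e'[of s]] by (simp add: algebra_simps)
  have cut: "cutoff a b n = (\<lambda>s. 1 - 1 / (1 + real (Suc n) * y s))"
    by (simp add: fun_eq_iff cutoff_def y_def c_def e_def)
  have "(cutoff a b n has_real_derivative real (Suc n) * y' s / (1 + real (Suc n) * y s)\<^sup>2) (at s)" for s
    unfolding cut using pos[of s]
    by (auto intro!: derivative_eq_intros dy simp: power2_eq_square)
  moreover have "continuous_on UNIV (\<lambda>s. real (Suc n) * y' s / (1 + real (Suc n) * y s)\<^sup>2)"
    unfolding y_def[abs_def] y'_def[abs_def]
    using pos unfolding y_def by (intro continuous_intros) (auto simp: less_imp_neq[symmetric] dest: spec)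
  ultimately show ?thesis using that by blast
qed

lemma cutoff_range: "0 \<le> cutoff a b n s" "cutoff a b n s \<le> 1"
proof -
  let ?y = "(max 0 (s - (a + (b - a) / (real n + 3))))\<^sup>2 * (max 0 ((b - (b - a) / (real n + 3)) - s))\<^sup>2"
  have u: "0 \<le> 1 / x \<and> 1 / x \<le> 1" if "1 \<le> x" for x :: real using that by simp
  have "0 \<le> real (Suc n) * ?y" by simp
  then have "1 \<le> 1 + real (Suc n) * ?y" by linarith
  from u[OF this] have "0 \<le> 1 / (1 + real (Suc n) * ?y)" "1 / (1 + real (Suc n) * ?y) \<le> 1" by blast+
  then show "0 \<le> cutoff a b n s" "cutoff a b n s \<le> 1" unfolding cutoff_def by linarith+
qed

lemma cutoff_support:
  "s \<notin> {a + (b - a) / (real n + 3)..b - (b - a) / (real n + 3)} \<Longrightarrow> cutoff a b n s = 0"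
  by (auto simp: cutoff_def max_def)

lemma cutoff_tendsto:
  assumes "a < s" "s < b" shows "(\<lambda>n. cutoff a b n s) \<longlonglongrightarrow> 1"
proof -
  have l0: "(\<lambda>n. (b - a) / (real n + 3)) \<longlonglongrightarrow> 0"
    by (rule real_tendsto_divide_at_top[OF tendsto_const])
      (rule filterlim_at_top_mono[OF filterlim_real_sequentially], simp)
  have "(\<lambda>n. (max 0 (s - (a + (b - a) / (real n + 3))))\<^sup>2 * (max 0 ((b - (b - a) / (real n + 3)) - s))\<^sup>2)
      \<longlonglongrightarrow> (max 0 (s - (a + 0)))\<^sup>2 * (max 0 ((b - 0) - s))\<^sup>2"
    by (intro tendsto_intros l0)
  moreover have "0 < (max 0 (s - (a + 0)))\<^sup>2 * (max 0 ((b - 0) - s))\<^sup>2" using assms by simp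
  ultimately have "filterlim (\<lambda>n. ((max 0 (s - (a + (b - a) / (real n + 3))))\<^sup>2 * (max 0 ((b - (b - a) / (real n + 3)) - s))\<^sup>2) * real (Suc n)) at_top sequentially"
    by (rule filterlim_tendsto_pos_mult_at_top)
      (rule filterlim_compose[OF filterlim_real_sequentially filterlim_Suc])
  then have "filterlim (\<lambda>n. 1 + real (Suc n) * ((max 0 (s - (a + (b - a) / (real n + 3))))\<^sup>2 * (max 0 ((b - (b - a) / (real n + 3)) - s))\<^sup>2)) at_top sequentially"
    by (intro filterlim_tendsto_add_at_top[OF tendsto_const]) (simp add: mult.commute)
  then have "(\<lambda>n. 1 - 1 / (1 + real (Suc n) * ((max 0 (s - (a + (b - a) / (real n + 3))))\<^sup>2 * (max 0 ((b - (b - a) / (real n + 3)) - s))\<^sup>2))) \<longlonglongrightarrow> 1 - 0"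
    by (intro tendsto_diff tendsto_const real_tendsto_divide_at_top[OF tendsto_const])
  then show ?thesis by (simp add: cutoff_def[abs_def])
qed

lemma test_function_polynomial_cutoff:
  assumes "a < b" and q: "real_polynomial_function q"
  shows "test_function a b (\<lambda>s. q s * cutoff a b n s)"
proof -
  obtain q' where q': "real_polynomial_function q'" "\<And>s. (q has_real_derivative q' s) (at s)"
    using has_real_derivative_polynomial_function[OF q[unfolded real_polynomial_function_eq[symmetric]]]
    by (metis q has_real_derivative_polynomial_function real_polynomial_function_eq)
  obtain D where D: "continuous_on UNIV D" "\<And>s. (cutoff a b n has_real_derivative D s) (at s)"
    by (rule cutoff_C1) (rule that)
  define F where "F i s = (if i = 0 then q s * cutoff a b n s else q' s * cutoff a b n s + q s * D s)" for i :: nat and s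
  have cq: "continuous_on UNIV q" "continuous_on UNIV q'"
    using q q'(1) by (auto intro!: continuous_at_imp_continuous_on continuous_real_polymonial_function)
  have cc: "continuous_on UNIV (cutoff a b n)"
    by (rule DERIV_continuous_on[where D = D]) (simp add: D(2))
  have "Ck_on 1 UNIV (\<lambda>s. q s * cutoff a b n s)"
    unfolding Ck_on_def
  proof (intro exI[of _ F] conjI allI impI ballI)
    show "F 0 = (\<lambda>s. q s * cutoff a b n s)" by (simp add: F_def fun_eq_iff)
    show "continuous_on UNIV (F i)" for i
      unfolding F_def using cq cc D(1) by (cases "i = 0") (auto intro!: continuous_intros)
    show "(F i has_vector_derivative F (Suc i) s) (at s within UNIV)" if "i < 1" for i s
      using that DERIV_mult[OF q'(2)[of s] D(2)[of s]]
      by (simp add: F_def[abs_def] has_real_derivative_iff_has_vector_derivative[symmetric] mult.commute add.commute)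
  qed
  moreover have "\<exists>c e. a < c \<and> e < b \<and> (\<forall>s. s \<notin> {c..e} \<longrightarrow> q s * cutoff a b n s = 0)"
    using assms(1) cutoff_support[of _ a b n]
    by (intro exI[of _ "a + (b - a) / (real n + 3)"] exI[of _ "b - (b - a) / (real n + 3)"]) auto
  ultimately show ?thesis by (simp add: test_function_def)
qed

(* The sign of f is an almost everywhere limit of bounded test functions. *)
lemma fundamental_lemma:
  fixes f :: "real \<Rightarrow> real"
  assumes ab: "a < b" and f: "integrable (lebesgue_on {a<..<b}) f"
    and z: "\<And>\<phi>. test_function a b \<phi> \<Longrightarrow> (\<integral>s. \<phi> s * f s \<partial>lebesgue_on {a<..<b}) = 0"
  shows "AE s in lebesgue_on {a<..<b}. f s = 0"
proof -
  let ?M = "lebesgue_on {a<..<b}"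
  have [measurable]: "f \<in> borel_measurable ?M" using f by auto
  have "(\<lambda>s. sgn (f s)) \<in> borel_measurable ?M" by measurable
  then have "(\<lambda>s. sgn (f s)) measurable_on {a<..<b}"
    by (simp add: measurable_on_iff_borel_measurable)
  then obtain N g where N: "negligible N" and g: "\<And>n. continuous_on UNIV (g n)"
    and lim: "\<And>x. x \<notin> N \<Longrightarrow> (\<lambda>n. g n x) \<longlonglongrightarrow> (if x \<in> {a<..<b} then sgn (f x) else 0)"
    unfolding measurable_on_def by blast
  \<comment> \<open>Truncation to [-1,1] preserves the limit sgn f and provides the uniform bound
    for dominated convergence. The polynomials that replace h n supply differentiability, and the
    cutoff supplies compact support.\<close>
  define h where "h n s = max (- 1) (min 1 (g n s))" for n s
  have "\<exists>q. real_polynomial_function q \<and> (\<forall>s\<in>{a..b}. \<bar>h n s - q s\<bar> < 1 / real (Suc n))" for n :: nat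
  proof -
    have "continuous_on {a..b} (h n)"
      unfolding h_def[abs_def] by (intro continuous_intros continuous_on_subset[OF g]) auto
    from Stone_Weierstrass_real_polynomial_function[OF compact_Icc this, of "1 / real (Suc n)"]
    show ?thesis by (metis of_nat_0_less_iff zero_less_Suc zero_less_divide_1_iff)
  qed
  then have "\<forall>n::nat. \<exists>q. real_polynomial_function q \<and> (\<forall>s\<in>{a..b}. \<bar>h n s - q s\<bar> < 1 / real (Suc n))" by blast
  from choice[OF this] obtain q where q: "\<forall>n. real_polynomial_function (q n) \<and> (\<forall>s\<in>{a..b}. \<bar>h n s - q n s\<bar> < 1 / real (Suc n))" ..
  define \<phi> where "\<phi> n s = q n s * cutoff a b n s" for n s
  have test: "test_function a b (\<phi> n)" for n
    unfolding \<phi>_def[abs_def] using q by (intro test_function_polynomial_cutoff ab) auto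
  have bound: "\<bar>\<phi> n s\<bar> \<le> 2" if "s \<in> {a..b}" for n s
  proof -
    have "\<bar>h n s\<bar> \<le> 1" by (auto simp: h_def)
    moreover have "\<bar>h n s - q n s\<bar> < 1 / real (Suc n)" using q that by blast
    moreover have "1 / real (Suc n) \<le> 1" by (simp add: divide_simps)
    ultimately have "\<bar>q n s\<bar> \<le> 2" by linarith
    then show ?thesis
      using cutoff_range[of a b n s] mult_mono[of "\<bar>q n s\<bar>" 2 "\<bar>cutoff a b n s\<bar>" 1] by (simp add: \<phi>_def abs_mult)
  qed
  have pw: "(\<lambda>n. \<phi> n s) \<longlonglongrightarrow> sgn (f s)" if s: "s \<in> {a<..<b}" "s \<notin> N" for s
  proof -
    have "(\<lambda>n. h n s) \<longlonglongrightarrow> max (- 1) (min 1 (sgn (f s)))"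
      unfolding h_def using lim[OF s(2)] s(1) by (intro tendsto_intros) simp
    moreover have "max (- 1) (min 1 (sgn (f s))) = sgn (f s)" by (auto simp: sgn_if)
    ultimately have h: "(\<lambda>n. h n s) \<longlonglongrightarrow> sgn (f s)" by simp
    have "(\<lambda>n. h n s - q n s) \<longlonglongrightarrow> 0"
    proof (rule Lim_null_comparison)
      show "\<forall>\<^sub>F n in sequentially. norm (h n s - q n s) \<le> 1 / real (Suc n)"
        using q s by (intro always_eventually) (auto intro!: less_imp_le simp del: of_nat_Suc)
      show "(\<lambda>n. 1 / real (Suc n)) \<longlonglongrightarrow> 0" using LIMSEQ_inverse_real_of_nat by (simp add: inverse_eq_divide)
    qed
    from tendsto_diff[OF h this] have "(\<lambda>n. q n s) \<longlonglongrightarrow> sgn (f s)" by simp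
    from tendsto_mult[OF this cutoff_tendsto[of a s b]] s show ?thesis by (simp add: \<phi>_def)
  qed
  have AEN: "AE s in ?M. s \<in> {a<..<b} \<and> s \<notin> N"
  proof -
    have "AE s in lebesgue. s \<notin> N"
      using N by (simp add: negligible_iff_null_sets AE_not_in)
    then show ?thesis by (subst AE_restrict_space_iff) auto
  qed
  have meas: "\<phi> n \<in> borel_measurable ?M" for n
  proof -
    have "continuous_on {a<..<b} (\<phi> n)"
      using test[of n] unfolding test_function_def Ck_on_def by (metis continuous_on_subset subset_UNIV le0)
    then show ?thesis by (intro continuous_imp_measurable_on_sets_lebesgue) auto
  qed
  have "(\<lambda>n. \<integral>s. \<phi> n s * f s \<partial>?M) \<longlonglongrightarrow> (\<integral>s. sgn (f s) * f s \<partial>?M)"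
  proof (rule integral_dominated_convergence[where w = "\<lambda>s. 2 * \<bar>f s\<bar>"])
    show "(\<lambda>s. sgn (f s) * f s) \<in> borel_measurable ?M" by measurable
    show "(\<lambda>s. \<phi> n s * f s) \<in> borel_measurable ?M" for n using meas[of n] by measurable
    show "integrable ?M (\<lambda>s. 2 * \<bar>f s\<bar>)" using f by auto
    show "AE s in ?M. (\<lambda>n. \<phi> n s * f s) \<longlonglongrightarrow> sgn (f s) * f s"
      using AEN by eventually_elim (intro tendsto_mult tendsto_const pw, auto)
    show "AE s in ?M. norm (\<phi> n s * f s) \<le> 2 * \<bar>f s\<bar>" for n
      using AEN by eventually_elim (use bound in \<open>auto simp: abs_mult intro!: mult_right_mono\<close>)
  qed
  then have "(\<integral>s. sgn (f s) * f s \<partial>?M) = 0"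
    using z[OF test] by (simp add: LIMSEQ_const_iff)
  moreover have "sgn y * y = \<bar>y\<bar>" for y :: real by (simp add: sgn_if)
  ultimately have "(\<integral>s. \<bar>f s\<bar> \<partial>?M) = 0" by simp
  then have "AE s in ?M. \<bar>f s\<bar> = 0"
    using f by (subst (asm) integral_nonneg_eq_0_iff_AE) auto
  then show ?thesis by simp
qed

lemma test_function_derivative:
  assumes "test_function a b \<phi>"
  shows "continuous_on UNIV (deriv \<phi>)" "(\<phi> has_real_derivative deriv \<phi> s) (at s)"
proof -
  obtain F where F: "F 0 = \<phi>" "\<forall>i\<le>1. continuous_on UNIV (F i)"
    "\<forall>i<1. \<forall>t\<in>UNIV. (F i has_vector_derivative F (Suc i) t) (at t within UNIV)"
    using assms unfolding test_function_def Ck_on_def by blast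
  have d: "(\<phi> has_real_derivative F 1 s) (at s)" for s
    using F(1,3) by (auto simp: has_real_derivative_iff_has_vector_derivative)
  then have "deriv \<phi> = F 1" by (intro ext DERIV_imp_deriv)
  then show "continuous_on UNIV (deriv \<phi>)" "(\<phi> has_real_derivative deriv \<phi> s) (at s)"
    using F(2) d by auto
qed

text \<open>By \<open>fundamental_lemma\<close> two weak derivatives agree almost everywhere in each
  component, so \<open>HD1_norm\<close> does not depend on the choice hidden in its
  \<open>SOME\<close>.\<close>

lemma weak_derivative_unique:
  fixes g1 g2 :: "real \<Rightarrow> real^'k"
  assumes ab: "a < b" and g: "g1 \<in> L2 a b" "g2 \<in> L2 a b"
    and w: "weak_derivative a b u g1" "weak_derivative a b u g2"
  shows "L2_norm a b g1 = L2_norm a b g2"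
proof -
  let ?M = "lebesgue_on {a<..<b}"
  have i: "integrable ?M g1" "integrable ?M g2" using g L2_integrable by auto
  have "AE s in ?M. g1 s $ c - g2 s $ c = 0" for c
  proof (rule fundamental_lemma[OF ab])
    have ic: "integrable ?M (\<lambda>s. g s $ c)" if "integrable ?M g" for g :: "real \<Rightarrow> real^'k"
      using integrable_bounded_linear[OF bounded_linear_vec_nth that] .
    show "integrable ?M (\<lambda>s. g1 s $ c - g2 s $ c)" using ic i by auto
    fix \<phi> assume t: "test_function a b \<phi>"
    have c\<phi>: "continuous_on UNIV \<phi>"
      by (rule DERIV_continuous_on) (use test_function_derivative(2)[OF t] in simp)
    have m\<phi>: "\<phi> \<in> borel_measurable ?M"
      by (intro continuous_imp_measurable_on_sets_lebesgue continuous_on_subset[OF c\<phi>]) auto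
    have "bounded (\<phi> ` {a..b})"
      by (intro compact_imp_bounded compact_continuous_image continuous_on_subset[OF c\<phi>]) auto
    then obtain K where K: "\<And>s. s \<in> {a..b} \<Longrightarrow> \<bar>\<phi> s\<bar> \<le> K" by (force simp: bounded_iff)
    have i\<phi>: "integrable ?M (\<lambda>s. \<phi> s *\<^sub>R g s)" if "integrable ?M g" for g :: "real \<Rightarrow> real^'k"
    proof (rule Bochner_Integration.integrable_bound)
      show "integrable ?M (\<lambda>s. K * norm (g s))" using that by auto
      show "(\<lambda>s. \<phi> s *\<^sub>R g s) \<in> borel_measurable ?M" using m\<phi> that by measurable
      show "AE s in ?M. norm (\<phi> s *\<^sub>R g s) \<le> norm (K * norm (g s))"
      proof (rule AE_I2)
        fix s assume "s \<in> space ?M"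
        then have "\<bar>\<phi> s\<bar> \<le> \<bar>K\<bar>" using K[of s] by auto
        then show "norm (\<phi> s *\<^sub>R g s) \<le> norm (K * norm (g s))" by (simp add: abs_mult mult_right_mono)
      qed
    qed
    have "(\<integral>s. \<phi> s *\<^sub>R g1 s \<partial>?M) = (\<integral>s. \<phi> s *\<^sub>R g2 s \<partial>?M)"
      using w(1)[unfolded weak_derivative_def, rule_format, OF t] w(2)[unfolded weak_derivative_def, rule_format, OF t] by simp
    then have "(\<integral>s. (\<phi> s *\<^sub>R g1 s) $ c \<partial>?M) = (\<integral>s. (\<phi> s *\<^sub>R g2 s) $ c \<partial>?M)"
      using integral_bounded_linear[OF bounded_linear_vec_nth i\<phi>[OF i(1)], of c]
        integral_bounded_linear[OF bounded_linear_vec_nth i\<phi>[OF i(2)], of c] by simp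
    moreover have "(\<integral>s. \<phi> s * (g1 s $ c - g2 s $ c) \<partial>?M) = (\<integral>s. (\<phi> s *\<^sub>R g1 s) $ c \<partial>?M) - (\<integral>s. (\<phi> s *\<^sub>R g2 s) $ c \<partial>?M)"
      using ic[OF i\<phi>[OF i(1)]] ic[OF i\<phi>[OF i(2)]]
      by (subst Bochner_Integration.integral_diff[symmetric]) (simp_all add: right_diff_distrib)
    ultimately show "(\<integral>s. \<phi> s * (g1 s $ c - g2 s $ c) \<partial>?M) = 0" by simp
  qed
  then have "AE s in ?M. \<forall>c. g1 s $ c - g2 s $ c = 0" by (simp add: AE_all_countable)
  then have "AE s in ?M. (norm (g1 s))\<^sup>2 = (norm (g2 s))\<^sup>2"
    by eventually_elim (simp add: vec_eq_iff[symmetric])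
  then have "(\<integral>s. (norm (g1 s))\<^sup>2 \<partial>?M) = (\<integral>s. (norm (g2 s))\<^sup>2 \<partial>?M)"
    using i by (intro integral_cong_AE) auto
  then show ?thesis by (simp add: L2_norm_def)
qed

text \<open>Integration by parts on each piece. The boundary terms telescope because f is continuous
  across the mesh points, and the outermost ones vanish with the test function.\<close>

lemma weak_derivative_pieces:
  fixes f :: "real \<Rightarrow> real^'k"
  assumes p: "is_partition a b n t" and f: "continuous_on {a..b} f"
    and d: "\<And>j s. j \<in> {1..n} \<Longrightarrow> s \<in> {t (j - 1)<..<t j} \<Longrightarrow> (f has_vector_derivative v j s) (at s)"
    and c: "\<And>j. j \<in> {1..n} \<Longrightarrow> continuous_on {t (j - 1)..t j} (v j)"
    and g: "\<And>j s. j \<in> {1..n} \<Longrightarrow> s \<in> {t (j - 1)<..<t j} \<Longrightarrow> g s = v j s"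
  shows "weak_derivative a b f g"
  unfolding weak_derivative_def
proof (intro allI impI)
  fix \<phi> assume t: "test_function a b \<phi>"
  note \<phi>' = test_function_derivative[OF t]
  have c\<phi>: "continuous_on S \<phi>" for S
    by (rule DERIV_continuous_on) (use \<phi>'(2) DERIV_subset[OF _ subset_UNIV] in blast)
  have c\<phi>': "continuous_on S (deriv \<phi>)" for S using continuous_on_subset[OF \<phi>'(1)] by simp
  have fs: "continuous_on {t (j - 1)..t j} f" if "j \<in> {1..n}" for j
    using continuous_on_subset[OF f partition_piece_subset[OF p that]] .
  have c1: "continuous_on {t (j - 1)..t j} (\<lambda>s. deriv \<phi> s *\<^sub>R f s)" if "j \<in> {1..n}" for j
    by (intro continuous_intros c\<phi>' fs that)
  have c2: "continuous_on {t (j - 1)..t j} (\<lambda>s. \<phi> s *\<^sub>R v j s)" if "j \<in> {1..n}" for j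
    by (intro continuous_intros c\<phi> c that)
  have e2: "\<phi> s *\<^sub>R g s = \<phi> s *\<^sub>R v j s" if "j \<in> {1..n}" "s \<in> {t (j - 1)<..<t j}" for j s
    using g[OF that] by simp
  have I1: "(\<integral>s. deriv \<phi> s *\<^sub>R f s \<partial>lebesgue_on {a<..<b}) = (\<Sum>j=1..n. integral {t (j - 1)..t j} (\<lambda>s. deriv \<phi> s *\<^sub>R f s))"
    by (rule pieces_integrable(2)[where g = "\<lambda>j s. deriv \<phi> s *\<^sub>R f s", OF p c1 refl])
  have I2: "(\<integral>s. \<phi> s *\<^sub>R g s \<partial>lebesgue_on {a<..<b}) = (\<Sum>j=1..n. integral {t (j - 1)..t j} (\<lambda>s. \<phi> s *\<^sub>R v j s))"
    by (rule pieces_integrable(2)[where g = "\<lambda>j s. \<phi> s *\<^sub>R v j s", OF p c2 e2])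
  have one: "integral {t (j - 1)..t j} (\<lambda>s. deriv \<phi> s *\<^sub>R f s) + integral {t (j - 1)..t j} (\<lambda>s. \<phi> s *\<^sub>R v j s) =
      \<phi> (t j) *\<^sub>R f (t j) - \<phi> (t (j - 1)) *\<^sub>R f (t (j - 1))" if j: "j \<in> {1..n}" for j
  proof -
    have "((\<lambda>s. \<phi> s *\<^sub>R v j s + deriv \<phi> s *\<^sub>R f s) has_integral
        \<phi> (t j) *\<^sub>R f (t j) - \<phi> (t (j - 1)) *\<^sub>R f (t (j - 1))) {t (j - 1)..t j}"
    proof (rule fundamental_theorem_of_calculus_interior)
      show "t (j - 1) \<le> t j" using partition_step[OF p j] by simp
      show "continuous_on {t (j - 1)..t j} (\<lambda>s. \<phi> s *\<^sub>R f s)" by (intro continuous_intros c\<phi> fs j)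
      show "((\<lambda>s. \<phi> s *\<^sub>R f s) has_vector_derivative \<phi> s *\<^sub>R v j s + deriv \<phi> s *\<^sub>R f s) (at s)"
        if "s \<in> {t (j - 1)<..<t j}" for s
        by (intro has_vector_derivative_scaleR \<phi>'(2) d j that)
    qed
    moreover have "((\<lambda>s. \<phi> s *\<^sub>R v j s + deriv \<phi> s *\<^sub>R f s) has_integral
        integral {t (j - 1)..t j} (\<lambda>s. \<phi> s *\<^sub>R v j s) + integral {t (j - 1)..t j} (\<lambda>s. deriv \<phi> s *\<^sub>R f s)) {t (j - 1)..t j}"
      by (intro has_integral_add integrable_integral integrable_continuous_real c1 c2 j)
    ultimately show ?thesis by (simp add: has_integral_unique add.commute)
  qed
  obtain c' e' where ce: "a < c'" "e' < b" "\<forall>s. s \<notin> {c'..e'} \<longrightarrow> \<phi> s = 0"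
    using t unfolding test_function_def by blast
  have "(\<Sum>j=1..n. integral {t (j - 1)..t j} (\<lambda>s. deriv \<phi> s *\<^sub>R f s) + integral {t (j - 1)..t j} (\<lambda>s. \<phi> s *\<^sub>R v j s)) =
      (\<Sum>j=1..n. \<phi> (t j) *\<^sub>R f (t j) - \<phi> (t (j - 1)) *\<^sub>R f (t (j - 1)))"
    by (rule sum.cong[OF refl one])
  also have "\<dots> = \<phi> (t n) *\<^sub>R f (t n) - \<phi> (t 0) *\<^sub>R f (t 0)"
    using sum_telescope''[of 0 n "\<lambda>j. \<phi> (t j) *\<^sub>R f (t j)"]
    by (simp add: atLeastSucAtMost_greaterThanAtMost[symmetric])
  also have "\<dots> = 0" using ce partition_ends[OF p] by simp
  finally have "(\<integral>s. deriv \<phi> s *\<^sub>R f s \<partial>lebesgue_on {a<..<b}) + (\<integral>s. \<phi> s *\<^sub>R g s \<partial>lebesgue_on {a<..<b}) = 0"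
    unfolding I1 I2 sum.distrib[symmetric] .
  then show "(\<integral>s. deriv \<phi> s *\<^sub>R f s \<partial>lebesgue_on {a<..<b}) = - (\<integral>s. \<phi> s *\<^sub>R g s \<partial>lebesgue_on {a<..<b})"
    by (simp add: eq_neg_iff_add_eq_0)
qed

text \<open>The piecewise classical derivative is a weak derivative, and by uniqueness its norm
  equals that of the chosen one.\<close>

lemma HD1_pieces:
  fixes x :: "real \<Rightarrow> real^('k::finite+'r::finite)" and v :: "nat \<Rightarrow> real \<Rightarrow> real^'k"
  assumes ab: "a < b" and p: "is_partition a b n t" and Dx: "continuous_on {a..b} (\<lambda>s. Dmat *v x s :: real^'k)"
    and d: "\<And>j s. j \<in> {1..n} \<Longrightarrow> s \<in> {t (j - 1)<..<t j} \<Longrightarrow> ((\<lambda>s. Dmat *v x s) has_vector_derivative v j s) (at s)"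
    and c: "\<And>j. j \<in> {1..n} \<Longrightarrow> continuous_on {t (j - 1)..t j} (v j)"
    and cx: "\<And>j. j \<in> {1..n} \<Longrightarrow> continuous_on {t (j - 1)..t j} (y j)"
    and e: "\<And>j s. j \<in> {1..n} \<Longrightarrow> s \<in> {t (j - 1)<..<t j} \<Longrightarrow> x s = y j s"
  shows "x \<in> HD1 a b" "HD1_norm a b x = sqrt (\<Sum>j=1..n. integral {t (j - 1)..t j} (\<lambda>s. (norm (y j s))\<^sup>2) +
      integral {t (j - 1)..t j} (\<lambda>s. (norm (v j s))\<^sup>2))"
proof -
  define g where "g s = v (idx n t s) s" for s
  have ge: "g s = v j s" if "j \<in> {1..n}" "s \<in> {t (j - 1)<..<t j}" for j s
    using idx_eq[OF p that(1), of s] that by (simp add: g_def)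
  note xL = pieces_L2[where g = y and f = x, OF p cx e]
  note gL = pieces_L2[where g = v and f = g, OF p c ge]
  have DxL: "(\<lambda>s. Dmat *v x s :: real^'k) \<in> L2 a b"
    by (rule pieces_L2(1)[where g = "\<lambda>j s. Dmat *v x s", OF p continuous_on_subset[OF Dx partition_piece_subset[OF p]] refl])
  have w: "weak_derivative a b (\<lambda>s. Dmat *v x s) g"
    by (rule weak_derivative_pieces[OF p Dx d c ge])
  show "x \<in> HD1 a b" using xL(1) DxL gL(1) w by (auto simp: HD1_def H1_def)
  define g' where "g' = (SOME g :: real \<Rightarrow> real^'k. g \<in> L2 a b \<and> weak_derivative a b (\<lambda>t. Dmat *v x t) g)"
  have "g' \<in> L2 a b \<and> weak_derivative a b (\<lambda>t. Dmat *v x t) g'"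
    unfolding g'_def by (rule someI[of _ g]) (use gL(1) w in simp)
  then have "L2_norm a b g' = L2_norm a b g"
    using weak_derivative_unique[OF ab _ gL(1) _ w] by blast
  then show "HD1_norm a b x = sqrt (\<Sum>j=1..n. integral {t (j - 1)..t j} (\<lambda>s. (norm (y j s))\<^sup>2) +
      integral {t (j - 1)..t j} (\<lambda>s. (norm (v j s))\<^sup>2))"
    unfolding HD1_norm_def g'_def[symmetric] using xL(2) gL(2) by (simp add: sum.distrib)
qed

section \<open>Existence of minima of quadratic functionals\<close>

text \<open>The functional is \<beta> c c + 2 lf c on a linear space U of coefficient functions
  supported in I. The form \<beta> is merely semidefinite; the lower bound m is what excludes
  descent along null directions.\<close>

locale quadratic_functional =
  fixes I :: "'i set" and U :: "('i \<Rightarrow> real) set" and \<beta> :: "('i \<Rightarrow> real) \<Rightarrow> ('i \<Rightarrow> real) \<Rightarrow> real"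
    and lf :: "('i \<Rightarrow> real) \<Rightarrow> real" and m :: real
  assumes zero: "(\<lambda>_. 0) \<in> U"
    and lin: "\<And>c d s. c \<in> U \<Longrightarrow> d \<in> U \<Longrightarrow> (\<lambda>i. c i + s * d i) \<in> U"
    and supp: "\<And>c i. c \<in> U \<Longrightarrow> i \<notin> I \<Longrightarrow> c i = 0"
    and bil: "\<And>c d e s. c \<in> U \<Longrightarrow> d \<in> U \<Longrightarrow> e \<in> U \<Longrightarrow> \<beta> (\<lambda>i. c i + s * d i) e = \<beta> c e + s * \<beta> d e"
    and sym: "\<And>c d. c \<in> U \<Longrightarrow> d \<in> U \<Longrightarrow> \<beta> c d = \<beta> d c"
    and psd: "\<And>c. c \<in> U \<Longrightarrow> 0 \<le> \<beta> c c"
    and ll: "\<And>c d s. c \<in> U \<Longrightarrow> d \<in> U \<Longrightarrow> lf (\<lambda>i. c i + s * d i) = lf c + s * lf d"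
    and bdd: "\<And>c. c \<in> U \<Longrightarrow> m \<le> \<beta> c c + 2 * lf c"

(* Eliminates one coordinate at a time: minimising over a line leaves a quadratic functional of the
   same kind, given by a Schur complement. *)
lemma quadratic_minimum:
  assumes "finite I"
  shows "\<forall>U \<beta> lf m. quadratic_functional I U \<beta> lf m \<longrightarrow>
    (\<exists>c\<in>U. \<forall>d\<in>U. \<beta> c c + 2 * lf c \<le> \<beta> d d + 2 * lf d)"
  using assms
proof (induction I rule: finite_induct)
  case empty
  show ?case
  proof (intro allI impI)
    fix U \<beta> lf m assume q: "quadratic_functional ({} :: 'a set) U \<beta> lf m"
    show "\<exists>c\<in>U. \<forall>d\<in>U. \<beta> c c + 2 * lf c \<le> \<beta> d d + 2 * lf d"
    proof (intro bexI[of _ "\<lambda>_. 0"] ballI)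
      fix d assume "d \<in> U"
      have "d = (\<lambda>_. 0)" by (rule ext, rule quadratic_functional.supp[OF q \<open>d \<in> U\<close>]) simp
      then show "\<beta> (\<lambda>_. 0) (\<lambda>_. 0) + 2 * lf (\<lambda>_. 0) \<le> \<beta> d d + 2 * lf d" by simp
    qed (rule quadratic_functional.zero[OF q])
  qed
next
  case (insert i I)
  show ?case
  proof (intro allI impI)
  fix U \<beta> lf m assume q: "quadratic_functional (insert i I) U \<beta> lf m"
  note zero = quadratic_functional.zero[OF q] and lin = quadratic_functional.lin[OF q]
    and supp = quadratic_functional.supp[OF q] and bil = quadratic_functional.bil[OF q]
    and sym = quadratic_functional.sym[OF q] and psd = quadratic_functional.psd[OF q]
    and ll = quadratic_functional.ll[OF q] and bdd = quadratic_functional.bdd[OF q]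
  show "\<exists>c\<in>U. \<forall>d\<in>U. \<beta> c c + 2 * lf c \<le> \<beta> d d + 2 * lf d"
  proof (cases "\<forall>c\<in>U. c i = 0")
    case True
    have supp': "c j = 0" if "c \<in> U" "j \<notin> I" for c j
      using supp[OF that(1), of j] that True by (cases "j = i") auto
    have "quadratic_functional I U \<beta> lf m"
    proof (rule quadratic_functional.intro, goal_cases)
      case 1 show ?case by (rule zero)
    next
      case (2 c d s) then show ?case by (rule lin)
    next
      case (3 c i) then show ?case by (rule supp')
    next
      case (4 c d e s) then show ?case by (rule bil)
    next
      case (5 c d) then show ?case by (rule sym)
    next
      case (6 c) then show ?case by (rule psd)
    next
      case (7 c d s) then show ?case by (rule ll)
    next
      case (8 c) then show ?case by (rule bdd)
    qed
    then show ?thesis by (rule insert.IH[rule_format])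
  next
    case False
    then obtain v0 where v0: "v0 \<in> U" "v0 i \<noteq> 0" by auto
    define v where "v = (\<lambda>j. 0 + (1 / v0 i) * v0 j)"
    have v: "v \<in> U" "v i = 1" using lin[OF zero v0(1), of "1 / v0 i"] v0 by (auto simp: v_def)
    define U' where "U' = {c \<in> U. c i = 0}"
    have sub: "c \<in> U' \<Longrightarrow> c \<in> U" for c by (simp add: U'_def)
    have zero': "(\<lambda>_. 0) \<in> U'" using zero by (simp add: U'_def)
    have lin': "(\<lambda>i. c i + s * d i) \<in> U'" if "c \<in> U'" "d \<in> U'" for c d s
      using lin[of c d s] that by (simp add: U'_def)
    have supp': "c j = 0" if "c \<in> U'" "j \<notin> I" for c j
      using supp[of c j] that by (cases "j = i") (auto simp: U'_def)
    \<comment> \<open>U is the sum of the line through v and the subspace U' of vectors with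
      vanishing i-th coordinate.\<close>
    have decomp: "\<exists>d'\<in>U'. \<exists>s. d = (\<lambda>j. d' j + s * v j)" if d: "d \<in> U" for d
    proof (intro bexI exI)
      show "d = (\<lambda>j. (\<lambda>j. d j + (- d i) * v j) j + d i * v j)" by (intro ext) simp
      show "(\<lambda>j. d j + (- d i) * v j) \<in> U'"
        using lin[OF d v(1), of "- d i"] v by (simp add: U'_def)
    qed
    have bsq: "\<beta> (\<lambda>j. c j + s * v j) (\<lambda>j. c j + s * v j) = \<beta> c c + 2 * s * \<beta> c v + s\<^sup>2 * \<beta> v v"
      if c: "c \<in> U" for c s
    proof -
      have cs: "(\<lambda>j. c j + s * v j) \<in> U" by (rule lin[OF c v(1)])
      have "\<beta> (\<lambda>j. c j + s * v j) (\<lambda>j. c j + s * v j) = \<beta> c (\<lambda>j. c j + s * v j) + s * \<beta> v (\<lambda>j. c j + s * v j)"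
        by (rule bil[OF c v(1) cs])
      also have "\<beta> c (\<lambda>j. c j + s * v j) = \<beta> c c + s * \<beta> c v"
        using sym[OF c cs] bil[OF c v(1) c, of s] sym[OF v(1) c] by simp
      also have "\<beta> v (\<lambda>j. c j + s * v j) = \<beta> c v + s * \<beta> v v"
        using sym[OF v(1) cs] bil[OF c v(1) v(1), of s] by simp
      finally show ?thesis by (simp add: power2_eq_square algebra_simps)
    qed
    have Q: "\<beta> (\<lambda>j. c j + s * v j) (\<lambda>j. c j + s * v j) + 2 * lf (\<lambda>j. c j + s * v j) =
        \<beta> c c + 2 * lf c + 2 * s * (\<beta> c v + lf v) + s\<^sup>2 * \<beta> v v" if c: "c \<in> U" for c s
      unfolding bsq[OF c] ll[OF c v(1)] by (simp add: algebra_simps)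
    \<comment> \<open>An affine function of s that is bounded below on the real line has slope
      0.\<close>
    have linear_bdd: "y = 0" if "\<And>s. K \<le> M + s * y" for y K M :: real
    proof (rule ccontr)
      assume "y \<noteq> 0"
      with that[of "(K - M - 1) / y"] show False by simp
    qed
    show ?thesis
    proof (cases "\<beta> v v = 0")
      case True
      \<comment> \<open>For a null vector v semidefiniteness makes \<beta> c v vanish for all c, and
        the lower bound makes lf v vanish. The functional is then constant along v, and minimizing
        over U' suffices.\<close>
      have bv: "\<beta> c v = 0" if c: "c \<in> U" for c
      proof (rule linear_bdd)
        fix s
        have "0 \<le> \<beta> (\<lambda>j. c j + (s / 2) * v j) (\<lambda>j. c j + (s / 2) * v j)" by (rule psd[OF lin[OF c v(1)]])
        also have "\<dots> = \<beta> c c + s * \<beta> c v" unfolding bsq[OF c] using True by simp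
        finally show "0 \<le> \<beta> c c + s * \<beta> c v" .
      qed
      have lv: "lf v = 0"
      proof (rule linear_bdd)
        fix s
        have "m \<le> \<beta> (\<lambda>j. (\<lambda>_. 0) j + (s / 2) * v j) (\<lambda>j. (\<lambda>_. 0) j + (s / 2) * v j) + 2 * lf (\<lambda>j. (\<lambda>_. 0) j + (s / 2) * v j)"
          by (rule bdd[OF lin[OF zero v(1)]])
        also have "\<dots> = \<beta> (\<lambda>_. 0) (\<lambda>_. 0) + 2 * lf (\<lambda>_. 0) + s * lf v"
          unfolding Q[OF zero] using True bv[OF zero] by simp
        finally show "m \<le> \<beta> (\<lambda>_. 0) (\<lambda>_. 0) + 2 * lf (\<lambda>_. 0) + s * lf v" .
      qed
      have "quadratic_functional I U' \<beta> lf m"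
      proof (rule quadratic_functional.intro, goal_cases)
        case 1 show ?case by (rule zero')
      next
        case (2 c d s) then show ?case by (rule lin')
      next
        case (3 c i) then show ?case by (rule supp')
      next
        case (4 c d e s) then show ?case by (intro bil sub)
      next
        case (5 c d) then show ?case by (intro sym sub)
      next
        case (6 c) then show ?case by (intro psd sub)
      next
        case (7 c d s) then show ?case by (intro ll sub)
      next
        case (8 c) then show ?case by (intro bdd sub)
      qed
      then have "\<exists>c\<in>U'. \<forall>d\<in>U'. \<beta> c c + 2 * lf c \<le> \<beta> d d + 2 * lf d"
        by (rule insert.IH[rule_format])
      then obtain c where c: "c \<in> U'" "\<And>d. d \<in> U' \<Longrightarrow> \<beta> c c + 2 * lf c \<le> \<beta> d d + 2 * lf d" by blast
      show ?thesis
      proof (intro bexI[of _ c] ballI)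
        fix d assume "d \<in> U"
        from decomp[OF this] obtain d' s where d: "d' \<in> U'" "d = (\<lambda>j. d' j + s * v j)" by blast
        have "\<beta> d d + 2 * lf d = \<beta> d' d' + 2 * lf d'"
          unfolding d(2) Q[OF sub[OF d(1)]] using True lv bv[OF sub[OF d(1)]] by simp
        then show "\<beta> c c + 2 * lf c \<le> \<beta> d d + 2 * lf d" using c(2)[OF d(1)] by simp
      qed (use c sub in auto)
    next
      case False
      define \<alpha> where "\<alpha> = \<beta> v v"
      have \<alpha>: "0 < \<alpha>" using psd[OF v(1)] False by (simp add: \<alpha>_def)
      \<comment> \<open>The Schur complement: up to a constant, \<beta>' and lf' give the minimum of
        the functional over the line c + s v. Completing the square in s, as in \<open>opt\<close>,
        shows this.\<close>
      define \<beta>' where "\<beta>' c d = \<beta> c d - \<beta> c v * \<beta> d v / \<alpha>" for c d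
      define lf' where "lf' c = lf c - \<beta> c v * lf v / \<alpha>" for c
      have opt: "\<beta> (\<lambda>j. c j + s * v j) (\<lambda>j. c j + s * v j) + 2 * lf (\<lambda>j. c j + s * v j) =
          \<beta>' c c + 2 * lf' c - (lf v)\<^sup>2 / \<alpha> + \<alpha> * (s + (\<beta> c v + lf v) / \<alpha>)\<^sup>2" if c: "c \<in> U" for c s
        unfolding Q[OF c] \<beta>'_def lf'_def \<alpha>_def[symmetric] using \<alpha>
        by (simp add: power2_eq_square field_simps)
      have psd': "0 \<le> \<beta>' c c" if c: "c \<in> U" for c
      proof -
        have "0 \<le> \<beta> (\<lambda>j. c j + (- \<beta> c v / \<alpha>) * v j) (\<lambda>j. c j + (- \<beta> c v / \<alpha>) * v j)"
          by (rule psd[OF lin[OF c v(1)]])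
        also have "\<dots> = \<beta>' c c"
          unfolding bsq[OF c] \<beta>'_def \<alpha>_def[symmetric] using \<alpha> by (simp add: power2_eq_square field_simps)
        finally show ?thesis .
      qed
      have bdd': "m \<le> \<beta>' c c + 2 * lf' c" if c: "c \<in> U" for c
      proof -
        have "m \<le> \<beta>' c c + 2 * lf' c - (lf v)\<^sup>2 / \<alpha>"
          using bdd[OF lin[OF c v(1), of "- (\<beta> c v + lf v) / \<alpha>"]] unfolding opt[OF c] using \<alpha>
          by (simp add: field_simps)
        also have "\<dots> \<le> \<beta>' c c + 2 * lf' c" using \<alpha> by simp
        finally show ?thesis .
      qed
      have bil': "\<beta>' (\<lambda>i. c i + s * d i) e = \<beta>' c e + s * \<beta>' d e" if "c \<in> U" "d \<in> U" "e \<in> U" for c d e s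
        unfolding \<beta>'_def using bil[OF that] bil[OF that(1,2) v(1)] \<alpha> by (simp add: field_simps)
      have sym': "\<beta>' c d = \<beta>' d c" if "c \<in> U" "d \<in> U" for c d
        unfolding \<beta>'_def using sym[OF that] by (simp add: mult.commute)
      have ll': "lf' (\<lambda>i. c i + s * d i) = lf' c + s * lf' d" if "c \<in> U" "d \<in> U" for c d s
        unfolding lf'_def using ll[OF that] bil[OF that v(1)] \<alpha> by (simp add: field_simps)
      have "quadratic_functional I U' \<beta>' lf' m"
      proof (rule quadratic_functional.intro, goal_cases)
        case 1 show ?case by (rule zero')
      next
        case (2 c d s) then show ?case by (rule lin')
      next
        case (3 c i) then show ?case by (rule supp')
      next
        case (4 c d e s) then show ?case by (intro bil' sub)
      next
        case (5 c d) then show ?case by (intro sym' sub)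
      next
        case (6 c) then show ?case by (intro psd' sub)
      next
        case (7 c d s) then show ?case by (intro ll' sub)
      next
        case (8 c) then show ?case by (intro bdd' sub)
      qed
      then have "\<exists>c\<in>U'. \<forall>d\<in>U'. \<beta>' c c + 2 * lf' c \<le> \<beta>' d d + 2 * lf' d"
        by (rule insert.IH[rule_format])
      then obtain c where c: "c \<in> U'" "\<And>d. d \<in> U' \<Longrightarrow> \<beta>' c c + 2 * lf' c \<le> \<beta>' d d + 2 * lf' d" by blast
      \<comment> \<open>The value of s at which the square in \<open>opt\<close> vanishes.\<close>
      let ?c = "\<lambda>j. c j + (- (\<beta> c v + lf v) / \<alpha>) * v j"
      show ?thesis
      proof (intro bexI[of _ ?c] ballI)
        fix d assume "d \<in> U"
        from decomp[OF this] obtain d' s where d: "d' \<in> U'" "d = (\<lambda>j. d' j + s * v j)" by blast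
        have "\<beta> ?c ?c + 2 * lf ?c = \<beta>' c c + 2 * lf' c - (lf v)\<^sup>2 / \<alpha>"
        proof -
          have z: "- (\<beta> c v + lf v) / \<alpha> + (\<beta> c v + lf v) / \<alpha> = 0" by (simp add: diff_divide_distrib add_divide_distrib)
          show ?thesis unfolding opt[OF sub[OF c(1)]] z by simp
        qed
        also have "\<dots> \<le> \<beta>' d' d' + 2 * lf' d' - (lf v)\<^sup>2 / \<alpha>" using c(2)[OF d(1)] by simp
        also have "\<dots> \<le> \<beta> d d + 2 * lf d"
          unfolding d(2) opt[OF sub[OF d(1)]] using \<alpha> by simp
        finally show "\<beta> ?c ?c + 2 * lf ?c \<le> \<beta> d d + 2 * lf d" .
      qed (rule lin[OF sub[OF c(1)] v(1)])
    qed
  qed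
qed
qed

section \<open>Approximation of smooth functions in the ansatz space\<close>

definition taylor_poly :: "(nat \<Rightarrow> real \<Rightarrow> real) \<Rightarrow> nat \<Rightarrow> real \<Rightarrow> real poly" where
  "taylor_poly f m u = (\<Sum>i\<le>m. smult (f i u / fact i) ([:- u, 1:] ^ i))"

lemma poly_taylor_poly: "poly (taylor_poly f m u) s = (\<Sum>i\<le>m. f i u * (s - u) ^ i / fact i)"
  by (simp add: taylor_poly_def poly_sum)

lemma degree_taylor_poly: "degree (taylor_poly f m u) \<le> m"
  unfolding taylor_poly_def
proof (intro degree_sum_le)
  fix i assume "i \<in> {..m}"
  then show "degree (smult (f i u / fact i) ([:- u, 1:] ^ i)) \<le> m"
    by (auto intro!: order_trans[OF degree_smult_le] simp: degree_linear_power)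
qed simp

lemma pderiv_taylor_poly: "pderiv (taylor_poly f (Suc m) u) = taylor_poly (\<lambda>i. f (Suc i)) m u"
proof -
  have "pderiv (smult (f (Suc i) u / fact (Suc i)) ([:- u, 1:] ^ Suc i)) = smult (f (Suc i) u / fact i) ([:- u, 1:] ^ i)" for i
  proof -
    have "pderiv ([:- u, 1:] ^ Suc i) = smult (real (Suc i)) ([:- u, 1:] ^ i)"
      by (simp only: pderiv_power_Suc) (simp add: pderiv_pCons del: of_nat_Suc power_Suc)
    then show ?thesis by (simp add: pderiv_smult del: of_nat_Suc power_Suc)
  qed
  then show ?thesis
    unfolding taylor_poly_def sum.atMost_Suc_shift pderiv_add pderiv_sum by (simp add: pderiv_smult)
qed

lemma taylor_poly_error:
  fixes f :: "nat \<Rightarrow> real \<Rightarrow> real"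
  assumes "\<And>i s. i \<le> m \<Longrightarrow> s \<in> {a..b} \<Longrightarrow> (f i has_real_derivative f (Suc i) s) (at s within {a..b})"
    and "\<And>s. s \<in> {a..b} \<Longrightarrow> \<bar>f (Suc m) s\<bar> \<le> K" and u: "u \<in> {a..b}" and s: "s \<in> {a..b}" "\<bar>s - u\<bar> \<le> h"
  shows "\<bar>f 0 s - poly (taylor_poly f m u) s\<bar> \<le> K * h ^ Suc m"
proof -
  have "0 \<le> K" using assms(2)[OF u] by (smt (verit))
  have "\<bar>f 0 s - poly (taylor_poly f m u) s\<bar> \<le> K * \<bar>s - u\<bar> ^ Suc m / fact m"
    using field_Taylor[of "{a..b}" m f K u s] assms by (simp add: poly_taylor_poly)
  also have "\<dots> \<le> K * \<bar>s - u\<bar> ^ Suc m / 1"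
    using \<open>0 \<le> K\<close> by (intro divide_left_mono) (auto simp: fact_ge_1)
  also have "\<dots> \<le> K * h ^ Suc m"
    using \<open>0 \<le> K\<close> power_mono[OF s(2), of "Suc m"] by (simp add: mult_left_mono)
  finally show ?thesis .
qed

(* The Taylor polynomial at the left end, corrected by a linear term to interpolate at the right end too. *)
lemma interpolating_taylor_poly:
  fixes f :: "nat \<Rightarrow> real \<Rightarrow> real"
  assumes N: "1 \<le> N" and d: "\<And>i s. i \<le> N \<Longrightarrow> s \<in> {a..b} \<Longrightarrow> (f i has_real_derivative f (Suc i) s) (at s within {a..b})"
    and K: "\<And>i s. i \<le> Suc N \<Longrightarrow> s \<in> {a..b} \<Longrightarrow> \<bar>f i s\<bar> \<le> K" and u: "u \<in> {a..b}" "v \<in> {a..b}" "u < v"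
  shows "\<exists>p. degree p \<le> N \<and> poly p u = f 0 u \<and> poly p v = f 0 v \<and>
    (\<forall>s\<in>{u..v}. \<bar>poly p s - f 0 s\<bar> \<le> 2 * (b - a) * K * (v - u) ^ N \<and> \<bar>poly (pderiv p) s - f 1 s\<bar> \<le> 2 * K * (v - u) ^ N)"
proof -
  obtain N0 where N0: "N = Suc N0" using N by (cases N) auto
  define h where "h = v - u"
  define T where "T = taylor_poly f N u"
  \<comment> \<open>The slope of the linear correction that makes p exact at v. The Taylor error at
    v is of order h^(N+1), so \<kappa> is of order h^N and spoils neither the values nor the
    derivative.\<close>
  define \<kappa> where "\<kappa> = (f 0 v - poly T v) / h"
  define p where "p = T + [:- \<kappa> * u, \<kappa>:]"
  have h: "0 < h" "h \<le> b - a" using u by (auto simp: h_def)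
  have K0: "0 \<le> K" using K[of 0 u] u by (smt (verit) zero_le)
  have T: "\<bar>f 0 s - poly T s\<bar> \<le> K * h ^ Suc N" if "s \<in> {u..v}" for s
    unfolding T_def using that u by (intro taylor_poly_error[where a = a and b = b] d K) (auto simp: h_def)
  have T': "\<bar>f 1 s - poly (pderiv T) s\<bar> \<le> K * h ^ N" if "s \<in> {u..v}" for s
  proof -
    have "\<bar>f (Suc 0) s - poly (taylor_poly (\<lambda>i. f (Suc i)) N0 u) s\<bar> \<le> K * h ^ Suc N0"
      using that u by (intro taylor_poly_error[where a = a and b = b] d K) (auto simp: h_def N0)
    then show ?thesis by (simp add: T_def N0 pderiv_taylor_poly)
  qed
  have \<kappa>: "\<bar>\<kappa>\<bar> \<le> K * h ^ N"
  proof -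
    have "\<bar>\<kappa>\<bar> = \<bar>f 0 v - poly T v\<bar> / h" using h by (simp add: \<kappa>_def abs_divide)
    also have "\<dots> \<le> (K * h ^ Suc N) / h" using T[of v] u h by (intro divide_right_mono) auto
    also have "\<dots> = K * h ^ N" using h by simp
    finally show ?thesis .
  qed
  have pe: "poly p s = poly T s + \<kappa> * (s - u)" for s by (simp add: p_def algebra_simps)
  have pd: "poly (pderiv p) s = poly (pderiv T) s + \<kappa>" for s
    by (simp add: p_def pderiv_add pderiv_pCons)
  have "degree p \<le> N"
    unfolding p_def by (rule degree_add_le) (use N in \<open>auto simp: T_def degree_taylor_poly\<close>)
  moreover have "poly p u = f 0 u"
    by (simp add: pe T_def poly_taylor_poly sum.atMost_shift power_0_left if_distrib cong: if_cong)
  moreover have "poly p v = f 0 v" using h by (simp add: pe \<kappa>_def h_def)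
  moreover have "\<bar>poly p s - f 0 s\<bar> \<le> 2 * (b - a) * K * (v - u) ^ N \<and> \<bar>poly (pderiv p) s - f 1 s\<bar> \<le> 2 * K * (v - u) ^ N"
    if s: "s \<in> {u..v}" for s
  proof
    have "\<bar>\<kappa> * (s - u)\<bar> \<le> (K * h ^ N) * h"
      unfolding abs_mult using s \<kappa> K0 h by (intro mult_mono) (auto simp: h_def)
    then have "\<bar>poly p s - f 0 s\<bar> \<le> 2 * (K * h ^ N * h)"
      using T[OF s] by (simp add: pe mult_ac)
    also have "\<dots> \<le> 2 * (K * h ^ N * (b - a))" using K0 h by (intro mult_left_mono) auto
    finally show "\<bar>poly p s - f 0 s\<bar> \<le> 2 * (b - a) * K * (v - u) ^ N" by (simp only: h_def mult_ac)
    show "\<bar>poly (pderiv p) s - f 1 s\<bar> \<le> 2 * K * (v - u) ^ N"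
      using T'[OF s] \<kappa> by (simp add: pd h_def)
  qed
  ultimately show ?thesis by blast
qed

lemma norm_vec_le_const:
  fixes x :: "real^'n" assumes "\<And>i. \<bar>x $ i\<bar> \<le> e" shows "norm x \<le> real CARD('n) * e"
  using norm_le_l1_cart[of x] sum_bounded_above[of UNIV "\<lambda>i. \<bar>x $ i\<bar>" e] assms by simp

text \<open>Differentiated components use the corrected Taylor polynomials of degree N: exactness at
  both ends of every piece makes D x continuous and the boundary values exact, and the derivative
  has error h^N. For the other components a Taylor polynomial of degree N-1 already has error
  h^N.\<close>

lemma approximation:
  fixes x :: "real \<Rightarrow> real^('k::finite+'r::finite)"
  assumes ab: "a < b" and N: "1 \<le> N" and x: "Ck_on (N + 1) {a..b} x"
  shows "\<exists>K\<ge>0. \<exists>v. continuous_on {a..b} v \<and>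
    (\<forall>s\<in>{a..b}. ((\<lambda>s. (Dmat :: real^('k+'r)^'k) *v x s) has_vector_derivative v s) (at s within {a..b})) \<and>
    (\<forall>n t. is_partition a b n t \<longrightarrow> (\<exists>P. admissible_family N n t P \<and>
      (\<forall>j\<in>{1..n}. (Dmat :: real^('k+'r)^'k) *v pval (P j) (t (j - 1)) = Dmat *v x (t (j - 1)) \<and>
        (Dmat :: real^('k+'r)^'k) *v pval (P j) (t j) = Dmat *v x (t j) \<and>
        (\<forall>s\<in>{t (j - 1)..t j}. norm (pval (P j) s - x s) \<le> K * step t j ^ N \<and> norm (dval (P j) s - v s) \<le> K * step t j ^ N))))"
proof -
  obtain F where F: "F 0 = x" "\<And>i. i \<le> Suc N \<Longrightarrow> continuous_on {a..b} (F i)"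
    "\<And>i s. i \<le> N \<Longrightarrow> s \<in> {a..b} \<Longrightarrow> (F i has_vector_derivative F (Suc i) s) (at s within {a..b})"
    using x unfolding Ck_on_def by (auto simp: less_Suc_eq_le)
  have Fc: "((\<lambda>s. F i s $ c) has_real_derivative F (Suc i) s $ c) (at s within {a..b})" if "i \<le> N" "s \<in> {a..b}" for i s c
    using F(3)[OF that] by (simp add: has_vector_derivative_vec_iff)
  have "\<exists>K. \<forall>s\<in>{a..b}. norm (F i s) \<le> K" if "i \<le> Suc N" for i
    using compact_imp_bounded[OF compact_continuous_image[OF F(2)[OF that] compact_Icc]]
    by (auto simp: bounded_iff)
  then have "\<forall>i. \<exists>K. i \<le> Suc N \<longrightarrow> (\<forall>s\<in>{a..b}. norm (F i s) \<le> K)" by blast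
  from choice[OF this] obtain Kf where Kf: "\<forall>i. i \<le> Suc N \<longrightarrow> (\<forall>s\<in>{a..b}. norm (F i s) \<le> Kf i)" ..
  define K where "K = (\<Sum>i\<le>Suc N. \<bar>Kf i\<bar>)"
  have K: "\<bar>F i s $ c\<bar> \<le> K" if "i \<le> Suc N" "s \<in> {a..b}" for i s c
  proof -
    have "\<bar>F i s $ c\<bar> \<le> norm (F i s)" by (rule component_le_norm_cart)
    also have "\<dots> \<le> \<bar>Kf i\<bar>" using Kf that by force
    also have "\<dots> \<le> K" unfolding K_def using that by (intro member_le_sum) auto
    finally show ?thesis .
  qed
  have K0: "0 \<le> K" by (simp add: K_def sum_nonneg)
  define L where "L = (2 * (b - a) + 2 + 1) * K"
  have L: "2 * (b - a) * K \<le> L" "2 * K \<le> L" "K \<le> L" "0 \<le> L"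
    using K0 ab mult_nonneg_nonneg[of "b - a" K] by (auto simp: L_def distrib_right)
  let ?v = "\<lambda>s. (Dmat :: real^('k+'r)^'k) *v F 1 s"
  let ?C = "real CARD('k + 'r) * L"
  have cardk: "real CARD('k) * L \<le> ?C" using L by (intro mult_right_mono) (auto simp: card_UNIV_sum)
  have "continuous_on {a..b} ?v"
    by (intro continuous_on_compose2[OF linear_continuous_on[OF matrix_vector_mul_bounded_linear] F(2)]) (use N in auto)
  moreover have "((\<lambda>s. (Dmat :: real^('k+'r)^'k) *v x s) has_vector_derivative ?v s) (at s within {a..b})" if "s \<in> {a..b}" for s
    using bounded_linear.has_vector_derivative[OF matrix_vector_mul_bounded_linear F(3)[of 0 s]] that F(1) by simp
  moreover have "\<exists>P. admissible_family N n t P \<and>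
      (\<forall>j\<in>{1..n}. (Dmat :: real^('k+'r)^'k) *v pval (P j) (t (j - 1)) = Dmat *v x (t (j - 1)) \<and>
        (Dmat :: real^('k+'r)^'k) *v pval (P j) (t j) = Dmat *v x (t j) \<and>
        (\<forall>s\<in>{t (j - 1)..t j}. norm (pval (P j) s - x s) \<le> ?C * step t j ^ N \<and> norm (dval (P j) s - ?v s) \<le> ?C * step t j ^ N))"
    if p: "is_partition a b n t" for n t
  proof -
    have "\<exists>p. degree p \<le> (case c of Inl _ \<Rightarrow> N | Inr _ \<Rightarrow> N - 1) \<and> (\<forall>s\<in>{t (j - 1)..t j}. \<bar>poly p s - x s $ c\<bar> \<le> L * step t j ^ N) \<and>
       (\<forall>i. c = Inl i \<longrightarrow> poly p (t (j - 1)) = x (t (j - 1)) $ c \<and> poly p (t j) = x (t j) $ c \<and>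
          (\<forall>s\<in>{t (j - 1)..t j}. \<bar>poly (pderiv p) s - F 1 s $ c\<bar> \<le> L * step t j ^ N))"
      if j: "j \<in> {1..n}" for j and c :: "'k + 'r"
    proof -
      have sub: "{t (j - 1)..t j} \<subseteq> {a..b}" and lt: "t (j - 1) < t j"
        using partition_piece_subset[OF p j] partition_step[OF p j] by auto
      have st: "0 \<le> step t j ^ N" using lt by (simp add: step_def)
      show ?thesis
      proof (cases c)
        case (Inl i)
        obtain q where "degree q \<le> N" "poly q (t (j - 1)) = F 0 (t (j - 1)) $ c" "poly q (t j) = F 0 (t j) $ c"
          "\<forall>s\<in>{t (j - 1)..t j}. \<bar>poly q s - F 0 s $ c\<bar> \<le> 2 * (b - a) * K * (t j - t (j - 1)) ^ N \<and>
            \<bar>poly (pderiv q) s - F 1 s $ c\<bar> \<le> 2 * K * (t j - t (j - 1)) ^ N"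
          using interpolating_taylor_poly[of N a b "\<lambda>i s. F i s $ c" K "t (j - 1)" "t j", OF N Fc K] sub lt by auto
        then show ?thesis
          using Inl F(1) mult_right_mono[OF L(1) st] mult_right_mono[OF L(2) st]
          by (intro exI[of _ q]) (fastforce simp: step_def)
      next
        case (Inr i)
        have "\<bar>poly (taylor_poly (\<lambda>i s. F i s $ c) (N - 1) (t (j - 1))) s - x s $ c\<bar> \<le> L * step t j ^ N"
          if s: "s \<in> {t (j - 1)..t j}" for s
        proof -
          have "\<bar>F 0 s $ c - poly (taylor_poly (\<lambda>i s. F i s $ c) (N - 1) (t (j - 1))) s\<bar> \<le> K * step t j ^ Suc (N - 1)"
            using s sub lt by (intro taylor_poly_error[where a = a and b = b] Fc K) (auto simp: step_def)
          then show ?thesis using F(1) N mult_right_mono[OF L(3) st] by (simp add: abs_minus_commute)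
        qed
        then show ?thesis
          using Inr by (intro exI[of _ "taylor_poly (\<lambda>i s. F i s $ c) (N - 1) (t (j - 1))"]) (simp add: degree_taylor_poly)
      qed
    qed
    then have "\<forall>jc. \<exists>p. fst jc \<in> {1..n} \<longrightarrow> degree p \<le> (case snd jc of Inl _ \<Rightarrow> N | Inr _ \<Rightarrow> N - 1) \<and> (\<forall>s\<in>{t (fst jc - 1)..t (fst jc)}. \<bar>poly p s - x s $ snd jc\<bar> \<le> L * step t (fst jc) ^ N) \<and>
       (\<forall>i. snd jc = Inl i \<longrightarrow> poly p (t (fst jc - 1)) = x (t (fst jc - 1)) $ snd jc \<and> poly p (t (fst jc)) = x (t (fst jc)) $ snd jc \<and>
          (\<forall>s\<in>{t (fst jc - 1)..t (fst jc)}. \<bar>poly (pderiv p) s - F 1 s $ snd jc\<bar> \<le> L * step t (fst jc) ^ N))" by blast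
    from choice[OF this] obtain P' where P': "\<forall>jc. fst jc \<in> {1..n} \<longrightarrow> degree (P' jc) \<le> (case snd jc of Inl _ \<Rightarrow> N | Inr _ \<Rightarrow> N - 1) \<and> (\<forall>s\<in>{t (fst jc - 1)..t (fst jc)}. \<bar>poly (P' jc) s - x s $ snd jc\<bar> \<le> L * step t (fst jc) ^ N) \<and>
       (\<forall>i. snd jc = Inl i \<longrightarrow> poly (P' jc) (t (fst jc - 1)) = x (t (fst jc - 1)) $ snd jc \<and> poly (P' jc) (t (fst jc)) = x (t (fst jc)) $ snd jc \<and>
          (\<forall>s\<in>{t (fst jc - 1)..t (fst jc)}. \<bar>poly (pderiv (P' jc)) s - F 1 s $ snd jc\<bar> \<le> L * step t (fst jc) ^ N))" ..
    define P where "P j c = P' (j, c)" for j c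
    have P: "degree (P j c) \<le> (case c of Inl _ \<Rightarrow> N | Inr _ \<Rightarrow> N - 1)"
      "s \<in> {t (j - 1)..t j} \<Longrightarrow> \<bar>poly (P j c) s - x s $ c\<bar> \<le> L * step t j ^ N"
      "c = Inl i \<Longrightarrow> poly (P j c) (t (j - 1)) = x (t (j - 1)) $ c"
      "c = Inl i \<Longrightarrow> poly (P j c) (t j) = x (t j) $ c"
      "c = Inl i \<Longrightarrow> s \<in> {t (j - 1)..t j} \<Longrightarrow> \<bar>poly (pderiv (P j c)) s - F 1 s $ c\<bar> \<le> L * step t j ^ N"
      if "j \<in> {1..n}" for j c s i
      using P'[rule_format, of "(j, c)"] that unfolding P_def fst_conv snd_conv by blast+
    have "poly (P j (Inl i)) (t j) = poly (P (Suc j) (Inl i)) (t j)" if "j \<in> {1..<n}" for j i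
      using P(4)[of j "Inl i" i] P(3)[of "Suc j" "Inl i" i] that by auto
    then have "admissible_family N n t P" using P(1) by (simp add: admissible_family_def)
    moreover have "(Dmat :: real^('k+'r)^'k) *v pval (P j) (t (j - 1)) = Dmat *v x (t (j - 1))"
      "(Dmat :: real^('k+'r)^'k) *v pval (P j) (t j) = Dmat *v x (t j)" if "j \<in> {1..n}" for j
      using P(3,4)[OF that] by (simp_all add: vec_eq_iff Dmat_nth pval_def)
    moreover have "norm (pval (P j) s - x s) \<le> ?C * step t j ^ N" if "j \<in> {1..n}" "s \<in> {t (j - 1)..t j}" for j s
      using norm_vec_le_const[of "pval (P j) s - x s" "L * step t j ^ N"] P(2)[OF that] by (simp add: pval_def mult.assoc)
    moreover have "norm (dval (P j) s - ?v s) \<le> ?C * step t j ^ N" if "j \<in> {1..n}" "s \<in> {t (j - 1)..t j}" for j s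
    proof -
      have "norm (dval (P j) s - ?v s) \<le> real CARD('k) * (L * step t j ^ N)"
        using P(5)[OF that(1) refl that(2)] by (intro norm_vec_le_const) (simp add: dval_def Dmat_nth)
      also have "\<dots> \<le> ?C * step t j ^ N"
        using mult_right_mono[OF cardk, of "step t j ^ N"] partition_step[OF p that(1)] by (simp add: step_def mult.assoc)
      finally show ?thesis .
    qed
    ultimately show ?thesis by (intro exI[of _ P]) blast
  qed
  moreover have "0 \<le> ?C" using L by simp
  ultimately show ?thesis by (intro exI[of _ ?C] conjI exI[of _ ?v]) blast+
qed

section \<open>Step sizes, collocation points, and equality of the two functionals\<close>

lemma pw_cong:
  assumes p: "is_partition a b n t" and e: "\<And>j. j \<in> {1..n} \<Longrightarrow> P j = P' j"
  shows "pw n t P = pw n t P'"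
  unfolding pw_def
proof (rule restrict_ext)
  fix s assume "s \<in> {t 0..t n}"
  then obtain j where "j \<in> {1..n}" "idx n t s = j"
    using partition_cover_closed[OF p, of s] partition_ends[OF p] by auto
  then show "pval (P (idx n t s)) s = pval (P' (idx n t s)) s" using e by simp
qed

lemma step_le:
  assumes p: "is_partition a b n t" and j: "j \<in> {1..n}"
  shows "0 < step_min n t" "step_min n t \<le> step t j" "step t j \<le> step_max n t"
proof -
  have ne: "step t ` {1..n} \<noteq> {}" using j by auto
  show "0 < step_min n t"
    unfolding step_min_def using partition_step[OF p] ne by (subst Min_gr_iff) (auto simp: step_def)
  show "step_min n t \<le> step t j" "step t j \<le> step_max n t"
    unfolding step_min_def step_max_def using j by auto
qed

lemma sum_step: "is_partition a b n t \<Longrightarrow> (\<Sum>j=1..n. step t j) = b - a"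
  using sum_telescope''[of 0 n t] partition_ends[of a b n t]
  by (simp add: step_def atLeastSucAtMost_greaterThanAtMost[symmetric])

text \<open>Lagrange basis polynomials are invariant under affine changes of variable. Bounds and
  exactness on [0,1] thus carry over to every piece with constants independent of the
  partition.\<close>

lemma lagrange_affine:
  assumes "t (j - 1) < t j"
  shows "lagrange M (colloc t \<tau> j) i (t (j - 1) + \<sigma> * step t j) = lagrange M \<tau> i \<sigma>"
  unfolding lagrange_def
proof (rule prod.cong[OF refl])
  fix \<kappa>
  have "t (j - 1) + \<sigma> * step t j - colloc t \<tau> j \<kappa> = step t j * (\<sigma> - \<tau> \<kappa>)"
    "colloc t \<tau> j i - colloc t \<tau> j \<kappa> = step t j * (\<tau> i - \<tau> \<kappa>)"
    by (simp_all add: colloc_def algebra_simps)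
  then show "(t (j - 1) + \<sigma> * step t j - colloc t \<tau> j \<kappa>) / (colloc t \<tau> j i - colloc t \<tau> j \<kappa>) = (\<sigma> - \<tau> \<kappa>) / (\<tau> i - \<tau> \<kappa>)"
    using assms by (simp add: step_def)
qed

lemma continuous_on_lagrange: "continuous_on S (lagrange M \<sigma> i)"
proof -
  have "lagrange M \<sigma> i = poly (lagrange_poly M \<sigma> i)" by (simp add: fun_eq_iff poly_lagrange_poly)
  then show ?thesis by (simp add: continuous_on_poly continuous_on_id)
qed

lemma lagrange_bounded: "\<exists>C\<ge>0. \<forall>i\<in>{1..M}. \<forall>\<sigma>\<in>{0..1}. \<bar>lagrange M \<tau> i \<sigma>\<bar> \<le> C"
proof -
  have "\<exists>C. \<forall>\<sigma>\<in>{0..1}. \<bar>lagrange M \<tau> i \<sigma>\<bar> \<le> C" for i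
    using compact_imp_bounded[OF compact_continuous_image[OF continuous_on_lagrange[of "{0..1}" M \<tau> i] compact_Icc]]
    by (auto simp: bounded_iff)
  then have "\<forall>i. \<exists>C. \<forall>\<sigma>\<in>{0..1}. \<bar>lagrange M \<tau> i \<sigma>\<bar> \<le> C" by blast
  from choice[OF this] obtain C where C: "\<forall>i. \<forall>\<sigma>\<in>{0..1}. \<bar>lagrange M \<tau> i \<sigma>\<bar> \<le> C i" ..
  have "\<bar>lagrange M \<tau> i \<sigma>\<bar> \<le> (\<Sum>i=1..M. \<bar>C i\<bar>)" if "i \<in> {1..M}" "\<sigma> \<in> {0..1}" for i \<sigma>
  proof -
    have "\<bar>lagrange M \<tau> i \<sigma>\<bar> \<le> C i" using C that(2) by blast
    also have "\<dots> \<le> \<bar>C i\<bar>" by simp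
    also have "\<dots> \<le> (\<Sum>i=1..M. \<bar>C i\<bar>)" using that(1) by (intro member_le_sum) auto
    finally show ?thesis .
  qed
  then show ?thesis by (intro exI[of _ "\<Sum>i=1..M. \<bar>C i\<bar>"] conjI sum_nonneg ballI) auto
qed

lemma nodes_inj: "nodes M \<tau> \<Longrightarrow> inj_on \<tau> {1..M}"
  by (simp add: nodes_def strict_mono_on_imp_inj_on)

lemma colloc_inj:
  assumes "nodes M \<tau>" "t (j - 1) < t j" shows "inj_on (colloc t \<tau> j) {1..M}"
proof (rule inj_onI)
  fix i i' assume "i \<in> {1..M}" "i' \<in> {1..M}" "colloc t \<tau> j i = colloc t \<tau> j i'"
  then show "i = i'" using inj_onD[OF nodes_inj[OF assms(1)], of i i'] assms(2) by (simp add: colloc_def step_def)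
qed

lemma colloc_mem:
  assumes "nodes M \<tau>" "t (j - 1) < t j" "i \<in> {1..M}" shows "colloc t \<tau> j i \<in> {t (j - 1)..t j}"
proof -
  have "\<tau> i \<in> {0..1}" using assms(1,3) unfolding nodes_def by blast
  then have "0 \<le> \<tau> i * (t j - t (j - 1))" "\<tau> i * (t j - t (j - 1)) \<le> 1 * (t j - t (j - 1))"
    using assms(2) by (auto intro!: mult_right_mono)
  moreover have "u + y \<in> {u..v}" if "0 \<le> y" "y \<le> 1 * (v - u)" for u v y :: real using that by simp
  ultimately show ?thesis unfolding colloc_def step_def by blast
qed

text \<open>On a piece the squared norm of the interpolated residual is a polynomial of degree at
  most 2M-2 that takes the value |w_ji|^2 at the nodes, so the quadrature rule integrates it
  exactly.\<close>

lemma PhiI_eq_PhiR: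
  assumes p: "is_partition a b n t" and \<tau>: "nodes M \<tau>" and M: "1 \<le> M" and ex: "exact_up_to (2 * M - 2) M \<tau> \<gamma>"
  shows "PhiI a b A B q l Ga Gb d M \<tau> \<gamma> n t = PhiR a b A B q l Ga Gb d M \<tau> n t"
proof (rule ext)
  fix x
  have "step t j * (\<Sum>i=1..M. \<gamma> i * (norm (res i))\<^sup>2) =
      integral {t (j - 1)..t j} (\<lambda>s. (norm (\<Sum>i=1..M. lagrange M (colloc t \<tau> j) i s *\<^sub>R res i))\<^sup>2)"
    if j: "j \<in> {1..n}" for j and res :: "nat \<Rightarrow> real^('a + 'b)"
  proof -
    have lt: "t (j - 1) < t j" using partition_step[OF p j] .
    then have h: "0 < step t j" by (simp add: step_def)
    define w where "w c = (\<Sum>i=1..M. smult (res i $ c) (lagrange_poly M \<tau> i))" for c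
    \<comment> \<open>The integrand as a polynomial on the reference interval.\<close>
    define F where "F = (\<Sum>c\<in>UNIV. (w c)\<^sup>2)"
    let ?f = "\<lambda>s. (norm (\<Sum>i=1..M. lagrange M (colloc t \<tau> j) i s *\<^sub>R res i))\<^sup>2"
    have dw: "degree (w c) \<le> M - 1" for c
      unfolding w_def by (intro degree_sum_le order_trans[OF degree_smult_le] degree_lagrange_poly) auto
    have "degree F \<le> 2 * M - 2"
      unfolding F_def
    proof (intro degree_sum_le)
      fix c
      show "degree ((w c)\<^sup>2) \<le> 2 * M - 2"
        using degree_power_le[of "w c" 2] dw[of c] M by linarith
    qed simp
    then have e: "(\<Sum>i=1..M. \<gamma> i * poly F (\<tau> i)) = integral {0..1} (poly F)"
      using ex by (simp add: exact_up_to_def)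
    have F: "poly F \<sigma> = (norm (\<Sum>i=1..M. lagrange M \<tau> i \<sigma> *\<^sub>R res i))\<^sup>2" for \<sigma>
      by (simp add: F_def w_def norm_pow2_vec poly_sum poly_lagrange_poly mult.commute)
    have Fn: "poly F (\<tau> i) = (norm (res i))\<^sup>2" if i: "i \<in> {1..M}" for i
    proof -
      have "(\<Sum>k=1..M. lagrange M \<tau> k (\<tau> i) *\<^sub>R res k) = (\<Sum>k=1..M. if k = i then res i else 0)"
        using lagrange_node[OF nodes_inj[OF \<tau>] _ i] by (intro sum.cong) auto
      then show ?thesis using i by (simp add: F)
    qed
    have "(?f has_integral integral {t (j - 1)..t j} ?f) {t (j - 1)..t j}"
      by (intro integrable_integral integrable_continuous_real continuous_intros continuous_on_lagrange)
    from has_integral_affinity'[OF this[folded box_real(2)] h, of "t (j - 1)"]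
    have "((\<lambda>\<sigma>. ?f (t (j - 1) + \<sigma> * step t j)) has_integral integral {t (j - 1)..t j} ?f / step t j) {0..1}"
      using h by (simp add: step_def add.commute mult.commute divide_inverse_commute)
    then have "(poly F has_integral integral {t (j - 1)..t j} ?f / step t j) {0..1}"
      unfolding lagrange_affine[OF lt] F[symmetric] .
    then have "integral {0..1} (poly F) = integral {t (j - 1)..t j} ?f / step t j"
      by (rule integral_unique)
    then show ?thesis using e Fn h by simp
  qed
  then show "PhiI a b A B q l Ga Gb d M \<tau> \<gamma> n t x = PhiR a b A B q l Ga Gb d M \<tau> n t x"
    unfolding PhiI_def PhiR_def by simp
qed

section \<open>The least-squares functional on families of polynomials\<close>

text \<open>The linear structure on families: P + s P'. The parameter s = -1 gives
  differences.\<close>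

definition comb :: "(nat \<Rightarrow> 'c \<Rightarrow> real poly) \<Rightarrow> real \<Rightarrow> (nat \<Rightarrow> 'c \<Rightarrow> real poly) \<Rightarrow> nat \<Rightarrow> 'c \<Rightarrow> real poly" where
  "comb P s P' j c = P j c + smult s (P' j c)"

text \<open>Coefficients indexed by piece, component and power, in the shape required by
  \<open>quadratic_functional\<close>.\<close>

definition coeff_family :: "nat \<Rightarrow> (nat \<times> 'c \<times> nat \<Rightarrow> real) \<Rightarrow> nat \<Rightarrow> 'c \<Rightarrow> real poly" where
  "coeff_family N f j c = (\<Sum>i\<le>N. monom (f (j, c, i)) i)"

lemma coeff_coeff_family: "coeff (coeff_family N f j c) i = (if i \<le> N then f (j, c, i) else 0)"
  by (simp add: coeff_family_def coeff_sum)

lemma coeff_family_comb: "coeff_family N (\<lambda>i. f i + s * g i) = comb (coeff_family N f) s (coeff_family N g)"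
  by (intro ext poly_eqI) (simp add: comb_def coeff_coeff_family)

lemma coeff_family_zero: "coeff_family N (\<lambda>_. 0) = (\<lambda>_ _. 0)"
  by (intro ext poly_eqI) (simp add: coeff_coeff_family)

lemma coeff_family_coeff:
  assumes "degree (P j c) \<le> N" "\<And>i. i \<le> N \<Longrightarrow> f (j, c, i) = coeff (P j c) i"
  shows "coeff_family N f j c = P j c"
  using assms by (intro poly_eqI) (auto simp: coeff_coeff_family coeff_eq_0)

lemma admissible_comb:
  assumes "admissible_family N n t P" "admissible_family N n t P'"
  shows "admissible_family N n t (comb P s P')"
  using assms unfolding admissible_family_def comb_def
  by (auto intro!: degree_add_le order_trans[OF degree_smult_le])

lemma admissible_cong:
  assumes "admissible_family N n t P" "\<And>j. j \<in> {1..n} \<Longrightarrow> P j = P' j"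
  shows "admissible_family N n t P'"
  using assms unfolding admissible_family_def by auto

lemma pval_comb: "pval (comb P s P' j) x = pval (P j) x + s *\<^sub>R pval (P' j) x"
  by (simp add: pval_def comb_def vec_eq_iff)

lemma dval_comb: "dval (comb P s P' j) x = dval (P j) x + s *\<^sub>R dval (P' j) x"
  by (simp add: dval_def comb_def vec_eq_iff pderiv_add pderiv_smult)

lemma integral_ge_0:
  fixes f :: "real \<Rightarrow> real" assumes "\<And>x. x \<in> S \<Longrightarrow> 0 \<le> f x" shows "0 \<le> integral S f"
  using assms by (cases "f integrable_on S") (auto intro: integral_nonneg simp: not_integrable_integral)

lemma norm_add_squared_le: "(norm (x + y))\<^sup>2 \<le> 2 * (norm x)\<^sup>2 + 2 * (norm (y :: 'v::real_normed_vector))\<^sup>2"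
proof -
  have "(norm (x + y))\<^sup>2 \<le> (norm x + norm y)\<^sup>2" by (intro power_mono norm_triangle_ineq) simp
  also have "\<dots> \<le> 2 * (norm x)\<^sup>2 + 2 * (norm y)\<^sup>2"
    using zero_le_power2[of "norm x - norm y"] by (simp add: power2_eq_square algebra_simps)
  finally show ?thesis .
qed

context dae_bvp_fund
begin

lemma DAE_op_bounded: "\<exists>C\<ge>0. \<forall>s\<in>{a..b}. \<forall>v x. norm (DAE_op s v x) \<le> C * (norm v + norm x)"
proof -
  obtain CA where CA: "0 \<le> CA" "\<And>t v. t \<in> {a..b} \<Longrightarrow> norm (A t *v v) \<le> CA * norm v"
    by (rule smm_bounded[OF smA compact_Icc]) (rule that)
  obtain CB where CB: "0 \<le> CB" "\<And>t v. t \<in> {a..b} \<Longrightarrow> norm (B t *v v) \<le> CB * norm v"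
    by (rule smm_bounded[OF smB compact_Icc]) (rule that)
  have "norm (DAE_op s v x) \<le> (CA + CB) * (norm v + norm x)" if "s \<in> {a..b}" for s v x
  proof -
    have "norm (DAE_op s v x) \<le> CA * norm v + CB * norm x"
      unfolding DAE_op_def using CA(2)[OF that, of v] CB(2)[OF that, of x] norm_triangle_ineq[of "A s *v v" "B s *v x"] by linarith
    also have "\<dots> \<le> (CA + CB) * (norm v + norm x)"
      using CA(1) CB(1) mult_nonneg_nonneg[of CA "norm x"] mult_nonneg_nonneg[of CB "norm v"] by (simp add: algebra_simps)
    finally show ?thesis .
  qed
  then show ?thesis using CA(1) CB(1) by (intro exI[of _ "CA + CB"]) auto
qed

lemma wj_comb: "wj (rp (comb P s P' j)) 0 x = wj (rp (P j)) 0 x + s *\<^sub>R wj (rp (P' j)) 0 x"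
  by (simp add: vec_eq_iff wj_def rp_def comb_def poly_sum pderiv_add pderiv_smult algebra_simps sum.distrib sum_distrib_left)

lemma bdry_comb:
  assumes "is_partition a b n t"
  shows "bdry (pw n t (comb P s P')) i = bdry (pw n t P) i + s * bdry (pw n t P') i"
  using partition_ends[OF assms] ab
  by (simp add: bdry_def pw_def pval_comb inner_add_right algebra_simps)

text \<open>The bilinear form of the homogeneous problem. With \<open>lform\<close> it gives the
  expansion of \<open>lsq\<close> as bform P P + 2 lform P plus a constant
  (\<open>lsq_expand\<close>), where y is the piecewise right-hand side and d the boundary
  data.\<close>

definition bform :: "nat \<Rightarrow> (nat \<Rightarrow> real) \<Rightarrow> (nat \<Rightarrow> 'k + 'r \<Rightarrow> real poly) \<Rightarrow> (nat \<Rightarrow> 'k + 'r \<Rightarrow> real poly) \<Rightarrow> real" where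
  "bform n t P P' = (\<Sum>j=1..n. integral {t (j - 1)..t j} (\<lambda>s. wj (rp (P j)) 0 s \<bullet> wj (rp (P' j)) 0 s)) +
     (\<Sum>i<l. bdry (pw n t P) i * bdry (pw n t P') i)"

definition lform :: "(nat \<Rightarrow> real \<Rightarrow> real^('k + 'r)) \<Rightarrow> (nat \<Rightarrow> real) \<Rightarrow> nat \<Rightarrow> (nat \<Rightarrow> real) \<Rightarrow> (nat \<Rightarrow> 'k + 'r \<Rightarrow> real poly) \<Rightarrow> real" where
  "lform y d n t P = - (\<Sum>j=1..n. integral {t (j - 1)..t j} (\<lambda>s. wj (rp (P j)) 0 s \<bullet> y j s)) -
     (\<Sum>i<l. bdry (pw n t P) i * d i)"

definition lsq :: "(nat \<Rightarrow> real \<Rightarrow> real^('k + 'r)) \<Rightarrow> (nat \<Rightarrow> real) \<Rightarrow> nat \<Rightarrow> (nat \<Rightarrow> real) \<Rightarrow> (nat \<Rightarrow> 'k + 'r \<Rightarrow> real poly) \<Rightarrow> real" where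
  "lsq y d n t P = (\<Sum>j=1..n. integral {t (j - 1)..t j} (\<lambda>s. (norm (wj (rp (P j)) 0 s - y j s))\<^sup>2)) +
     (\<Sum>i<l. (bdry (pw n t P) i - d i)\<^sup>2)"

lemma lsq_nonneg: "0 \<le> lsq y d n t P"
  unfolding lsq_def by (intro add_nonneg_nonneg sum_nonneg integral_ge_0) auto

lemma lsq_cong:
  assumes "is_partition a b n t" "\<And>j. j \<in> {1..n} \<Longrightarrow> P j = P' j"
  shows "lsq y d n t P = lsq y d n t P'"
  using pw_cong[OF assms] assms(2) by (simp add: lsq_def)

lemma bform_self: "bform n t P P = wenergy n t P + (\<Sum>i<l. (bdry (pw n t P) i)\<^sup>2)"
  by (simp add: bform_def wenergy_def power2_norm_eq_inner power2_eq_square[of "bdry _ _"])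

lemma bform_sym: "bform n t P P' = bform n t P' P"
  by (simp add: bform_def inner_commute mult.commute)

lemma bform_comb:
  assumes p: "is_partition a b n t"
  shows "bform n t (comb P1 s P2) P' = bform n t P1 P' + s * bform n t P2 P'"
proof -
  have i: "(\<lambda>x. wj (rp p) 0 x \<bullet> wj (rp p') 0 x) integrable_on {c..e}" for p p' and c e :: real
    by (intro integrable_continuous_real continuous_intros continuous_on_wj)
  have "integral {t (j - 1)..t j} (\<lambda>x. wj (rp (comb P1 s P2 j)) 0 x \<bullet> wj (rp (P' j)) 0 x) =
      integral {t (j - 1)..t j} (\<lambda>x. wj (rp (P1 j)) 0 x \<bullet> wj (rp (P' j)) 0 x) +
      s * integral {t (j - 1)..t j} (\<lambda>x. wj (rp (P2 j)) 0 x \<bullet> wj (rp (P' j)) 0 x)" for j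
    unfolding wj_comb inner_add_left inner_scaleR_left integral_mult_right[symmetric]
    by (intro integral_add i integrable_on_mult_right)
  then show ?thesis
    by (simp add: bform_def bdry_comb[OF p] sum.distrib sum_distrib_left algebra_simps)
qed

lemma lform_comb:
  assumes p: "is_partition a b n t" and y: "\<And>j. continuous_on UNIV (y j)"
  shows "lform y d n t (comb P1 s P2) = lform y d n t P1 + s * lform y d n t P2"
proof -
  have i: "(\<lambda>x. wj (rp p) 0 x \<bullet> y j x) integrable_on {c..e}" for p j and c e :: real
    by (intro integrable_continuous_real continuous_intros continuous_on_wj continuous_on_subset[OF y]) simp
  have "integral {t (j - 1)..t j} (\<lambda>x. wj (rp (comb P1 s P2 j)) 0 x \<bullet> y j x) =
      integral {t (j - 1)..t j} (\<lambda>x. wj (rp (P1 j)) 0 x \<bullet> y j x) +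
      s * integral {t (j - 1)..t j} (\<lambda>x. wj (rp (P2 j)) 0 x \<bullet> y j x)" for j
    unfolding wj_comb inner_add_left inner_scaleR_left integral_mult_right[symmetric]
    by (intro integral_add i integrable_on_mult_right)
  then show ?thesis
    by (simp add: lform_def bdry_comb[OF p] sum.distrib sum_distrib_left algebra_simps)
qed

lemma lsq_expand:
  assumes y: "\<And>j. continuous_on UNIV (y j)"
  shows "lsq y d n t P = bform n t P P + 2 * lform y d n t P +
    ((\<Sum>j=1..n. integral {t (j - 1)..t j} (\<lambda>s. (norm (y j s))\<^sup>2)) + (\<Sum>i<l. (d i)\<^sup>2))"
proof -
  have c: "continuous_on S (y j)" for S j using continuous_on_subset[OF y] by simp
  have sq: "(norm (v - w))\<^sup>2 = v \<bullet> v + ((- 2) * (v \<bullet> w) + (norm w)\<^sup>2)" for v w :: "real^('k + 'r)"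
    by (simp add: power2_norm_eq_inner inner_diff_left inner_diff_right inner_commute)
  have "integral {t (j - 1)..t j} (\<lambda>s. (norm (wj (rp (P j)) 0 s - y j s))\<^sup>2) =
      integral {t (j - 1)..t j} (\<lambda>s. wj (rp (P j)) 0 s \<bullet> wj (rp (P j)) 0 s) +
      ((- 2) * integral {t (j - 1)..t j} (\<lambda>s. wj (rp (P j)) 0 s \<bullet> y j s) + integral {t (j - 1)..t j} (\<lambda>s. (norm (y j s))\<^sup>2))" for j
    unfolding sq integral_mult_right[symmetric]
    by (subst integral_add, (intro integrable_continuous_real continuous_intros continuous_on_wj c)+)+ (rule refl)
  then have S1: "(\<Sum>j=1..n. integral {t (j - 1)..t j} (\<lambda>s. (norm (wj (rp (P j)) 0 s - y j s))\<^sup>2)) =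
      (\<Sum>j=1..n. integral {t (j - 1)..t j} (\<lambda>s. wj (rp (P j)) 0 s \<bullet> wj (rp (P j)) 0 s)) +
      ((- 2) * (\<Sum>j=1..n. integral {t (j - 1)..t j} (\<lambda>s. wj (rp (P j)) 0 s \<bullet> y j s)) +
        (\<Sum>j=1..n. integral {t (j - 1)..t j} (\<lambda>s. (norm (y j s))\<^sup>2)))"
    by (simp only: sum.distrib sum_distrib_left)
  have "(bdry x i - d i)\<^sup>2 = bdry x i * bdry x i + ((- 2) * (bdry x i * d i) + (d i)\<^sup>2)" for x i
    by (simp add: power2_eq_square algebra_simps)
  then have S2: "(\<Sum>i<l. (bdry (pw n t P) i - d i)\<^sup>2) = (\<Sum>i<l. bdry (pw n t P) i * bdry (pw n t P) i) +
      ((- 2) * (\<Sum>i<l. bdry (pw n t P) i * d i) + (\<Sum>i<l. (d i)\<^sup>2))"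
    by (simp only: sum.distrib sum_distrib_left)
  show ?thesis unfolding lsq_def bform_def lform_def S1 S2 by (simp add: algebra_simps)
qed

text \<open>The family in the last term is the midpoint of P and P', and \<open>lsq\<close> is
  nonnegative. So the form of the difference is bounded by twice the sum of the two values, and it
  is nonpositive if both families are minimizers.\<close>

lemma lsq_parallelogram:
  assumes p: "is_partition a b n t" and y: "\<And>j. continuous_on UNIV (y j)"
  defines "\<delta> P P' \<equiv> comb P (- 1) P'"
  shows "bform n t (\<delta> P P') (\<delta> P P') = 2 * lsq y d n t P + 2 * lsq y d n t P' - 4 * lsq y d n t (comb P (- 1 / 2) (\<delta> P P'))"
proof -
  have e: "lsq y d n t (comb P s D) = lsq y d n t P + 2 * s * (bform n t P D + lform y d n t D) + s\<^sup>2 * bform n t D D" for s D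
    unfolding lsq_expand[where y = y, OF y] lform_comb[OF p y] bform_comb[OF p] bform_sym[of n t P "comb P s D"] bform_sym[of n t D "comb P s D"]
    by (simp add: bform_sym[of n t D P] power2_eq_square algebra_simps)
  have "P' = comb P (- 1) (\<delta> P P')" by (simp add: \<delta>_def comb_def fun_eq_iff)
  then have "lsq y d n t P' = lsq y d n t P - 2 * (bform n t P (\<delta> P P') + lform y d n t (\<delta> P P')) + bform n t (\<delta> P P') (\<delta> P P')"
    using e[of "- 1" "\<delta> P P'"] by simp
  then show ?thesis using e[of "- 1 / 2" "\<delta> P P'"] by (simp add: power2_eq_square)
qed

text \<open>Families with bounded degrees on n pieces form a finite-dimensional space, and
  nonnegativity of \<open>lsq\<close> is the lower bound that \<open>quadratic_minimum\<close> asks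
  for.\<close>

lemma lsq_minimum:
  assumes p: "is_partition a b n t" and y: "\<And>j. continuous_on UNIV (y j)"
  shows "\<exists>P. admissible_family N n t P \<and> (\<forall>P'. admissible_family N n t P' \<longrightarrow> lsq y d n t P \<le> lsq y d n t P')"
proof -
  define I :: "(nat \<times> ('k + 'r) \<times> nat) set" where "I = {1..n} \<times> UNIV \<times> {..N}"
  define U where "U = {f. (\<forall>i. i \<notin> I \<longrightarrow> f i = 0) \<and> admissible_family N n t (coeff_family N f)}"
  let ?m = "- ((\<Sum>j=1..n. integral {t (j - 1)..t j} (\<lambda>s. (norm (y j s))\<^sup>2)) + (\<Sum>i<l. (d i)\<^sup>2))"
  let ?\<beta> = "\<lambda>f g. bform n t (coeff_family N f) (coeff_family N g)" and ?lf = "\<lambda>f. lform y d n t (coeff_family N f)"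
  have fin: "finite I" by (simp add: I_def)
  have "quadratic_functional I U ?\<beta> ?lf ?m"
  proof (rule quadratic_functional.intro, goal_cases)
    case 1 show ?case by (simp add: U_def coeff_family_zero admissible_family_def)
  next
    case (2 f g s) then show ?case by (simp add: U_def coeff_family_comb admissible_comb)
  next
    case (3 f i) then show ?case unfolding U_def by blast
  next
    case (4 f g e s) show ?case by (simp only: coeff_family_comb bform_comb[OF p])
  next
    case (5 f g) show ?case by (rule bform_sym)
  next
    case (6 f) show ?case
      unfolding bform_def by (intro add_nonneg_nonneg sum_nonneg integral_ge_0) auto
  next
    case (7 f g s) show ?case by (simp only: coeff_family_comb lform_comb[OF p y])
  next
    case (8 f) show ?case
      using lsq_nonneg[of y d n t "coeff_family N f"] unfolding lsq_expand[where y = y, OF y] by linarith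
  qed
  from quadratic_minimum[OF fin, rule_format, OF this]
  obtain f where f: "f \<in> U" "\<And>g. g \<in> U \<Longrightarrow> lsq y d n t (coeff_family N f) \<le> lsq y d n t (coeff_family N g)"
    unfolding lsq_expand[where y = y, OF y] by auto
  have "lsq y d n t (coeff_family N f) \<le> lsq y d n t P'" if P': "admissible_family N n t P'" for P'
  proof -
    \<comment> \<open>The coefficients of P' on the pieces 1 to n, zero elsewhere; members of P'
      outside this range do not influence \<open>lsq\<close>.\<close>
    define g where "g i = (if i \<in> I then coeff (P' (fst i) (fst (snd i))) (snd (snd i)) else 0)" for i
    have e: "P' j = coeff_family N g j" if "j \<in> {1..n}" for j
      using degree_admissible[OF P' that] that
      by (intro ext sym[OF coeff_family_coeff]) (auto simp: g_def I_def)
    have "g \<in> U" using admissible_cong[OF P' e] by (simp add: U_def g_def)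
    then show ?thesis using f(2) lsq_cong[OF p e, where y = y and d = d] by simp
  qed
  then show ?thesis using f(1) by (intro exI[of _ "coeff_family N f"]) (simp add: U_def)
qed

end

section \<open>Minimizers and their convergence\<close>

context dae_bvp_fund
begin

text \<open>The residual of an ansatz function has degree at most N + N' < M on each piece, so
  interpolation at M nodes reproduces it and acts on the right-hand side only.\<close>

lemma interpolated_residual:
  assumes dA: "\<And>c i. degree (PA c i) \<le> N'" and dB: "\<And>c d. degree (PB c d) \<le> N'"
    and p: "is_partition a b n t" and P: "admissible_family N n t P" and j: "j \<in> {1..n}"
    and \<tau>: "nodes M \<tau>" and NM: "N + N' < M"
  shows "(\<Sum>i=1..M. lagrange M (colloc t \<tau> j) i s *\<^sub>R (wj (rp (P j)) 0 (colloc t \<tau> j i) - y i)) =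
    wj (rp (P j)) 0 s - (\<Sum>i=1..M. lagrange M (colloc t \<tau> j) i s *\<^sub>R y i)"
proof -
  have "degree (rp (P j) c) < M" for c
    using degree_rp[where p = "P j" and c = c, OF dA dB degree_admissible[OF P j]] NM by simp
  from poly_lagrange[OF colloc_inj[OF \<tau> partition_step[OF p j]] this, of _ s]
  have e: "(\<Sum>i=1..M. lagrange M (colloc t \<tau> j) i s * poly (rp (P j) c) (colloc t \<tau> j i)) = poly (rp (P j) c) s" for c
    by simp
  show ?thesis
    unfolding vec_eq_iff
    by (simp only: wj_def sum_component vector_minus_component vector_scaleR_component vec_lambda_beta
        real_scaleR_def right_diff_distrib sum_subtractf funpow_0 e simp_thms)
qed

lemma residual_pw:
  assumes p: "is_partition a b n t" and j: "j \<in> {1..n}" and \<tau>: "nodes M \<tau>" and i: "i \<in> {1..M}"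
  shows "residual A B q t \<tau> (pw n t P) j i = wj (rp (P j)) 0 (colloc t \<tau> j i) - q (colloc t \<tau> j i)"
proof -
  have "colloc t \<tau> j i \<in> {a..b}"
    using colloc_mem[OF \<tau> partition_step[OF p j] i] partition_piece_subset[OF p j] by blast
  from DAE_op_pval[OF this, of "P j", symmetric] show ?thesis
    by (simp add: residual_def Let_def piece_pw[OF p j] DAE_op_def dval_def pval_def)
qed

lemma PhiR_pw:
  assumes dA: "\<And>c i. degree (PA c i) \<le> N'" and dB: "\<And>c d. degree (PB c d) \<le> N'"
    and p: "is_partition a b n t" and P: "admissible_family N n t P"
    and \<tau>: "nodes M \<tau>" and NM: "N + N' < M"
  shows "PhiR a b A B q l Ga Gb d M \<tau> n t (pw n t P) =
    lsq (\<lambda>j s. \<Sum>i=1..M. lagrange M (colloc t \<tau> j) i s *\<^sub>R q (colloc t \<tau> j i)) d n t P"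
proof -
  have "(\<Sum>i=1..M. lagrange M (colloc t \<tau> j) i s *\<^sub>R residual A B q t \<tau> (pw n t P) j i) =
      wj (rp (P j)) 0 s - (\<Sum>i=1..M. lagrange M (colloc t \<tau> j) i s *\<^sub>R q (colloc t \<tau> j i))" if j: "j \<in> {1..n}" for j s
    unfolding interpolated_residual[OF dA dB p P j \<tau> NM, symmetric]
    by (rule sum.cong[OF refl]) (simp only: residual_pw[OF p j \<tau>])
  then show ?thesis
    unfolding PhiR_def lsq_def boundary_defect_def bdry_def
    by (intro arg_cong2[where f = "(+)"] sum.cong refl) simp
qed

text \<open>Stability makes the form definite on functions: if the form of the difference vanishes,
  so do its energy and, by continuity, all its pieces. The conclusion concerns functions, as
  families are free outside the indices 1 to n.\<close>

lemma pw_unique: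
  assumes S: "\<And>n t P h\<^sub>0. is_partition a b n t \<Longrightarrow> admissible_family N n t P \<Longrightarrow> 0 < h\<^sub>0 \<Longrightarrow> h\<^sub>0 \<le> 1 \<Longrightarrow>
      (\<And>j. j \<in> {1..n} \<Longrightarrow> h\<^sub>0 \<le> step t j) \<Longrightarrow> (h\<^sub>0 ^ e)\<^sup>2 * henergy n t P \<le> S * bform n t P P" and S0: "0 \<le> S"
    and p: "is_partition a b n t" and P: "admissible_family N n t P" "admissible_family N n t P'"
    and z: "bform n t (comb P (- 1) P') (comb P (- 1) P') \<le> 0"
  shows "pw n t P = pw n t P'"
proof -
  let ?\<delta> = "comb P (- 1) P'"
  let ?f = "\<lambda>j s. (norm (pval (?\<delta> j) s))\<^sup>2 + (norm (dval (?\<delta> j) s))\<^sup>2"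
  \<comment> \<open>Any admissible h0 does here, as no rate is at stake; the minimum with 1 meets
    the conditions of S.\<close>
  define h\<^sub>0 where "h\<^sub>0 = min 1 (step_min n t)"
  have n1: "1 \<in> {1..n}" using partition_ends[OF p] by simp
  have h0: "0 < h\<^sub>0" "h\<^sub>0 \<le> 1" using step_le(1)[OF p n1] by (auto simp: h\<^sub>0_def)
  have hj: "h\<^sub>0 \<le> step t j" if "j \<in> {1..n}" for j using step_le(2)[OF p that] by (simp add: h\<^sub>0_def)
  have "(h\<^sub>0 ^ e)\<^sup>2 * henergy n t ?\<delta> \<le> S * bform n t ?\<delta> ?\<delta>"
    by (rule S[OF p admissible_comb[OF P] h0 hj])
  also have "\<dots> \<le> 0" using S0 z by (rule mult_nonneg_nonpos)
  finally have le: "henergy n t ?\<delta> \<le> 0" using h0 by (simp add: mult_le_0_iff)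
  have nn: "0 \<le> integral {t (j - 1)..t j} (?f j)" for j by (rule integral_ge_0) simp
  have z: "integral {t (j - 1)..t j} (?f j) = 0" if "j \<in> {1..n}" for j
  proof -
    have "0 \<le> henergy n t ?\<delta>" unfolding henergy_def by (intro sum_nonneg nn)
    then have "henergy n t ?\<delta> = 0" using le by simp
    then show ?thesis
      unfolding henergy_def using that nn by (subst (asm) sum_nonneg_eq_0_iff) auto
  qed
  have "pval (P j) s = pval (P' j) s" if j: "j \<in> {1..n}" and s: "s \<in> {t (j - 1)..t j}" for j s
  proof -
    have c: "continuous_on (cbox (t (j - 1)) (t j)) (?f j)"
      by (intro continuous_intros continuous_on_pval continuous_on_dval)
    have hi: "(?f j has_integral 0) (cbox (t (j - 1)) (t j))"
      using integrable_integral[OF integrable_continuous[OF c]] z[OF j] by simp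
    have "?f j s = 0"
      by (rule has_integral_0_cbox_imp_0[OF c _ hi]) (use s partition_step[OF p j] in auto)
    then have "pval (?\<delta> j) s = 0" by (simp add: add_nonneg_eq_0_iff)
    then show ?thesis by (simp add: pval_comb)
  qed
  then have "pval (P (idx n t s)) s = pval (P' (idx n t s)) s" if "s \<in> {t 0..t n}" for s
    using partition_cover_closed[OF p, of s] partition_ends[OF p] that by metis
  then show ?thesis unfolding pw_def by (intro restrict_ext)
qed

text \<open>The rows of G_a and G_b do not see ker D, so agreement of D x at the end points gives
  the same boundary values.\<close>

lemma bdry_approximation:
  assumes p: "is_partition a b n t" and P: "admissible_family N n t P"
    and Da: "(Dmat :: real^('k+'r)^'k) *v pval (P 1) (t 0) = Dmat *v x a"
    and Db: "(Dmat :: real^('k+'r)^'k) *v pval (P n) (t n) = Dmat *v x b" and i: "i < l"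
  shows "bdry (pw n t P) i = Ga i \<bullet> x a + Gb i \<bullet> x b"
proof -
  have n: "1 \<in> {1..n}" "n \<in> {1..n}" and te: "t 0 = a" "t n = b" using partition_ends[OF p] by auto
  have "(Dmat :: real^('k+'r)^'k) *v pw n t P a = Dmat *v x a"
    using pw_Dmat[OF p P n(1), of a] Da te partition_step[OF p n(1)] by simp
  then have "pw n t P a - x a \<in> ker (Dmat :: real^('k+'r)^'k)" by (simp add: ker_def matrix_vector_mult_diff_distrib)
  then have 1: "Ga i \<bullet> pw n t P a = Ga i \<bullet> x a" using GG[OF i] by (auto simp: inner_diff_right)
  have "(Dmat :: real^('k+'r)^'k) *v pw n t P b = Dmat *v x b"
    using pw_Dmat[OF p P n(2), of b] Db te partition_step[OF p n(2)] by simp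
  then have "pw n t P b - x b \<in> ker (Dmat :: real^('k+'r)^'k)" by (simp add: ker_def matrix_vector_mult_diff_distrib)
  then have "Gb i \<bullet> pw n t P b = Gb i \<bullet> x b" using GG[OF i] by (auto simp: inner_diff_right)
  then show ?thesis using 1 by (simp add: bdry_def)
qed

text \<open>The minimizer P is compared with the approximant P' of the solution. Since
  \<open>lsq\<close> at P is at most \<open>lsq\<close> at P', of order h^(2N), the parallelogram
  identity bounds the form of P - P' by the same order, and stability bounds its energy by h^(2N) /
  h_min^(2e). The triangle inequality adds the error of P'. The rate is written as a quotient
  because e may exceed N.\<close>

lemma convergence:
  assumes dA: "\<And>c i. degree (PA c i) \<le> N'" and dB: "\<And>c d. degree (PB c d) \<le> N'"
    and e: "\<mu> \<le> Suc e \<or> N + N' \<le> e" and N: "1 \<le> N" and NM: "N + N' < M" and \<tau>: "nodes M \<tau>"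
    and x: "Ck_on (N + 1) {a..b} x" and sol: "dae_solution a b A B q x" and bc: "boundary_condition a b l Ga Gb d x"
  shows "\<exists>C. \<forall>n t. is_partition a b n t \<longrightarrow> step_max n t / step_min n t \<le> \<rho> \<longrightarrow> step_max n t \<le> 1 \<longrightarrow>
    (\<exists>xR. unique_minimizer (PhiR a b A B q l Ga Gb d M \<tau> n t) (ansatz_space a b N n t) xR \<and>
      HD1_error_le a b xR x (C * (step_max n t ^ N / step_max n t ^ e)))"
proof -
  from stability[OF dA dB e] obtain S where S': "0 \<le> S \<and> (\<forall>n t P h\<^sub>0. is_partition a b n t \<longrightarrow> admissible_family N n t P \<longrightarrow>
    0 < h\<^sub>0 \<longrightarrow> h\<^sub>0 \<le> 1 \<longrightarrow> (\<forall>j\<in>{1..n}. h\<^sub>0 \<le> step t j) \<longrightarrow>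
    (h\<^sub>0 ^ e)\<^sup>2 * henergy n t P \<le> S * (wenergy n t P + (\<Sum>i<l. (bdry (pw n t P) i)\<^sup>2)))" ..
  then have S0: "0 \<le> S" by (rule conjunct1)
  have S: "(h\<^sub>0 ^ e)\<^sup>2 * henergy n t P \<le> S * bform n t P P"
    if "is_partition a b n t" "admissible_family N n t P" "0 < h\<^sub>0" "h\<^sub>0 \<le> 1" "\<And>j. j \<in> {1..n} \<Longrightarrow> h\<^sub>0 \<le> step t j" for n t P h\<^sub>0
    unfolding bform_self by (rule S'[THEN conjunct2, rule_format, OF that]) 
  from approximation[OF ab N x] obtain K where "0 \<le> K \<and> (\<exists>v. continuous_on {a..b} v \<and>
    (\<forall>s\<in>{a..b}. ((\<lambda>s. (Dmat :: real^('k+'r)^'k) *v x s) has_vector_derivative v s) (at s within {a..b})) \<and>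
    (\<forall>n t. is_partition a b n t \<longrightarrow> (\<exists>P. admissible_family N n t P \<and>
      (\<forall>j\<in>{1..n}. (Dmat :: real^('k+'r)^'k) *v pval (P j) (t (j - 1)) = Dmat *v x (t (j - 1)) \<and>
        (Dmat :: real^('k+'r)^'k) *v pval (P j) (t j) = Dmat *v x (t j) \<and>
        (\<forall>s\<in>{t (j - 1)..t j}. norm (pval (P j) s - x s) \<le> K * step t j ^ N \<and> norm (dval (P j) s - v s) \<le> K * step t j ^ N)))))" ..
  then obtain v where K0: "0 \<le> K" and cv: "continuous_on {a..b} v"
    and dv: "\<And>s. s \<in> {a..b} \<Longrightarrow> ((\<lambda>s. (Dmat :: real^('k+'r)^'k) *v x s) has_vector_derivative v s) (at s within {a..b})"
    and appr: "\<And>n t. is_partition a b n t \<Longrightarrow> (\<exists>P. admissible_family N n t P \<and>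
      (\<forall>j\<in>{1..n}. (Dmat :: real^('k+'r)^'k) *v pval (P j) (t (j - 1)) = Dmat *v x (t (j - 1)) \<and>
        (Dmat :: real^('k+'r)^'k) *v pval (P j) (t j) = Dmat *v x (t j) \<and>
        (\<forall>s\<in>{t (j - 1)..t j}. norm (pval (P j) s - x s) \<le> K * step t j ^ N \<and> norm (dval (P j) s - v s) \<le> K * step t j ^ N)))"
    by auto
  from DAE_op_bounded obtain D where D': "0 \<le> D \<and> (\<forall>s\<in>{a..b}. \<forall>v x. norm (DAE_op s v x) \<le> D * (norm v + norm x))" ..
  from lagrange_bounded[of M \<tau>] obtain \<Lambda> where \<Lambda>': "0 \<le> \<Lambda> \<and> (\<forall>i\<in>{1..M}. \<forall>\<sigma>\<in>{0..1}. \<bar>lagrange M \<tau> i \<sigma>\<bar> \<le> \<Lambda>)" ..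
  have cx: "continuous_on {a..b} x" using sol by (simp add: dae_solution_def)
  have qs: "q s = DAE_op s (v s) (x s)" if "s \<in> {a..b}" for s
  proof -
    have "A s *v vector_derivative (\<lambda>s. (Dmat :: real^('k+'r)^'k) *v x s) (at s within {a..b}) + B s *v x s = q s"
      using sol that unfolding dae_solution_def by blast
    then show ?thesis unfolding vector_derivative_within_closed_interval[OF ab that dv[OF that]] DAE_op_def by simp
  qed
  \<comment> \<open>The residual of the approximant, interpolated: M basis polynomials bounded by
    \<Lambda>, the operator bound D, and K h^N each for the error in value and in
    derivative.\<close>
  define E where "E = real M * (\<Lambda> * (D * (2 * K)))"
  \<comment> \<open>Twice the energy bound of P - P', with h_min replaced by h at the cost of
    \<rho>^e, and the squared approximation error in both parts of the norm.\<close>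
  define C2 where "C2 = 2 * (S * (4 * (b - a) * E\<^sup>2)) * (\<rho> ^ e)\<^sup>2 + 4 * (b - a) * K\<^sup>2"
  have C2: "0 \<le> C2" using S0 ab by (simp add: C2_def)
  show ?thesis
  proof (rule exI[of _ "sqrt C2"], intro allI impI)
    fix n t assume p: "is_partition a b n t" and \<rho>: "step_max n t / step_min n t \<le> \<rho>" and h1: "step_max n t \<le> 1"
    define h where "h = step_max n t"
    define hm where "hm = step_min n t"
    define y where "y j s = (\<Sum>i=1..M. lagrange M (colloc t \<tau> j) i s *\<^sub>R q (colloc t \<tau> j i))" for j s
    have n1: "1 \<in> {1..n}" "n \<in> {1..n}" using partition_ends[OF p] by auto
    have hm: "0 < hm" "hm \<le> h" and h: "0 < h" "h \<le> 1" and hj: "\<And>j. j \<in> {1..n} \<Longrightarrow> step t j \<le> h" "\<And>j. j \<in> {1..n} \<Longrightarrow> hm \<le> step t j"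
      using step_le[OF p] step_le[OF p n1(1)] h1 by (auto simp: hm_def h_def)
    have hrho: "h / hm \<le> \<rho>" using \<rho> by (simp add: h_def hm_def)
    have y: "continuous_on UNIV (y j)" for j
      unfolding y_def[abs_def] by (intro continuous_intros continuous_on_lagrange)
    from lsq_minimum[of n t y, OF p y, of N d]
    obtain P where P: "admissible_family N n t P" and Pmin: "\<And>P'. admissible_family N n t P' \<Longrightarrow> lsq y d n t P \<le> lsq y d n t P'"
      by auto
    from appr[OF p] obtain P' where P': "admissible_family N n t P'"
      and end': "\<And>j. j \<in> {1..n} \<Longrightarrow> (Dmat :: real^('k+'r)^'k) *v pval (P' j) (t (j - 1)) = Dmat *v x (t (j - 1))"
        "\<And>j. j \<in> {1..n} \<Longrightarrow> (Dmat :: real^('k+'r)^'k) *v pval (P' j) (t j) = Dmat *v x (t j)"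
      and err': "\<And>j s. j \<in> {1..n} \<Longrightarrow> s \<in> {t (j - 1)..t j} \<Longrightarrow> norm (pval (P' j) s - x s) \<le> K * step t j ^ N \<and> norm (dval (P' j) s - v s) \<le> K * step t j ^ N"
      by auto
    have err: "norm (pval (P' j) s - x s) \<le> K * h ^ N" "norm (dval (P' j) s - v s) \<le> K * h ^ N"
      if "j \<in> {1..n}" "s \<in> {t (j - 1)..t j}" for j s
    proof -
      have "K * step t j ^ N \<le> K * h ^ N"
        using hj[OF that(1)] hm(1) K0 by (intro mult_left_mono power_mono) auto
      then show "norm (pval (P' j) s - x s) \<le> K * h ^ N" "norm (dval (P' j) s - v s) \<le> K * h ^ N"
        using err'[OF that] by auto
    qed
    have sub: "{t (j - 1)..t j} \<subseteq> {a..b}" if "j \<in> {1..n}" for j using partition_piece_subset[OF p that] .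
    \<comment> \<open>Because q = A v + B x_s at the nodes, with v the derivative of D x_s, each
      nodal residual is the DAE operator applied to the approximation error.\<close>
    have res: "norm (wj (rp (P' j)) 0 s - y j s) \<le> E * h ^ N" if j: "j \<in> {1..n}" and s: "s \<in> {t (j - 1)..t j}" for j s
    proof -
      let ?\<sigma> = "colloc t \<tau> j"
      have lt: "t (j - 1) < t j" using partition_step[OF p j] .
      have one: "norm (lagrange M ?\<sigma> i s *\<^sub>R (wj (rp (P' j)) 0 (?\<sigma> i) - q (?\<sigma> i))) \<le> \<Lambda> * (D * (2 * K)) * h ^ N" if i: "i \<in> {1..M}" for i
      proof -
        have m: "?\<sigma> i \<in> {t (j - 1)..t j}" by (rule colloc_mem[OF \<tau> lt i])
        then have mab: "?\<sigma> i \<in> {a..b}" using sub[OF j] by blast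
        have "wj (rp (P' j)) 0 (?\<sigma> i) - q (?\<sigma> i) = DAE_op (?\<sigma> i) (dval (P' j) (?\<sigma> i) - v (?\<sigma> i)) (pval (P' j) (?\<sigma> i) - x (?\<sigma> i))"
          unfolding qs[OF mab] DAE_op_pval[OF mab, symmetric] by (simp add: DAE_op_def matrix_vector_mult_diff_distrib)
        then have "norm (wj (rp (P' j)) 0 (?\<sigma> i) - q (?\<sigma> i)) \<le> D * (norm (dval (P' j) (?\<sigma> i) - v (?\<sigma> i)) + norm (pval (P' j) (?\<sigma> i) - x (?\<sigma> i)))"
          using D' mab by simp
        also have "\<dots> \<le> D * (K * h ^ N + K * h ^ N)"
          using D' err[OF j m] by (intro mult_left_mono add_mono) auto
        finally have r: "norm (wj (rp (P' j)) 0 (?\<sigma> i) - q (?\<sigma> i)) \<le> D * (2 * K) * h ^ N" by (simp add: algebra_simps)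
        have "(s - t (j - 1)) / step t j \<in> {0..1}" using s lt by (simp add: step_def)
        moreover have "s = t (j - 1) + (s - t (j - 1)) / step t j * step t j" using lt by (simp add: step_def)
        ultimately have "\<bar>lagrange M ?\<sigma> i s\<bar> \<le> \<Lambda>"
          using \<Lambda>' i lagrange_affine[OF lt, of M \<tau> i "(s - t (j - 1)) / step t j"] by auto
        from mult_mono[OF this r] show ?thesis using \<Lambda>' by (simp add: mult.assoc)
      qed
      have "norm (wj (rp (P' j)) 0 s - y j s) = norm (\<Sum>i=1..M. lagrange M ?\<sigma> i s *\<^sub>R (wj (rp (P' j)) 0 (?\<sigma> i) - q (?\<sigma> i)))"
        unfolding y_def interpolated_residual[OF dA dB p P' j \<tau> NM] ..
      also have "\<dots> \<le> (\<Sum>i=1..M. \<Lambda> * (D * (2 * K)) * h ^ N)" by (rule sum_norm_le[OF one])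
      also have "\<dots> = E * h ^ N" by (simp add: E_def)
      finally show ?thesis .
    qed
    have lsqP': "lsq y d n t P' \<le> (b - a) * (E * h ^ N)\<^sup>2"
    proof -
      have "bdry (pw n t P') i = d i" if i: "i < l" for i
        using bdry_approximation[OF p P' _ _ i, of x] end'(1)[OF n1(1)] end'(2)[OF n1(2)] partition_ends[OF p] bc i
        by (simp add: boundary_condition_def)
      then have "lsq y d n t P' = (\<Sum>j=1..n. integral {t (j - 1)..t j} (\<lambda>s. (norm (wj (rp (P' j)) 0 s - y j s))\<^sup>2))"
        by (simp add: lsq_def)
      also have "\<dots> \<le> (\<Sum>j=1..n. step t j * (E * h ^ N)\<^sup>2)"
      proof (rule sum_mono)
        fix j assume j: "j \<in> {1..n}"
        have "integral {t (j - 1)..t j} (\<lambda>s. (norm (wj (rp (P' j)) 0 s - y j s))\<^sup>2) \<le> integral {t (j - 1)..t j} (\<lambda>s. (E * h ^ N)\<^sup>2)"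
        proof (rule integral_le)
          show "(\<lambda>s. (norm (wj (rp (P' j)) 0 s - y j s))\<^sup>2) integrable_on {t (j - 1)..t j}"
            by (intro integrable_continuous_real continuous_intros continuous_on_wj continuous_on_subset[OF y]) simp
          show "(norm (wj (rp (P' j)) 0 s - y j s))\<^sup>2 \<le> (E * h ^ N)\<^sup>2" if "s \<in> {t (j - 1)..t j}" for s
            by (rule power_mono[OF res[OF j that]]) simp
        qed (rule integrable_const_ivl)
        also have "\<dots> = step t j * (E * h ^ N)\<^sup>2" using partition_step[OF p j] by (simp add: step_def)
        finally show "integral {t (j - 1)..t j} (\<lambda>s. (norm (wj (rp (P' j)) 0 s - y j s))\<^sup>2) \<le> step t j * (E * h ^ N)\<^sup>2" .
      qed
      also have "\<dots> = (b - a) * (E * h ^ N)\<^sup>2" by (simp only: sum_distrib_right[symmetric] sum_step[OF p])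
      finally show ?thesis .
    qed
    let ?\<delta> = "comb P (- 1) P'"
    \<comment> \<open>The midpoint term of the parallelogram identity is nonpositive, and minimality
      of P bounds both remaining terms by the value at P'.\<close>
    have "bform n t ?\<delta> ?\<delta> \<le> 4 * ((b - a) * (E * h ^ N)\<^sup>2)"
      using lsq_parallelogram[where y = y and d = d and P = P and P' = P', OF p y] lsq_nonneg[of y d n t "comb P (- 1 / 2) ?\<delta>"] Pmin[OF P'] lsqP' by linarith
    then have "S * bform n t ?\<delta> ?\<delta> \<le> S * (4 * ((b - a) * (E * h ^ N)\<^sup>2))" using S0 by (rule mult_left_mono)
    then have "(hm ^ e)\<^sup>2 * henergy n t ?\<delta> \<le> S * (4 * ((b - a) * (E * h ^ N)\<^sup>2))"
      using S[OF p admissible_comb[OF P P', of "- 1"] hm(1) _ hj(2)] hm(2) h(2) by linarith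
    then have "henergy n t ?\<delta> \<le> S * (4 * ((b - a) * (E * h ^ N)\<^sup>2)) / (hm ^ e)\<^sup>2"
      using hm(1) by (simp add: pos_le_divide_eq mult.commute)
    also have "\<dots> = S * (4 * (b - a) * E\<^sup>2) * (h ^ N / hm ^ e)\<^sup>2"
      by (simp add: power_mult_distrib power_divide)
    \<comment> \<open>The mesh ratio h / h_min \<le> \<rho> enters here.\<close>
    also have "\<dots> \<le> S * (4 * (b - a) * E\<^sup>2) * (\<rho> ^ e * (h ^ N / h ^ e))\<^sup>2"
    proof (intro mult_left_mono power_mono)
      have "h ^ N / hm ^ e = (h / hm) ^ e * (h ^ N / h ^ e)" using h(1) by (simp add: power_divide)
      also have "\<dots> \<le> \<rho> ^ e * (h ^ N / h ^ e)" using hrho h(1) hm(1) by (intro mult_right_mono power_mono) auto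
      finally show "h ^ N / hm ^ e \<le> \<rho> ^ e * (h ^ N / h ^ e)" .
    qed (use S0 ab h hm in auto)
    finally have hen: "henergy n t ?\<delta> \<le> S * (4 * (b - a) * E\<^sup>2) * (\<rho> ^ e * (h ^ N / h ^ e))\<^sup>2" .
    \<comment> \<open>As h \<le> 1, the approximation error h^N is no larger than the rate h^N /
      h^e.\<close>
    have hX: "h ^ N \<le> h ^ N / h ^ e" using h by (simp add: pos_le_divide_eq mult_left_le power_le_one)
    let ?xR = "pw n t P"
    let ?y = "\<lambda>j s. pval (P j) s - x s" and ?v = "\<lambda>j s. dval (P j) s - v s"
    have cy: "continuous_on {t (j - 1)..t j} (?y j)" and cv': "continuous_on {t (j - 1)..t j} (?v j)" if "j \<in> {1..n}" for j
      using continuous_on_subset[OF cx sub[OF that]] continuous_on_subset[OF cv sub[OF that]]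
      by (auto intro!: continuous_intros continuous_on_pval continuous_on_dval)
    have Dx: "continuous_on {a..b} (\<lambda>s. (Dmat :: real^('k+'r)^'k) *v (?xR s - x s))"
      unfolding matrix_vector_mult_diff_distrib
      by (intro continuous_on_diff pw_Dmat_continuous[OF p P] continuous_on_compose2[OF linear_continuous_on[OF matrix_vector_mul_bounded_linear] cx]) auto
    have dx: "((\<lambda>s. (Dmat :: real^('k+'r)^'k) *v (?xR s - x s)) has_vector_derivative ?v j s) (at s)"
      if j: "j \<in> {1..n}" and s: "s \<in> {t (j - 1)<..<t j}" for j s
    proof -
      have "a \<le> t (j - 1)" "t j \<le> b" using partition_mem[OF p, of "j - 1"] partition_mem[OF p, of j] j by auto
      then have "a < s" "s < b" using s by auto
      then show ?thesis
        unfolding matrix_vector_mult_diff_distrib using dv[of s]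
        by (intro has_vector_derivative_diff pw_deriv[OF p j s]) (simp add: at_within_Icc_at)
    qed
    have ex: "?xR s - x s = ?y j s" if "j \<in> {1..n}" "s \<in> {t (j - 1)<..<t j}" for j s
      using pw_eq[OF p that(1), of s P] that by simp
    have H1: "(\<lambda>s. ?xR s - x s) \<in> HD1 a b"
      by (rule HD1_pieces(1)[where x = "\<lambda>s. ?xR s - x s" and v = ?v and y = ?y, OF ab p Dx dx cv' cy ex])
    have H2: "HD1_norm a b (\<lambda>s. ?xR s - x s) = sqrt (\<Sum>j=1..n. integral {t (j - 1)..t j} (\<lambda>s. (norm (?y j s))\<^sup>2) + integral {t (j - 1)..t j} (\<lambda>s. (norm (?v j s))\<^sup>2))"
      using HD1_pieces(2)[where x = "\<lambda>s. ?xR s - x s" and v = ?v and y = ?y, OF ab p Dx dx cv' cy ex] by simp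
    have "(\<Sum>j=1..n. integral {t (j - 1)..t j} (\<lambda>s. (norm (?y j s))\<^sup>2) + integral {t (j - 1)..t j} (\<lambda>s. (norm (?v j s))\<^sup>2)) \<le>
        (\<Sum>j=1..n. 2 * integral {t (j - 1)..t j} (\<lambda>s. (norm (pval (?\<delta> j) s))\<^sup>2 + (norm (dval (?\<delta> j) s))\<^sup>2) + step t j * (4 * (K * h ^ N)\<^sup>2))"
    proof (rule sum_mono)
      fix j assume j: "j \<in> {1..n}"
      let ?J = "{t (j - 1)..t j}" and ?w = "\<lambda>s. (norm (pval (?\<delta> j) s))\<^sup>2 + (norm (dval (?\<delta> j) s))\<^sup>2"
      have iw: "?w integrable_on ?J" by (intro integrable_continuous_real continuous_intros continuous_on_pval continuous_on_dval)
      have iy: "(\<lambda>s. (norm (?y j s))\<^sup>2) integrable_on ?J" "(\<lambda>s. (norm (?v j s))\<^sup>2) integrable_on ?J"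
        using cy[OF j] cv'[OF j] by (auto intro!: integrable_continuous_real continuous_intros)
      have "integral ?J (\<lambda>s. (norm (?y j s))\<^sup>2) + integral ?J (\<lambda>s. (norm (?v j s))\<^sup>2) = integral ?J (\<lambda>s. (norm (?y j s))\<^sup>2 + (norm (?v j s))\<^sup>2)"
        by (rule integral_add[symmetric, OF iy])
      also have "\<dots> \<le> integral ?J (\<lambda>s. 2 * ?w s + 4 * (K * h ^ N)\<^sup>2)"
      proof (rule integral_le)
        show "(\<lambda>s. (norm (?y j s))\<^sup>2 + (norm (?v j s))\<^sup>2) integrable_on ?J" by (rule integrable_add[OF iy])
        show "(\<lambda>s. 2 * ?w s + 4 * (K * h ^ N)\<^sup>2) integrable_on ?J" by (rule integrable_add[OF integrable_on_mult_right[OF iw] integrable_const_ivl])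
        fix s assume s: "s \<in> ?J"
        have "(norm (?y j s))\<^sup>2 \<le> 2 * (norm (pval (?\<delta> j) s))\<^sup>2 + 2 * (norm (pval (P' j) s - x s))\<^sup>2"
          using norm_add_squared_le[of "pval (?\<delta> j) s" "pval (P' j) s - x s"] by (simp add: pval_comb)
        moreover have "(norm (?v j s))\<^sup>2 \<le> 2 * (norm (dval (?\<delta> j) s))\<^sup>2 + 2 * (norm (dval (P' j) s - v s))\<^sup>2"
          using norm_add_squared_le[of "dval (?\<delta> j) s" "dval (P' j) s - v s"] by (simp add: dval_comb)
        moreover have "(norm (pval (P' j) s - x s))\<^sup>2 \<le> (K * h ^ N)\<^sup>2" "(norm (dval (P' j) s - v s))\<^sup>2 \<le> (K * h ^ N)\<^sup>2"
          by (rule power_mono[OF err(1)[OF j s]], simp, rule power_mono[OF err(2)[OF j s]], simp)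
        ultimately show "(norm (?y j s))\<^sup>2 + (norm (?v j s))\<^sup>2 \<le> 2 * ?w s + 4 * (K * h ^ N)\<^sup>2"
          unfolding distrib_left by linarith
      qed
      also have "\<dots> = 2 * integral ?J ?w + step t j * (4 * (K * h ^ N)\<^sup>2)"
        unfolding integral_add[OF integrable_on_mult_right[OF iw] integrable_const_ivl] integral_mult_right
        using partition_step[OF p j] by (simp add: step_def)
      finally show "integral ?J (\<lambda>s. (norm (?y j s))\<^sup>2) + integral ?J (\<lambda>s. (norm (?v j s))\<^sup>2) \<le> 2 * integral ?J ?w + step t j * (4 * (K * h ^ N)\<^sup>2)" .
    qed
    also have "\<dots> = 2 * henergy n t ?\<delta> + (b - a) * (4 * (K * h ^ N)\<^sup>2)"
      by (simp only: henergy_def sum.distrib sum_distrib_left[symmetric] sum_distrib_right[symmetric] sum_step[OF p])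
    also have "\<dots> \<le> 2 * (S * (4 * (b - a) * E\<^sup>2) * (\<rho> ^ e * (h ^ N / h ^ e))\<^sup>2) + (b - a) * (4 * (K * (h ^ N / h ^ e))\<^sup>2)"
    proof (intro add_mono mult_left_mono hen power_mono hX)
    qed (use K0 ab h in auto)
    also have "\<dots> = C2 * (h ^ N / h ^ e)\<^sup>2"
      unfolding C2_def power_mult_distrib distrib_right by (simp only: mult_ac)
    finally have "HD1_norm a b (\<lambda>s. ?xR s - x s) \<le> sqrt (C2 * (h ^ N / h ^ e)\<^sup>2)"
      by (subst H2) (rule real_sqrt_le_mono)
    then have "HD1_error_le a b ?xR x (sqrt C2 * (h ^ N / h ^ e))"
      using H1 h(1) C2 by (simp add: HD1_error_le_def real_sqrt_mult real_sqrt_divide)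
    moreover have "unique_minimizer (PhiR a b A B q l Ga Gb d M \<tau> n t) (ansatz_space a b N n t) ?xR"
    proof -
      let ?\<Phi> = "PhiR a b A B q l Ga Gb d M \<tau> n t" and ?X = "ansatz_space a b N n t :: (real \<Rightarrow> real^('k + 'r)) set"
      have \<Phi>: "?\<Phi> (pw n t F) = lsq y d n t F" if "admissible_family N n t F" for F
        using PhiR_pw[OF dA dB p that \<tau> NM, of q d] by (simp add: y_def[abs_def])
      have le: "?\<Phi> ?xR \<le> ?\<Phi> w" if "w \<in> ?X" for w
        using \<Phi>[OF P] \<Phi>[OF ansatz_space_pw(1)[OF p that]] Pmin[OF ansatz_space_pw(1)[OF p that]]
        by (simp add: ansatz_space_pw(2)[OF p that])
      have xX: "?xR \<in> ?X" by (rule pw_in_ansatz_space[OF p P])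
      \<comment> \<open>Every minimizer is the \<open>pw\<close> of its own pieces; the
        parallelogram identity with two minimal values makes the form of the difference
        nonpositive.\<close>
      have "w = ?xR" if w: "is_arg_min ?\<Phi> (\<lambda>w. w \<in> ?X) w" for w
      proof -
        have wX: "w \<in> ?X" and "?\<Phi> w \<le> ?\<Phi> ?xR" using w xX by (auto simp: is_arg_min_linorder)
        note F = ansatz_space_pw[OF p wX]
        have "lsq y d n t (piece t w) \<le> lsq y d n t P"
          using \<open>?\<Phi> w \<le> ?\<Phi> ?xR\<close> \<Phi>[OF P] \<Phi>[OF F(1)] by (simp add: F(2))
        moreover have "lsq y d n t P \<le> lsq y d n t (comb P (- 1 / 2) (comb P (- 1) (piece t w)))"
          by (intro Pmin admissible_comb P F(1))
        ultimately have "bform n t (comb P (- 1) (piece t w)) (comb P (- 1) (piece t w)) \<le> 0"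
          using lsq_parallelogram[where y = y and d = d and P = P and P' = "piece t w", OF p y] by linarith
        from pw_unique[OF S S0 p P F(1) this] show ?thesis unfolding F(2) by (rule sym)
      qed
      moreover have "is_arg_min ?\<Phi> (\<lambda>w. w \<in> ?X) ?xR"
        unfolding is_arg_min_linorder by (intro conjI allI impI le xX)
      ultimately show ?thesis
        unfolding unique_minimizer_def by (intro conjI allI impI)
    qed
    ultimately show "\<exists>xR. unique_minimizer (PhiR a b A B q l Ga Gb d M \<tau> n t) (ansatz_space a b N n t) xR \<and>
      HD1_error_le a b xR x (sqrt C2 * (step_max n t ^ N / step_max n t ^ e))"
      unfolding h_def by (intro exI[of _ ?xR], rule conjI[rotated])
  qed
qed

end

section \<open>From the hypotheses of the theorem to the locales, and conclusion\<close>

lemma poly_entries_choice: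
  assumes "poly_entries a b e F"
  obtains P where "\<And>i j. degree (P i j) \<le> e" "\<And>t i j. t \<in> {a..b} \<Longrightarrow> F t $ i $ j = poly (P i j) t"
proof -
  have "\<forall>i. \<exists>P. \<forall>j. degree (P j) \<le> e \<and> (\<forall>t\<in>{a..b}. F t $ i $ j = poly (P j) t)"
    using assms unfolding poly_entries_def by (intro allI choice) blast
  from choice[OF this] obtain P where "\<forall>i j. degree (P i j) \<le> e \<and> (\<forall>t\<in>{a..b}. F t $ i $ j = poly (P i j) t)" ..
  then show ?thesis using that[of P] by blast
qed

lemma regular_tractability:
  fixes A :: "real \<Rightarrow> real ^ 'k ^ ('k::finite + 'r::finite)"
  assumes ab: "a < b" and A: "properly_involved a b A" and reg: "regular_with_index a b A B \<mu> r"
  shows "\<exists>G Bs Q Pi R. tractability a b A B \<mu> r G Bs Q Pi R"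
proof -
  let ?D = "Dmat :: real ^ ('k + 'r) ^ 'k"
  have inj: "u = 0" if t: "t \<in> {a..b}" and u: "A t *v u = 0" for t u
  proof -
    \<comment> \<open>D is onto, so trivial intersection of ker A with im D means that A is
      injective.\<close>
    have "u = ?D *v (\<chi> c. case c of Inl i \<Rightarrow> u $ i | Inr _ \<Rightarrow> 0)" by (simp add: vec_eq_iff Dmat_nth)
    then have "u \<in> range ((*v) ?D)" by blast
    then have "u \<in> ker (A t) \<inter> range ((*v) ?D)" using u by (simp add: ker_def)
    then show ?thesis using A t unfolding properly_involved_def by blast
  qed
  from reg obtain G Bs Q and Pi :: "nat \<Rightarrow> real \<Rightarrow> real ^ ('k + 'r) ^ ('k + 'r)" where
    0: "\<forall>t\<in>{a..b}. G 0 t = A t ** ?D \<and> Bs 0 t = B t \<and> Pi 0 t = transpose ?D ** ?D \<and> Q 0 t = mat 1 - transpose ?D ** ?D"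
    and 1: "\<forall>i\<in>{1..\<mu>}. \<forall>t\<in>{a..b}. G i t = G (i - 1) t + Bs (i - 1) t ** Q (i - 1) t"
    and 2: "\<forall>i\<in>{1..<\<mu>}. continuous_on {a..b} (Q i) \<and> Ck_on 1 {a..b} (\<lambda>s. ?D ** Pi i s ** transpose ?D) \<and>
      (\<forall>t\<in>{a..b}. projector_onto (Q i t) (ker (G i t)) \<and> span (\<Union>j<i. ker (G j t)) \<subseteq> ker (Q i t) \<and>
         Pi i t = Pi (i - 1) t ** (mat 1 - Q i t) \<and>
         Bs i t = Bs (i - 1) t ** (mat 1 - Q (i - 1) t)
           - G i t ** transpose ?D ** vector_derivative (\<lambda>s. ?D ** Pi i s ** transpose ?D) (at t within {a..b}) ** ?D ** Pi (i - 1) t)"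
    and 3: "\<forall>i\<le>\<mu>. \<forall>t\<in>{a..b}. rank (G i t) = r i" and 4: "r \<mu> = CARD('k + 'r)"
    unfolding regular_with_index_def Let_def by (elim exE conjE) (rule that)
  define R where "R i t = vector_derivative (\<lambda>s. ?D ** Pi i s ** transpose ?D) (at t within {a..b})" for i t
  have dR: "((\<lambda>s. ?D ** Pi i s ** transpose ?D) has_vector_derivative R i t) (at t within {a..b})"
    if "t \<in> {a..b}" "i \<in> {1..<\<mu>}" for i t
  proof -
    have "Ck_on 1 {a..b} (\<lambda>s. ?D ** Pi i s ** transpose ?D)" using 2 that by blast
    then obtain F where "F 0 = (\<lambda>s. ?D ** Pi i s ** transpose ?D)"
      "\<forall>i<1. \<forall>t\<in>{a..b}. (F i has_vector_derivative F (Suc i) t) (at t within {a..b})"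
      unfolding Ck_on_def by blast
    then have d: "((\<lambda>s. ?D ** Pi i s ** transpose ?D) has_vector_derivative F 1 t) (at t within {a..b})" using that by force
    show ?thesis unfolding R_def vector_derivative_within_closed_interval[OF ab that(1) d] by (rule d)
  qed
  have "tractability a b A B \<mu> r G Bs Q Pi R"
  proof (unfold_locales, goal_cases)
    case 1 show ?case by (rule ab)
  next
    case (2 t u) then show ?case by (rule inj)
  next
    case (7 t i) then show ?case using 1[rule_format, of "Suc i" t] by simp
  next
    case (8 t i) then show ?case by (intro dR) auto
  qed (use 0 2 3 4 in \<open>auto simp: R_def\<close>)
  then show ?thesis by blast
qed

lemma regular_bvp:
  fixes A :: "real \<Rightarrow> real ^ 'k ^ ('k::finite + 'r::finite)"
  assumes "a < b" and "properly_involved a b A" and "regular_with_index a b A B \<mu> r"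
    and l: "l + (\<Sum>i<\<mu>. CARD('k + 'r) - r i) = CARD('k + 'r)"
    and GG: "\<And>i. i < l \<Longrightarrow> ker (Dmat :: real ^ ('k + 'r) ^ 'k) \<subseteq> {z. Ga i \<bullet> z = 0} \<inter> {z. Gb i \<bullet> z = 0}"
    and acc: "accurately_stated a b A B l Ga Gb"
    and pA: "poly_entries a b N' A" and pB: "poly_entries a b N' B"
  shows "\<exists>G Bs Q Pi R PA PB z u. dae_bvp_fund a b A B \<mu> r G Bs Q Pi R l Ga Gb PA PB z u \<and>
    (\<forall>c i. degree (PA c i) \<le> N') \<and> (\<forall>c d. degree (PB c d) \<le> N')"
proof -
  obtain G Bs Q Pi R where "tractability a b A B \<mu> r G Bs Q Pi R"
    using regular_tractability[OF assms(1-3)] by blast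
  then interpret tractability a b A B \<mu> r G Bs Q Pi R .
  obtain PA where entA: "\<And>c i. degree (PA c i) \<le> N'" "\<And>t c i. t \<in> {a..b} \<Longrightarrow> A t $ c $ i = poly (PA c i) t"
    by (rule poly_entries_choice[OF pA]) (rule that)
  obtain PB where entB: "\<And>c d. degree (PB c d) \<le> N'" "\<And>t c d. t \<in> {a..b} \<Longrightarrow> B t $ c $ d = poly (PB c d) t"
    by (rule poly_entries_choice[OF pB]) (rule that)
  interpret dae_bvp a b A B \<mu> r G Bs Q Pi R l Ga Gb PA PB
  proof unfold_locales
    show "smm {a..b} A" unfolding smm_def by (intro allI sm_cong[OF sm_poly]) (simp add: entA(2))
    show "smm {a..b} B" unfolding smm_def by (intro allI sm_cong[OF sm_poly]) (simp add: entB(2))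
  qed (use entA(2) entB(2) l GG acc in \<open>auto simp: dK_def\<close>)
  obtain z u where zu: "\<forall>i<l. continuous_on {a..b} (z i) \<and> continuous_on {a..b} (u i) \<and> (\<forall>t\<in>{a..b}.
      ((\<lambda>s. (Dmat :: real^('k+'r)^'k) *v z i s) has_vector_derivative u i t) (at t within {a..b}) \<and> DAE_op t (u i t) (z i t) = 0)"
    "\<forall>i<l. \<forall>i'<l. Ga i \<bullet> z i' a + Gb i \<bullet> z i' b = (if i = i' then 1 else 0)"
    using fundamental_solutions by (elim exE conjE) (rule that)
  have "dae_bvp_fund a b A B \<mu> r G Bs Q Pi R l Ga Gb PA PB z u"
    by unfold_locales (use zu in blast)+
  then show ?thesis using entA(1) entB(1) by (intro exI conjI allI)
qed

text \<open>The degree bound N' of the coefficients and the loss e are left open, so that the same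
  statement serves polynomial coefficients with e = \<mu>-1 and constant ones with N' = 0. The
  integer exponent k may be negative.\<close>

lemma unique_minimizer_error:
  fixes A :: "real \<Rightarrow> real ^ 'k ^ ('k::finite + 'r::finite)"
  assumes bvp: "a < b" "properly_involved a b A" "regular_with_index a b A B \<mu> r"
      "l + (\<Sum>i<\<mu>. CARD('k + 'r) - r i) = CARD('k + 'r)"
      "\<And>i. i < l \<Longrightarrow> ker (Dmat :: real ^ ('k + 'r) ^ 'k) \<subseteq> {z. Ga i \<bullet> z = 0} \<inter> {z. Gb i \<bullet> z = 0}"
      "accurately_stated a b A B l Ga Gb" "poly_entries a b N' A" "poly_entries a b N' B"
    and N: "1 \<le> N" "N + N' < M" and \<tau>: "nodes M \<tau>" and x: "Ck_on (N + 1) {a..b} x"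
    and sol: "dae_solution a b A B q x" "boundary_condition a b l Ga Gb d x"
    and e: "\<mu> \<le> Suc e \<or> N + N' \<le> e" and k: "k = int N - int e"
  shows "\<exists>C. \<forall>n t. is_partition a b n t \<and> step_max n t / step_min n t \<le> \<rho> \<and> step_max n t \<le> 1 \<longrightarrow>
    (\<exists>xR. unique_minimizer (PhiR a b A B q l Ga Gb d M \<tau> n t) (ansatz_space a b N n t) xR \<and>
      HD1_error_le a b xR x (C * step_max n t powi k))"
proof -
  obtain G Bs Q Pi R PA PB z u where I: "dae_bvp_fund a b A B \<mu> r G Bs Q Pi R l Ga Gb PA PB z u"
    and deg: "\<And>c i. degree (PA c i) \<le> N'" "\<And>c d. degree (PB c d) \<le> N'"
    using regular_bvp[OF bvp] by blast
  from dae_bvp_fund.convergence[OF I deg e N \<tau> x sol, of \<rho>]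
  obtain C where C: "\<forall>n t. is_partition a b n t \<longrightarrow> step_max n t / step_min n t \<le> \<rho> \<longrightarrow> step_max n t \<le> 1 \<longrightarrow>
    (\<exists>xR. unique_minimizer (PhiR a b A B q l Ga Gb d M \<tau> n t) (ansatz_space a b N n t) xR \<and>
      HD1_error_le a b xR x (C * (step_max n t ^ N / step_max n t ^ e)))" ..
  have "step_max n t powi k = step_max n t ^ N / step_max n t ^ e" if p: "is_partition a b n t" for n t
  proof -
    have "1 \<in> {1..n}" using partition_ends[OF p] by simp
    from step_le[OF p this] have "step_max n t \<noteq> 0" by linarith
    then show ?thesis by (simp add: k power_int_diff)
  qed
  then show ?thesis using C by (intro exI[of _ C]) simp
qed

lemma regular_index_pos:
  fixes A :: "real \<Rightarrow> real ^ 'k ^ ('k::finite + 'r::finite)"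
  assumes "a < b" "properly_involved a b A" "regular_with_index a b A B \<mu> r"
  shows "0 < \<mu>"
  using regular_tractability[OF assms] tractability.mu_pos by blast

theorem theorem3:
  fixes a b \<rho> :: real
    and A :: "real \<Rightarrow> real ^ 'k ^ ('k::finite + 'r::finite)"
    and B :: "real \<Rightarrow> real ^ ('k + 'r) ^ ('k + 'r)"
    and Ga Gb :: "nat \<Rightarrow> real ^ ('k + 'r)"
    and l \<mu> N N\<^sub>A\<^sub>B M :: nat and r :: "nat \<Rightarrow> nat"
  assumes "a < b"
    and "properly_involved a b A"
    and "regular_with_index a b A B \<mu> r"
    and "l + (\<Sum>i<\<mu>. CARD('k + 'r) - r i) = CARD('k + 'r)"
    and "\<And>i. i < l \<Longrightarrow> ker (Dmat :: real ^ ('k + 'r) ^ 'k) \<subseteq> {z. Ga i \<bullet> z = 0} \<inter> {z. Gb i \<bullet> z = 0}"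
    and "accurately_stated a b A B l Ga Gb"
    and "poly_entries a b N\<^sub>A\<^sub>B A" and "poly_entries a b N\<^sub>A\<^sub>B B"
    and "1 \<le> N" and "N + 1 + N\<^sub>A\<^sub>B \<le> M"
  shows "\<exists>smoothness :: nat. \<forall>q d x\<^sub>s.
    Ck_on smoothness {a..b} q \<and> Ck_on smoothness {a..b} x\<^sub>s \<and>
    dae_solution a b A B q x\<^sub>s \<and> boundary_condition a b l Ga Gb d x\<^sub>s \<longrightarrow>
    (\<forall>\<tau>. nodes M \<tau> \<longrightarrow> (\<exists>C\<^sub>R.
      for_fine_partitions a b \<rho> (\<lambda>n t. \<exists>x\<^sub>R.
        unique_minimizer (PhiR a b A B q l Ga Gb d M \<tau> n t) (ansatz_space a b N n t) x\<^sub>R \<and>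
        HD1_error_le a b x\<^sub>R x\<^sub>s (C\<^sub>R * step_max n t powi (int N - int \<mu> + 1))) \<and>
      (\<forall>\<gamma>. interpolation_type M \<tau> \<gamma> \<and> (\<forall>i\<in>{1..M}. 0 < \<gamma> i) \<and> exact_up_to (2 * M - 2) M \<tau> \<gamma> \<longrightarrow>
        for_fine_partitions a b \<rho> (\<lambda>n t. \<exists>x\<^sub>R x\<^sub>I.
          unique_minimizer (PhiR a b A B q l Ga Gb d M \<tau> n t) (ansatz_space a b N n t) x\<^sub>R \<and>
          unique_minimizer (PhiI a b A B q l Ga Gb d M \<tau> \<gamma> n t) (ansatz_space a b N n t) x\<^sub>I \<and>
          x\<^sub>I = x\<^sub>R \<and>
          HD1_error_le a b x\<^sub>I x\<^sub>s (C\<^sub>R * step_max n t powi (int N - int \<mu> + 1)))))) \<and>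
    ((\<exists>A\<^sub>0 B\<^sub>0. \<forall>t\<in>{a..b}. A t = A\<^sub>0 \<and> B t = B\<^sub>0) \<longrightarrow>
      (\<forall>\<tau>. nodes M \<tau> \<longrightarrow> (\<exists>C\<^sub>R.
        for_fine_partitions a b \<rho> (\<lambda>n t. \<exists>x\<^sub>R.
          unique_minimizer (PhiR a b A B q l Ga Gb d M \<tau> n t) (ansatz_space a b N n t) x\<^sub>R \<and>
          HD1_error_le a b x\<^sub>R x\<^sub>s (C\<^sub>R * step_max n t powi (max 0 (int N - int \<mu> + 1)))))))"
proof (rule exI[of _ "N + 1"], intro allI impI, elim conjE)
  \<comment> \<open>The witness N + 1 is the number of derivatives of the solution consumed by
    \<open>approximation\<close>.\<close>
  fix q d x\<^sub>s
  assume x: "Ck_on (N + 1) {a..b} x\<^sub>s"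
    and sol: "dae_solution a b A B q x\<^sub>s" "boundary_condition a b l Ga Gb d x\<^sub>s"
  have \<mu>: "0 < \<mu>" by (rule regular_index_pos[OF assms(1-3)])
  let ?R = "\<lambda>\<tau> n t xR. unique_minimizer (PhiR a b A B q l Ga Gb d M \<tau> n t) (ansatz_space a b N n t) xR"
  \<comment> \<open>The loss is e = \<mu>-1; as \<mu> is positive, the natural subtraction is exact
    and N - e equals N - \<mu> + 1.\<close>
  have general: "\<exists>C. \<forall>n t. is_partition a b n t \<and> step_max n t / step_min n t \<le> \<rho> \<and> step_max n t \<le> 1 \<longrightarrow>
      (\<exists>xR. ?R \<tau> n t xR \<and> HD1_error_le a b xR x\<^sub>s (C * step_max n t powi (int N - int \<mu> + 1)))"
    if \<tau>: "nodes M \<tau>" for \<tau>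
    by (rule unique_minimizer_error[OF assms(1-9) _ \<tau> x sol, where e = "\<mu> - 1"])
      (use assms(10) \<mu> in auto)
  \<comment> \<open>Constant entries are polynomials of degree 0, so the residual has degree at most
    N and the loss e may be taken as the minimum of \<mu>-1 and N. Then N - e is the maximum of 0
    and N - \<mu> + 1.\<close>
  have const: "\<exists>C. \<forall>n t. is_partition a b n t \<and> step_max n t / step_min n t \<le> \<rho> \<and> step_max n t \<le> 1 \<longrightarrow>
      (\<exists>xR. ?R \<tau> n t xR \<and> HD1_error_le a b xR x\<^sub>s (C * step_max n t powi (max 0 (int N - int \<mu> + 1))))"
    if AB: "\<exists>A\<^sub>0 B\<^sub>0. \<forall>t\<in>{a..b}. A t = A\<^sub>0 \<and> B t = B\<^sub>0" and \<tau>: "nodes M \<tau>" for \<tau>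
  proof -
    from AB obtain A\<^sub>0 B\<^sub>0 where AB: "\<forall>t\<in>{a..b}. A t = A\<^sub>0 \<and> B t = B\<^sub>0" by blast
    have A0: "poly_entries a b 0 A" unfolding poly_entries_def
    proof (intro allI)
      fix i j show "\<exists>p. degree p \<le> 0 \<and> (\<forall>t\<in>{a..b}. A t $ i $ j = poly p t)"
        using AB by (intro exI[of _ "[:A\<^sub>0 $ i $ j:]"]) simp
    qed
    have B0: "poly_entries a b 0 B" unfolding poly_entries_def
    proof (intro allI)
      fix i j show "\<exists>p. degree p \<le> 0 \<and> (\<forall>t\<in>{a..b}. B t $ i $ j = poly p t)"
        using AB by (intro exI[of _ "[:B\<^sub>0 $ i $ j:]"]) simp
    qed
    show ?thesis
      by (rule unique_minimizer_error[OF assms(1-6) A0 B0 assms(9) _ \<tau> x sol, where e = "min (\<mu> - 1) N"])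
        (use assms(10) \<mu> in auto)
  qed
  let ?g = "\<forall>\<tau>. nodes M \<tau> \<longrightarrow> (\<exists>C\<^sub>R.
      for_fine_partitions a b \<rho> (\<lambda>n t. \<exists>x\<^sub>R. ?R \<tau> n t x\<^sub>R \<and>
        HD1_error_le a b x\<^sub>R x\<^sub>s (C\<^sub>R * step_max n t powi (int N - int \<mu> + 1))) \<and>
      (\<forall>\<gamma>. interpolation_type M \<tau> \<gamma> \<and> (\<forall>i\<in>{1..M}. 0 < \<gamma> i) \<and> exact_up_to (2 * M - 2) M \<tau> \<gamma> \<longrightarrow>
        for_fine_partitions a b \<rho> (\<lambda>n t. \<exists>x\<^sub>R x\<^sub>I. ?R \<tau> n t x\<^sub>R \<and>
          unique_minimizer (PhiI a b A B q l Ga Gb d M \<tau> \<gamma> n t) (ansatz_space a b N n t) x\<^sub>I \<and>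
          x\<^sub>I = x\<^sub>R \<and>
          HD1_error_le a b x\<^sub>I x\<^sub>s (C\<^sub>R * step_max n t powi (int N - int \<mu> + 1)))))"
  have ?g
  proof (intro allI impI)
    fix \<tau> assume \<tau>: "nodes M \<tau>"
    from general[OF this] obtain C where C: "\<forall>n t. is_partition a b n t \<and> step_max n t / step_min n t \<le> \<rho> \<and> step_max n t \<le> 1 \<longrightarrow>
      (\<exists>xR. ?R \<tau> n t xR \<and> HD1_error_le a b xR x\<^sub>s (C * step_max n t powi (int N - int \<mu> + 1)))" ..
    have M: "1 \<le> M" using assms(10) by simp
    show "\<exists>C\<^sub>R. for_fine_partitions a b \<rho> (\<lambda>n t. \<exists>x\<^sub>R. ?R \<tau> n t x\<^sub>R \<and>
        HD1_error_le a b x\<^sub>R x\<^sub>s (C\<^sub>R * step_max n t powi (int N - int \<mu> + 1))) \<and>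
      (\<forall>\<gamma>. interpolation_type M \<tau> \<gamma> \<and> (\<forall>i\<in>{1..M}. 0 < \<gamma> i) \<and> exact_up_to (2 * M - 2) M \<tau> \<gamma> \<longrightarrow>
        for_fine_partitions a b \<rho> (\<lambda>n t. \<exists>x\<^sub>R x\<^sub>I. ?R \<tau> n t x\<^sub>R \<and>
          unique_minimizer (PhiI a b A B q l Ga Gb d M \<tau> \<gamma> n t) (ansatz_space a b N n t) x\<^sub>I \<and>
          x\<^sub>I = x\<^sub>R \<and>
          HD1_error_le a b x\<^sub>I x\<^sub>s (C\<^sub>R * step_max n t powi (int N - int \<mu> + 1))))"
    proof (rule exI[of _ C], rule conjI)
      show "for_fine_partitions a b \<rho> (\<lambda>n t. \<exists>x\<^sub>R. ?R \<tau> n t x\<^sub>R \<and>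
          HD1_error_le a b x\<^sub>R x\<^sub>s (C * step_max n t powi (int N - int \<mu> + 1)))"
        unfolding for_fine_partitions_def by (rule exI[of _ 1], rule conjI, simp, rule C)
      show "\<forall>\<gamma>. interpolation_type M \<tau> \<gamma> \<and> (\<forall>i\<in>{1..M}. 0 < \<gamma> i) \<and> exact_up_to (2 * M - 2) M \<tau> \<gamma> \<longrightarrow>
        for_fine_partitions a b \<rho> (\<lambda>n t. \<exists>x\<^sub>R x\<^sub>I. ?R \<tau> n t x\<^sub>R \<and>
          unique_minimizer (PhiI a b A B q l Ga Gb d M \<tau> \<gamma> n t) (ansatz_space a b N n t) x\<^sub>I \<and>
          x\<^sub>I = x\<^sub>R \<and>
          HD1_error_le a b x\<^sub>I x\<^sub>s (C * step_max n t powi (int N - int \<mu> + 1)))"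
        unfolding for_fine_partitions_def
      proof (intro allI impI, elim conjE, rule exI[of _ 1], rule conjI[OF zero_less_one], intro allI impI)
        fix \<gamma> n t assume ex: "exact_up_to (2 * M - 2) M \<tau> \<gamma>"
          and p: "is_partition a b n t \<and> step_max n t / step_min n t \<le> \<rho> \<and> step_max n t \<le> 1"
        from C[rule_format, OF p] obtain xR where
          "?R \<tau> n t xR \<and> HD1_error_le a b xR x\<^sub>s (C * step_max n t powi (int N - int \<mu> + 1))" ..
        \<comment> \<open>Both functionals are the same function here, so the minimizer of one is
          that of the other, with the same constant.\<close>
        then show "\<exists>x\<^sub>R x\<^sub>I. ?R \<tau> n t x\<^sub>R \<and>
          unique_minimizer (PhiI a b A B q l Ga Gb d M \<tau> \<gamma> n t) (ansatz_space a b N n t) x\<^sub>I \<and>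
          x\<^sub>I = x\<^sub>R \<and> HD1_error_le a b x\<^sub>I x\<^sub>s (C * step_max n t powi (int N - int \<mu> + 1))"
          unfolding PhiI_eq_PhiR[OF conjunct1[OF p] \<tau> M ex]
          by (intro exI[of _ xR] conjI) simp_all
      qed
    qed
  qed
  moreover have "\<exists>C\<^sub>R. for_fine_partitions a b \<rho> (\<lambda>n t. \<exists>x\<^sub>R. ?R \<tau> n t x\<^sub>R \<and>
          HD1_error_le a b x\<^sub>R x\<^sub>s (C\<^sub>R * step_max n t powi (max 0 (int N - int \<mu> + 1))))"
    if AB: "\<exists>A\<^sub>0 B\<^sub>0. \<forall>t\<in>{a..b}. A t = A\<^sub>0 \<and> B t = B\<^sub>0" and \<tau>: "nodes M \<tau>" for \<tau>
  proof -
    from const[OF AB \<tau>] obtain C where C: "\<forall>n t. is_partition a b n t \<and> step_max n t / step_min n t \<le> \<rho> \<and> step_max n t \<le> 1 \<longrightarrow>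
      (\<exists>xR. ?R \<tau> n t xR \<and> HD1_error_le a b xR x\<^sub>s (C * step_max n t powi (max 0 (int N - int \<mu> + 1))))" ..
    show ?thesis
      unfolding for_fine_partitions_def by (rule exI[of _ C], rule exI[of _ 1], rule conjI, simp, rule C)
  qed
  ultimately show "?g \<and> ((\<exists>A\<^sub>0 B\<^sub>0. \<forall>t\<in>{a..b}. A t = A\<^sub>0 \<and> B t = B\<^sub>0) \<longrightarrow>
      (\<forall>\<tau>. nodes M \<tau> \<longrightarrow> (\<exists>C\<^sub>R. for_fine_partitions a b \<rho> (\<lambda>n t. \<exists>x\<^sub>R. ?R \<tau> n t x\<^sub>R \<and>
          HD1_error_le a b x\<^sub>R x\<^sub>s (C\<^sub>R * step_max n t powi (max 0 (int N - int \<mu> + 1)))))))" by blast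
qed

end
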